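(* (Existence.) Let $K\subset\mathbb{R}^4$ be compact. There exists $\delta>0$, depending only on $K$, such that for every $\lambda=(c_0,d_0,b_0^{\rho},b_0^{\phi})\in K$ there exists a unique $(-1)$-homogeneous axisymmetric solution $(u_\lambda,p_\lambda)\in C^\infty(\Omega_\delta\setminus\{x'=0\})$ of the stationary Navier-Stokes equations $$-\Delta u+(u\cdot\nabla)u+\nabla p=0,\qquad \operatorname{div}u=0$$ in $\Omega_\delta\setminus\{x'=0\}$ such that $|u_\lambda|=o(|x'|^{-1})$ as $x'\to0$ for each fixed $x_3>0$, and such that on $\{x_3=1\}$, with $(u,p)=(u_\lambda,p_\lambda)$, $$c_0=\lim_{\rho\to0^+}\rho\,\partial_\rho p,\quad d_0=\lim_{\rho\to0^+}(p-c_0\ln\rho),\quad b_0^\rho=\lim_{\rho\to0^+}\frac1\rho\Big(u^\rho-\frac12c_0\rho\ln\rho\Big),\quad b_0^\phi=\lim_{\rho\to0^+}\frac1\rho u^\phi.\qquad( * )$$ Moreover, $$u_\lambda=\sum_{n=0}^\infty u_n,\qquad p_\lambda=\sum_{n=0}^\infty p_n,$$ where $\{(u_n,p_n)\}_{n\ge0}$ is uniquely determined by $\lambda$ through the properties (A1)-(A3) (see context). For every compact set $V\subset\Omega_\delta\setminus\{x'=0\}$, both series converge in $C^2(V)$, uniformly for $\lambda\in K$. (Classification.) Conversely, let $\tilde\delta>0$ and let $(u,p)$ be a $C^2$ $(-1)$-homogeneous axisymmetric solution of the stationary Navier-Stokes equations in $\Omega_{\tilde\delta}\setminus\{x'=0\}$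 satisfying $|u|=o(|x'|^{-1})$ as $x'\to0$ for each fixed $x_3>0$. Then the limits in $( * )$ exist and determine a unique $\lambda=(c_0,d_0,b_0^\rho,b_0^\phi)\in\mathbb{R}^4$, and there exists $0<\delta_1\le\tilde\delta$ such that $(u,p)=(u_\lambda,p_\lambda)$ in $\Omega_{\delta_1}\setminus\{x'=0\}$, where $(u_\lambda,p_\lambda)$ is the solution given by the first part with $K=\{\lambda\}$.
   Context: Write $x=(x_1,x_2,x_3)\in\mathbb{R}^3$, $x'=(x_1,x_2)$, $r=|x'|$, $\nabla_{x'}=(\partial_1,\partial_2)$, $\Delta'=\partial_1^2+\partial_2^2$; $\phi$ is the azimuthal angle about the $x_3$-axis. Throughout $x_3>0$. Set $\rho=r/x_3$, $t=\ln\rho$. With $(e_r,e_\phi,e_3)$ the cylindrical orthonormal frame and $e_\rho:=e_r$, write $u=u^\rho e_\rho+u^\phi e_\phi+u^3e_3$ and $u'=u^\rho e_\rho+u^\phi e_\phi$ (equivalently $u'=u^1e_1+u^2e_2$). For $\delta>0$, $\Omega_\delta=\{x\in\mathbb{R}^3: |x'|<\delta x_3,\ x_3>0\}$. A function $f$ is $(-\alpha)$-homogeneous if $f(sx)=s^{-\alpha}f(x)$ for all $s>0$. A solution $(u,p)$ is called $(-1)$-homogeneous if $u$ is $(-1)$-homogeneous and $p$ is $(-2)$-homogeneous. It is axisymmetric if $u^\rho,u^\phi,u^3,p$ are independent of $\phi$. Properties of $\{(u_n,p_n)\}_{n\ge0}$ for given $\lambda=(c_0,d_0,b_0^\rho,b_0^\phi)$: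 (A1) Each $u_n=u_n^\rho e_\rho+u_n^\phi e_\phi+u_n^3e_3$ is $(-1)$-homogeneous, each $p_n$ is $(-2)$-homogeneous, and for $n\ge0$ $$u_n^\rho=x_3^{-1}\rho^{2n+1}a_n^\rho(t),\quad u_n^\phi=x_3^{-1}\rho^{2n+1}a_n^\phi(t),\quad u_n^3=x_3^{-1}\rho^{2n}a_n^3(t),\quad p_n=x_3^{-2}\rho^{2n}c_n(t)$$ where $a_n^j$ ($j=\rho,\phi,3$) and $c_n$ are polynomials in $t$ (here $t=\ln\rho$) with $\deg a_n^j\le n+1$, $\deg c_n\le n+1$. (A2) $u_0^\rho=x_3^{-1}\rho(\tfrac12c_0t+b_0^\rho)$, $u_0^\phi=b_0^\phi x_3^{-1}\rho$, $u_0^3=x_3^{-1}(c_0t+b_0^3)$, $p_0=x_3^{-2}(c_0t+d_0)$, with $b_0^3=2b_0^\rho-\tfrac12c_0$. (Here the symbol $c_0$ denotes the constant parameter, not the polynomial of (A1) with index $0$.) (A3) For every $n\ge0$, $(u_{n+1},p_{n+1})$ is uniquely determined, within the class in (A1), by $$-\Delta'p_{n+1}=\partial_3^2p_n+\sum_{m=0}^n\operatorname{div}(u_m\cdot\nabla u_{n-m}),$$ $$\Delta'u'_{n+1}=-\partial_3^2u'_n+\sum_{m=0}^nu_m\cdot\nabla u'_{n-m}+\nabla_{x'}p_{n+1},$$ $$\Delta'u^3_{n+1}=-\partial_3^2u^3_n+\sum_{m=0}^nu_m\cdot\nabla u^3_{n-m}+\partial_3p_n.$$ Here $u'_n=u_n^1e_1+u_n^2e_2$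 is treated as a planar vector field, with operators acting on its Cartesian components. *)

theory Defs
  imports "HOL-Analysis.Analysis" "HOL-Library.Landau_Symbols"
begin

text \<open>\<open>partial\<close> is the partial derivative only where \<open>f\<close> is differentiable (and arbitrary
  elsewhere); it is used below only for functions that are regular on the open set in question.\<close>

definition partial :: "3 \<Rightarrow> (real^3 \<Rightarrow> 'a::real_normed_vector) \<Rightarrow> real^3 \<Rightarrow> 'a" where
  "partial i f x = frechet_derivative f (at x) (axis i 1)"

text \<open>\<open>Ck_on k S f\<close> is meant for open \<open>S\<close> only: differentiability is at, not within \<open>S\<close>.\<close>

primrec Ck_on :: "nat \<Rightarrow> 'a::real_normed_vector set \<Rightarrow> ('a \<Rightarrow> 'b::real_normed_vector) \<Rightarrow> bool" where
  "Ck_on 0 S f \<longleftrightarrow> continuous_on S f"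
| "Ck_on (Suc k) S f \<longleftrightarrow> (\<forall>x\<in>S. f differentiable (at x)) \<and>
     (\<forall>v. Ck_on k S (\<lambda>x. frechet_derivative f (at x) v))"

definition Cinf_on :: "'a::real_normed_vector set \<Rightarrow> ('a \<Rightarrow> 'b::real_normed_vector) \<Rightarrow> bool" where
  "Cinf_on S f \<longleftrightarrow> (\<forall>k. Ck_on k S f)"

definition laplacian :: "(real^3 \<Rightarrow> 'a::real_normed_vector) \<Rightarrow> real^3 \<Rightarrow> 'a" where
  "laplacian f x = (\<Sum>i\<in>UNIV. partial i (partial i f) x)"

definition planar_laplacian :: "(real^3 \<Rightarrow> 'a::real_normed_vector) \<Rightarrow> real^3 \<Rightarrow> 'a" where
  "planar_laplacian f x = partial 1 (partial 1 f) x + partial 2 (partial 2 f) x"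

definition gradient :: "(real^3 \<Rightarrow> real) \<Rightarrow> real^3 \<Rightarrow> real^3" where
  "gradient p x = (\<chi> i. partial i p x)"

definition divergence :: "(real^3 \<Rightarrow> real^3) \<Rightarrow> real^3 \<Rightarrow> real" where
  "divergence u x = (\<Sum>i\<in>UNIV. partial i (\<lambda>y. u y $ i) x)"

definition advect :: "(real^3 \<Rightarrow> real^3) \<Rightarrow> (real^3 \<Rightarrow> 'a::real_normed_vector) \<Rightarrow> real^3 \<Rightarrow> 'a" where
  \<comment> \<open>\<open>u \<cdot> \<nabla> f\<close>\<close>
  "advect u f x = (\<Sum>j\<in>UNIV. (u x $ j) *\<^sub>R partial j f x)"

definition stationary_NS_on :: "(real^3) set \<Rightarrow> (real^3 \<Rightarrow> real^3) \<Rightarrow> (real^3 \<Rightarrow> real) \<Rightarrow> bool" where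
  "stationary_NS_on S u p \<longleftrightarrow>
     (\<forall>x\<in>S. - laplacian u x + advect u u x + gradient p x = 0 \<and> divergence u x = 0)"

definition horiz :: "real^3 \<Rightarrow> real^2" where
  "horiz x = vector [x$1, x$2]"

definition rad :: "real^3 \<Rightarrow> real" where
  "rad x = norm (horiz x)"

definition rho :: "real^3 \<Rightarrow> real" where
  "rho x = rad x / x$3"

definition cyl :: "real \<Rightarrow> real \<Rightarrow> real \<Rightarrow> real^3" where
  "cyl r \<phi> z = vector [r * cos \<phi>, r * sin \<phi>, z]"

text \<open>The punctured cone \<open>\<Omega>\<^sub>\<delta> \<setminus> {x' = 0}\<close>, and the whole open upper half space without the axis
  (the domain of the terms of the expansion).\<close>

definition cone :: "real \<Rightarrow> (real^3) set" where
  "cone \<delta> = {x. rad x < \<delta> * x$3 \<and> x$3 > 0}"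

definition pcone :: "real \<Rightarrow> (real^3) set" where
  "pcone \<delta> = cone \<delta> - {x. horiz x = 0}"

definition phalf :: "(real^3) set" where
  "phalf = {x. x$3 > 0} - {x. horiz x = 0}"

definition e_rho :: "real^3 \<Rightarrow> real^3" where
  "e_rho x = vector [x$1 / rad x, x$2 / rad x, 0]"

definition e_phi :: "real^3 \<Rightarrow> real^3" where
  "e_phi x = vector [- (x$2) / rad x, x$1 / rad x, 0]"

definition comp_rho :: "(real^3 \<Rightarrow> real^3) \<Rightarrow> real^3 \<Rightarrow> real" where
  "comp_rho u x = u x \<bullet> e_rho x"

definition comp_phi :: "(real^3 \<Rightarrow> real^3) \<Rightarrow> real^3 \<Rightarrow> real" where
  "comp_phi u x = u x \<bullet> e_phi x"

definition neg_homogeneous_on :: "(real^3) set \<Rightarrow> real \<Rightarrow> (real^3 \<Rightarrow> 'a::real_normed_vector) \<Rightarrow> bool" where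
  "neg_homogeneous_on S \<alpha> f \<longleftrightarrow> (\<forall>x\<in>S. \<forall>s>0. f (s *\<^sub>R x) = s powr (- \<alpha>) *\<^sub>R f x)"

definition phi_independent_on :: "(real^3) set \<Rightarrow> (real^3 \<Rightarrow> real) \<Rightarrow> bool" where
  "phi_independent_on S f \<longleftrightarrow> (\<forall>r>0. \<forall>z \<phi> \<psi>. cyl r \<phi> z \<in> S \<longrightarrow> cyl r \<psi> z \<in> S \<longrightarrow>
     f (cyl r \<phi> z) = f (cyl r \<psi> z))"

definition axisymmetric_on :: "(real^3) set \<Rightarrow> (real^3 \<Rightarrow> real^3) \<Rightarrow> (real^3 \<Rightarrow> real) \<Rightarrow> bool" where
  "axisymmetric_on S u p \<longleftrightarrow> phi_independent_on S (comp_rho u) \<and> phi_independent_on S (comp_phi u) \<and>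
     phi_independent_on S (\<lambda>x. u x $ 3) \<and> phi_independent_on S p"

text \<open>\<open>|u| = o(|x'|\<^sup>-\<^sup>1)\<close> as \<open>x' \<rightarrow> 0\<close>, for each fixed \<open>x\<^sub>3 > 0\<close>.\<close>

definition mild_at_axis :: "(real^3 \<Rightarrow> real^3) \<Rightarrow> bool" where
  "mild_at_axis u \<longleftrightarrow> (\<forall>z>0. (\<lambda>y::real^2. norm (u (vector [y$1, y$2, z]))) \<in> o[at 0](\<lambda>y. inverse (norm y)))"

definition hom_axi_NS_solution :: "real \<Rightarrow> (real^3 \<Rightarrow> real^3) \<Rightarrow> (real^3 \<Rightarrow> real) \<Rightarrow> bool" where
  "hom_axi_NS_solution \<delta> u p \<longleftrightarrow> stationary_NS_on (pcone \<delta>) u p \<and>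
     neg_homogeneous_on (pcone \<delta>) 1 u \<and> neg_homogeneous_on (pcone \<delta>) 2 p \<and>
     axisymmetric_on (pcone \<delta>) u p"

text \<open>A parameter is \<open>\<lambda> = (c\<^sub>0, d\<^sub>0, b\<^sub>0\<^sup>\<rho>, b\<^sub>0\<^sup>\<phi>) \<in> \<real>\<^sup>4\<close>.\<close>

abbreviation par_c :: "real^4 \<Rightarrow> real" where "par_c l \<equiv> l $ 1"
abbreviation par_d :: "real^4 \<Rightarrow> real" where "par_d l \<equiv> l $ 2"
abbreviation par_brho :: "real^4 \<Rightarrow> real" where "par_brho l \<equiv> l $ 3"
abbreviation par_bphi :: "real^4 \<Rightarrow> real" where "par_bphi l \<equiv> l $ 4"

text \<open>On \<open>{x\<^sub>3 = 1}\<close> one has \<open>\<rho> = |x'|\<close>, so \<open>\<rho>\<close> is the polar radius there; the limits are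
  required along every ray \<open>\<phi> = const\<close>.\<close>

definition axis_limits :: "real^4 \<Rightarrow> (real^3 \<Rightarrow> real^3) \<Rightarrow> (real^3 \<Rightarrow> real) \<Rightarrow> bool" where
  "axis_limits l u p \<longleftrightarrow> (\<forall>\<phi>.
     ((\<lambda>s. s * deriv (\<lambda>\<sigma>. p (cyl \<sigma> \<phi> 1)) s) \<longlongrightarrow> par_c l) (at_right 0) \<and>
     ((\<lambda>s. p (cyl s \<phi> 1) - par_c l * ln s) \<longlongrightarrow> par_d l) (at_right 0) \<and>
     ((\<lambda>s. 1 / s * (comp_rho u (cyl s \<phi> 1) - 1/2 * par_c l * s * ln s)) \<longlongrightarrow> par_brho l) (at_right 0) \<and>
     ((\<lambda>s. 1 / s * comp_phi u (cyl s \<phi> 1)) \<longlongrightarrow> par_bphi l) (at_right 0))"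

definition param_solution :: "real \<Rightarrow> real^4 \<Rightarrow> (real^3 \<Rightarrow> real^3) \<Rightarrow> (real^3 \<Rightarrow> real) \<Rightarrow> bool" where
  "param_solution \<delta> l u p \<longleftrightarrow> hom_axi_NS_solution \<delta> u p \<and>
     Cinf_on (pcone \<delta>) u \<and> Cinf_on (pcone \<delta>) p \<and> mild_at_axis u \<and> axis_limits l u p"

definition expansion_class :: "nat \<Rightarrow> (real^3 \<Rightarrow> real^3) \<Rightarrow> (real^3 \<Rightarrow> real) \<Rightarrow> bool" where
  "expansion_class n v q \<longleftrightarrow>
     neg_homogeneous_on phalf 1 v \<and> neg_homogeneous_on phalf 2 q \<and>
     (\<exists>a_rho a_phi a3 c :: real poly.
        degree a_rho \<le> n + 1 \<and> degree a_phi \<le> n + 1 \<and> degree a3 \<le> n + 1 \<and> degree c \<le> n + 1 \<and>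
        (\<forall>x\<in>phalf.
           comp_rho v x = inverse (x$3) * rho x ^ (2*n+1) * poly a_rho (ln (rho x)) \<and>
           comp_phi v x = inverse (x$3) * rho x ^ (2*n+1) * poly a_phi (ln (rho x)) \<and>
           v x $ 3 = inverse (x$3) * rho x ^ (2*n) * poly a3 (ln (rho x)) \<and>
           q x = inverse ((x$3)^2) * rho x ^ (2*n) * poly c (ln (rho x))))"

definition leading_term :: "real^4 \<Rightarrow> (real^3 \<Rightarrow> real^3) \<Rightarrow> (real^3 \<Rightarrow> real) \<Rightarrow> bool" where
  "leading_term l v q \<longleftrightarrow> (\<forall>x\<in>phalf.
     comp_rho v x = inverse (x$3) * rho x * (1/2 * par_c l * ln (rho x) + par_brho l) \<and>
     comp_phi v x = par_bphi l * inverse (x$3) * rho x \<and>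
     v x $ 3 = inverse (x$3) * (par_c l * ln (rho x) + (2 * par_brho l - 1/2 * par_c l)) \<and>
     q x = inverse ((x$3)^2) * (par_c l * ln (rho x) + par_d l))"

text \<open>The equations for the term \<open>(v, q)\<close> of index \<open>n + 1\<close>, given the terms of index \<open>\<le> n\<close>.\<close>

definition recursion_eqs :: "nat \<Rightarrow> (nat \<Rightarrow> real^3 \<Rightarrow> real^3) \<Rightarrow> (nat \<Rightarrow> real^3 \<Rightarrow> real) \<Rightarrow>
    (real^3 \<Rightarrow> real^3) \<Rightarrow> (real^3 \<Rightarrow> real) \<Rightarrow> bool" where
  "recursion_eqs n u p v q \<longleftrightarrow> (\<forall>x\<in>phalf.
     - planar_laplacian q x =
         partial 3 (partial 3 (p n)) x + (\<Sum>m=0..n. divergence (advect (u m) (u (n - m))) x) \<and>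
     (\<forall>i\<in>{1, 2}. planar_laplacian (\<lambda>y. v y $ i) x =
         - partial 3 (partial 3 (\<lambda>y. u n y $ i)) x
         + (\<Sum>m=0..n. advect (u m) (\<lambda>y. u (n - m) y $ i) x) + partial i q x) \<and>
     planar_laplacian (\<lambda>y. v y $ 3) x =
         - partial 3 (partial 3 (\<lambda>y. u n y $ 3)) x
         + (\<Sum>m=0..n. advect (u m) (\<lambda>y. u (n - m) y $ 3) x) + partial 3 (p n) x)"

definition expansion :: "real^4 \<Rightarrow> (nat \<Rightarrow> real^3 \<Rightarrow> real^3) \<Rightarrow> (nat \<Rightarrow> real^3 \<Rightarrow> real) \<Rightarrow> bool" where
  "expansion l u p \<longleftrightarrow>
     (\<forall>n. expansion_class n (u n) (p n)) \<and>
     leading_term l (u 0) (p 0) \<and>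
     (\<forall>n. recursion_eqs n u p (u (Suc n)) (p (Suc n)) \<and>
        (\<forall>v q. expansion_class (Suc n) v q \<and> recursion_eqs n u p v q \<longrightarrow>
           (\<forall>x\<in>phalf. v x = u (Suc n) x \<and> q x = p (Suc n) x)))"

text \<open>Convergence of the series of the \<open>f l n\<close> to \<open>F l\<close> in \<open>C\<^sup>2(V)\<close>, uniformly for \<open>l \<in> K\<close>.\<close>

definition C2_series_uniform ::
  "'l set \<Rightarrow> (real^3) set \<Rightarrow> ('l \<Rightarrow> nat \<Rightarrow> real^3 \<Rightarrow> 'a::real_normed_vector) \<Rightarrow> ('l \<Rightarrow> real^3 \<Rightarrow> 'a) \<Rightarrow> bool" where
  "C2_series_uniform K V f F \<longleftrightarrow>
     uniform_limit (K \<times> V) (\<lambda>N (l, x). \<Sum>n<N. f l n x) (\<lambda>(l, x). F l x) sequentially \<and>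
     (\<forall>i. uniform_limit (K \<times> V) (\<lambda>N (l, x). partial i (\<lambda>y. \<Sum>n<N. f l n y) x)
        (\<lambda>(l, x). partial i (F l) x) sequentially) \<and>
     (\<forall>i j. uniform_limit (K \<times> V) (\<lambda>N (l, x). partial i (partial j (\<lambda>y. \<Sum>n<N. f l n y)) x)
        (\<lambda>(l, x). partial i (partial j (F l)) x) sequentially)"

text \<open>\<open>solution_family K \<delta> U P\<close>: the pairs \<open>(U l, P l)\<close>, \<open>l \<in> K\<close>, are the solutions on the
  punctured cone with parameters \<open>l\<close>, they are unique, and they are the sums of their expansions.\<close>

definition solution_family ::
  "(real^4) set \<Rightarrow> real \<Rightarrow> (real^4 \<Rightarrow> real^3 \<Rightarrow> real^3) \<Rightarrow> (real^4 \<Rightarrow> real^3 \<Rightarrow> real) \<Rightarrow> bool" where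
  "solution_family K \<delta> U P \<longleftrightarrow>
     (\<forall>l\<in>K. param_solution \<delta> l (U l) (P l) \<and>
        (\<forall>v q. param_solution \<delta> l v q \<longrightarrow> (\<forall>x\<in>pcone \<delta>. v x = U l x \<and> q x = P l x))) \<and>
     (\<exists>u p.
        (\<forall>l\<in>K. expansion l (u l) (p l) \<and>
           (\<forall>u' p'. expansion l u' p' \<longrightarrow>
              (\<forall>n. \<forall>x\<in>phalf. u' n x = u l n x \<and> p' n x = p l n x)) \<and>
           (\<forall>x\<in>pcone \<delta>. (\<lambda>n. u l n x) sums U l x \<and> (\<lambda>n. p l n x) sums P l x)) \<and>
        (\<forall>V. compact V \<and> V \<subseteq> pcone \<delta> \<longrightarrow> C2_series_uniform K V u U \<and> C2_series_uniform K V p P))"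

end

theory Submission
  imports Defs
begin

text \<open>With \<open>t = ln \<rho>\<close>, a \<open>(-1)\<close>-homogeneous axisymmetric solution has the form
  \<open>u = (x\<^sub>1 \<alpha> - x\<^sub>2 \<beta>, x\<^sub>2 \<alpha> + x\<^sub>1 \<beta>, x\<^sub>3 \<gamma>) / x\<^sub>3\<^sup>2\<close>, \<open>p = \<pi> / x\<^sub>3\<^sup>2\<close> with functions
  \<open>\<alpha>, \<beta>, \<gamma>, \<pi>\<close> of \<open>t\<close>, and the Navier-Stokes equations become ordinary differential equations.
  In terms of \<open>\<sigma> = \<alpha> - \<gamma>\<close>, \<open>G = \<beta>' + 2 \<beta>\<close>, \<open>\<kappa> = \<rho>\<^sup>2 / (1 + \<rho>\<^sup>2)\<close> and three further quantities
  \<open>h, k, N\<close> these yield a first-order system whose right-hand side is a constant linear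
  part plus terms carrying the factor \<open>\<kappa> = O(e\<^sup>2\<^sup>t)\<close>. The growth condition \<open>|u| = o(1/|x'|)\<close> makes
  \<open>\<kappa> \<sigma>\<close> tend to \<open>0\<close> as \<open>t\<close> tends to \<open>-\<infinity>\<close>; bootstrapping from this gives asymptotics up to
  \<open>O(e\<^sup>t)\<close> governed by four constants, equivalent to the limits in the theorem. Two solutions with the same
  constants differ by \<open>O(e\<^sup>t)\<close>, and a Gronwall argument starting at \<open>-\<infinity>\<close> shows that they coincide.
  For existence the recursion is solved on the level of the coefficient polynomials, where a convolution
  inequality \<open>A\<^sub>n\<^sub>+\<^sub>1 \<le> C (A\<^sub>n + \<Sum> A\<^sub>m A\<^sub>n\<^sub>-\<^sub>m)\<close> for their norms gives a geometric bound; the series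
  \<open>\<Sum> e\<^sup>2\<^sup>n\<^sup>t a\<^sub>n(t)\<close> and all its derivatives then converge for sufficiently negative \<open>t\<close>.\<close>

section \<open>Homogeneous axisymmetric functions\<close>

text \<open>At minus infinity the first-order system has six modes. Two behave like
  \<open>exp (-2*t)\<close>: one in \<beta>, from \<open>\<beta>' = G - 2 \<beta>\<close>, and one
  in h, from \<open>h' = k - 2 h\<close>, which \<sigma> inherits. The growth condition excludes
  these two, and the limits of G, k, N together with the constant term of \<sigma> are the four
  constants that remain. The obstacle is that nothing bounds the quadratic terms in advance, since
  \<sigma> is only known to be \<open>o(exp (-2*t))\<close>. The variables h, k, N overcome it:
  pressure and most quadratic terms cancel, the equations for h, k and N do not contain \<sigma>,
  and the one for G sees it only through \<kappa> \<sigma>, which tends to 0. For \<sigma> itself an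
  equation of Riccati type with inhomogeneity h is left. For the series, the point is that C does
  not depend on n. Each step of the recursion inverts two first-order operators of size about n, and
  its right-hand side costs at most two derivatives of size about n; degrees grow by one per step,
  so the weight of the polynomial norm can keep the logarithms subordinate to the powers of
  \<rho>.\<close>

text \<open>The span of the functions of this shape is closed under the partial derivatives.\<close>
definition hm :: "nat \<Rightarrow> nat \<Rightarrow> nat \<Rightarrow> nat \<Rightarrow> (real \<Rightarrow> real) \<Rightarrow> real^3 \<Rightarrow> real" where
  "hm a b k m g x = x$1 ^ a * x$2 ^ b * inverse (x$3) ^ k * inverse ((x$1)\<^sup>2 + (x$2)\<^sup>2) ^ m * g (ln (rho x))"

text \<open>Both domains are preimages under \<open>ln (rho x)\<close>: \<open>UNIV\<close> gives
  \<open>phalf\<close> and \<open>{..<ln \<delta>}\<close> gives \<open>pcone \<delta>\<close>, so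
  one calculus serves the terms of the expansion and the solutions.\<close>

definition sect :: "real set \<Rightarrow> (real^3) set" where
  "sect I = {x \<in> phalf. ln (rho x) \<in> I}"

lemma rad_eq: "rad x = sqrt ((x$1)\<^sup>2 + (x$2)\<^sup>2)"
  by (simp add: rad_def horiz_def norm_vec_def L2_set_def UNIV_2)

lemma horiz_eq_0_iff: "horiz x = 0 \<longleftrightarrow> x$1 = 0 \<and> x$2 = 0"
  by (simp add: horiz_def vec_eq_iff forall_2)

lemma mem_phalf_iff: "x \<in> phalf \<longleftrightarrow> x$3 > 0 \<and> (x$1)\<^sup>2 + (x$2)\<^sup>2 > 0"
  by (auto simp: phalf_def horiz_eq_0_iff sum_power2_gt_zero_iff)

lemma rho_pos: "x \<in> phalf \<Longrightarrow> rho x > 0"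
  by (simp add: rho_def rad_eq mem_phalf_iff)

lemma sect_UNIV: "sect UNIV = phalf"
  by (simp add: sect_def)

lemma pcone_eq_sect: "\<delta> > 0 \<Longrightarrow> pcone \<delta> = sect {..<ln \<delta>}"
proof -
  assume d: "\<delta> > 0"
  have "x \<in> pcone \<delta> \<longleftrightarrow> x \<in> phalf \<and> rho x < \<delta>" for x
    by (auto simp: pcone_def cone_def phalf_def rho_def field_simps)
  moreover have "rho x < \<delta> \<longleftrightarrow> ln (rho x) < ln \<delta>" if "x \<in> phalf" for x
    using rho_pos[OF that] d by simp
  ultimately show ?thesis
    by (auto simp: sect_def)
qed

lemma open_phalf: "open phalf"
proof -
  have eq: "phalf = {x. x$3 > 0} \<inter> {x. (x$1)\<^sup>2 + (x$2)\<^sup>2 > 0}"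
    by (auto simp: mem_phalf_iff)
  show ?thesis
    unfolding eq by (intro open_Int open_Collect_less continuous_intros)
qed

lemma ln_rho_eq: "x \<in> phalf \<Longrightarrow> ln (rho x) = ln ((x$1)\<^sup>2 + (x$2)\<^sup>2) / 2 - ln (x$3)"
  by (simp add: rho_def rad_eq mem_phalf_iff ln_divide_pos real_sqrt_gt_zero ln_sqrt)

lemma exp_ln_rho: "x \<in> phalf \<Longrightarrow> exp (2 * ln (rho x)) = ((x$1)\<^sup>2 + (x$2)\<^sup>2) / (x$3)\<^sup>2"
  using rho_pos[of x]
  by (simp add: exp_double) (simp add: rho_def rad_eq power_divide mem_phalf_iff)

lemma has_derivative_nth3 [derivative_intros]:
  "((\<lambda>x::real^3. x $ i) has_derivative (\<lambda>v. v $ i)) F"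
  by (rule bounded_linear.has_derivative[OF bounded_linear_vec_nth]) (rule has_derivative_ident)

lemma ln_rho_has_derivative:
  assumes "x \<in> phalf"
  shows "((\<lambda>x. ln (rho x)) has_derivative
    (\<lambda>v. inverse ((x$1)\<^sup>2 + (x$2)\<^sup>2) * (x$1 * v$1 + x$2 * v$2) - inverse (x$3) * v$3)) (at x)"
proof (rule has_derivative_transform_within_open[OF _ open_phalf assms])
  show "((\<lambda>x. ln ((x$1)\<^sup>2 + (x$2)\<^sup>2) / 2 - ln (x$3)) has_derivative
    (\<lambda>v. inverse ((x$1)\<^sup>2 + (x$2)\<^sup>2) * (x$1 * v$1 + x$2 * v$2) - inverse (x$3) * v$3)) (at x)"
    using assms unfolding mem_phalf_iff
    by (auto intro!: derivative_eq_intros simp: fun_eq_iff)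
qed (simp add: ln_rho_eq)

lemma open_sect:
  assumes "open I"
  shows "open (sect I)"
proof -
  have "continuous_on phalf (\<lambda>x. ln (rho x))"
    using ln_rho_has_derivative has_derivative_continuous continuous_at_imp_continuous_on
    by blast
  then have "open (phalf \<inter> (\<lambda>x. ln (rho x)) -` I)"
    using assms open_phalf continuous_open_preimage by blast
  then show ?thesis
    by (simp add: sect_def vimage_def Int_def)
qed

lemma inverse_power_has_derivative:
  fixes f :: "'a::real_normed_vector \<Rightarrow> real"
  assumes "(f has_derivative f') (at x)" "f x \<noteq> 0"
  shows "((\<lambda>x. inverse (f x) ^ m) has_derivative (\<lambda>v. - (real m * inverse (f x) ^ (m + 1) * f' v))) (at x)"
proof (cases m)
  case 0
  then show ?thesis by simp
next
  case (Suc j)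
  show ?thesis
    unfolding Suc
  proof (rule has_derivative_eq_rhs[OF has_derivative_power[OF Deriv.has_derivative_inverse[OF assms(2,1)]]])
    show "(\<lambda>y. of_nat (Suc j) * - (inverse (f x) * f' y * inverse (f x)) * inverse (f x) ^ (Suc j - 1)) =
      (\<lambda>v. - (real (Suc j) * inverse (f x) ^ (Suc j + 1) * f' v))"
      by (simp add: fun_eq_iff)
  qed
qed

text \<open>In a horizontal direction, the power of 1/(x1^2 + x2^2) and the profile both produce the
  factor x1/(x1^2 + x2^2) or x2/(x1^2 + x2^2), so their contributions merge into one term with
  profile g' - 2 m g. For a = 0 the truncated \<open>a - 1\<close> is harmless because its
  coefficient vanishes.\<close>

lemma hm_has_derivative:
  assumes x: "x \<in> phalf"
    and g: "(g has_real_derivative g' (ln (rho x))) (at (ln (rho x)))"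
  shows "(hm a b k m g has_derivative (\<lambda>v.
      v$1 * (real a * hm (a - 1) b k m g x + hm (a + 1) b k (m + 1) (\<lambda>t. g' t - 2 * real m * g t) x)
    + v$2 * (real b * hm a (b - 1) k m g x + hm a (b + 1) k (m + 1) (\<lambda>t. g' t - 2 * real m * g t) x)
    - v$3 * hm a b (k + 1) m (\<lambda>t. real k * g t + g' t) x)) (at x)"
proof -
  let ?R = "(x$1)\<^sup>2 + (x$2)\<^sup>2" and ?t = "ln (rho x)"
  have R: "?R \<noteq> 0" "x$3 \<noteq> 0" using x by (auto simp: mem_phalf_iff)
  have d1: "((\<lambda>x::real^3. x$1 ^ a) has_derivative (\<lambda>v. real a * x$1 ^ (a - 1) * v$1)) (at x)"
    "((\<lambda>x::real^3. x$2 ^ b) has_derivative (\<lambda>v. real b * x$2 ^ (b - 1) * v$2)) (at x)"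
    by (auto intro!: derivative_eq_intros)
  have d3: "((\<lambda>x::real^3. inverse (x$3) ^ k) has_derivative (\<lambda>v. - (real k * inverse (x$3) ^ (k + 1) * v$3))) (at x)"
    by (rule inverse_power_has_derivative[OF has_derivative_nth3 R(2)])
  have d4: "((\<lambda>x::real^3. inverse ((x$1)\<^sup>2 + (x$2)\<^sup>2) ^ m) has_derivative
      (\<lambda>v. - (real m * inverse ?R ^ (m + 1) * (2 * x$1 * v$1 + 2 * x$2 * v$2)))) (at x)"
    by (rule inverse_power_has_derivative[where f="\<lambda>x. (x$1)\<^sup>2 + (x$2)\<^sup>2", OF _ R(1)])
      (auto intro!: derivative_eq_intros)
  have d5: "((\<lambda>x. g (ln (rho x))) has_derivative
      (\<lambda>v. g' ?t * (inverse ?R * (x$1 * v$1 + x$2 * v$2) - inverse (x$3) * v$3))) (at x)"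
    using has_derivative_compose[OF ln_rho_has_derivative[OF x] g[unfolded has_field_derivative_def]] .
  note D = has_derivative_mult[OF has_derivative_mult[OF has_derivative_mult[OF has_derivative_mult[OF d1] d3] d4] d5]
  show ?thesis
    unfolding hm_def[abs_def]
    by (rule has_derivative_eq_rhs[OF D]) (simp add: fun_eq_iff algebra_simps)
qed

section \<open>Elementary rules for partial derivatives\<close>

lemma partial_eqI: "(f has_derivative f') (at x) \<Longrightarrow> partial i f x = f' (axis i 1)"
  by (simp add: partial_def frechet_derivative_at[symmetric])

text \<open>The set of Frechet derivatives at x depends only on the germ of the function, so the
  choice behind \<open>frechet_derivative\<close> returns the same map on both sides, even where
  that set is empty.\<close>

lemma partial_cong_open:
  assumes "open S" "x \<in> S" "\<And>y. y \<in> S \<Longrightarrow> f y = g y"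
  shows "partial i f x = partial i g x"
proof -
  have "(f has_derivative f') (at x) \<longleftrightarrow> (g has_derivative f') (at x)" for f'
    using assms has_derivative_transform_within_open[of f f' x UNIV S g]
      has_derivative_transform_within_open[of g f' x UNIV S f] by auto
  then show ?thesis
    by (simp add: partial_def frechet_derivative_def)
qed

lemma partial_vec_nth:
  fixes f :: "real^3 \<Rightarrow> real^'n"
  assumes "f differentiable (at x)"
  shows "partial i f x $ j = partial i (\<lambda>y. f y $ j) x"
proof -
  obtain f' where f': "(f has_derivative f') (at x)"
    using assms by (auto simp: differentiable_def)
  have "((\<lambda>y. f y $ j) has_derivative (\<lambda>v. f' v $ j)) (at x)"
    using bounded_linear.has_derivative[OF bounded_linear_vec_nth f'] .
  then show ?thesis
    using f' by (simp add: partial_eqI)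
qed

lemma partial_add:
  assumes "f differentiable (at x)" "g differentiable (at x)"
  shows "partial i (\<lambda>x. f x + g x) x = partial i f x + partial i g x"
proof -
  obtain f' g' where "(f has_derivative f') (at x)" "(g has_derivative g') (at x)"
    using assms by (auto simp: differentiable_def)
  then show ?thesis
    by (simp add: partial_eqI[OF has_derivative_add] partial_eqI)
qed

lemma partial_diff:
  assumes "f differentiable (at x)" "g differentiable (at x)"
  shows "partial i (\<lambda>x. f x - g x) x = partial i f x - partial i g x"
proof -
  obtain f' g' where "(f has_derivative f') (at x)" "(g has_derivative g') (at x)"
    using assms by (auto simp: differentiable_def)
  then show ?thesis
    by (simp add: partial_eqI[OF has_derivative_diff] partial_eqI)
qed

lemma partial_scaleR_left:
  assumes "f differentiable (at x)"
  shows "partial i (\<lambda>x. f x *\<^sub>R e) x = partial i f x *\<^sub>R e"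
proof -
  obtain f' where "(f has_derivative f') (at x)"
    using assms by (auto simp: differentiable_def)
  then show ?thesis
    by (simp add: partial_eqI[OF has_derivative_scaleR_left] partial_eqI)
qed

lemma partial_cmult:
  fixes f :: "real^3 \<Rightarrow> real"
  assumes "f differentiable (at x)"
  shows "partial i (\<lambda>x. c * f x) x = c * partial i f x"
proof -
  obtain f' where "(f has_derivative f') (at x)"
    using assms by (auto simp: differentiable_def)
  then show ?thesis
    by (simp add: partial_eqI[OF has_derivative_mult_right] partial_eqI)
qed

lemma axis_nth3 [simp]:
  "(axis 1 1 :: real^3) $ 1 = 1" "(axis 1 1 :: real^3) $ 2 = 0" "(axis 1 1 :: real^3) $ 3 = 0"
  "(axis 2 1 :: real^3) $ 1 = 0" "(axis 2 1 :: real^3) $ 2 = 1" "(axis 2 1 :: real^3) $ 3 = 0"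
  "(axis 3 1 :: real^3) $ 1 = 0" "(axis 3 1 :: real^3) $ 2 = 0" "(axis 3 1 :: real^3) $ 3 = 1"
  by (simp_all add: axis_def)

context
  fixes I :: "real set" and g g' :: "real \<Rightarrow> real" and x :: "real^3"
  assumes g: "\<And>t. t \<in> I \<Longrightarrow> (g has_real_derivative g' t) (at t)" and x: "x \<in> sect I"
begin

lemma hm_differentiable: "hm a b k m g differentiable (at x)"
  using hm_has_derivative[of x g g'] g x unfolding sect_def differentiable_def by blast

lemma partial_hm:
  "partial 1 (hm a b k m g) x =
    real a * hm (a - 1) b k m g x + hm (a + 1) b k (m + 1) (\<lambda>t. g' t - 2 * real m * g t) x"
  "partial 2 (hm a b k m g) x =
    real b * hm a (b - 1) k m g x + hm a (b + 1) k (m + 1) (\<lambda>t. g' t - 2 * real m * g t) x"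
  "partial 3 (hm a b k m g) x = - hm a b (k + 1) m (\<lambda>t. real k * g t + g' t) x"
  using partial_eqI[OF hm_has_derivative[of x g g' a b k m]] g x
  by (auto simp: sect_def)

end

section \<open>Scalar and vector fields determined by profiles in t\<close>

definition D1 :: "real set \<Rightarrow> (real \<Rightarrow> real) \<Rightarrow> (real \<Rightarrow> real) \<Rightarrow> bool" where
  "D1 I f f1 \<longleftrightarrow> (\<forall>t\<in>I. (f has_real_derivative f1 t) (at t))"

lemma D1D: "D1 I f f1 \<Longrightarrow> t \<in> I \<Longrightarrow> (f has_real_derivative f1 t) (at t)"
  by (simp add: D1_def)

lemma D1_lincomb: "D1 I f f1 \<Longrightarrow> D1 I g g1 \<Longrightarrow> D1 I (\<lambda>t. c * f t + g t) (\<lambda>t. c * f1 t + g1 t)"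
  unfolding D1_def by (auto intro!: derivative_eq_intros)

lemma D1_diffcomb: "D1 I f f1 \<Longrightarrow> D1 I g g1 \<Longrightarrow> D1 I (\<lambda>t. f t - c * g t) (\<lambda>t. f1 t - c * g1 t)"
  unfolding D1_def by (auto intro!: derivative_eq_intros)

definition SF :: "nat \<Rightarrow> (real \<Rightarrow> real) \<Rightarrow> real^3 \<Rightarrow> real" where
  "SF k f x = inverse (x$3) ^ k * f (ln (rho x))"

text \<open>\<open>\<alpha>\<close> and \<open>\<beta>\<close> encode the radial and azimuthal
  components divided by the radius. This makes the horizontal Cartesian components linear in x1 and
  x2 with coefficients of the form \<open>SF\<close>, without the frame \<open>e_rho\<close>,
  \<open>e_phi\<close>. Velocities have k = 1, the terms of the momentum equation k = 3.\<close>

definition VF :: "nat \<Rightarrow> (real \<Rightarrow> real) \<Rightarrow> (real \<Rightarrow> real) \<Rightarrow> (real \<Rightarrow> real) \<Rightarrow> real^3 \<Rightarrow> real^3" where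
  "VF k \<alpha> \<beta> \<gamma> x = vector [x$1 * SF (k+1) \<alpha> x - x$2 * SF (k+1) \<beta> x,
     x$2 * SF (k+1) \<alpha> x + x$1 * SF (k+1) \<beta> x, SF k \<gamma> x]"

lemma SF_eq_hm: "SF k f = hm 0 0 k 0 f"
  by (simp add: SF_def hm_def fun_eq_iff)

lemma VF_nth:
  "VF k \<alpha> \<beta> \<gamma> x $ 1 = x$1 * SF (k+1) \<alpha> x - x$2 * SF (k+1) \<beta> x"
  "VF k \<alpha> \<beta> \<gamma> x $ 2 = x$2 * SF (k+1) \<alpha> x + x$1 * SF (k+1) \<beta> x"
  "VF k \<alpha> \<beta> \<gamma> x $ 3 = SF k \<gamma> x"
  by (simp_all add: VF_def)

lemma VF_nth_hm:
  "(\<lambda>y. VF k \<alpha> \<beta> \<gamma> y $ 1) = (\<lambda>y. hm 1 0 (k+1) 0 \<alpha> y - hm 0 1 (k+1) 0 \<beta> y)"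
  "(\<lambda>y. VF k \<alpha> \<beta> \<gamma> y $ 2) = (\<lambda>y. hm 0 1 (k+1) 0 \<alpha> y + hm 1 0 (k+1) 0 \<beta> y)"
  "(\<lambda>y. VF k \<alpha> \<beta> \<gamma> y $ 3) = hm 0 0 k 0 \<gamma>"
  by (simp_all add: VF_def SF_def hm_def fun_eq_iff)

text \<open>Sending (a, b) to (x1 a - x2 b, x2 a + x1 b) is a rotation times the radius, with
  determinant x1^2 + x2^2 > 0 off the axis. Hence equality of the vectors at x is equality of the
  three profiles at one value of t.\<close>

lemma VF_eq_iff:
  assumes x: "x \<in> phalf"
  shows "VF k \<alpha> \<beta> \<gamma> x = VF k \<alpha>' \<beta>' \<gamma>' x \<longleftrightarrow>
    \<alpha> (ln (rho x)) = \<alpha>' (ln (rho x)) \<and> \<beta> (ln (rho x)) = \<beta>' (ln (rho x)) \<and> \<gamma> (ln (rho x)) = \<gamma>' (ln (rho x))"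
proof -
  let ?t = "ln (rho x)"
  have x3: "x$3 \<noteq> 0" and R: "(x$1)\<^sup>2 + (x$2)\<^sup>2 \<noteq> 0"
    using x by (auto simp: mem_phalf_iff)
  have *: "a = 0 \<and> b = 0" if "x$1 * a - x$2 * b = 0" "x$2 * a + x$1 * b = 0" for a b
  proof -
    have "((x$1)\<^sup>2 + (x$2)\<^sup>2) * a = 0" "((x$1)\<^sup>2 + (x$2)\<^sup>2) * b = 0"
      using that by algebra+
    then show ?thesis using R by (metis mult_eq_0_iff)
  qed
  have "\<alpha> ?t = \<alpha>' ?t \<and> \<beta> ?t = \<beta>' ?t" if "VF k \<alpha> \<beta> \<gamma> x = VF k \<alpha>' \<beta>' \<gamma>' x"
  proof -
    have "x$1 * (SF (k+1) \<alpha> x - SF (k+1) \<alpha>' x) - x$2 * (SF (k+1) \<beta> x - SF (k+1) \<beta>' x) = 0"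
      "x$2 * (SF (k+1) \<alpha> x - SF (k+1) \<alpha>' x) + x$1 * (SF (k+1) \<beta> x - SF (k+1) \<beta>' x) = 0"
      using arg_cong[OF that, of "\<lambda>v. v $ 1"] arg_cong[OF that, of "\<lambda>v. v $ 2"]
      by (simp_all add: VF_nth algebra_simps)
    from *[OF this] show ?thesis
      using x3 by (simp add: SF_def)
  qed
  moreover have "\<gamma> ?t = \<gamma>' ?t" if "VF k \<alpha> \<beta> \<gamma> x = VF k \<alpha>' \<beta>' \<gamma>' x"
    using arg_cong[OF that, of "\<lambda>v. v $ 3"] x3 by (simp add: VF_nth SF_def)
  ultimately show ?thesis
    by (auto simp: vec_eq_iff forall_3 VF_nth SF_def)
qed

text \<open>The weight 1/r^2 is traded for two powers of 1/x3 and the factor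
  \<open>exp (-2*t)\<close>; this is where the singular coefficients of the ordinary differential
  equations come from.\<close>

lemma inverse_radius_sq:
  "x \<in> phalf \<Longrightarrow> inverse ((x$1)\<^sup>2 + (x$2)\<^sup>2) = inverse (x$3) * inverse (x$3) * exp (- 2 * ln (rho x))"
  using exp_ln_rho[of x] by (simp add: mem_phalf_iff exp_minus power2_eq_square field_simps)

text \<open>Replaces x1^2 by (x1^2 + x2^2) - x2^2, the bracket cancelling one inverse power. It is
  what lets the second derivatives in x1 and x2 combine in the planar Laplacian.\<close>

lemma hm_reduce:
  assumes "x \<in> phalf"
  shows "hm (a + 2) b k (m + 1) g x = hm a b k m g x - hm a (b + 2) k (m + 1) g x"
proof -
  have "((x$1)\<^sup>2 + (x$2)\<^sup>2) * inverse ((x$1)\<^sup>2 + (x$2)\<^sup>2) = 1"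
    using assms by (intro right_inverse less_imp_neq[symmetric]) (simp add: mem_phalf_iff)
  then have "hm a b k m g x = hm a b k m g x * (((x$1)\<^sup>2 + (x$2)\<^sup>2) * inverse ((x$1)\<^sup>2 + (x$2)\<^sup>2))"
    by (simp only: mult_1_right)
  also have "\<dots> = hm (a + 2) b k (m + 1) g x + hm a (b + 2) k (m + 1) g x"
    unfolding hm_def power_add power_one_right by (simp only: distrib_left distrib_right mult_ac)
  finally show ?thesis by simp
qed

lemma partial_partial_add:
  assumes "open S" "x \<in> S" "\<And>y. y \<in> S \<Longrightarrow> f differentiable (at y)" "\<And>y. y \<in> S \<Longrightarrow> g differentiable (at y)"
    "partial j f differentiable (at x)" "partial j g differentiable (at x)"
  shows "partial i (partial j (\<lambda>x. f x + g x)) x = partial i (partial j f) x + partial i (partial j g) x"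
proof -
  have "partial i (partial j (\<lambda>x. f x + g x)) x = partial i (\<lambda>x. partial j f x + partial j g x) x"
    using assms by (intro partial_cong_open[of S]) (auto simp: partial_add)
  then show ?thesis using assms by (simp add: partial_add)
qed

lemma partial_partial_diff:
  assumes "open S" "x \<in> S" "\<And>y. y \<in> S \<Longrightarrow> f differentiable (at y)" "\<And>y. y \<in> S \<Longrightarrow> g differentiable (at y)"
    "partial j f differentiable (at x)" "partial j g differentiable (at x)"
  shows "partial i (partial j (\<lambda>x. f x - g x)) x = partial i (partial j f) x - partial i (partial j g) x"
proof -
  have "partial i (partial j (\<lambda>x. f x - g x)) x = partial i (\<lambda>x. partial j f x - partial j g x) x"
    using assms by (intro partial_cong_open[of S]) (auto simp: partial_diff)
  then show ?thesis using assms by (simp add: partial_diff)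
qed

lemma differentiable_cong_open:
  assumes "open S" "x \<in> S" "\<And>y. y \<in> S \<Longrightarrow> f y = g y" "g differentiable (at x)"
  shows "f differentiable (at x)"
  using assms has_derivative_transform_within_open[of g _ x UNIV S f]
  unfolding differentiable_def by auto

section \<open>Second derivatives of scalar fields and the planar Laplacian\<close>

context
  fixes I :: "real set" and g g1 g2 :: "real \<Rightarrow> real" and x :: "real^3"
  assumes I: "open I" and g: "D1 I g g1" "D1 I g1 g2" and x: "x \<in> sect I"
begin

lemma hm_diff: "hm a b k m g differentiable (at x)"
  by (rule hm_differentiable[OF D1D[OF g(1)] x])

lemma hm_comb_diff: "hm a b k m (\<lambda>t. g1 t - c * g t) differentiable (at x)"
  by (rule hm_differentiable[OF D1D[OF D1_diffcomb[OF g(2,1)]] x])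

lemma hm_comb_diff': "hm a b k m (\<lambda>t. c * g t + g1 t) differentiable (at x)"
  by (rule hm_differentiable[OF D1D[OF D1_lincomb[OF g(1,2)]] x])

lemma partial_hm_cong:
  "y \<in> sect I \<Longrightarrow> partial 1 (hm a b k m g) y =
    real a * hm (a - 1) b k m g y + hm (a + 1) b k (m + 1) (\<lambda>t. g1 t - (2 * real m) * g t) y"
  "y \<in> sect I \<Longrightarrow> partial 2 (hm a b k m g) y =
    real b * hm a (b - 1) k m g y + hm a (b + 1) k (m + 1) (\<lambda>t. g1 t - (2 * real m) * g t) y"
  "y \<in> sect I \<Longrightarrow> partial 3 (hm a b k m g) y = - hm a b (k + 1) m (\<lambda>t. real k * g t + g1 t) y"
  using partial_hm[OF D1D[OF g(1)]] by auto

lemma partial_hm_diff: "partial i (hm a b k m g) differentiable (at x)"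
proof -
  have "i = 1 \<or> i = 2 \<or> i = 3" using exhaust_3 by blast
  moreover have "partial 1 (hm a b k m g) differentiable (at x)"
    by (rule differentiable_cong_open[OF open_sect[OF I] x partial_hm_cong(1)])
      (auto intro!: differentiable_add differentiable_mult hm_diff hm_comb_diff hm_comb_diff')
  moreover have "partial 2 (hm a b k m g) differentiable (at x)"
    by (rule differentiable_cong_open[OF open_sect[OF I] x partial_hm_cong(2)])
      (auto intro!: differentiable_add differentiable_mult hm_diff hm_comb_diff hm_comb_diff')
  moreover have "partial 3 (hm a b k m g) differentiable (at x)"
    by (rule differentiable_cong_open[OF open_sect[OF I] x partial_hm_cong(3)])
      (auto intro!: differentiable_minus hm_comb_diff')
  ultimately show ?thesis by auto
qed

lemma partial_partial_hm:
  "partial 1 (partial 1 (hm a b k m g)) x =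
    real a * (real (a - 1) * hm (a - 1 - 1) b k m g x + hm (a - 1 + 1) b k (m + 1) (\<lambda>t. g1 t - (2 * real m) * g t) x)
    + (real (a + 1) * hm (a + 1 - 1) b k (m + 1) (\<lambda>t. g1 t - (2 * real m) * g t) x
       + hm (a + 1 + 1) b k (m + 1 + 1) (\<lambda>t. (g2 t - (2 * real m) * g1 t) - 2 * real (m + 1) * (g1 t - (2 * real m) * g t)) x)"
  "partial 2 (partial 2 (hm a b k m g)) x =
    real b * (real (b - 1) * hm a (b - 1 - 1) k m g x + hm a (b - 1 + 1) k (m + 1) (\<lambda>t. g1 t - (2 * real m) * g t) x)
    + (real (b + 1) * hm a (b + 1 - 1) k (m + 1) (\<lambda>t. g1 t - (2 * real m) * g t) x
       + hm a (b + 1 + 1) k (m + 1 + 1) (\<lambda>t. (g2 t - (2 * real m) * g1 t) - 2 * real (m + 1) * (g1 t - (2 * real m) * g t)) x)"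
  "partial 3 (partial 3 (hm a b k m g)) x =
    hm a b (k + 1 + 1) m (\<lambda>t. real (k + 1) * (real k * g t + g1 t) + (real k * g1 t + g2 t)) x"
proof -
  have "partial 1 (partial 1 (hm a b k m g)) x = partial 1 (\<lambda>y.
    real a * hm (a - 1) b k m g y + hm (a + 1) b k (m + 1) (\<lambda>t. g1 t - (2 * real m) * g t) y) x"
    by (rule partial_cong_open[OF open_sect[OF I] x]) (rule partial_hm_cong)
  also have "\<dots> = real a * partial 1 (hm (a - 1) b k m g) x
    + partial 1 (hm (a + 1) b k (m + 1) (\<lambda>t. g1 t - (2 * real m) * g t)) x"
    by (subst partial_add) (auto intro!: partial_cmult differentiable_mult hm_diff hm_comb_diff hm_comb_diff')
  finally show "partial 1 (partial 1 (hm a b k m g)) x =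
    real a * (real (a - 1) * hm (a - 1 - 1) b k m g x + hm (a - 1 + 1) b k (m + 1) (\<lambda>t. g1 t - (2 * real m) * g t) x)
    + (real (a + 1) * hm (a + 1 - 1) b k (m + 1) (\<lambda>t. g1 t - (2 * real m) * g t) x
       + hm (a + 1 + 1) b k (m + 1 + 1) (\<lambda>t. (g2 t - (2 * real m) * g1 t) - 2 * real (m + 1) * (g1 t - (2 * real m) * g t)) x)"
    by (simp only: partial_hm[OF D1D[OF g(1)] x] partial_hm[OF D1D[OF D1_diffcomb[OF g(2,1)]] x])
  have "partial 2 (partial 2 (hm a b k m g)) x = partial 2 (\<lambda>y.
    real b * hm a (b - 1) k m g y + hm a (b + 1) k (m + 1) (\<lambda>t. g1 t - (2 * real m) * g t) y) x"
    by (rule partial_cong_open[OF open_sect[OF I] x]) (rule partial_hm_cong)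
  also have "\<dots> = real b * partial 2 (hm a (b - 1) k m g) x
    + partial 2 (hm a (b + 1) k (m + 1) (\<lambda>t. g1 t - (2 * real m) * g t)) x"
    by (subst partial_add) (auto intro!: partial_cmult differentiable_mult hm_diff hm_comb_diff hm_comb_diff')
  finally show "partial 2 (partial 2 (hm a b k m g)) x =
    real b * (real (b - 1) * hm a (b - 1 - 1) k m g x + hm a (b - 1 + 1) k (m + 1) (\<lambda>t. g1 t - (2 * real m) * g t) x)
    + (real (b + 1) * hm a (b + 1 - 1) k (m + 1) (\<lambda>t. g1 t - (2 * real m) * g t) x
       + hm a (b + 1 + 1) k (m + 1 + 1) (\<lambda>t. (g2 t - (2 * real m) * g1 t) - 2 * real (m + 1) * (g1 t - (2 * real m) * g t)) x)"
    by (simp only: partial_hm[OF D1D[OF g(1)] x] partial_hm[OF D1D[OF D1_diffcomb[OF g(2,1)]] x])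
  have "partial 3 (partial 3 (hm a b k m g)) x = partial 3 (\<lambda>y.
    (- 1) * hm a b (k + 1) m (\<lambda>t. real k * g t + g1 t) y) x"
    by (rule partial_cong_open[OF open_sect[OF I] x]) (simp add: partial_hm_cong)
  also have "\<dots> = (- 1) * partial 3 (hm a b (k + 1) m (\<lambda>t. real k * g t + g1 t)) x"
    by (rule partial_cmult) (rule hm_comb_diff')
  finally show "partial 3 (partial 3 (hm a b k m g)) x =
    hm a b (k + 1 + 1) m (\<lambda>t. real (k + 1) * (real k * g t + g1 t) + (real k * g1 t + g2 t)) x"
    by (simp only: partial_hm[OF D1D[OF D1_lincomb[OF g(1,2)]] x])
qed

text \<open>In polar coordinates with t the logarithm of the radius up to a shift, the Laplacian of
  g(t) is g''/r^2, and multiplying g by a linear harmonic function adds 2 g' to g''.\<close>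

lemma planar_laplacian_hm:
  "planar_laplacian (hm 0 0 k 0 g) x = hm 0 0 k 1 g2 x"
  "planar_laplacian (hm 1 0 k 0 g) x = hm 1 0 k 1 (\<lambda>t. g2 t + 2 * g1 t) x"
  "planar_laplacian (hm 0 1 k 0 g) x = hm 0 1 k 1 (\<lambda>t. g2 t + 2 * g1 t) x"
proof -
  have p: "x \<in> phalf" using x by (simp add: sect_def)
  show "planar_laplacian (hm 0 0 k 0 g) x = hm 0 0 k 1 g2 x"
    using hm_reduce[OF p, of 0 0 k 1]
    by (simp add: planar_laplacian_def partial_partial_hm numeral_2_eq_2) (simp add: hm_def algebra_simps)
  show "planar_laplacian (hm 1 0 k 0 g) x = hm 1 0 k 1 (\<lambda>t. g2 t + 2 * g1 t) x"
    using hm_reduce[OF p, of 1 0 k 1]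
    by (simp add: planar_laplacian_def partial_partial_hm numeral_2_eq_2) (simp add: hm_def algebra_simps)
  show "planar_laplacian (hm 0 1 k 0 g) x = hm 0 1 k 1 (\<lambda>t. g2 t + 2 * g1 t) x"
    using hm_reduce[OF p, of 0 1 k 1]
    by (simp add: planar_laplacian_def partial_partial_hm numeral_2_eq_2) (simp add: hm_def algebra_simps)
qed

lemma planar_laplacian_SF: "planar_laplacian (SF k g) x = SF (k + 2) (\<lambda>t. exp (-2*t) * g2 t) x"
  using x by (simp add: SF_eq_hm planar_laplacian_hm) (simp add: hm_def SF_def sect_def inverse_radius_sq power_add)

lemma partial33_SF: "partial 3 (partial 3 (SF k g)) x =
    SF (k + 2) (\<lambda>t. real (k + 1) * (real k * g t + g1 t) + (real k * g1 t + g2 t)) x"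
  by (simp add: SF_eq_hm partial_partial_hm)

end

lemma partial_SF:
  assumes "D1 I g g1" "x \<in> sect I"
  shows "partial 1 (SF k g) x = x$1 * inverse ((x$1)\<^sup>2 + (x$2)\<^sup>2) * SF k g1 x"
    "partial 2 (SF k g) x = x$2 * inverse ((x$1)\<^sup>2 + (x$2)\<^sup>2) * SF k g1 x"
    "partial 3 (SF k g) x = - SF (k+1) (\<lambda>t. real k * g t + g1 t) x"
  by (simp_all add: SF_eq_hm partial_hm[OF D1D[OF assms(1)] assms(2)]) (simp_all add: hm_def)

lemma partial_SF_VF:
  assumes g: "D1 I g g1" and x: "x \<in> sect I"
  shows "partial i (SF k g) x =
    VF (k + 1) (\<lambda>t. exp (-2*t) * g1 t) (\<lambda>t. 0) (\<lambda>t. - (real k * g t + g1 t)) x $ i"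
proof -
  have "i = 1 \<or> i = 2 \<or> i = 3" using exhaust_3 by blast
  then show ?thesis
    using x by (auto simp: partial_SF[OF g x] VF_nth SF_def inverse_radius_sq sect_def algebra_simps)
qed

section \<open>Advection and divergence\<close>

lemma partial_mult:
  fixes f g :: "real^3 \<Rightarrow> real"
  assumes "f differentiable (at x)" "g differentiable (at x)"
  shows "partial i (\<lambda>x. f x * g x) x = f x * partial i g x + partial i f x * g x"
proof -
  obtain f' g' where "(f has_derivative f') (at x)" "(g has_derivative g') (at x)"
    using assms by (auto simp: differentiable_def)
  then show ?thesis
    by (simp add: partial_eqI[OF has_derivative_mult] partial_eqI)
qed

lemma partial_nth: "partial i (\<lambda>y::real^3. y $ j) x = (if i = j then 1 else 0)"
  by (subst partial_eqI[OF has_derivative_nth3]) (simp add: axis_def)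

lemma nth3_differentiable: "(\<lambda>y::real^3. y $ j) differentiable (at x)"
  using has_derivative_nth3 by (auto simp: differentiable_def)

lemma advect_mult:
  fixes f g :: "real^3 \<Rightarrow> real"
  assumes "f differentiable (at x)" "g differentiable (at x)"
  shows "advect u (\<lambda>x. f x * g x) x = f x * advect u g x + advect u f x * g x"
  using assms
  by (simp add: advect_def partial_mult algebra_simps sum.distrib sum_distrib_left)

lemma advect_nth: "advect u (\<lambda>y::real^3. y $ j) x = u x $ j"
  by (simp add: advect_def partial_nth if_distrib cong: if_cong)

lemma advect_add:
  assumes "f differentiable (at x)" "g differentiable (at x)"
  shows "advect u (\<lambda>x. f x + g x) x = advect u f x + advect u g x"
  using assms by (simp add: advect_def partial_add algebra_simps sum.distrib)

lemma advect_diff: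
  assumes "f differentiable (at x)" "g differentiable (at x)"
  shows "advect u (\<lambda>x. f x - g x) x = advect u f x - advect u g x"
  using assms by (simp add: advect_def partial_diff algebra_simps sum_subtractf)

lemma advect_vec_nth:
  fixes f :: "real^3 \<Rightarrow> real^'n"
  assumes "f differentiable (at x)"
  shows "advect u f x $ j = advect u (\<lambda>y. f y $ j) x"
  by (simp add: advect_def partial_vec_nth[OF assms])

lemma advect_cong_open:
  assumes "open S" "x \<in> S" "\<And>y. y \<in> S \<Longrightarrow> f y = g y" "u x = v x"
  shows "advect u f x = advect v g x"
  using partial_cong_open[OF assms(1-3)] assms(4) by (simp add: advect_def)

lemma partial_partial_cong_open:
  assumes "open S" "x \<in> S" "\<And>y. y \<in> S \<Longrightarrow> f y = g y"
  shows "partial i (partial j f) x = partial i (partial j g) x"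
  by (rule partial_cong_open[OF assms(1,2)]) (rule partial_cong_open[OF assms(1) _ assms(3)])

lemma planar_laplacian_cong_open:
  assumes "open S" "x \<in> S" "\<And>y. y \<in> S \<Longrightarrow> f y = g y"
  shows "planar_laplacian f x = planar_laplacian g x"
  by (simp add: planar_laplacian_def partial_partial_cong_open[OF assms])

lemma divergence_cong_open:
  assumes "open S" "x \<in> S" "\<And>y. y \<in> S \<Longrightarrow> f y = g y"
  shows "divergence f x = divergence g x"
  using assms by (auto simp: divergence_def intro!: sum.cong partial_cong_open)

lemma laplacian_eq: "laplacian f x = planar_laplacian f x + partial 3 (partial 3 f) x"
  by (simp add: laplacian_def planar_laplacian_def sum_3)

lemma differentiable_vecI:
  fixes f :: "real^3 \<Rightarrow> real^3"
  assumes "\<And>i. (\<lambda>y. f y $ i) differentiable (at x)"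
  shows "f differentiable (at x)"
proof -
  have "((\<lambda>y. f y \<bullet> b) differentiable (at x))" if "b \<in> Basis" for b
    using that assms by (auto simp: Basis_vec_def inner_axis)
  then show ?thesis
    using differentiable_componentwise_within[of f x UNIV] by simp
qed

lemma sum_VF_nth: "(\<Sum>m\<in>M. VF k (a m) (b m) (c m) x $ i) =
    VF k (\<lambda>t. \<Sum>m\<in>M. a m t) (\<lambda>t. \<Sum>m\<in>M. b m t) (\<lambda>t. \<Sum>m\<in>M. c m t) x $ i"
proof -
  have "i = 1 \<or> i = 2 \<or> i = 3" using exhaust_3 by blast
  then show ?thesis
    by (auto simp: VF_nth SF_def sum_subtractf sum.distrib sum_distrib_left)
qed

lemma SF_differentiable: "D1 I g g1 \<Longrightarrow> x \<in> sect I \<Longrightarrow> SF k g differentiable (at x)"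
  unfolding SF_eq_hm using hm_differentiable D1D by metis

lemma VF_nth_differentiable:
  assumes "D1 I \<alpha> \<alpha>1" "D1 I \<beta> \<beta>1" "D1 I \<gamma> \<gamma>1" "x \<in> sect I"
  shows "(\<lambda>y. VF k \<alpha> \<beta> \<gamma> y $ i) differentiable (at x)"
proof -
  have "i = 1 \<or> i = 2 \<or> i = 3" using exhaust_3 by blast
  then show ?thesis
    using SF_differentiable[OF assms(1,4)] SF_differentiable[OF assms(2,4)] SF_differentiable[OF assms(3,4)]
    by (auto simp: VF_nth intro!: differentiable_add differentiable_diff differentiable_mult nth3_differentiable)
qed

text \<open>The azimuthal velocity is tangent to the level sets of a function of x3 and t, so
  \<open>\<beta>\<close> drops out. The rest acts as (\<open>\<alpha>\<close> -
  \<open>\<gamma>\<close>) d/dt, and differentiating the power of x3 contributes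
  \<open>- k \<gamma>\<close>.\<close>

lemma advect_SF:
  assumes g: "D1 I g g1" and x: "x \<in> sect I"
    and u: "u x = VF 1 \<alpha> \<beta> \<gamma> x"
  shows "advect u (SF k g) x = SF (k+2) (\<lambda>t. (\<alpha> t - \<gamma> t) * g1 t - real k * \<gamma> t * g t) x"
proof -
  let ?R = "(x$1)\<^sup>2 + (x$2)\<^sup>2"
  have R: "inverse ?R * ?R = 1"
    using x by (intro left_inverse less_imp_neq[symmetric]) (simp add: sect_def mem_phalf_iff)
  have "advect u (SF k g) x = VF 1 \<alpha> \<beta> \<gamma> x $ 1 * (x$1 * inverse ?R * SF k g1 x)
      + VF 1 \<alpha> \<beta> \<gamma> x $ 2 * (x$2 * inverse ?R * SF k g1 x)
      - VF 1 \<alpha> \<beta> \<gamma> x $ 3 * SF (k+1) (\<lambda>t. real k * g t + g1 t) x"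
    by (simp add: advect_def sum_3 u partial_SF[OF g x])
  also have "\<dots> = (inverse ?R * ?R) * (SF (1+1) \<alpha> x * SF k g1 x)
      - SF 1 \<gamma> x * SF (k+1) (\<lambda>t. real k * g t + g1 t) x"
    by (simp add: VF_nth algebra_simps power2_eq_square)
  also have "\<dots> = SF (k+2) (\<lambda>t. (\<alpha> t - \<gamma> t) * g1 t - real k * \<gamma> t * g t) x"
    unfolding R by (simp add: SF_def algebra_simps power2_eq_square)
  finally show ?thesis .
qed

text \<open>Differentiating the factors x1 and x2 rotates the field and yields
  \<open>\<alpha> \<alpha>' - \<beta> \<beta>'\<close> and
  \<open>\<alpha> \<beta>' + \<beta> \<alpha>'\<close>. The remaining terms are
  \<open>advect_SF\<close> for each profile, with k = 2 for the horizontal ones and k = 1 for the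
  vertical one.\<close>

lemma advect_VF_nth:
  assumes D: "D1 I \<alpha>' \<alpha>1" "D1 I \<beta>' \<beta>1" "D1 I \<gamma>' \<gamma>1"
    and x: "x \<in> sect I" and u: "u x = VF 1 \<alpha> \<beta> \<gamma> x"
  shows "advect u (\<lambda>y. VF 1 \<alpha>' \<beta>' \<gamma>' y $ i) x =
    VF 3 (\<lambda>t. \<alpha> t * \<alpha>' t - \<beta> t * \<beta>' t + (\<alpha> t - \<gamma> t) * \<alpha>1 t - 2 * \<gamma> t * \<alpha>' t)
         (\<lambda>t. \<alpha> t * \<beta>' t + \<beta> t * \<alpha>' t + (\<alpha> t - \<gamma> t) * \<beta>1 t - 2 * \<gamma> t * \<beta>' t)
         (\<lambda>t. (\<alpha> t - \<gamma> t) * \<gamma>1 t - \<gamma> t * \<gamma>' t) x $ i"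
proof -
  note sf = SF_differentiable[OF D(1) x] SF_differentiable[OF D(2) x] SF_differentiable[OF D(3) x]
  note adv = advect_SF[where u=u and \<alpha>=\<alpha> and \<beta>=\<beta> and \<gamma>=\<gamma>, OF D(1) x u] advect_SF[where u=u and \<alpha>=\<alpha> and \<beta>=\<beta> and \<gamma>=\<gamma>, OF D(2) x u] advect_SF[where u=u and \<alpha>=\<alpha> and \<beta>=\<beta> and \<gamma>=\<gamma>, OF D(3) x u]
  note ds = sf differentiable_mult[OF nth3_differentiable sf(1)] differentiable_mult[OF nth3_differentiable sf(2)]
  have "i = 1 \<or> i = 2 \<or> i = 3" using exhaust_3 by blast
  then show ?thesis
    by (auto simp: VF_nth advect_add advect_diff advect_mult ds nth3_differentiable advect_nth adv u)
      (simp_all add: SF_def algebra_simps eval_nat_numeral)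
qed

lemma divergence_VF:
  assumes D: "D1 I \<alpha> \<alpha>1" "D1 I \<beta> \<beta>1" "D1 I \<gamma> \<gamma>1" and x: "x \<in> sect I"
  shows "divergence (VF k \<alpha> \<beta> \<gamma>) x = SF (k+1) (\<lambda>t. 2 * \<alpha> t + \<alpha>1 t - \<gamma>1 t - real k * \<gamma> t) x"
proof -
  let ?R = "(x$1)\<^sup>2 + (x$2)\<^sup>2" and ?t = "ln (rho x)"
  have R: "inverse ?R * ?R = 1"
    using x by (intro left_inverse less_imp_neq[symmetric]) (simp add: sect_def mem_phalf_iff)
  note sf = SF_differentiable[OF D(1) x] SF_differentiable[OF D(2) x]
  note ds = sf differentiable_mult[OF nth3_differentiable sf(1)] differentiable_mult[OF nth3_differentiable sf(2)]
  have "divergence (VF k \<alpha> \<beta> \<gamma>) x = 2 * SF (k+1) \<alpha> x + (inverse ?R * ?R) * SF (k+1) \<alpha>1 x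
     - SF (k+1) (\<lambda>t. real k * \<gamma> t + \<gamma>1 t) x"
    by (simp add: divergence_def sum_3 VF_nth partial_add partial_diff partial_mult ds nth3_differentiable partial_nth
       partial_SF[OF D(1) x] partial_SF[OF D(2) x] partial_SF[OF D(3) x] power2_eq_square) (simp add: algebra_simps)
  also have "\<dots> = SF (k+1) (\<lambda>t. 2 * \<alpha> t + \<alpha>1 t - \<gamma>1 t - real k * \<gamma> t) x"
    unfolding R by (simp add: SF_def algebra_simps)
  finally show ?thesis .
qed

section \<open>Second derivatives of vector fields\<close>

context
  fixes I :: "real set" and \<alpha> \<alpha>1 \<alpha>2 \<beta> \<beta>1 \<beta>2 \<gamma> \<gamma>1 \<gamma>2 :: "real \<Rightarrow> real" and x :: "real^3"
  assumes I: "open I" and D\<alpha>: "D1 I \<alpha> \<alpha>1" "D1 I \<alpha>1 \<alpha>2" and D\<beta>: "D1 I \<beta> \<beta>1" "D1 I \<beta>1 \<beta>2"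
    and D\<gamma>: "D1 I \<gamma> \<gamma>1" "D1 I \<gamma>1 \<gamma>2" and x: "x \<in> sect I"
begin

lemma partial_partial_VF_nth:
  "partial i (partial j (\<lambda>y. VF k \<alpha> \<beta> \<gamma> y $ 1)) x = partial i (partial j (hm 1 0 (k+1) 0 \<alpha>)) x - partial i (partial j (hm 0 1 (k+1) 0 \<beta>)) x"
  "partial i (partial j (\<lambda>y. VF k \<alpha> \<beta> \<gamma> y $ 2)) x = partial i (partial j (hm 0 1 (k+1) 0 \<alpha>)) x + partial i (partial j (hm 1 0 (k+1) 0 \<beta>)) x"
proof -
  show "partial i (partial j (\<lambda>y. VF k \<alpha> \<beta> \<gamma> y $ 1)) x = partial i (partial j (hm 1 0 (k+1) 0 \<alpha>)) x - partial i (partial j (hm 0 1 (k+1) 0 \<beta>)) x"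
    unfolding VF_nth_hm
    by (rule partial_partial_diff[OF open_sect[OF I] x hm_diff[OF I D\<alpha>] hm_diff[OF I D\<beta>]
      partial_hm_diff[OF I D\<alpha> x] partial_hm_diff[OF I D\<beta> x]])
  show "partial i (partial j (\<lambda>y. VF k \<alpha> \<beta> \<gamma> y $ 2)) x = partial i (partial j (hm 0 1 (k+1) 0 \<alpha>)) x + partial i (partial j (hm 1 0 (k+1) 0 \<beta>)) x"
    unfolding VF_nth_hm
    by (rule partial_partial_add[OF open_sect[OF I] x hm_diff[OF I D\<alpha>] hm_diff[OF I D\<beta>]
      partial_hm_diff[OF I D\<alpha> x] partial_hm_diff[OF I D\<beta> x]])
qed

lemma planar_laplacian_VF_nth:
  "planar_laplacian (\<lambda>y. VF k \<alpha> \<beta> \<gamma> y $ i) x =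
   VF (k+2) (\<lambda>t. exp (-2*t) * (\<alpha>2 t + 2 * \<alpha>1 t)) (\<lambda>t. exp (-2*t) * (\<beta>2 t + 2 * \<beta>1 t)) (\<lambda>t. exp (-2*t) * \<gamma>2 t) x $ i"
proof -
  have p: "x \<in> phalf" using x by (simp add: sect_def)
  have 1: "planar_laplacian (\<lambda>y. VF k \<alpha> \<beta> \<gamma> y $ 1) x = planar_laplacian (hm 1 0 (k+1) 0 \<alpha>) x - planar_laplacian (hm 0 1 (k+1) 0 \<beta>) x"
    by (simp only: planar_laplacian_def partial_partial_VF_nth)
  have 2: "planar_laplacian (\<lambda>y. VF k \<alpha> \<beta> \<gamma> y $ 2) x = planar_laplacian (hm 0 1 (k+1) 0 \<alpha>) x + planar_laplacian (hm 1 0 (k+1) 0 \<beta>) x"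
    by (simp only: planar_laplacian_def partial_partial_VF_nth)
  have 3: "planar_laplacian (\<lambda>y. VF k \<alpha> \<beta> \<gamma> y $ 3) x = planar_laplacian (hm 0 0 k 0 \<gamma>) x"
    by (simp only: VF_nth_hm)
  note L = planar_laplacian_hm[OF I D\<alpha> x] planar_laplacian_hm[OF I D\<beta> x] planar_laplacian_hm[OF I D\<gamma> x]
  have "i = 1 \<or> i = 2 \<or> i = 3" using exhaust_3 by blast
  then show ?thesis
    by (elim disjE; simp only: 1 2 3 L)
      (simp_all add: VF_nth SF_def hm_def inverse_radius_sq[OF p] algebra_simps)
qed

lemma partial33_VF_nth:
  "partial 3 (partial 3 (\<lambda>y. VF 1 \<alpha> \<beta> \<gamma> y $ i)) x =
   VF 3 (\<lambda>t. \<alpha>2 t + 5 * \<alpha>1 t + 6 * \<alpha> t) (\<lambda>t. \<beta>2 t + 5 * \<beta>1 t + 6 * \<beta> t) (\<lambda>t. \<gamma>2 t + 3 * \<gamma>1 t + 2 * \<gamma> t) x $ i"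
proof -
  have 3: "partial 3 (partial 3 (\<lambda>y. VF 1 \<alpha> \<beta> \<gamma> y $ 3)) x = partial 3 (partial 3 (hm 0 0 1 0 \<gamma>)) x"
    by (simp only: VF_nth_hm)
  note L = partial_partial_hm(3)[OF I D\<alpha> x] partial_partial_hm(3)[OF I D\<beta> x] partial_partial_hm(3)[OF I D\<gamma> x]
  have "i = 1 \<or> i = 2 \<or> i = 3" using exhaust_3 by blast
  then show ?thesis
    by (elim disjE; simp only: partial_partial_VF_nth 3 L)
      (simp_all add: VF_nth SF_def hm_def algebra_simps eval_nat_numeral)
qed

lemma partial_VF_nth_differentiable: "partial j (\<lambda>y. VF k \<alpha> \<beta> \<gamma> y $ i) differentiable (at x)"
proof -
  have a: "partial j (\<lambda>y. VF k \<alpha> \<beta> \<gamma> y $ 1) differentiable (at x)"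
    by (rule differentiable_cong_open[OF open_sect[OF I] x, of _ "\<lambda>y. partial j (hm 1 0 (k+1) 0 \<alpha>) y - partial j (hm 0 1 (k+1) 0 \<beta>) y"])
      (auto simp: VF_nth_hm intro!: partial_diff hm_diff[OF I D\<alpha>] hm_diff[OF I D\<beta>]
        differentiable_diff partial_hm_diff[OF I D\<alpha> x] partial_hm_diff[OF I D\<beta> x])
  have b: "partial j (\<lambda>y. VF k \<alpha> \<beta> \<gamma> y $ 2) differentiable (at x)"
    by (rule differentiable_cong_open[OF open_sect[OF I] x, of _ "\<lambda>y. partial j (hm 0 1 (k+1) 0 \<alpha>) y + partial j (hm 1 0 (k+1) 0 \<beta>) y"])
      (auto simp: VF_nth_hm intro!: partial_add hm_diff[OF I D\<alpha>] hm_diff[OF I D\<beta>]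
        differentiable_add partial_hm_diff[OF I D\<alpha> x] partial_hm_diff[OF I D\<beta> x])
  have "i = 1 \<or> i = 2 \<or> i = 3" using exhaust_3 by blast
  then show ?thesis
    using a b partial_hm_diff[OF I D\<gamma> x] by (auto simp: VF_nth_hm)
qed

end


section \<open>Reduction to ordinary differential equations\<close>

text \<open>The witness lies in the half plane x2 = 0 at height 1. Since every t in I is attained, a
  condition that involves x only through \<open>ln (rho x)\<close> can be read as a condition in
  t.\<close>

lemma ex_sect: "t \<in> I \<Longrightarrow> \<exists>x \<in> sect I. ln (rho x) = t"
proof (rule bexI[of _ "vector [exp t, 0, 1]"])
  show "ln (rho (vector [exp t, 0, 1])) = t"
    by (simp add: rho_def rad_eq)
  then show "t \<in> I \<Longrightarrow> vector [exp t, 0, 1] \<in> sect I"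
    by (simp add: sect_def mem_phalf_iff)
qed

lemma all_sect_iff: "(\<forall>x\<in>sect I. P (ln (rho x))) \<longleftrightarrow> (\<forall>t\<in>I. P t)"
  using ex_sect[of _ I] by (fastforce simp: sect_def)

text \<open>The conjuncts are the radial, azimuthal and axial momentum equations and
  incompressibility. The factor \<open>exp (-2*t)\<close> marks the planar Laplacian and the
  horizontal pressure gradient.\<close>

definition NS_ode :: "(real \<Rightarrow> real) \<Rightarrow> (real \<Rightarrow> real) \<Rightarrow> (real \<Rightarrow> real) \<Rightarrow> (real \<Rightarrow> real) \<Rightarrow> (real \<Rightarrow> real) \<Rightarrow> (real \<Rightarrow> real) \<Rightarrow>
    (real \<Rightarrow> real) \<Rightarrow> (real \<Rightarrow> real) \<Rightarrow> (real \<Rightarrow> real) \<Rightarrow> (real \<Rightarrow> real) \<Rightarrow> (real \<Rightarrow> real) \<Rightarrow> real \<Rightarrow> bool" where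
  "NS_ode \<alpha> \<alpha>1 \<alpha>2 \<beta> \<beta>1 \<beta>2 \<gamma> \<gamma>1 \<gamma>2 \<pi> \<pi>1 t \<longleftrightarrow>
     exp (-2*t) * (\<alpha>2 t + 2 * \<alpha>1 t) + (\<alpha>2 t + 5 * \<alpha>1 t + 6 * \<alpha> t) =
       (\<alpha> t * \<alpha> t - \<beta> t * \<beta> t + (\<alpha> t - \<gamma> t) * \<alpha>1 t - 2 * \<gamma> t * \<alpha> t) + exp (-2*t) * \<pi>1 t \<and>
     exp (-2*t) * (\<beta>2 t + 2 * \<beta>1 t) + (\<beta>2 t + 5 * \<beta>1 t + 6 * \<beta> t) =
       (\<alpha> t * \<beta> t + \<beta> t * \<alpha> t + (\<alpha> t - \<gamma> t) * \<beta>1 t - 2 * \<gamma> t * \<beta> t) \<and>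
     exp (-2*t) * \<gamma>2 t + (\<gamma>2 t + 3 * \<gamma>1 t + 2 * \<gamma> t) =
       ((\<alpha> t - \<gamma> t) * \<gamma>1 t - \<gamma> t * \<gamma> t) - (2 * \<pi> t + \<pi>1 t) \<and>
     2 * \<alpha> t + \<alpha>1 t - \<gamma>1 t - \<gamma> t = 0"

lemma VF_lin:
  "VF k a b c x $ i + VF k a' b' c' x $ i = VF k (\<lambda>t. a t + a' t) (\<lambda>t. b t + b' t) (\<lambda>t. c t + c' t) x $ i"
  "- VF k a b c x $ i = VF k (\<lambda>t. - a t) (\<lambda>t. - b t) (\<lambda>t. - c t) x $ i"
proof -
  have "i = 1 \<or> i = 2 \<or> i = 3" using exhaust_3 by blast
  then show "VF k a b c x $ i + VF k a' b' c' x $ i = VF k (\<lambda>t. a t + a' t) (\<lambda>t. b t + b' t) (\<lambda>t. c t + c' t) x $ i"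
    "- VF k a b c x $ i = VF k (\<lambda>t. - a t) (\<lambda>t. - b t) (\<lambda>t. - c t) x $ i"
    by (auto simp: VF_nth SF_def algebra_simps)
qed

lemma VF_nth_eq_iff:
  assumes x: "x \<in> phalf"
  shows "(\<forall>i. VF k \<alpha> \<beta> \<gamma> x $ i = VF k \<alpha>' \<beta>' \<gamma>' x $ i) \<longleftrightarrow>
    \<alpha> (ln (rho x)) = \<alpha>' (ln (rho x)) \<and> \<beta> (ln (rho x)) = \<beta>' (ln (rho x)) \<and> \<gamma> (ln (rho x)) = \<gamma>' (ln (rho x))"
  using VF_eq_iff[OF x] by (simp add: vec_eq_iff)

lemma SF_eq_iff: "x \<in> phalf \<Longrightarrow> SF k f x = SF k g x \<longleftrightarrow> f (ln (rho x)) = g (ln (rho x))"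
  by (simp add: SF_def mem_phalf_iff)

text \<open>Every term of the momentum equation is a \<open>VF 3\<close>, so x can be stripped off
  by \<open>VF_nth_eq_iff\<close>; one equation per profile remains.\<close>

lemma stationary_NS_iff_ode:
  assumes I: "open I" and D\<alpha>: "D1 I \<alpha> \<alpha>1" "D1 I \<alpha>1 \<alpha>2" and D\<beta>: "D1 I \<beta> \<beta>1" "D1 I \<beta>1 \<beta>2"
    and D\<gamma>: "D1 I \<gamma> \<gamma>1" "D1 I \<gamma>1 \<gamma>2" and D\<pi>: "D1 I \<pi> \<pi>1"
    and u: "\<And>x. x \<in> sect I \<Longrightarrow> u x = VF 1 \<alpha> \<beta> \<gamma> x" and p: "\<And>x. x \<in> sect I \<Longrightarrow> p x = SF 2 \<pi> x"
  shows "stationary_NS_on (sect I) u p \<longleftrightarrow> (\<forall>t\<in>I. NS_ode \<alpha> \<alpha>1 \<alpha>2 \<beta> \<beta>1 \<beta>2 \<gamma> \<gamma>1 \<gamma>2 \<pi> \<pi>1 t)"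
proof -
  have *: "(- laplacian u x + advect u u x + gradient p x = 0 \<and> divergence u x = 0) \<longleftrightarrow>
      NS_ode \<alpha> \<alpha>1 \<alpha>2 \<beta> \<beta>1 \<beta>2 \<gamma> \<gamma>1 \<gamma>2 \<pi> \<pi>1 (ln (rho x))" if x: "x \<in> sect I" for x
  proof -
    let ?t = "ln (rho x)"
    have ph: "x \<in> phalf" using x by (simp add: sect_def)
    note S = open_sect[OF I]
    note vd = VF_nth_differentiable[OF D\<alpha>(1) D\<beta>(1) D\<gamma>(1)]
    have ui: "u y $ i = VF 1 \<alpha> \<beta> \<gamma> y $ i" if "y \<in> sect I" for y i
      using u[OF that] by simp
    have ud: "u differentiable (at y)" if "y \<in> sect I" for y
      by (rule differentiable_cong_open[OF S that u]) (simp_all add: differentiable_vecI vd that)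
    have pu: "partial j u y $ i = partial j (\<lambda>y. VF 1 \<alpha> \<beta> \<gamma> y $ i) y" if "y \<in> sect I" for y i j
      unfolding partial_vec_nth[OF ud[OF that]] by (rule partial_cong_open[OF S that ui])
    \<comment> \<open>\<open>laplacian\<close> differentiates the vector field
      \<open>partial j u\<close> itself, so its differentiability must be known before passing to
      components.\<close>
    have pd: "partial j u differentiable (at x)" for j
    proof (rule differentiable_vecI)
      fix i
      show "(\<lambda>y. partial j u y $ i) differentiable (at x)"
        by (rule differentiable_cong_open[OF S x pu partial_VF_nth_differentiable[OF I D\<alpha> D\<beta> D\<gamma> x]])
    qed
    have pp: "partial i (partial j u) x $ l = partial i (partial j (\<lambda>y. VF 1 \<alpha> \<beta> \<gamma> y $ l)) x" for i j l
    proof -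
      have "partial i (partial j u) x $ l = partial i (\<lambda>y. partial j u y $ l) x"
        by (rule partial_vec_nth[OF pd])
      also have "\<dots> = partial i (partial j (\<lambda>y. VF 1 \<alpha> \<beta> \<gamma> y $ l)) x"
        by (rule partial_cong_open[OF S x pu])
      finally show ?thesis .
    qed
    have lap: "laplacian u x $ i =
      VF 3 (\<lambda>t. exp (-2*t) * (\<alpha>2 t + 2 * \<alpha>1 t)) (\<lambda>t. exp (-2*t) * (\<beta>2 t + 2 * \<beta>1 t)) (\<lambda>t. exp (-2*t) * \<gamma>2 t) x $ i
      + VF 3 (\<lambda>t. \<alpha>2 t + 5 * \<alpha>1 t + 6 * \<alpha> t) (\<lambda>t. \<beta>2 t + 5 * \<beta>1 t + 6 * \<beta> t) (\<lambda>t. \<gamma>2 t + 3 * \<gamma>1 t + 2 * \<gamma> t) x $ i" for i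
    proof -
      have "laplacian u x $ i = planar_laplacian (\<lambda>y. VF 1 \<alpha> \<beta> \<gamma> y $ i) x + partial 3 (partial 3 (\<lambda>y. VF 1 \<alpha> \<beta> \<gamma> y $ i)) x"
        by (simp add: laplacian_eq planar_laplacian_def pp)
      then show ?thesis
        unfolding planar_laplacian_VF_nth[OF I D\<alpha> D\<beta> D\<gamma> x] partial33_VF_nth[OF I D\<alpha> D\<beta> D\<gamma> x]
        by (simp add: eval_nat_numeral)
    qed
    have adv: "advect u u x $ i = VF 3 (\<lambda>t. \<alpha> t * \<alpha> t - \<beta> t * \<beta> t + (\<alpha> t - \<gamma> t) * \<alpha>1 t - 2 * \<gamma> t * \<alpha> t)
         (\<lambda>t. \<alpha> t * \<beta> t + \<beta> t * \<alpha> t + (\<alpha> t - \<gamma> t) * \<beta>1 t - 2 * \<gamma> t * \<beta> t)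
         (\<lambda>t. (\<alpha> t - \<gamma> t) * \<gamma>1 t - \<gamma> t * \<gamma> t) x $ i" for i
    proof -
      have "advect u u x $ i = advect u (\<lambda>y. VF 1 \<alpha> \<beta> \<gamma> y $ i) x"
        unfolding advect_vec_nth[OF ud[OF x]] by (rule advect_cong_open[OF S x ui refl])
      then show ?thesis
        unfolding advect_VF_nth[where u=u and \<alpha>=\<alpha> and \<beta>=\<beta> and \<gamma>=\<gamma>, OF D\<alpha>(1) D\<beta>(1) D\<gamma>(1) x u[OF x]] .
    qed
    have slow_growth: "gradient p x $ i = VF 3 (\<lambda>t. exp (-2*t) * \<pi>1 t) (\<lambda>t. 0) (\<lambda>t. - (2 * \<pi> t + \<pi>1 t)) x $ i" for i
    proof -
      have "gradient p x $ i = partial i (SF 2 \<pi>) x"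
        unfolding gradient_def vec_lambda_beta by (rule partial_cong_open[OF S x p])
      then show ?thesis
        unfolding partial_SF_VF[OF D\<pi> x] by simp
    qed
    have dv: "divergence u x = SF 2 (\<lambda>t. 2 * \<alpha> t + \<alpha>1 t - \<gamma>1 t - \<gamma> t) x"
      using divergence_VF[OF D\<alpha>(1) D\<beta>(1) D\<gamma>(1) x, where k=1] divergence_cong_open[OF S x u] by (simp add: eval_nat_numeral)
    have "- laplacian u x + advect u u x + gradient p x = 0 \<longleftrightarrow>
      (\<forall>i. laplacian u x $ i = advect u u x $ i + gradient p x $ i)"
      by (simp add: vec_eq_iff algebra_simps) (auto simp: algebra_simps eq_neg_iff_add_eq_0)
    also have "\<dots> \<longleftrightarrow> (exp (-2*?t) * (\<alpha>2 ?t + 2 * \<alpha>1 ?t) + (\<alpha>2 ?t + 5 * \<alpha>1 ?t + 6 * \<alpha> ?t) =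
       (\<alpha> ?t * \<alpha> ?t - \<beta> ?t * \<beta> ?t + (\<alpha> ?t - \<gamma> ?t) * \<alpha>1 ?t - 2 * \<gamma> ?t * \<alpha> ?t) + exp (-2*?t) * \<pi>1 ?t \<and>
     exp (-2*?t) * (\<beta>2 ?t + 2 * \<beta>1 ?t) + (\<beta>2 ?t + 5 * \<beta>1 ?t + 6 * \<beta> ?t) =
       (\<alpha> ?t * \<beta> ?t + \<beta> ?t * \<alpha> ?t + (\<alpha> ?t - \<gamma> ?t) * \<beta>1 ?t - 2 * \<gamma> ?t * \<beta> ?t) + 0 \<and>
     exp (-2*?t) * \<gamma>2 ?t + (\<gamma>2 ?t + 3 * \<gamma>1 ?t + 2 * \<gamma> ?t) =
       ((\<alpha> ?t - \<gamma> ?t) * \<gamma>1 ?t - \<gamma> ?t * \<gamma> ?t) + - (2 * \<pi> ?t + \<pi>1 ?t))"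
      unfolding lap adv slow_growth VF_lin VF_nth_eq_iff[OF ph] ..
    finally have 1: "- laplacian u x + advect u u x + gradient p x = 0 \<longleftrightarrow> \<dots>" .
    have 2: "divergence u x = 0 \<longleftrightarrow> 2 * \<alpha> ?t + \<alpha>1 ?t - \<gamma>1 ?t - \<gamma> ?t = 0"
      unfolding dv using ph by (simp add: SF_def mem_phalf_iff)
    show ?thesis
      by (simp only: 1 2 NS_ode_def add_0_right add_uminus_conv_diff conj_assoc)
  qed
  show ?thesis
    unfolding stationary_NS_on_def all_sect_iff[symmetric] by (rule ball_cong[OF refl *])
qed

text \<open>\<open>F1\<close>, \<open>F2\<close>, \<open>F3\<close> are the profiles of the
  advection term with indices m and n - m. They are named because the pressure equation takes the
  divergence of this term, for which their derivatives have to be supplied.\<close>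

lemma recursion_eqs_iff_ode:
  assumes D\<alpha>: "\<And>m. D1 UNIV (\<alpha> m) (\<alpha>1 m)" "\<And>m. D1 UNIV (\<alpha>1 m) (\<alpha>2 m)"
    and D\<beta>: "\<And>m. D1 UNIV (\<beta> m) (\<beta>1 m)" "\<And>m. D1 UNIV (\<beta>1 m) (\<beta>2 m)"
    and D\<gamma>: "\<And>m. D1 UNIV (\<gamma> m) (\<gamma>1 m)" "\<And>m. D1 UNIV (\<gamma>1 m) (\<gamma>2 m)"
    and D\<pi>: "D1 UNIV \<pi> \<pi>1" "D1 UNIV \<pi>1 \<pi>2"
    and D\<alpha>': "D1 UNIV \<alpha>' \<alpha>1'" "D1 UNIV \<alpha>1' \<alpha>2'" and D\<beta>': "D1 UNIV \<beta>' \<beta>1'" "D1 UNIV \<beta>1' \<beta>2'"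
    and D\<gamma>': "D1 UNIV \<gamma>' \<gamma>1'" "D1 UNIV \<gamma>1' \<gamma>2'" and D\<pi>': "D1 UNIV \<pi>' \<pi>1'" "D1 UNIV \<pi>1' \<pi>2'"
    and F1: "\<And>m. F1 m = (\<lambda>t. \<alpha> m t * \<alpha> (n-m) t - \<beta> m t * \<beta> (n-m) t + (\<alpha> m t - \<gamma> m t) * \<alpha>1 (n-m) t - 2 * \<gamma> m t * \<alpha> (n-m) t)"
    and F2: "\<And>m. F2 m = (\<lambda>t. \<alpha> m t * \<beta> (n-m) t + \<beta> m t * \<alpha> (n-m) t + (\<alpha> m t - \<gamma> m t) * \<beta>1 (n-m) t - 2 * \<gamma> m t * \<beta> (n-m) t)"
    and F3: "\<And>m. F3 m = (\<lambda>t. (\<alpha> m t - \<gamma> m t) * \<gamma>1 (n-m) t - \<gamma> m t * \<gamma> (n-m) t)"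
    and DF: "\<And>m. D1 UNIV (F1 m) (F1' m)" "\<And>m. D1 UNIV (F2 m) (F2' m)" "\<And>m. D1 UNIV (F3 m) (F3' m)"
    and u: "\<And>m x. x \<in> phalf \<Longrightarrow> u m x = VF 1 (\<alpha> m) (\<beta> m) (\<gamma> m) x" and p: "\<And>x. x \<in> phalf \<Longrightarrow> p n x = SF 2 \<pi> x"
    and v: "\<And>x. x \<in> phalf \<Longrightarrow> v x = VF 1 \<alpha>' \<beta>' \<gamma>' x" and q: "\<And>x. x \<in> phalf \<Longrightarrow> q x = SF 2 \<pi>' x"
  shows "recursion_eqs n u p v q \<longleftrightarrow> (\<forall>t.
     - (exp (-2*t) * \<pi>2' t) = \<pi>2 t + 5 * \<pi>1 t + 6 * \<pi> t + (\<Sum>m=0..n. 2 * F1 m t + F1' m t - F3' m t - 3 * F3 m t) \<and>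
     exp (-2*t) * (\<alpha>2' t + 2 * \<alpha>1' t) = - (\<alpha>2 n t + 5 * \<alpha>1 n t + 6 * \<alpha> n t) + (\<Sum>m=0..n. F1 m t) + exp (-2*t) * \<pi>1' t \<and>
     exp (-2*t) * (\<beta>2' t + 2 * \<beta>1' t) = - (\<beta>2 n t + 5 * \<beta>1 n t + 6 * \<beta> n t) + (\<Sum>m=0..n. F2 m t) \<and>
     exp (-2*t) * \<gamma>2' t = - (\<gamma>2 n t + 3 * \<gamma>1 n t + 2 * \<gamma> n t) + (\<Sum>m=0..n. F3 m t) - (2 * \<pi> t + \<pi>1 t))"
    (is "_ \<longleftrightarrow> (\<forall>t. ?P t)")
proof -
  note S = open_phalf
  have *: "(- planar_laplacian q x =
         partial 3 (partial 3 (p n)) x + (\<Sum>m=0..n. divergence (advect (u m) (u (n - m))) x) \<and>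
     (\<forall>i\<in>{1, 2}. planar_laplacian (\<lambda>y. v y $ i) x =
         - partial 3 (partial 3 (\<lambda>y. u n y $ i)) x
         + (\<Sum>m=0..n. advect (u m) (\<lambda>y. u (n - m) y $ i) x) + partial i q x) \<and>
     planar_laplacian (\<lambda>y. v y $ 3) x =
         - partial 3 (partial 3 (\<lambda>y. u n y $ 3)) x
         + (\<Sum>m=0..n. advect (u m) (\<lambda>y. u (n - m) y $ 3) x) + partial 3 (p n) x) \<longleftrightarrow> ?P (ln (rho x))"
    if x: "x \<in> phalf" for x
  proof -
    let ?t = "ln (rho x)"
    have xs: "x \<in> sect UNIV" using x by (simp add: sect_UNIV)
    have ui: "u m y $ i = VF 1 (\<alpha> m) (\<beta> m) (\<gamma> m) y $ i" if "y \<in> phalf" for y i m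
      using u[OF that] by simp
    have vi: "v y $ i = VF 1 \<alpha>' \<beta>' \<gamma>' y $ i" if "y \<in> phalf" for y i
      using v[OF that] by simp
    have a1: "planar_laplacian q x = SF 4 (\<lambda>t. exp (-2*t) * \<pi>2' t) x"
      using planar_laplacian_cong_open[OF S x q] planar_laplacian_SF[OF open_UNIV D\<pi>' xs, where k=2] by simp
    have a2: "partial 3 (partial 3 (p n)) x = SF 4 (\<lambda>t. \<pi>2 t + 5 * \<pi>1 t + 6 * \<pi> t) x"
    proof -
      have "partial 3 (partial 3 (p n)) x = partial 3 (partial 3 (SF 2 \<pi>)) x"
        by (rule partial_partial_cong_open[OF S x p])
      also have "\<dots> = SF 4 (\<lambda>t. \<pi>2 t + 5 * \<pi>1 t + 6 * \<pi> t) x"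
        unfolding partial33_SF[OF open_UNIV D\<pi> xs] by (simp add: SF_def algebra_simps)
      finally show ?thesis .
    qed
    have adv: "advect (u m) (\<lambda>y. u (n - m) y $ i) y = VF 3 (F1 m) (F2 m) (F3 m) y $ i" if y: "y \<in> phalf" for m i y
    proof -
      have ys: "y \<in> sect UNIV" using y by (simp add: sect_UNIV)
      have "advect (u m) (\<lambda>y. u (n - m) y $ i) y = advect (u m) (\<lambda>y. VF 1 (\<alpha> (n-m)) (\<beta> (n-m)) (\<gamma> (n-m)) y $ i) y"
        by (rule advect_cong_open[OF S y ui refl])
      then show ?thesis
        unfolding advect_VF_nth[where u="u m" and \<alpha>="\<alpha> m" and \<beta>="\<beta> m" and \<gamma>="\<gamma> m", OF D\<alpha>(1) D\<beta>(1) D\<gamma>(1) ys u[OF y]] F1 F2 F3 .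
    qed
    have ud: "u m differentiable (at y)" if y: "y \<in> phalf" for m y
    proof -
      have ys: "y \<in> sect UNIV" using y by (simp add: sect_UNIV)
      show ?thesis
        by (rule differentiable_cong_open[OF S y u])
         (simp_all add: differentiable_vecI VF_nth_differentiable[OF D\<alpha>(1) D\<beta>(1) D\<gamma>(1) ys])
    qed
    have a3: "divergence (advect (u m) (u (n - m))) x = SF 4 (\<lambda>t. 2 * F1 m t + F1' m t - F3' m t - 3 * F3 m t) x" for m
    proof -
      have "advect (u m) (u (n - m)) y = VF 3 (F1 m) (F2 m) (F3 m) y" if y: "y \<in> phalf" for y
        by (simp add: vec_eq_iff advect_vec_nth[OF ud[OF y]] adv[OF y])
      from divergence_cong_open[OF S x this] show ?thesis
        using divergence_VF[OF DF xs, where k=3] by simp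
    qed
    have b1: "planar_laplacian (\<lambda>y. v y $ i) x = VF 3 (\<lambda>t. exp (-2*t) * (\<alpha>2' t + 2 * \<alpha>1' t)) (\<lambda>t. exp (-2*t) * (\<beta>2' t + 2 * \<beta>1' t)) (\<lambda>t. exp (-2*t) * \<gamma>2' t) x $ i" for i
    proof -
      have "planar_laplacian (\<lambda>y. v y $ i) x = planar_laplacian (\<lambda>y. VF 1 \<alpha>' \<beta>' \<gamma>' y $ i) x"
        by (rule planar_laplacian_cong_open[OF S x vi])
      then show ?thesis
        unfolding planar_laplacian_VF_nth[OF open_UNIV D\<alpha>' D\<beta>' D\<gamma>' xs] by (simp add: eval_nat_numeral)
    qed
    have b2: "partial 3 (partial 3 (\<lambda>y. u n y $ i)) x = VF 3 (\<lambda>t. \<alpha>2 n t + 5 * \<alpha>1 n t + 6 * \<alpha> n t) (\<lambda>t. \<beta>2 n t + 5 * \<beta>1 n t + 6 * \<beta> n t) (\<lambda>t. \<gamma>2 n t + 3 * \<gamma>1 n t + 2 * \<gamma> n t) x $ i" for i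
      using partial_partial_cong_open[where f="\<lambda>y. u n y $ i", OF S x ui, of 3 3] partial33_VF_nth[OF open_UNIV D\<alpha> D\<beta> D\<gamma> xs]
      by (rule trans)
    have b3: "partial i q x = VF 3 (\<lambda>t. exp (-2*t) * \<pi>1' t) (\<lambda>t. 0) (\<lambda>t. - (2 * \<pi>' t + \<pi>1' t)) x $ i" for i
      using partial_cong_open[where f=q, OF S x q, of i] partial_SF_VF[OF D\<pi>'(1) xs, of i 2] by simp
    have b4: "partial i (p n) x = VF 3 (\<lambda>t. exp (-2*t) * \<pi>1 t) (\<lambda>t. 0) (\<lambda>t. - (2 * \<pi> t + \<pi>1 t)) x $ i" for i
      using partial_cong_open[where f="p n", OF S x p, of i] partial_SF_VF[OF D\<pi>(1) xs, of i 2] by simp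
    have A: "(- planar_laplacian q x =
         partial 3 (partial 3 (p n)) x + (\<Sum>m=0..n. divergence (advect (u m) (u (n - m))) x)) \<longleftrightarrow>
        - (exp (-2*?t) * \<pi>2' ?t) = \<pi>2 ?t + 5 * \<pi>1 ?t + 6 * \<pi> ?t + (\<Sum>m=0..n. 2 * F1 m ?t + F1' m ?t - F3' m ?t - 3 * F3 m ?t)"
    proof -
      have "(- planar_laplacian q x =
         partial 3 (partial 3 (p n)) x + (\<Sum>m=0..n. divergence (advect (u m) (u (n - m))) x)) \<longleftrightarrow>
        SF 4 (\<lambda>t. - (exp (-2*t) * \<pi>2' t)) x = SF 4 (\<lambda>t. \<pi>2 t + 5 * \<pi>1 t + 6 * \<pi> t + (\<Sum>m=0..n. 2 * F1 m t + F1' m t - F3' m t - 3 * F3 m t)) x"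
        unfolding a1 a2 a3 by (simp only: SF_def sum_distrib_left distrib_left mult_minus_right)
      then show ?thesis unfolding SF_eq_iff[OF x] .
    qed
    let ?L = "VF 3 (\<lambda>t. exp (-2*t) * (\<alpha>2' t + 2 * \<alpha>1' t)) (\<lambda>t. exp (-2*t) * (\<beta>2' t + 2 * \<beta>1' t)) (\<lambda>t. exp (-2*t) * \<gamma>2' t) x"
    let ?R = "VF 3 (\<lambda>t. - (\<alpha>2 n t + 5 * \<alpha>1 n t + 6 * \<alpha> n t) + (\<Sum>m=0..n. F1 m t) + exp (-2*t) * \<pi>1' t)
      (\<lambda>t. - (\<beta>2 n t + 5 * \<beta>1 n t + 6 * \<beta> n t) + (\<Sum>m=0..n. F2 m t) + 0)
      (\<lambda>t. - (\<gamma>2 n t + 3 * \<gamma>1 n t + 2 * \<gamma> n t) + (\<Sum>m=0..n. F3 m t) + - (2 * \<pi> t + \<pi>1 t)) x"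
    have B: "((\<forall>i\<in>{1, 2}. planar_laplacian (\<lambda>y. v y $ i) x =
         - partial 3 (partial 3 (\<lambda>y. u n y $ i)) x
         + (\<Sum>m=0..n. advect (u m) (\<lambda>y. u (n - m) y $ i) x) + partial i q x) \<and>
     planar_laplacian (\<lambda>y. v y $ 3) x =
         - partial 3 (partial 3 (\<lambda>y. u n y $ 3)) x
         + (\<Sum>m=0..n. advect (u m) (\<lambda>y. u (n - m) y $ 3) x) + partial 3 (p n) x) \<longleftrightarrow> (\<forall>i. ?L $ i = ?R $ i)"
      unfolding b1 b2 b3 b4 adv[OF x] sum_VF_nth VF_lin
      by (simp add: forall_3 VF_nth)
    show ?thesis
      by (simp only: A B VF_nth_eq_iff[OF x] add_0_right add_uminus_conv_diff conj_assoc)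
  qed
  show ?thesis
    unfolding recursion_eqs_def all_sect_iff[of UNIV ?P, unfolded sect_UNIV ball_UNIV, symmetric]
    by (rule ball_cong[OF refl *])
qed

section \<open>Profiles of homogeneous axisymmetric solutions\<close>

lemma cyl_nth [simp]: "cyl r \<phi> z $ 1 = r * cos \<phi>" "cyl r \<phi> z $ 2 = r * sin \<phi>" "cyl r \<phi> z $ 3 = z"
  by (simp_all add: cyl_def)

lemma rad_cyl: "r > 0 \<Longrightarrow> rad (cyl r \<phi> z) = r"
proof -
  assume r: "r > 0"
  have "(r * cos \<phi>)\<^sup>2 + (r * sin \<phi>)\<^sup>2 = r\<^sup>2 * ((cos \<phi>)\<^sup>2 + (sin \<phi>)\<^sup>2)"
    by (simp only: power_mult_distrib distrib_left)
  then show ?thesis using r by (simp add: rad_eq)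
qed

lemma cyl_mem_pcone: "0 < r \<Longrightarrow> r < \<delta> \<Longrightarrow> cyl r \<phi> 1 \<in> pcone \<delta>"
  using rad_cyl[of r \<phi> 1] by (auto simp: pcone_def cone_def horiz_eq_0_iff) (metis sin_zero_abs_cos_one abs_zero zero_neq_one)

lemma rho_cyl: "r > 0 \<Longrightarrow> rho (cyl r \<phi> 1) = r"
  by (simp add: rho_def rad_cyl)

lemma inner_vec3: "(u::real^3) \<bullet> v = u$1 * v$1 + u$2 * v$2 + u$3 * v$3"
  by (simp add: inner_vec_def sum_3)

lemma comp_rho_eq: "comp_rho u x = (u x $ 1 * x$1 + u x $ 2 * x$2) / rad x"
  by (simp add: comp_rho_def e_rho_def inner_vec3 add_divide_distrib)

lemma comp_phi_eq: "comp_phi u x = (u x $ 2 * x$1 - u x $ 1 * x$2) / rad x"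
  by (simp add: comp_phi_def e_phi_def inner_vec3 diff_divide_distrib)

lemma rad_pos: "x \<in> phalf \<Longrightarrow> rad x > 0"
  by (simp add: rad_eq mem_phalf_iff)

lemma rad_sq: "(rad x)\<^sup>2 = (x$1)\<^sup>2 + (x$2)\<^sup>2"
  by (simp add: rad_eq)

lemma comp_eq_iff:
  assumes "x \<in> phalf"
  shows "comp_rho u x = rad x * A \<and> comp_phi u x = rad x * B \<longleftrightarrow>
    u x $ 1 = x$1 * A - x$2 * B \<and> u x $ 2 = x$2 * A + x$1 * B"
proof -
  have r: "rad x \<noteq> 0" using rad_pos[OF assms] by simp
  have R: "(rad x)\<^sup>2 = (x$1)\<^sup>2 + (x$2)\<^sup>2" by (rule rad_sq)
  have *: "comp_rho u x = rad x * A \<longleftrightarrow> u x $ 1 * x$1 + u x $ 2 * x$2 = (rad x)\<^sup>2 * A"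
    "comp_phi u x = rad x * B \<longleftrightarrow> u x $ 2 * x$1 - u x $ 1 * x$2 = (rad x)\<^sup>2 * B"
    using r by (auto simp: comp_rho_eq comp_phi_eq field_simps power2_eq_square)
  show ?thesis
  proof
    assume "comp_rho u x = rad x * A \<and> comp_phi u x = rad x * B"
    then have e: "u x $ 1 * x$1 + u x $ 2 * x$2 = (rad x)\<^sup>2 * A" "u x $ 2 * x$1 - u x $ 1 * x$2 = (rad x)\<^sup>2 * B"
      by (simp_all add: *)
    have "(rad x)\<^sup>2 * (u x $ 1) = (rad x)\<^sup>2 * (x$1 * A - x$2 * B)" "(rad x)\<^sup>2 * (u x $ 2) = (rad x)\<^sup>2 * (x$2 * A + x$1 * B)"
      using e R by algebra+
    then show "u x $ 1 = x$1 * A - x$2 * B \<and> u x $ 2 = x$2 * A + x$1 * B"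
      using r by simp
  next
    assume "u x $ 1 = x$1 * A - x$2 * B \<and> u x $ 2 = x$2 * A + x$1 * B"
    then have e: "u x $ 1 = x$1 * A - x$2 * B" "u x $ 2 = x$2 * A + x$1 * B" by simp_all
    show "comp_rho u x = rad x * A \<and> comp_phi u x = rad x * B"
      unfolding * R e by (simp add: algebra_simps power2_eq_square)
  qed
qed

lemma VF_comp_iff:
  assumes "x \<in> phalf"
  shows "u x = VF k \<alpha> \<beta> \<gamma> x \<longleftrightarrow> comp_rho u x = rad x * SF (k+1) \<alpha> x \<and> comp_phi u x = rad x * SF (k+1) \<beta> x \<and> u x $ 3 = SF k \<gamma> x"
  using comp_eq_iff[OF assms, of u "SF (k+1) \<alpha> x" "SF (k+1) \<beta> x"]
  by (simp only: vec_eq_iff forall_3 VF_nth conj_assoc[symmetric])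

text \<open>A curve that meets each orbit of rotations and dilations in \<open>phalf\<close> once,
  parametrised so that \<open>ln (rho (ax t))\<close> is t. The profiles of a solution are read off
  along it.\<close>

definition ax :: "real \<Rightarrow> real^3" where
  "ax t = vector [exp t, 0, 1]"

lemma ax_eq_cyl: "ax t = cyl (exp t) 0 1"
  by (simp add: ax_def cyl_def)

lemma ax_has_derivative: "(ax has_derivative (\<lambda>h. (h * exp t) *\<^sub>R axis 1 1)) (at t)"
proof -
  have eq: "ax = (\<lambda>t. exp t *\<^sub>R axis 1 1 + axis 3 1)"
    by (simp add: fun_eq_iff ax_def vec_eq_iff forall_3)
  show ?thesis
    unfolding eq by (auto intro!: derivative_eq_intros)
qed

lemma ax_compose_derivative:
  fixes f :: "real^3 \<Rightarrow> real^'n"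
  assumes "f differentiable (at (ax t))"
  shows "((\<lambda>t. f (ax t) $ i) has_real_derivative exp t * partial 1 f (ax t) $ i) (at t)"
proof -
  let ?f' = "frechet_derivative f (at (ax t))"
  have f': "(f has_derivative ?f') (at (ax t))"
    using assms by (simp add: frechet_derivative_works)
  have "((\<lambda>t. f (ax t)) has_derivative (\<lambda>h. ?f' ((h * exp t) *\<^sub>R axis 1 1))) (at t)"
    using has_derivative_compose[OF ax_has_derivative f'] .
  then have "((\<lambda>t. f (ax t) $ i) has_derivative (\<lambda>h. ?f' ((h * exp t) *\<^sub>R axis 1 1) $ i)) (at t)"
    by (rule bounded_linear.has_derivative[OF bounded_linear_vec_nth])
  moreover have "?f' ((h * exp t) *\<^sub>R axis 1 1) = (h * exp t) *\<^sub>R ?f' (axis 1 1)" for h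
    using has_derivative_bounded_linear[OF f'] by (simp add: linear_simps)
  moreover have "(\<lambda>h. h * exp t * ?f' (axis 1 1) $ i) = (*) (exp t * partial 1 f (ax t) $ i)"
    by (simp add: fun_eq_iff partial_def)
  ultimately show ?thesis
    by (simp add: has_field_derivative_def)
qed

lemma polar_representation:
  assumes x: "x \<in> phalf"
  obtains \<phi> where "x = x$3 *\<^sub>R cyl (rho x) \<phi> 1"
proof -
  have r: "rad x > 0" "x$3 > 0" using rad_pos[OF x] x by (auto simp: mem_phalf_iff)
  have "(x$1 / rad x)\<^sup>2 + (x$2 / rad x)\<^sup>2 = 1"
    using r(1) by (simp add: power_divide add_divide_distrib[symmetric] rad_sq[symmetric])
  then obtain \<phi> where "x$1 / rad x = cos \<phi>" "x$2 / rad x = sin \<phi>"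
    using sincos_total_2pi by metis
  then have "x = x$3 *\<^sub>R cyl (rho x) \<phi> 1"
    using r by (simp add: vec_eq_iff forall_3 rho_def field_simps)
  then show ?thesis by (rule that)
qed

text \<open>A dilation moves x to height 1 and a rotation moves it onto \<open>ax\<close>. There the
  frame \<open>e_rho\<close>, \<open>e_phi\<close> is the first two coordinate directions and the
  radius is e^t, which explains the factor \<open>exp (-t)\<close>.\<close>

lemma hom_axi_representation:
  assumes \<delta>: "\<delta> > 0" and hom: "neg_homogeneous_on (pcone \<delta>) 1 u" "neg_homogeneous_on (pcone \<delta>) 2 p"
    and axi: "axisymmetric_on (pcone \<delta>) u p" and x: "x \<in> pcone \<delta>"
  shows "u x = VF 1 (\<lambda>t. exp (-t) * u (ax t) $ 1) (\<lambda>t. exp (-t) * u (ax t) $ 2) (\<lambda>t. u (ax t) $ 3) x"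
    and "p x = SF 2 (\<lambda>t. p (ax t)) x"
proof -
  let ?\<alpha> = "\<lambda>t. exp (-t) * u (ax t) $ 1" and ?\<beta> = "\<lambda>t. exp (-t) * u (ax t) $ 2" and ?t = "ln (rho x)"
  have ph: "x \<in> phalf" using x \<delta> by (simp add: pcone_eq_sect sect_def)
  have r: "rho x > 0" "x$3 > 0" "rho x < \<delta>"
    using rho_pos[OF ph] x by (auto simp: pcone_def cone_def rho_def field_simps)
  obtain \<phi> where \<phi>: "x = x$3 *\<^sub>R cyl (rho x) \<phi> 1"
    by (rule polar_representation[OF ph])
  define y where "y = cyl (rho x) \<phi> 1"
  have xy: "x = x$3 *\<^sub>R y" using \<phi> by (simp add: y_def)
  have y: "y \<in> pcone \<delta>" and y0: "cyl (rho x) 0 1 \<in> pcone \<delta>"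
    unfolding y_def using r by (auto intro: cyl_mem_pcone)
  have yp: "y \<in> phalf" using y \<delta> by (simp add: pcone_eq_sect sect_def)
  have y0p: "cyl (rho x) 0 1 \<in> phalf" using y0 \<delta> by (simp add: pcone_eq_sect sect_def)
  have ax: "ax ?t = cyl (rho x) 0 1" using r by (simp add: ax_eq_cyl)
  have e: "exp (- ?t) = inverse (rho x)" using r by (simp add: exp_minus)
  have ind: "f y = f (ax ?t)" if "phi_independent_on (pcone \<delta>) f" for f
    using that[unfolded phi_independent_on_def, rule_format, OF r(1)] y y0 unfolding y_def ax by blast
  have "comp_rho u y = comp_rho u (ax ?t)" "comp_phi u y = comp_phi u (ax ?t)" "u y $ 3 = u (ax ?t) $ 3" "p y = p (ax ?t)"
    using axi ind[of "comp_rho u"] ind[of "comp_phi u"] ind[of "\<lambda>x. u x $ 3"] ind[of p]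
    unfolding axisymmetric_on_def by simp_all
  moreover have "comp_rho u (ax ?t) = rad y * ?\<alpha> ?t" "comp_phi u (ax ?t) = rad y * ?\<beta> ?t"
    using r by (simp_all add: ax comp_rho_eq comp_phi_eq rad_cyl y_def exp_minus)
  ultimately have *: "u y $ 1 = y$1 * ?\<alpha> ?t - y$2 * ?\<beta> ?t" "u y $ 2 = y$2 * ?\<alpha> ?t + y$1 * ?\<beta> ?t"
    "u y $ 3 = u (ax ?t) $ 3" "p y = p (ax ?t)"
    using comp_eq_iff[OF yp, of u "?\<alpha> ?t" "?\<beta> ?t"] by simp_all
  have "u (x$3 *\<^sub>R y) = (x$3) powr (-1) *\<^sub>R u y" "p (x$3 *\<^sub>R y) = (x$3) powr (-2) *\<^sub>R p y"
    using hom y r unfolding neg_homogeneous_on_def by auto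
  then have ux: "u x = inverse (x$3) *\<^sub>R u y" "p x = inverse (x$3) ^ 2 * p y"
    using r xy by (simp_all add: powr_minus power_inverse)
  have yx: "y$1 = inverse (x$3) * x$1" "y$2 = inverse (x$3) * x$2"
    using arg_cong[OF xy, of "\<lambda>v. v $ 1"] arg_cong[OF xy, of "\<lambda>v. v $ 2"] r
    by (simp_all add: field_simps)
  show "u x = VF 1 ?\<alpha> ?\<beta> (\<lambda>t. u (ax t) $ 3) x"
    unfolding vec_eq_iff forall_3 VF_nth SF_def ux(1) vector_scaleR_component * real_scaleR_def yx
    by (simp add: algebra_simps power2_eq_square)
  show "p x = SF 2 (\<lambda>t. p (ax t)) x"
    by (simp add: SF_def ux * )
qed

lemma ax_mem_pcone: "\<delta> > 0 \<Longrightarrow> t < ln \<delta> \<Longrightarrow> ax t \<in> pcone \<delta>"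
  using exp_less_cancel_iff[of t "ln \<delta>"] unfolding ax_eq_cyl by (intro cyl_mem_pcone) simp_all

lemma solution_profile:
  assumes \<delta>: "\<delta> > 0" and sol: "hom_axi_NS_solution \<delta> u p" and C2: "Ck_on 2 (pcone \<delta>) u" "Ck_on 2 (pcone \<delta>) p"
  obtains \<alpha> \<alpha>1 \<alpha>2 \<beta> \<beta>1 \<beta>2 \<gamma> \<gamma>1 \<gamma>2 \<pi> \<pi>1 where
    "D1 {..<ln \<delta>} \<alpha> \<alpha>1" "D1 {..<ln \<delta>} \<alpha>1 \<alpha>2" "D1 {..<ln \<delta>} \<beta> \<beta>1" "D1 {..<ln \<delta>} \<beta>1 \<beta>2"
    "D1 {..<ln \<delta>} \<gamma> \<gamma>1" "D1 {..<ln \<delta>} \<gamma>1 \<gamma>2" "D1 {..<ln \<delta>} \<pi> \<pi>1"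
    "\<And>x. x \<in> pcone \<delta> \<Longrightarrow> u x = VF 1 \<alpha> \<beta> \<gamma> x" "\<And>x. x \<in> pcone \<delta> \<Longrightarrow> p x = SF 2 \<pi> x"
    "\<And>t. t < ln \<delta> \<Longrightarrow> NS_ode \<alpha> \<alpha>1 \<alpha>2 \<beta> \<beta>1 \<beta>2 \<gamma> \<gamma>1 \<gamma>2 \<pi> \<pi>1 t"
proof -
  let ?I = "{..<ln \<delta>}"
  let ?a = "\<lambda>i t. u (ax t) $ i" and ?a1 = "\<lambda>i t. exp t * partial 1 u (ax t) $ i"
  let ?a2 = "\<lambda>i t. exp t * partial 1 u (ax t) $ i + exp t * (exp t * partial 1 (partial 1 u) (ax t) $ i)"
  have p1: "(\<lambda>x. frechet_derivative f (at x) (axis 1 1)) = partial 1 f" for f :: "real^3 \<Rightarrow> 'z::real_normed_vector"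
    by (simp add: partial_def fun_eq_iff)
  have ud: "u differentiable (at x)" "partial 1 u differentiable (at x)" if "x \<in> pcone \<delta>" for x
    using C2(1) that p1[of u] unfolding numeral_2_eq_2 by simp_all metis+
  have pd: "p differentiable (at x)" if "x \<in> pcone \<delta>" for x
    using C2(2) that unfolding numeral_2_eq_2 by simp
  have D: "D1 ?I (?a i) (?a1 i)" "D1 ?I (?a1 i) (?a2 i)" for i
    using ax_mem_pcone[OF \<delta>] ud
    by (auto simp: D1_def intro!: derivative_eq_intros ax_compose_derivative)
  have E: "D1 ?I (\<lambda>t. exp (-t) * f t) (\<lambda>t. exp (-t) * f1 t - exp (-t) * f t)" if "D1 ?I f f1" for f f1
    using that unfolding D1_def by (auto intro!: derivative_eq_intros)
  have E2: "D1 ?I (\<lambda>t. exp (-t) * f1 t - exp (-t) * f t) (\<lambda>t. exp (-t) * f2 t - 2 * exp (-t) * f1 t + exp (-t) * f t)"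
    if "D1 ?I f f1" "D1 ?I f1 f2" for f f1 f2
    using that unfolding D1_def by (auto intro!: derivative_eq_intros simp: algebra_simps)
  have P: "D1 ?I (\<lambda>t. p (ax t)) (\<lambda>t. exp t * partial 1 p (ax t))"
  proof -
    have "((\<lambda>t. p (ax t)) has_real_derivative exp t * partial 1 p (ax t)) (at t)" if "t < ln \<delta>" for t
    proof -
      \<comment> \<open>The chain rule along \<open>ax\<close> is available for vector-valued
        functions, so the pressure is viewed as one with values in \<open>real^1\<close>.\<close>
      let ?f = "\<lambda>x. p x *\<^sub>R (1 :: real^1)"
      have pd': "p differentiable (at (ax t))" by (rule pd[OF ax_mem_pcone[OF \<delta> that]])
      then have "?f differentiable (at (ax t))" by simp
      from ax_compose_derivative[OF this, of 1] show ?thesis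
        by (simp add: partial_scaleR_left[OF pd'])
    qed
    then show ?thesis by (simp add: D1_def)
  qed
  have h: "neg_homogeneous_on (pcone \<delta>) 1 u" "neg_homogeneous_on (pcone \<delta>) 2 p" "axisymmetric_on (pcone \<delta>) u p"
    using sol by (simp_all add: hom_axi_NS_solution_def)
  note rep = hom_axi_representation[OF \<delta> h]
  have ns: "stationary_NS_on (sect ?I) u p"
    using sol pcone_eq_sect[OF \<delta>] by (simp add: hom_axi_NS_solution_def)
  note DD = E[OF D(1), of 1] E2[OF D, of 1] E[OF D(1), of 2] E2[OF D, of 2] D(1)[of 3] D(2)[of 3] P
  note NS = stationary_NS_iff_ode[where u=u and p=p, OF open_lessThan DD rep[unfolded pcone_eq_sect[OF \<delta>]], THEN iffD1, OF _ _ ns]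
  show ?thesis
    by (rule that[OF DD rep]) (use NS in auto)
qed

text \<open>The condition is evaluated along \<open>ax\<close>, at height 1 and radius e^t. There
  |u| = o(e^(-t)), and the horizontal components are e^t times \<open>\<alpha>\<close> and
  \<open>\<beta>\<close>; hence the weight e^(2t) for these two and e^t for
  \<open>\<gamma>\<close>.\<close>

lemma mild_profile:
  assumes \<delta>: "\<delta> > 0" and u: "\<And>x. x \<in> pcone \<delta> \<Longrightarrow> u x = VF 1 \<alpha> \<beta> \<gamma> x"
  shows "mild_at_axis u \<Longrightarrow> ((\<lambda>t. exp (2*t) * \<alpha> t) \<longlongrightarrow> 0) at_bot \<and> ((\<lambda>t. exp (2*t) * \<beta> t) \<longlongrightarrow> 0) at_bot
      \<and> ((\<lambda>t. exp t * \<gamma> t) \<longlongrightarrow> 0) at_bot"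
proof -
  assume mild: "mild_at_axis u"
  have lim: "filterlim (\<lambda>t. vector [exp t, 0] :: real^2) (at 0) at_bot"
  proof (unfold filterlim_at, intro conjI)
    show "\<forall>\<^sub>F t in at_bot. (vector [exp t, 0] :: real^2) \<in> UNIV \<and> (vector [exp t, 0] :: real^2) \<noteq> 0"
      by (simp add: vec_eq_iff forall_2)
    have "((\<lambda>t. exp t *\<^sub>R axis 1 1 :: real^2) \<longlongrightarrow> 0 *\<^sub>R axis 1 1) at_bot"
      by (intro tendsto_intros exp_at_bot)
    moreover have "(vector [exp t, 0] :: real^2) = exp t *\<^sub>R axis 1 1" for t
      by (simp add: vec_eq_iff forall_2 axis_def)
    ultimately show "((\<lambda>t. vector [exp t, 0] :: real^2) \<longlongrightarrow> 0) at_bot" by simp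
  qed
  have *: "((\<lambda>t. exp t * norm (u (ax t))) \<longlongrightarrow> 0) at_bot"
  proof (rule tendstoI)
    fix e :: real assume e: "e > 0"
    have "(\<lambda>y::real^2. norm (u (vector [y$1, y$2, 1]))) \<in> o[at 0](\<lambda>y. inverse (norm y))"
      using mild by (simp add: mild_at_axis_def)
    from landau_o.smallD[OF this, of "e/2"] e
    have "\<forall>\<^sub>F y in at (0::real^2). norm (u (vector [y$1, y$2, 1])) \<le> e/2 * inverse (norm y)"
      by simp
    then have "\<forall>\<^sub>F t in at_bot. norm (u (vector [exp t, 0, 1])) \<le> e/2 * inverse (norm (vector [exp t, 0] :: real^2))"
      using eventually_compose_filterlim[OF _ lim] by fastforce
    then show "\<forall>\<^sub>F t in at_bot. dist (exp t * norm (u (ax t))) 0 < e"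
    proof (rule eventually_mono)
      fix t :: real
      assume "norm (u (vector [exp t, 0, 1])) \<le> e/2 * inverse (norm (vector [exp t, 0] :: real^2))"
      then have "norm (u (ax t)) \<le> e/2 * exp (-t)"
        by (simp add: ax_def norm_vec_def L2_set_def UNIV_2 exp_minus)
      then have "exp t * norm (u (ax t)) \<le> exp t * (e/2 * exp (-t))"
        by (intro mult_left_mono) auto
      also have "\<dots> < e" using e by (simp add: exp_minus)
      finally show "dist (exp t * norm (u (ax t))) 0 < e" by simp
    qed
  qed
  have ev: "\<forall>\<^sub>F t in at_bot. t < ln \<delta>" by (rule eventually_at_bot_dense[THEN iffD2]) blast
  have bnd: "((\<lambda>t. exp t * u (ax t) $ i) \<longlongrightarrow> 0) at_bot" for i
    by (rule Lim_null_comparison[OF _ *]) (simp add: abs_mult component_le_norm_cart)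
  have comp: "exp t * u (ax t) $ 1 = exp (2*t) * \<alpha> t" "exp t * u (ax t) $ 2 = exp (2*t) * \<beta> t"
    "exp t * u (ax t) $ 3 = exp t * \<gamma> t" if "t < ln \<delta>" for t
    using u[OF ax_mem_pcone[OF \<delta> that]]
    by (simp_all add: VF_nth SF_def ax_eq_cyl rho_cyl exp_double power2_eq_square)
  show ?thesis
    using bnd[of 1] bnd[of 2] bnd[of 3] tendsto_cong[OF eventually_mono[OF ev comp(1)]]
     tendsto_cong[OF eventually_mono[OF ev comp(2)]] tendsto_cong[OF eventually_mono[OF ev comp(3)]] by simp
qed

lemma filterlim_exp_at_right_0: "filterlim exp (at_right 0) (at_bot :: real filter)"
  by (simp add: filterlim_at exp_at_bot)

lemma tendsto_at_right_0_iff: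
  fixes f :: "real \<Rightarrow> real"
  assumes \<delta>: "\<delta> > 0" and f: "\<And>s. 0 < s \<Longrightarrow> s < \<delta> \<Longrightarrow> f s = g (ln s)"
  shows "(f \<longlongrightarrow> L) (at_right 0) \<longleftrightarrow> (g \<longlongrightarrow> L) at_bot"
proof -
  have "\<forall>\<^sub>F s in at_right 0. 0 < s \<and> s < \<delta>"
    using eventually_at_right_real[OF \<delta>] by simp
  then have "(f \<longlongrightarrow> L) (at_right 0) \<longleftrightarrow> ((\<lambda>s. g (ln s)) \<longlongrightarrow> L) (at_right 0)"
    using f by (intro filterlim_cong) (auto elim: eventually_mono)
  also have "\<dots> \<longleftrightarrow> (g \<longlongrightarrow> L) at_bot"
  proof
    assume "((\<lambda>s. g (ln s)) \<longlongrightarrow> L) (at_right 0)"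
    from filterlim_compose[OF this filterlim_exp_at_right_0] show "(g \<longlongrightarrow> L) at_bot" by simp
  next
    assume "(g \<longlongrightarrow> L) at_bot"
    from filterlim_compose[OF this ln_at_0] show "((\<lambda>s. g (ln s)) \<longlongrightarrow> L) (at_right 0)" .
  qed
  finally show ?thesis .
qed

text \<open>The substitution s = e^t turns s d/ds into d/dt, so the limit for the pressure
  derivative is that of \<open>\<pi>1\<close>. The profiles do not depend on the angle, and the
  requirements along all rays collapse to one.\<close>

lemma axis_limits_profile:
  assumes \<delta>: "\<delta> > 0" and u: "\<And>x. x \<in> pcone \<delta> \<Longrightarrow> u x = VF 1 \<alpha> \<beta> \<gamma> x"
    and p: "\<And>x. x \<in> pcone \<delta> \<Longrightarrow> p x = SF 2 \<pi> x" and D: "D1 {..<ln \<delta>} \<pi> \<pi>1"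
  shows "axis_limits l u p \<longleftrightarrow> (\<pi>1 \<longlongrightarrow> par_c l) at_bot \<and> ((\<lambda>t. \<pi> t - par_c l * t) \<longlongrightarrow> par_d l) at_bot \<and>
     ((\<lambda>t. \<alpha> t - 1/2 * par_c l * t) \<longlongrightarrow> par_brho l) at_bot \<and> (\<beta> \<longlongrightarrow> par_bphi l) at_bot"
proof -
  have pc: "p (cyl s \<phi> 1) = \<pi> (ln s)" if "0 < s" "s < \<delta>" for s \<phi>
    using p[OF cyl_mem_pcone[OF that]] that by (simp add: SF_def rho_cyl)
  have uc: "comp_rho u (cyl s \<phi> 1) = s * \<alpha> (ln s)" "comp_phi u (cyl s \<phi> 1) = s * \<beta> (ln s)" if "0 < s" "s < \<delta>" for s \<phi>
  proof -
    have c: "cyl s \<phi> 1 \<in> pcone \<delta>" by (rule cyl_mem_pcone[OF that])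
    then have ph: "cyl s \<phi> 1 \<in> phalf" using \<delta> by (simp add: pcone_eq_sect sect_def)
    show "comp_rho u (cyl s \<phi> 1) = s * \<alpha> (ln s)" "comp_phi u (cyl s \<phi> 1) = s * \<beta> (ln s)"
      using VF_comp_iff[where u=u and k=1, OF ph, THEN iffD1, OF u[OF c]] that by (simp_all add: SF_def rho_cyl rad_cyl)
  qed
  have dp: "s * deriv (\<lambda>\<sigma>. p (cyl \<sigma> \<phi> 1)) s = \<pi>1 (ln s)" if s: "0 < s" "s < \<delta>" for s \<phi>
  proof -
    have "((\<lambda>s. \<pi> (ln s)) has_real_derivative \<pi>1 (ln s) * inverse s) (at s)"
      using D1D[OF D, of "ln s"] s \<delta> by (auto intro!: derivative_eq_intros DERIV_chain2[of \<pi>] simp: divide_inverse)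
    then have "((\<lambda>\<sigma>. p (cyl \<sigma> \<phi> 1)) has_real_derivative \<pi>1 (ln s) * inverse s) (at s)"
      by (rule has_field_derivative_transform_within_open[of _ _ _ "{0<..<\<delta>}"]) (use s pc in auto)
    then show ?thesis using s by (simp add: DERIV_imp_deriv)
  qed
  have "((\<lambda>s. s * deriv (\<lambda>\<sigma>. p (cyl \<sigma> \<phi> 1)) s) \<longlongrightarrow> c) (at_right 0) \<longleftrightarrow> (\<pi>1 \<longlongrightarrow> c) at_bot" for \<phi> c
    by (rule tendsto_at_right_0_iff[OF \<delta>]) (rule dp)
  moreover have "((\<lambda>s. p (cyl s \<phi> 1) - c * ln s) \<longlongrightarrow> d) (at_right 0) \<longleftrightarrow> ((\<lambda>t. \<pi> t - c * t) \<longlongrightarrow> d) at_bot" for \<phi> c d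
    by (rule tendsto_at_right_0_iff[OF \<delta>]) (simp add: pc)
  moreover have "((\<lambda>s. 1 / s * (comp_rho u (cyl s \<phi> 1) - 1/2 * c * s * ln s)) \<longlongrightarrow> d) (at_right 0) \<longleftrightarrow> ((\<lambda>t. \<alpha> t - 1/2 * c * t) \<longlongrightarrow> d) at_bot" for \<phi> c d
    by (rule tendsto_at_right_0_iff[OF \<delta>]) (simp add: uc field_simps)
  moreover have "((\<lambda>s. 1 / s * comp_phi u (cyl s \<phi> 1)) \<longlongrightarrow> d) (at_right 0) \<longleftrightarrow> (\<beta> \<longlongrightarrow> d) at_bot" for \<phi> d
    by (rule tendsto_at_right_0_iff[OF \<delta>]) (simp add: uc field_simps)
  ultimately show ?thesis
    unfolding axis_limits_def by simp
qed

section \<open>A first-order system\<close>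

text \<open>Equal to 1 / (1 + \<open>exp (-2*t)\<close>), the reciprocal of the coefficient of the
  second derivatives in \<open>NS_ode\<close>. Multiplication by it brings these equations to normal
  form and replaces \<open>exp (-2*t)\<close> by the bounded coefficient 1 - \<kappa>.\<close>

definition kap :: "real \<Rightarrow> real" where
  "kap t = exp (2*t) / (1 + exp (2*t))"

lemma kap_bounds: "0 < kap t" "kap t < 1" "kap t \<le> exp (2*t)"
  using exp_gt_zero[of "2*t"] by (auto simp: kap_def field_simps pos_add_strict intro: less_trans)

lemma kap_has_derivative: "(kap has_real_derivative 2 * kap t * (1 - kap t)) (at t)"
proof -
  have "1 + exp (2*t) \<noteq> 0" using exp_gt_zero[of "2*t"] by linarith
  then show ?thesis
    unfolding kap_def[abs_def]
    by (auto intro!: derivative_eq_intros simp: field_simps power2_eq_square)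
qed

text \<open>With \<open>kap\<close> replaced by 0 the quantities G, k, N are constant, \<sigma> is a
  primitive of h, and \<beta> and h are damped at rate 2. The only nonlinear terms are \<kappa>
  \<sigma> G, \<kappa> \<sigma>^2 / 2 and 2 \<kappa> \<beta> G.\<close>

definition first_order_system :: "real \<Rightarrow> (real \<Rightarrow> real) \<Rightarrow> (real \<Rightarrow> real) \<Rightarrow> (real \<Rightarrow> real) \<Rightarrow> (real \<Rightarrow> real) \<Rightarrow> (real \<Rightarrow> real) \<Rightarrow> (real \<Rightarrow> real) \<Rightarrow> bool" where
  "first_order_system T \<beta> G \<sigma> h k N \<longleftrightarrow> (\<forall>t<T.
     (\<beta> has_real_derivative G t - 2 * \<beta> t) (at t) \<and>
     (G has_real_derivative kap t * (\<sigma> t - 3) * G t) (at t) \<and>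
     (\<sigma> has_real_derivative h t - kap t * (\<sigma> t - \<sigma> t * \<sigma> t / 2)) (at t) \<and>
     (h has_real_derivative k t - 2 * h t) (at t) \<and>
     (k has_real_derivative kap t * (N t - 3 * k t)) (at t) \<and>
     (N has_real_derivative kap t * (2 * \<beta> t * G t - 4 * N t)) (at t))"

text \<open>Incompressibility reads \<open>\<sigma>' = - \<alpha> - \<sigma>\<close>. The three functions below are
  \<open>h = \<sigma>' + \<kappa> (\<sigma> - \<sigma>\<^sup>2 / 2)\<close>, \<open>k = h' + 2 h\<close> and \<open>N = k' / \<kappa> + 3 k\<close>, with the higher derivatives
  of \<open>\<sigma>\<close> eliminated by means of the momentum equations.\<close>
definition hfun :: "(real \<Rightarrow> real) \<Rightarrow> (real \<Rightarrow> real) \<Rightarrow> real \<Rightarrow> real" where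
  "hfun \<alpha> \<sigma> t = - \<alpha> t - \<sigma> t + kap t * (\<sigma> t - \<sigma> t * \<sigma> t / 2)"

definition kfun :: "(real \<Rightarrow> real) \<Rightarrow> (real \<Rightarrow> real) \<Rightarrow> (real \<Rightarrow> real) \<Rightarrow> real \<Rightarrow> real" where
  "kfun \<alpha> \<alpha>1 \<sigma> t = - \<alpha>1 t - \<alpha> t - \<sigma> t
     + kap t * ((4 - 2 * kap t) * (\<sigma> t - \<sigma> t * \<sigma> t / 2) + (- \<alpha> t - \<sigma> t) * (1 - \<sigma> t))"

definition Nfun :: "(real \<Rightarrow> real) \<Rightarrow> (real \<Rightarrow> real) \<Rightarrow> (real \<Rightarrow> real) \<Rightarrow> (real \<Rightarrow> real) \<Rightarrow> (real \<Rightarrow> real) \<Rightarrow> real \<Rightarrow> real" where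
  "Nfun \<alpha> \<alpha>1 \<beta> \<sigma> \<pi> t = (\<alpha>1 t + \<alpha> t + \<sigma> t)
    + kap t * (3 * \<alpha>1 t + 6 * \<alpha> t - (\<alpha> t * \<alpha> t - \<beta> t * \<beta> t + \<sigma> t * \<alpha>1 t - 2 * (\<alpha> t - \<sigma> t) * \<alpha> t))
    + (1 - kap t) * (3 * (\<alpha>1 t + \<alpha> t + \<sigma> t) + 2 * (\<alpha> t - \<sigma> t) - \<sigma> t * (\<alpha>1 t + \<alpha> t + \<sigma> t) + (\<alpha> t - \<sigma> t) * (\<alpha> t - \<sigma> t))
    + 2 * (1 - kap t) * \<pi> t
    + 2 * (1 - kap t) * ((4 - 2 * kap t) * (\<sigma> t - \<sigma> t * \<sigma> t / 2) + (- \<alpha> t - \<sigma> t) * (1 - \<sigma> t))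
    - 4 * kap t * (1 - kap t) * (\<sigma> t - \<sigma> t * \<sigma> t / 2) + (4 - 2 * kap t) * ((- \<alpha> t - \<sigma> t) * (1 - \<sigma> t))
    + ((- \<alpha>1 t + \<alpha> t + \<sigma> t) * (1 - \<sigma> t) - (\<alpha> t + \<sigma> t) * (\<alpha> t + \<sigma> t)) + 3 * kfun \<alpha> \<alpha>1 \<sigma> t"

text \<open>The premise on \<open>\<gamma>2\<close> is the differentiated incompressibility
  condition. With it the radial and the axial equation both determine \<open>\<alpha>2\<close>, and
  comparing the two yields the derivative of the pressure.\<close>

lemma NS_ode_solved:
  assumes "NS_ode \<alpha> \<alpha>1 \<alpha>2 \<beta> \<beta>1 \<beta>2 \<gamma> \<gamma>1 \<gamma>2 \<pi> \<pi>1 t" and \<sigma>: "\<sigma> = \<alpha> t - \<gamma> t"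
    and g2: "\<gamma>2 t = \<alpha>2 t + 2 * \<alpha>1 t - \<gamma>1 t" and K: "K = kap t"
  defines "F1 \<equiv> \<alpha> t * \<alpha> t - \<beta> t * \<beta> t + \<sigma> * \<alpha>1 t - 2 * (\<alpha> t - \<sigma>) * \<alpha> t"
  shows "\<pi>1 t = \<alpha>1 t + \<alpha> t + \<sigma> + K * (3 * \<alpha>1 t + 6 * \<alpha> t) - K * F1
      - K * (3 * (\<alpha>1 t + \<alpha> t + \<sigma>) + 2 * (\<alpha> t - \<sigma>)) + K * (\<sigma> * (\<alpha>1 t + \<alpha> t + \<sigma>) - (\<alpha> t - \<sigma>) * (\<alpha> t - \<sigma>)) - 2 * K * \<pi> t" (is ?A)
    and "\<alpha>2 t = - 2 * \<alpha>1 t - K * (3 * \<alpha>1 t + 6 * \<alpha> t) + K * F1 + (1 - K) * \<pi>1 t" (is ?B)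
    and "\<beta>2 t = - 2 * \<beta>1 t - K * (3 * \<beta>1 t + 6 * \<beta> t) + K * (\<sigma> * (\<beta>1 t + 2 * \<beta> t))" (is ?C)
proof -
  have KE: "K * exp (-2*t) = 1 - K"
  proof -
    have "1 + exp (2*t) \<noteq> 0" using exp_gt_zero[of "2*t"] by linarith
    then have "1 - K = 1 / (1 + exp (2*t))"
      by (simp add: K kap_def field_simps)
    moreover have "exp (2*t) * exp (-2*t) = 1"
      by (simp add: exp_add[symmetric])
    ultimately show ?thesis
      by (simp add: K kap_def)
  qed
  have g: "\<gamma> t = \<alpha> t - \<sigma>" using \<sigma> by simp
  note ns = assms(1)[unfolded NS_ode_def]
  have g1: "\<gamma>1 t = \<alpha>1 t + \<alpha> t + \<sigma>" using ns \<sigma> by simp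
  have e1: "exp (-2*t) * (\<alpha>2 t + 2 * \<alpha>1 t) + (\<alpha>2 t + 5 * \<alpha>1 t + 6 * \<alpha> t) = F1 + exp (-2*t) * \<pi>1 t"
    using ns unfolding F1_def g by simp
  have e2: "exp (-2*t) * (\<beta>2 t + 2 * \<beta>1 t) + (\<beta>2 t + 5 * \<beta>1 t + 6 * \<beta> t) = \<sigma> * (\<beta>1 t + 2 * \<beta> t)"
    using ns unfolding g by (simp add: algebra_simps)
  have e3: "exp (-2*t) * (\<alpha>2 t + \<alpha>1 t - \<alpha> t - \<sigma>) + (\<alpha>2 t + \<alpha>1 t - \<alpha> t - \<sigma> + 3 * (\<alpha>1 t + \<alpha> t + \<sigma>) + 2 * (\<alpha> t - \<sigma>)) =
       (\<sigma> * (\<alpha>1 t + \<alpha> t + \<sigma>) - (\<alpha> t - \<sigma>) * (\<alpha> t - \<sigma>)) - (2 * \<pi> t + \<pi>1 t)"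
    using ns unfolding g2 g1 g by (simp add: algebra_simps)
  show b: ?B using e1 KE by algebra
  show ?C using e2 KE by algebra
  \<comment> \<open>The second formula for \<open>\<alpha>2\<close>, from the axial equation. It
    contains \<open>\<pi>1\<close> with coefficient -K, the radial one with 1 - K; their difference
    isolates \<open>\<pi>1\<close> with coefficient 1.\<close>
  have "\<alpha>2 t = - (\<alpha>1 t - \<alpha> t - \<sigma>) - K * (3 * (\<alpha>1 t + \<alpha> t + \<sigma>) + 2 * (\<alpha> t - \<sigma>)) + K * (\<sigma> * (\<alpha>1 t + \<alpha> t + \<sigma>) - (\<alpha> t - \<sigma>) * (\<alpha> t - \<sigma>)) - K * (2 * \<pi> t + \<pi>1 t)"
    using e3 KE by algebra
  with b show ?A by algebra
qed

lemma NS_ode_gamma2: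
  assumes D: "D1 {..<T} \<alpha> \<alpha>1" "D1 {..<T} \<alpha>1 \<alpha>2" "D1 {..<T} \<gamma> \<gamma>1" "D1 {..<T} \<gamma>1 \<gamma>2"
    and ns: "\<And>t. t < T \<Longrightarrow> NS_ode \<alpha> \<alpha>1 \<alpha>2 \<beta> \<beta>1 \<beta>2 \<gamma> \<gamma>1 \<gamma>2 \<pi> \<pi>1 t" and t: "t < T"
  shows "\<gamma>2 t = \<alpha>2 t + 2 * \<alpha>1 t - \<gamma>1 t"
proof -
  have g1: "2 * \<alpha> s + \<alpha>1 s - \<gamma> s = \<gamma>1 s" if "s < T" for s
    using ns[OF that] by (simp add: NS_ode_def)
  have "((\<lambda>s. 2 * \<alpha> s + \<alpha>1 s - \<gamma> s) has_real_derivative 2 * \<alpha>1 t + \<alpha>2 t - \<gamma>1 t) (at t)"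
    using D t by (auto intro!: derivative_eq_intros simp: D1_def)
  then have "(\<gamma>1 has_real_derivative 2 * \<alpha>1 t + \<alpha>2 t - \<gamma>1 t) (at t)"
    by (rule has_field_derivative_transform_within_open[of _ _ _ "{..<T}"]) (use t g1 in auto)
  moreover have "(\<gamma>1 has_real_derivative \<gamma>2 t) (at t)" using D1D[OF D(4)] t by simp
  ultimately show ?thesis using DERIV_unique by fastforce
qed

text \<open>The highest derivatives are eliminated by \<open>NS_ode_solved\<close>. Among the new
  variables the pressure occurs in N alone, and in N' it combines with all quadratic terms except
  the swirl term 2 \<beta> G into -4 \<kappa> N.\<close>

lemma first_order_system_of_NS_ode:
  assumes D: "D1 {..<T} \<alpha> \<alpha>1" "D1 {..<T} \<alpha>1 \<alpha>2" "D1 {..<T} \<beta> \<beta>1" "D1 {..<T} \<beta>1 \<beta>2"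
    "D1 {..<T} \<gamma> \<gamma>1" "D1 {..<T} \<gamma>1 \<gamma>2" "D1 {..<T} \<pi> \<pi>1"
    and ns: "\<And>t. t < T \<Longrightarrow> NS_ode \<alpha> \<alpha>1 \<alpha>2 \<beta> \<beta>1 \<beta>2 \<gamma> \<gamma>1 \<gamma>2 \<pi> \<pi>1 t"
  defines "\<sigma> \<equiv> \<lambda>t. \<alpha> t - \<gamma> t"
  shows "first_order_system T \<beta> (\<lambda>t. \<beta>1 t + 2 * \<beta> t) \<sigma> (hfun \<alpha> \<sigma>) (kfun \<alpha> \<alpha>1 \<sigma>) (Nfun \<alpha> \<alpha>1 \<beta> \<sigma> \<pi>)"
  unfolding first_order_system_def
proof (intro allI impI)
  fix t assume t: "t < T"
  have d: "(\<alpha> has_real_derivative \<alpha>1 t) (at t)" "(\<alpha>1 has_real_derivative \<alpha>2 t) (at t)"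
     "(\<beta> has_real_derivative \<beta>1 t) (at t)" "(\<beta>1 has_real_derivative \<beta>2 t) (at t)"
     "(\<gamma> has_real_derivative \<gamma>1 t) (at t)" "(\<gamma>1 has_real_derivative \<gamma>2 t) (at t)" "(\<pi> has_real_derivative \<pi>1 t) (at t)"
    using D t by (simp_all add: D1_def)
  have g1: "\<gamma>1 s = 2 * \<alpha> s + \<alpha>1 s - \<gamma> s" if "s < T" for s
    using ns[OF that] by (simp add: NS_ode_def)
  note g2 = NS_ode_gamma2[OF D(1,2,5,6) ns t]
  have d\<sigma>: "(\<sigma> has_real_derivative - \<alpha> t - \<sigma> t) (at t)"
    unfolding \<sigma>_def using d g1[OF t] by (auto intro!: derivative_eq_intros)
  note S = NS_ode_solved[OF ns[OF t] refl g2 refl, folded \<sigma>_def]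
  have S': "\<sigma> t = \<alpha> t - \<gamma> t" by (simp add: \<sigma>_def)
  note S = S[folded S']
  show "(\<beta> has_real_derivative \<beta>1 t + 2 * \<beta> t - 2 * \<beta> t) (at t) \<and>
     ((\<lambda>t. \<beta>1 t + 2 * \<beta> t) has_real_derivative kap t * (\<sigma> t - 3) * (\<beta>1 t + 2 * \<beta> t)) (at t) \<and>
     (\<sigma> has_real_derivative hfun \<alpha> \<sigma> t - kap t * (\<sigma> t - \<sigma> t * \<sigma> t / 2)) (at t) \<and>
     (hfun \<alpha> \<sigma> has_real_derivative kfun \<alpha> \<alpha>1 \<sigma> t - 2 * hfun \<alpha> \<sigma> t) (at t) \<and>
     (kfun \<alpha> \<alpha>1 \<sigma> has_real_derivative kap t * (Nfun \<alpha> \<alpha>1 \<beta> \<sigma> \<pi> t - 3 * kfun \<alpha> \<alpha>1 \<sigma> t)) (at t) \<and>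
     (Nfun \<alpha> \<alpha>1 \<beta> \<sigma> \<pi> has_real_derivative
        kap t * (2 * \<beta> t * (\<beta>1 t + 2 * \<beta> t) - 4 * Nfun \<alpha> \<alpha>1 \<beta> \<sigma> \<pi> t)) (at t)"
  proof (intro conjI)
    show "(\<beta> has_real_derivative \<beta>1 t + 2 * \<beta> t - 2 * \<beta> t) (at t)" using d by simp
    show "((\<lambda>t. \<beta>1 t + 2 * \<beta> t) has_real_derivative kap t * (\<sigma> t - 3) * (\<beta>1 t + 2 * \<beta> t)) (at t)"
      using d by (auto intro!: derivative_eq_intros simp: S(3) algebra_simps)
    show "(\<sigma> has_real_derivative hfun \<alpha> \<sigma> t - kap t * (\<sigma> t - \<sigma> t * \<sigma> t / 2)) (at t)"
      using d\<sigma> by (simp add: hfun_def)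
    show "(hfun \<alpha> \<sigma> has_real_derivative kfun \<alpha> \<alpha>1 \<sigma> t - 2 * hfun \<alpha> \<sigma> t) (at t)"
      unfolding hfun_def[abs_def] kfun_def
      by (rule DERIV_cdivide[THEN DERIV_cong] derivative_eq_intros d d\<sigma> kap_has_derivative refl)+ (simp add: field_simps)
    have dk: "(kfun \<alpha> \<alpha>1 \<sigma> has_real_derivative kap t * (Nfun \<alpha> \<alpha>1 \<beta> \<sigma> \<pi> t - 3 * kfun \<alpha> \<alpha>1 \<sigma> t)) (at t)"
      unfolding Nfun_def kfun_def[abs_def]
      by (rule DERIV_cdivide[THEN DERIV_cong] derivative_eq_intros d d\<sigma> kap_has_derivative refl)+ (simp add: S(2) S(1), algebra)
    then show "(kfun \<alpha> \<alpha>1 \<sigma> has_real_derivative kap t * (Nfun \<alpha> \<alpha>1 \<beta> \<sigma> \<pi> t - 3 * kfun \<alpha> \<alpha>1 \<sigma> t)) (at t)" .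
    show "(Nfun \<alpha> \<alpha>1 \<beta> \<sigma> \<pi> has_real_derivative
        kap t * (2 * \<beta> t * (\<beta>1 t + 2 * \<beta> t) - 4 * Nfun \<alpha> \<alpha>1 \<beta> \<sigma> \<pi> t)) (at t)"
      unfolding Nfun_def[abs_def]
      by (rule DERIV_cdivide[THEN DERIV_cong] derivative_eq_intros d d\<sigma> dk kap_has_derivative refl)+ (simp add: Nfun_def kfun_def S(2) S(1), algebra)
  qed
qed

section \<open>Asymptotics at minus infinity\<close>

text \<open>At minus infinity a larger exponent is the stronger statement: positive c means decay
  and negative c permits growth.\<close>

definition exp_O :: "real \<Rightarrow> (real \<Rightarrow> real) \<Rightarrow> bool" where
  "exp_O c f \<longleftrightarrow> f \<in> O[at_bot](\<lambda>t. exp (c * t))"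

lemma exp_O_D:
  assumes "exp_O c f"
  obtains C T where "C > 0" "\<And>t. t < T \<Longrightarrow> \<bar>f t\<bar> \<le> C * exp (c * t)"
proof -
  obtain C where C: "C > 0" "\<forall>\<^sub>F t in at_bot. norm (f t) \<le> C * norm (exp (c * t))"
    using assms unfolding exp_O_def by (rule landau_o.bigE)
  then obtain T where T: "\<And>t. t \<le> T \<Longrightarrow> \<bar>f t\<bar> \<le> C * exp (c * t)"
    by (auto simp: eventually_at_bot_linorder)
  show ?thesis by (rule that[OF C(1), of T]) (use T in auto)
qed

lemma exp_O_I: "(\<And>t. t < T \<Longrightarrow> \<bar>f t\<bar> \<le> C * exp (c * t)) \<Longrightarrow> exp_O c f"
  unfolding exp_O_def by (rule bigoI[of _ C]) (auto simp: eventually_at_bot_dense intro!: exI[of _ T])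

lemma exp_O_add: "exp_O c f \<Longrightarrow> exp_O c g \<Longrightarrow> exp_O c (\<lambda>t. f t + g t)"
  unfolding exp_O_def by (rule sum_in_bigo)

lemma exp_O_diff: "exp_O c f \<Longrightarrow> exp_O c g \<Longrightarrow> exp_O c (\<lambda>t. f t - g t)"
  unfolding exp_O_def by (rule sum_in_bigo)

lemma exp_O_minus: "exp_O c f \<Longrightarrow> exp_O c (\<lambda>t. - f t)"
  unfolding exp_O_def by simp

lemma exp_O_mult: "exp_O c f \<Longrightarrow> exp_O d g \<Longrightarrow> e \<le> c + d \<Longrightarrow> exp_O e (\<lambda>t. f t * g t)"
proof -
  assume fg: "exp_O c f" "exp_O d g" and e: "e \<le> c + d"
  obtain C1 T1 where 1: "C1 > 0" "\<And>t. t < T1 \<Longrightarrow> \<bar>f t\<bar> \<le> C1 * exp (c * t)" using exp_O_D[OF fg(1)] by blast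
  obtain C2 T2 where 2: "C2 > 0" "\<And>t. t < T2 \<Longrightarrow> \<bar>g t\<bar> \<le> C2 * exp (d * t)" using exp_O_D[OF fg(2)] by blast
  show ?thesis
  proof (rule exp_O_I[of "min 0 (min T1 T2)" _ "C1 * C2"])
    fix t assume t: "t < min 0 (min T1 T2)"
    have "\<bar>f t * g t\<bar> \<le> (C1 * exp (c * t)) * (C2 * exp (d * t))"
      unfolding abs_mult using 1 2 t by (intro mult_mono) auto
    also have "\<dots> = (C1 * C2) * exp ((c + d) * t)"
      by (simp add: exp_add[symmetric] algebra_simps)
    also have "\<dots> \<le> (C1 * C2) * exp (e * t)"
      using 1 2 t e by (intro mult_left_mono) (auto intro: mult_right_mono_neg)
    finally show "\<bar>f t * g t\<bar> \<le> C1 * C2 * exp (e * t)" .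
  qed
qed

lemma exp_O_const: "c \<le> 0 \<Longrightarrow> exp_O c (\<lambda>t. a)"
proof (rule exp_O_I[of 0 _ "\<bar>a\<bar>"])
  fix t :: real assume "c \<le> 0" "t < 0"
  then have "1 \<le> exp (c * t)" by (simp add: mult_nonpos_nonpos)
  then show "\<bar>a\<bar> \<le> \<bar>a\<bar> * exp (c * t)" using mult_left_mono[of 1 "exp (c*t)" "\<bar>a\<bar>"] by simp
qed

lemma exp_O_mono: "exp_O d f \<Longrightarrow> c \<le> d \<Longrightarrow> exp_O c f"
  using exp_O_mult[OF _ exp_O_const[of 0 1], of d f c] by simp

lemma exp_O_cmult: "exp_O c f \<Longrightarrow> exp_O c (\<lambda>t. a * f t)"
  using exp_O_mult[OF exp_O_const[of 0 a], of c f c] by simp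

lemma exp_O_exp: "exp_O c (\<lambda>t. exp (c * t))"
  by (rule exp_O_I[of 0 _ 1]) simp

lemma exp_O_kap: "c \<le> 2 \<Longrightarrow> exp_O c kap"
  by (rule exp_O_mono[of 2]) (auto intro!: exp_O_I[of 0 _ 1] simp: kap_bounds abs_of_pos)

lemma exp_O_cong: "exp_O c f \<Longrightarrow> (\<And>t. t < T \<Longrightarrow> f t = g t) \<Longrightarrow> exp_O c g"
proof -
  assume f: "exp_O c f" and eq: "\<And>t. t < T \<Longrightarrow> f t = g t"
  obtain C S where "C > 0" "\<And>t. t < S \<Longrightarrow> \<bar>f t\<bar> \<le> C * exp (c * t)" using exp_O_D[OF f] by blast
  then show ?thesis by (intro exp_O_I[of "min S T" _ C]) (auto simp: eq[symmetric])
qed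

lemma exp_O_ident: "c < 0 \<Longrightarrow> exp_O c (\<lambda>t. t)"
proof (rule exp_O_I[of 0 _ "1 / - c"])
  fix t :: real assume c: "c < 0" and t: "t < 0"
  have "c * t \<le> exp (c * t)" using exp_ge_add_one_self[of "c * t"] by linarith
  then show "\<bar>t\<bar> \<le> 1 / - c * exp (c * t)" using c t by (simp add: field_simps)
qed

lemma exp_tendsto_at_bot: "c > 0 \<Longrightarrow> ((\<lambda>t::real. exp (c * t)) \<longlongrightarrow> 0) at_bot"
  by (rule filterlim_compose[OF exp_at_bot]) (auto intro!: filterlim_tendsto_pos_mult_at_bot[OF tendsto_const] filterlim_ident)

lemma exp_O_tendsto_0: "exp_O c f \<Longrightarrow> c > 0 \<Longrightarrow> (f \<longlongrightarrow> 0) at_bot"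
proof -
  assume f: "exp_O c f" and c: "c > 0"
  obtain C T where C: "C > 0" "\<And>t. t < T \<Longrightarrow> \<bar>f t\<bar> \<le> C * exp (c * t)" using exp_O_D[OF f] by blast
  show ?thesis
  proof (rule Lim_null_comparison[of _ "\<lambda>t. C * exp (c * t)"])
    show "\<forall>\<^sub>F t in at_bot. norm (f t) \<le> C * exp (c * t)"
      using C by (auto simp: eventually_at_bot_dense intro!: exI[of _ T])
    show "((\<lambda>t. C * exp (c * t)) \<longlongrightarrow> 0) at_bot"
      using tendsto_mult[OF tendsto_const exp_tendsto_at_bot[OF c], of C] by simp
  qed
qed

lemma exp_O_tendsto: "exp_O c (\<lambda>t. f t - L) \<Longrightarrow> c > 0 \<Longrightarrow> (f \<longlongrightarrow> L) at_bot"
  using exp_O_tendsto_0[of c "\<lambda>t. f t - L"] by (simp add: LIM_zero_iff)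

lemma exp_O_tendsto_bounded: "(f \<longlongrightarrow> L) at_bot \<Longrightarrow> exp_O 0 f"
proof -
  assume "(f \<longlongrightarrow> L) at_bot"
  then have "\<forall>\<^sub>F t in at_bot. dist (f t) L < 1" by (rule tendstoD) simp
  then obtain T where "\<And>t. t < T \<Longrightarrow> dist (f t) L < 1" by (auto simp: eventually_at_bot_dense)
  then show ?thesis by (intro exp_O_I[of T _ "\<bar>L\<bar> + 1"]) (force simp: dist_real_def)
qed

section \<open>Integrating estimates from minus infinity\<close>

lemma mono_on_ray:
  fixes f :: "real \<Rightarrow> real"
  assumes "\<And>t. t < T \<Longrightarrow> (f has_real_derivative f' t) (at t)" "\<And>t. t < T \<Longrightarrow> f' t \<ge> 0" "s \<le> t" "t < T"
  shows "f s \<le> f t"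
proof (cases "s = t")
  case False
  then have "s < t" using assms by simp
  then show ?thesis
    using DERIV_nonneg_imp_nondecreasing[of s t f] assms by (meson less_imp_le order_le_less_trans)
qed simp

text \<open>With e a primitive of the bound on f', the function f + e is nondecreasing and f - e is
  nonincreasing. The infimum L of f + e is squeezed between the two, so f differs from L by at most
  e.\<close>

lemma exp_O_integral:
  assumes d: "\<And>t. t < T \<Longrightarrow> (f has_real_derivative f' t) (at t)" and f': "exp_O c f'" and c: "c > 0"
  obtains L where "exp_O c (\<lambda>t. f t - L)"
proof -
  obtain C S where C: "C > 0" "\<And>t. t < S \<Longrightarrow> \<bar>f' t\<bar> \<le> C * exp (c * t)" using exp_O_D[OF f'] by blast
  define R where "R = min S T"
  define e where "e = (\<lambda>t. C / c * exp (c * t))"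
  have de: "(e has_real_derivative C * exp (c * t)) (at t)" for t
    unfolding e_def using c by (auto intro!: derivative_eq_intros)
  have dp: "((\<lambda>t. f t + e t) has_real_derivative f' t + C * exp (c * t)) (at t)"
    and dm: "((\<lambda>t. e t - f t) has_real_derivative C * exp (c * t) - f' t) (at t)" if "t < R" for t
    using d de that by (auto intro!: derivative_eq_intros simp: R_def)
  have pm: "f s + e s \<le> f t + e t" "f t - e t \<le> f s - e s" if "s \<le> t" "t < R" for s t
    using mono_on_ray[OF dp _ that] mono_on_ray[OF dm _ that] C(2) by (force simp: R_def abs_le_iff)+
  have e0: "e t \<ge> 0" for t using C c by (simp add: e_def)
  have mp: "f s - e s \<le> f t + e t" if "s < R" "t < R" for s t
  proof (cases "s \<le> t")
    case True
    then show ?thesis using pm(1)[of s t] e0[of s] e0[of t] that by linarith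
  next
    case False
    then show ?thesis using pm(2)[of t s] e0[of s] e0[of t] that by linarith
  qed
  define L where "L = Inf ((\<lambda>t. f t + e t) ` {..<R})"
  have ne: "(\<lambda>t. f t + e t) ` {..<R} \<noteq> {}" by auto
  have bb: "bdd_below ((\<lambda>t. f t + e t) ` {..<R})"
    by (rule bdd_belowI[of _ "f (R - 1) - e (R - 1)"]) (auto intro!: mp)
  have "\<bar>f t - L\<bar> \<le> C / c * exp (c * t)" if t: "t < R" for t
  proof -
    have "L \<le> f t + e t" unfolding L_def using t bb by (intro cInf_lower) auto
    moreover have "f t - e t \<le> L" unfolding L_def using t ne by (intro cInf_greatest) (auto intro!: mp)
    ultimately show ?thesis by (simp add: e_def abs_le_iff)
  qed
  then show ?thesis by (intro that exp_O_I)
qed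

lemma exp_O_integral_0:
  assumes d: "\<And>t. t < T \<Longrightarrow> (f has_real_derivative f' t) (at t)" and f': "exp_O c f'" and c: "c > 0"
    and lim: "(f \<longlongrightarrow> 0) at_bot"
  shows "exp_O c f"
proof -
  obtain L where L: "exp_O c (\<lambda>t. f t - L)" by (rule exp_O_integral[OF d f' c])
  have "L = 0"
    using tendsto_unique[OF trivial_limit_at_bot_linorder exp_O_tendsto[OF L c] lim] .
  then show ?thesis using L by simp
qed

lemma exp_O_linear_ode:
  assumes d: "\<And>t. t < T \<Longrightarrow> (f has_real_derivative a t * f t + b t) (at t)"
    and a: "exp_O c a" and b: "exp_O c b" and c: "c > 0"
  obtains L where "exp_O c (\<lambda>t. f t - L)"
proof -
  \<comment> \<open>The derivative of \<open>ln (1 + f\<^sup>2)\<close> is exponentially small, hence \<open>f\<close> is bounded.\<close>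
  define g where "g = (\<lambda>t. ln (1 + f t * f t))"
  define g' where "g' = (\<lambda>t. a t * (2 * f t * f t / (1 + f t * f t)) + b t * (2 * f t / (1 + f t * f t)))"
  have pos: "1 + f t * f t > 0" for t using zero_le_square[of "f t"] by linarith
  have dg: "(g has_real_derivative g' t) (at t)" if "t < T" for t
    unfolding g_def g'_def using d[OF that] pos[of t]
    by (auto intro!: derivative_eq_intros simp: divide_simps) (auto simp: algebra_simps)
  have b1: "exp_O 0 (\<lambda>t. 2 * f t * f t / (1 + f t * f t))"
    by (rule exp_O_I[of 0 _ 2]) (use pos in \<open>simp add: field_simps abs_of_pos\<close>)
  have b2: "exp_O 0 (\<lambda>t. 2 * f t / (1 + f t * f t))"
  proof (rule exp_O_I[of 0 _ 1])
    fix t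
    have "2 * \<bar>f t\<bar> \<le> 1 + f t * f t" using zero_le_power2[of "\<bar>f t\<bar> - 1"] by (simp add: power2_eq_square algebra_simps)
    then show "\<bar>2 * f t / (1 + f t * f t)\<bar> \<le> 1 * exp (0 * t)" using pos[of t] by (simp add: abs_mult field_simps)
  qed
  have eg': "exp_O c g'"
    unfolding g'_def by (intro exp_O_add exp_O_mult[OF a b1] exp_O_mult[OF b b2]) simp_all
  obtain L where "exp_O c (\<lambda>t. g t - L)" by (rule exp_O_integral[OF dg eg' c])
  from exp_O_tendsto[OF this c] have "(g \<longlongrightarrow> L) at_bot" .
  from exp_O_tendsto_bounded[OF tendsto_exp[OF this]] have "exp_O 0 (\<lambda>t. 1 + f t * f t)"
    by (simp add: g_def pos)
  then obtain C S where C: "\<And>t. t < S \<Longrightarrow> \<bar>1 + f t * f t\<bar> \<le> C * exp (0 * t)"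
    using exp_O_D by blast
  have "exp_O 0 f"
  proof (rule exp_O_I[of S _ C])
    fix t assume "t < S"
    have "2 * \<bar>f t\<bar> \<le> 1 + f t * f t" using zero_le_power2[of "\<bar>f t\<bar> - 1"] by (simp add: power2_eq_square algebra_simps)
    then show "\<bar>f t\<bar> \<le> C * exp (0 * t)" using C[OF \<open>t < S\<close>] by simp
  qed
  then have "exp_O c (\<lambda>t. a t * f t + b t)"
    using exp_O_add[OF exp_O_mult[OF a, of 0 f c] b] by simp
  then show ?thesis using exp_O_integral[OF d _ c] that by blast
qed

text \<open>The integrating factor is e^(2t). The limit hypothesis removes the homogeneous solution
  \<open>exp (-2*t)\<close>, and c > -2 makes e^(2t) (g - L) decay, so that
  \<open>exp_O_integral_0\<close> applies.\<close>

lemma exp_O_damped: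
  assumes d: "\<And>t. t < T \<Longrightarrow> (f has_real_derivative g t - 2 * f t) (at t)"
    and g: "exp_O c (\<lambda>t. g t - L)" and c: "c > -2" and lim: "((\<lambda>t. exp (2*t) * f t) \<longlongrightarrow> 0) at_bot"
  shows "exp_O c (\<lambda>t. f t - L / 2)"
proof -
  let ?F = "\<lambda>t. exp (2*t) * (f t - L / 2)"
  have "(?F has_real_derivative exp (2*t) * (g t - L)) (at t)" if "t < T" for t
    using d[OF that] by (auto intro!: derivative_eq_intros simp: algebra_simps)
  moreover have "exp_O (c + 2) (\<lambda>t. exp (2*t) * (g t - L))"
    by (rule exp_O_mult[OF exp_O_exp g]) simp
  moreover have "(?F \<longlongrightarrow> 0) at_bot"
    using tendsto_diff[OF lim tendsto_mult[OF exp_tendsto_at_bot[of 2] tendsto_const[of "L/2"]]] by (simp add: algebra_simps)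
  ultimately have "exp_O (c + 2) ?F"
    by (intro exp_O_integral_0[of T ?F "\<lambda>t. exp (2*t) * (g t - L)"]) (use c in auto)
  from exp_O_mult[OF exp_O_exp[of "-2"] this, of c] show ?thesis
    by (simp add: mult.assoc[symmetric] exp_add[symmetric])
qed

text \<open>E e^(at) is nondecreasing, so a lower bound on E' turns into an upper bound on E towards
  minus infinity.\<close>

lemma exp_O_lower_ode:
  assumes d: "\<And>t. t < T \<Longrightarrow> (E has_real_derivative E' t) (at t)"
    and ge: "\<And>t. t < T \<Longrightarrow> E' t \<ge> - a * E t" and pos: "\<And>t. t < T \<Longrightarrow> E t \<ge> 0"
  shows "exp_O (-a) E"
proof (rule exp_O_I[of "T - 1" _ "E (T - 1) * exp (a * (T - 1))"])
  fix t assume t: "t < T - 1"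
  have "E t * exp (a * t) \<le> E (T - 1) * exp (a * (T - 1))"
  proof (rule mono_on_ray[of T "\<lambda>t. E t * exp (a * t)" "\<lambda>t. (E' t + a * E t) * exp (a * t)"])
    show "((\<lambda>t. E t * exp (a * t)) has_real_derivative (E' s + a * E s) * exp (a * s)) (at s)" if "s < T" for s
      using d[OF that] by (auto intro!: derivative_eq_intros simp: algebra_simps)
    show "0 \<le> (E' s + a * E s) * exp (a * s)" if "s < T" for s using ge[OF that] by simp
  qed (use t in auto)
  then have "E t * exp (a * t) * exp (- a * t) \<le> E (T - 1) * exp (a * (T - 1)) * exp (- a * t)"
    by (rule mult_right_mono) simp
  then show "\<bar>E t\<bar> \<le> E (T - 1) * exp (a * (T - 1)) * exp (- a * t)"
    using pos[of t] t by (simp add: mult.assoc exp_add[symmetric])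
qed

text \<open>By the mean value theorem on an interval of length 1, f' equals there a difference of
  two small values of f, while it is close to L throughout.\<close>

lemma derivative_limit_0:
  fixes f :: "real \<Rightarrow> real"
  assumes d: "\<And>t. t < T \<Longrightarrow> (f has_real_derivative f' t) (at t)" and f: "(f \<longlongrightarrow> 0) at_bot" and f': "(f' \<longlongrightarrow> L) at_bot"
  shows "L = 0"
proof (rule ccontr)
  assume "L \<noteq> 0"
  define e where "e = \<bar>L\<bar> / 4"
  have e: "e > 0" using \<open>L \<noteq> 0\<close> by (simp add: e_def)
  have "\<forall>\<^sub>F t in at_bot. dist (f t) 0 < e \<and> dist (f' t) L < e \<and> t < T"
    using tendstoD[OF f e] tendstoD[OF f' e] by (intro eventually_conj) (auto simp: eventually_at_bot_dense)
  then obtain S where S: "\<And>t. t < S \<Longrightarrow> \<bar>f t\<bar> < e \<and> \<bar>f' t - L\<bar> < e \<and> t < T"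
    by (auto simp: eventually_at_bot_dense dist_real_def)
  obtain z where z: "S - 2 < z" "z < S - 1" "f (S - 1) - f (S - 2) = (S - 1 - (S - 2)) * f' z"
    using MVT2[of "S - 2" "S - 1" f f'] d S by force
  have "f' z = f (S - 1) - f (S - 2)" using z(3) by simp
  then show False
    using S[of z] S[of "S - 1"] S[of "S - 2"] z e_def by (auto simp: abs_if split: if_splits)
qed

lemma exp_O_sqrt:
  assumes "exp_O (2*c) (\<lambda>t. f t * f t)"
  shows "exp_O c f"
proof -
  obtain C T where C: "C > 0" "\<And>t. t < T \<Longrightarrow> \<bar>f t * f t\<bar> \<le> C * exp (2 * c * t)" using exp_O_D[OF assms] by blast
  show ?thesis
  proof (rule exp_O_I[of T _ "sqrt C"])
    fix t assume "t < T"
    have "(sqrt C * exp (c * t))\<^sup>2 = C * exp (2 * c * t)"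
      using C(1) by (simp add: power_mult_distrib exp_double[symmetric])
    then have "(f t)\<^sup>2 \<le> (sqrt C * exp (c * t))\<^sup>2"
      using C(2)[OF \<open>t < T\<close>] by (simp add: power2_eq_square)
    then show "\<bar>f t\<bar> \<le> sqrt C * exp (c * t)"
      using C(1) by (simp add: abs_le_square_iff[symmetric])
  qed
qed

text \<open>Initially only \<open>kap t * \<sigma> t\<close> is under control. This gives a weak
  bound on G, hence on \<beta>, and these two control N and k, whose equations are free of \<sigma>.
  Next h follows once its \<open>exp (-2*t)\<close> mode is excluded, and a bounded h gives a weak
  bound on \<sigma>. After that every term with the factor \<open>kap\<close> is O(e^t).\<close>

lemma first_order_system_asymptotics:
  assumes sys: "first_order_system T \<beta> G \<sigma> h k N" and lim: "((\<lambda>t. exp (2*t) * \<sigma> t) \<longlongrightarrow> 0) at_bot" "((\<lambda>t. exp (2*t) * \<beta> t) \<longlongrightarrow> 0) at_bot"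
  obtains k0 N0 \<sigma>0 G0 where "exp_O 1 (\<lambda>t. k t - k0)" "exp_O 1 (\<lambda>t. N t - N0)" "exp_O 1 (\<lambda>t. h t - k0 / 2)"
    "exp_O 1 (\<lambda>t. \<sigma> t - (k0 / 2 * t + \<sigma>0))" "exp_O 1 (\<lambda>t. G t - G0)" "exp_O 1 (\<lambda>t. \<beta> t - G0 / 2)"
proof -
  have d: "(\<beta> has_real_derivative G t - 2 * \<beta> t) (at t)"
     "(G has_real_derivative kap t * (\<sigma> t - 3) * G t) (at t)"
     "(\<sigma> has_real_derivative h t - kap t * (\<sigma> t - \<sigma> t * \<sigma> t / 2)) (at t)"
     "(h has_real_derivative k t - 2 * h t) (at t)"
     "(k has_real_derivative kap t * (N t - 3 * k t)) (at t)"
     "(N has_real_derivative kap t * (2 * \<beta> t * G t - 4 * N t)) (at t)" if "t < T" for t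
    using sys that by (simp_all add: first_order_system_def)
  have ks: "((\<lambda>t. kap t * \<sigma> t) \<longlongrightarrow> 0) at_bot"
  proof (rule Lim_null_comparison[OF _ tendsto_rabs_zero[OF lim(1)]])
    show "\<forall>\<^sub>F t in at_bot. norm (kap t * \<sigma> t) \<le> \<bar>exp (2 * t) * \<sigma> t\<bar>"
      by (intro always_eventually allI) (simp add: abs_mult kap_bounds abs_of_pos mult_right_mono)
  qed
  have k0: "(kap \<longlongrightarrow> 0) at_bot" by (rule exp_O_tendsto_0[OF exp_O_kap[of 1]]) simp_all
  \<comment> \<open>The thresholds give 2 \<bar>\<kappa> \<sigma>\<bar> + 6 \<kappa> < 1/4 for the
    equation of G^2 and 1/48 + 1/32 < 1/16 in the estimate of \<sigma>^2 below. Any growth rate that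
    stays well below the gain e^(2t) of \<kappa> would serve.\<close>
  have "\<forall>\<^sub>F t in at_bot. dist (kap t * \<sigma> t) 0 < 1/16 \<and> dist (kap t) 0 < 1/48 \<and> t < T"
    using tendstoD[OF ks, of "1/16"] tendstoD[OF k0, of "1/48"] by (intro eventually_conj) (auto simp: eventually_at_bot_dense)
  then obtain S where S: "\<And>t. t < S \<Longrightarrow> \<bar>kap t * \<sigma> t\<bar> < 1/16 \<and> kap t < 1/48 \<and> t < T"
    by (auto simp: eventually_at_bot_dense dist_real_def kap_bounds abs_of_pos)
  have "exp_O (- (1/4)) (\<lambda>t. G t * G t)"
  proof (rule exp_O_lower_ode[of S _ "\<lambda>t. 2 * (kap t * (\<sigma> t - 3)) * (G t * G t)"])
    fix t assume t: "t < S"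
    show "((\<lambda>t. G t * G t) has_real_derivative 2 * (kap t * (\<sigma> t - 3)) * (G t * G t)) (at t)"
      using d(2)[of t] S[OF t] by (auto intro!: derivative_eq_intros)
    have "2 * (kap t * (\<sigma> t - 3)) = 2 * (kap t * \<sigma> t) - 6 * kap t" by (simp add: algebra_simps)
    then have "- (1/4) \<le> 2 * (kap t * (\<sigma> t - 3))" using S[OF t] by (simp only: abs_less_iff) linarith
    then show "- (1/4) * (G t * G t) \<le> 2 * (kap t * (\<sigma> t - 3)) * (G t * G t)" by (rule mult_right_mono) simp
  qed simp
  then have G1: "exp_O (- (1/8)) G" using exp_O_sqrt[of "- (1/8)" G] by simp
  have \<beta>1: "exp_O (- (1/8)) \<beta>"
    using exp_O_damped[where T=T and c="- (1/8)" and L=0, OF d(1) _ _ lim(2)] G1 by simp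
  \<comment> \<open>The factor \<kappa> gains exponent 2 and the product loses 1/4, which leaves
    more than 1.\<close>
  have bN: "exp_O 1 (\<lambda>t. kap t * (2 * \<beta> t * G t))"
    by (rule exp_O_mult[OF exp_O_kap[of 2] exp_O_mult[OF exp_O_cmult[OF \<beta>1] G1, of "- (1/4)"]]) simp_all
  have dN: "(N has_real_derivative - 4 * kap t * N t + kap t * (2 * \<beta> t * G t)) (at t)" if "t < T" for t
    by (rule DERIV_cong[OF d(6)[OF that]]) (simp add: algebra_simps)
  have aN: "exp_O 1 (\<lambda>t. - 4 * kap t)" and ak: "exp_O 1 (\<lambda>t. - 3 * kap t)"
    by (simp_all only: exp_O_cmult[OF exp_O_kap[of 1]] one_le_numeral)
  obtain N0 where N0: "exp_O 1 (\<lambda>t. N t - N0)"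
    by (rule exp_O_linear_ode[OF dN aN bN zero_less_one])
  have NO: "exp_O 0 N" using exp_O_add[OF exp_O_mono[OF N0, of 0] exp_O_const[of 0 N0]] by simp
  have bk: "exp_O 1 (\<lambda>t. kap t * N t)"
    by (rule exp_O_mult[OF exp_O_kap[of 2] NO]) simp_all
  have dk: "(k has_real_derivative - 3 * kap t * k t + kap t * N t) (at t)" if "t < T" for t
    by (rule DERIV_cong[OF d(5)[OF that]]) (simp add: algebra_simps)
  obtain k0 where k0: "exp_O 1 (\<lambda>t. k t - k0)"
    by (rule exp_O_linear_ode[OF dk ak bk zero_less_one])
  have kO: "exp_O 0 k" using exp_O_add[OF exp_O_mono[OF k0, of 0] exp_O_const[of 0 k0]] by simp
  have dH: "((\<lambda>t. exp (2*t) * h t) has_real_derivative exp (2*t) * k t) (at t)" if "t < T" for t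
    using d(4)[OF that] by (auto intro!: derivative_eq_intros simp: algebra_simps)
  have eH: "exp_O 2 (\<lambda>t. exp (2*t) * k t)" by (rule exp_O_mult[OF exp_O_exp kO]) simp
  obtain C0 where C0: "exp_O 2 (\<lambda>t. exp (2*t) * h t - C0)"
    by (rule exp_O_integral[OF dH eH zero_less_numeral])
  \<comment> \<open>C0 is the amplitude of the \<open>exp (-2*t)\<close> mode of h. It is also the
    limit of the derivative of e^(2t) \<sigma>, a function that tends to 0, so it must
    vanish.\<close>
  have "C0 = 0"
  proof (rule derivative_limit_0[OF _ lim(1)])
    show "((\<lambda>t. exp (2*t) * \<sigma> t) has_real_derivative
       2 * (exp (2*t) * \<sigma> t) + exp (2*t) * h t - kap t * (exp (2*t) * \<sigma> t) + (kap t * \<sigma> t) * (exp (2*t) * \<sigma> t) / 2) (at t)" if "t < T" for t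
      using d(3)[OF that] by (auto intro!: derivative_eq_intros simp: algebra_simps)
    have "((\<lambda>t. 2 * (exp (2*t) * \<sigma> t) + exp (2*t) * h t - kap t * (exp (2*t) * \<sigma> t) + (kap t * \<sigma> t) * (exp (2*t) * \<sigma> t) / 2)
       \<longlongrightarrow> 2 * 0 + C0 - 0 * 0 + 0 * 0 / 2) at_bot"
      by (intro tendsto_intros lim(1) exp_O_tendsto[OF C0] ks \<open>(kap \<longlongrightarrow> 0) at_bot\<close>) simp_all
    then show "((\<lambda>t. 2 * (exp (2*t) * \<sigma> t) + exp (2*t) * h t - kap t * (exp (2*t) * \<sigma> t) + (kap t * \<sigma> t) * (exp (2*t) * \<sigma> t) / 2)
       \<longlongrightarrow> C0) at_bot" by simp
  qed
  then have "((\<lambda>t. exp (2*t) * h t) \<longlongrightarrow> 0) at_bot"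
    using exp_O_tendsto[OF C0] by simp
  from exp_O_damped[OF d(4) k0 _ this] have h0: "exp_O 1 (\<lambda>t. h t - k0 / 2)" by simp
  have "exp_O 0 h" using exp_O_add[OF exp_O_mono[OF h0, of 0] exp_O_const[of 0 "k0/2"]] by simp
  then obtain C S' where C: "C > 0" "\<And>t. t < S' \<Longrightarrow> \<bar>h t\<bar> \<le> C * exp (0 * t)" by (rule exp_O_D) blast
  \<comment> \<open>The added constant absorbs the inhomogeneity h: by (\<bar>\<sigma>\<bar> - 8
    C)^2 \<ge> 0 one has 2 C \<bar>\<sigma>\<bar> \<le> \<sigma>^2/8 + 8 C^2, and 8 C^2 is a quarter
    of 32 C^2.\<close>
  have "exp_O (- (1/4)) (\<lambda>t. \<sigma> t * \<sigma> t + 32 * (C * C))"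
  proof (rule exp_O_lower_ode[of "min S S'" _ "\<lambda>t. 2 * \<sigma> t * (h t - kap t * (\<sigma> t - \<sigma> t * \<sigma> t / 2))"])
    fix t assume t: "t < min S S'"
    show "((\<lambda>t. \<sigma> t * \<sigma> t + 32 * (C * C)) has_real_derivative 2 * \<sigma> t * (h t - kap t * (\<sigma> t - \<sigma> t * \<sigma> t / 2))) (at t)"
      using d(3)[of t] S[of t] t by (auto intro!: derivative_eq_intros)
    have "\<bar>h t - kap t * (\<sigma> t - \<sigma> t * \<sigma> t / 2)\<bar> \<le> \<bar>h t\<bar> + kap t * \<bar>\<sigma> t\<bar> + \<bar>kap t * \<sigma> t\<bar> * \<bar>\<sigma> t\<bar> / 2"
    proof -
      have "h t - kap t * (\<sigma> t - \<sigma> t * \<sigma> t / 2) = h t - kap t * \<sigma> t + kap t * \<sigma> t * \<sigma> t / 2"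
        by (simp add: algebra_simps)
      also have "\<bar>\<dots>\<bar> \<le> \<bar>h t\<bar> + \<bar>kap t * \<sigma> t\<bar> + \<bar>kap t * \<sigma> t * \<sigma> t / 2\<bar>" by linarith
      finally show ?thesis using kap_bounds(1)[of t] by (simp add: abs_mult)
    qed
    also have "\<dots> \<le> C + 1/48 * \<bar>\<sigma> t\<bar> + 1/16 * \<bar>\<sigma> t\<bar> / 2"
      using C(2)[of t] S[of t] t by (intro add_mono divide_right_mono mult_right_mono) auto
    also have "\<dots> \<le> C + \<bar>\<sigma> t\<bar> / 16" by simp
    finally have b: "\<bar>h t - kap t * (\<sigma> t - \<sigma> t * \<sigma> t / 2)\<bar> \<le> C + \<bar>\<sigma> t\<bar> / 16" .
    have "- (2 * \<sigma> t * (h t - kap t * (\<sigma> t - \<sigma> t * \<sigma> t / 2))) \<le> 2 * \<bar>\<sigma> t\<bar> * \<bar>h t - kap t * (\<sigma> t - \<sigma> t * \<sigma> t / 2)\<bar>"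
      using abs_ge_minus_self[of "2 * \<sigma> t * (h t - kap t * (\<sigma> t - \<sigma> t * \<sigma> t / 2))"] by (simp add: abs_mult)
    also have "\<dots> \<le> 2 * \<bar>\<sigma> t\<bar> * (C + \<bar>\<sigma> t\<bar> / 16)" using b by (intro mult_left_mono) auto
    also have "\<dots> \<le> 1/4 * (\<sigma> t * \<sigma> t + 32 * (C * C))"
      using zero_le_square[of "\<bar>\<sigma> t\<bar> - 8 * C"] by (simp add: algebra_simps)
    finally show "- (1/4) * (\<sigma> t * \<sigma> t + 32 * (C * C)) \<le> 2 * \<sigma> t * (h t - kap t * (\<sigma> t - \<sigma> t * \<sigma> t / 2))"
      by linarith
  qed simp
  from exp_O_diff[OF this exp_O_const[of "- (1/4)" "32 * (C * C)"]] have "exp_O (- (1/4)) (\<lambda>t. \<sigma> t * \<sigma> t)" by simp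
  then have \<sigma>1: "exp_O (- (1/8)) \<sigma>" using exp_O_sqrt[of "- (1/8)" \<sigma>] by simp
  have e1: "exp_O 1 (\<lambda>t. kap t * (\<sigma> t - 3))"
    by (rule exp_O_mult[OF exp_O_kap[of 2] exp_O_diff[OF \<sigma>1 exp_O_const]]) simp_all
  have e2: "exp_O 1 (\<lambda>t. kap t * (\<sigma> t - \<sigma> t * \<sigma> t / 2))"
    by (rule exp_O_mult[OF exp_O_kap[of 2] exp_O_diff[OF exp_O_mono[OF \<sigma>1, of "-(1/4)"] exp_O_mult[OF \<sigma>1 exp_O_cmult[OF \<sigma>1, of "1/2"], of "- (1/4)", simplified]]]) simp_all
  \<comment> \<open>Since h tends to k0/2, \<sigma> has a linear part with this slope; only after
    subtracting it is the derivative integrable at minus infinity.\<close>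
  have ds: "((\<lambda>t. \<sigma> t - k0 / 2 * t) has_real_derivative (h t - k0 / 2) - kap t * (\<sigma> t - \<sigma> t * \<sigma> t / 2)) (at t)" if "t < T" for t
    using d(3)[OF that] by (auto intro!: derivative_eq_intros)
  obtain \<sigma>0 where \<sigma>0: "exp_O 1 (\<lambda>t. \<sigma> t - k0 / 2 * t - \<sigma>0)"
    by (rule exp_O_integral[OF ds exp_O_diff[OF h0 e2] zero_less_one])
  obtain G0 where G0: "exp_O 1 (\<lambda>t. G t - G0)"
    by (rule exp_O_linear_ode[of T G "\<lambda>t. kap t * (\<sigma> t - 3)" "\<lambda>t. 0" 1]) (use d(2) e1 exp_O_cmult[OF e1, of 0] in simp_all)
  have \<beta>0: "exp_O 1 (\<lambda>t. \<beta> t - G0 / 2)"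
    by (rule exp_O_damped[OF d(1) G0 _ lim(2)]) simp_all
  show ?thesis
    by (rule that[OF k0 N0 h0 _ G0 \<beta>0, of \<sigma>0]) (use \<sigma>0 in \<open>simp add: algebra_simps\<close>)
qed

section \<open>Uniqueness\<close>

text \<open>On the compact remainder of the ray continuity bounds f e^(-ct), so the asymptotic
  estimate extends to the whole ray with a larger constant. The Gronwall argument needs it up to the
  point where the solutions are compared.\<close>

lemma exp_O_bounded_on_ray:
  assumes f: "exp_O c f" and cont: "continuous_on {..R} f"
  obtains C where "C \<ge> 0" "\<And>t. t \<le> R \<Longrightarrow> \<bar>f t\<bar> \<le> C * exp (c * t)"
proof -
  obtain B S where B: "B > 0" "\<And>t. t < S \<Longrightarrow> \<bar>f t\<bar> \<le> B * exp (c * t)" using exp_O_D[OF f] by blast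
  have "continuous_on {S..R} (\<lambda>t. f t * exp (- c * t))"
    by (intro continuous_intros continuous_on_subset[OF cont]) auto
  from compact_imp_bounded[OF compact_continuous_image[OF this compact_Icc]]
  obtain A where "\<forall>y\<in>(\<lambda>t. f t * exp (- c * t)) ` {S..R}. norm y \<le> A"
    unfolding bounded_iff by blast
  then have A: "\<bar>f t * exp (- c * t)\<bar> \<le> A" if "t \<in> {S..R}" for t
    using that by (simp only: ball_simps real_norm_def)
  show ?thesis
  proof (rule that[of "max A B"])
    fix t assume t: "t \<le> R"
    show "\<bar>f t\<bar> \<le> max A B * exp (c * t)"
    proof (cases "t < S")
      case True
      then show ?thesis
        using order_trans[OF B(2)[OF True] mult_right_mono[of B "max A B" "exp (c*t)"]] by simp
    next
      case False
      then have "\<bar>f t * exp (- c * t)\<bar> * exp (c * t) \<le> max A B * exp (c * t)"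
        using A[of t] t by (intro mult_right_mono) (auto simp: max.coboundedI1)
      then show ?thesis by (simp add: abs_mult mult.assoc exp_add[symmetric])
    qed
  qed (use B in simp)
qed

text \<open>E e^(-\<Phi>) is nonincreasing, and because \<Phi> has a finite limit it tends to 0 at
  minus infinity; hence it is nowhere positive.\<close>

lemma gronwall_at_bot:
  assumes d: "\<And>t. t < T \<Longrightarrow> (E has_real_derivative E' t) (at t)" "\<And>t. t < T \<Longrightarrow> (\<Phi> has_real_derivative \<Phi>' t) (at t)"
    and le: "\<And>t. t < T \<Longrightarrow> E' t \<le> \<Phi>' t * E t" and E: "(E \<longlongrightarrow> 0) at_bot" and \<Phi>: "(\<Phi> \<longlongrightarrow> L) at_bot" and t: "t < T"
  shows "E t \<le> 0"
proof -
  let ?F = "\<lambda>t. - (E t * exp (- \<Phi> t))"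
  have "?F s \<le> ?F t" if "s \<le> t" for s
  proof (rule mono_on_ray[of T ?F "\<lambda>t. (\<Phi>' t * E t - E' t) * exp (- \<Phi> t)"])
    show "(?F has_real_derivative (\<Phi>' t * E t - E' t) * exp (- \<Phi> t)) (at t)" if "t < T" for t
      using d[OF that] by (auto intro!: derivative_eq_intros simp: algebra_simps)
    show "0 \<le> (\<Phi>' t * E t - E' t) * exp (- \<Phi> t)" if "t < T" for t using le[OF that] by simp
  qed (use that t in auto)
  then have ev: "\<forall>\<^sub>F s in at_bot. ?F s \<le> ?F t"
    by (auto simp: eventually_at_bot_linorder)
  have "(?F \<longlongrightarrow> - (0 * exp (- L))) at_bot" by (intro tendsto_intros E \<Phi>)
  from tendsto_upperbound[OF this ev] have "E t * exp (- \<Phi> t) \<le> 0" by simp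
  then show ?thesis by (simp add: mult_le_0_iff)
qed

text \<open>A sum E of squares of differences satisfies E' \<le> 24 C e^(t/2) E and tends to 0 at
  minus infinity. Differences of products are split so that each difference is multiplied by
  \<open>kap\<close> times a function of size at most e^(-t), whence the integrable
  coefficient.\<close>

lemma first_order_system_unique:
  assumes sys: "first_order_system T \<beta> G \<sigma> h k N" "first_order_system T \<beta>' G' \<sigma>' h' k' N'"
    and diff: "exp_O 1 (\<lambda>t. \<beta> t - \<beta>' t)" "exp_O 1 (\<lambda>t. G t - G' t)" "exp_O 1 (\<lambda>t. \<sigma> t - \<sigma>' t)"
      "exp_O 1 (\<lambda>t. h t - h' t)" "exp_O 1 (\<lambda>t. k t - k' t)" "exp_O 1 (\<lambda>t. N t - N' t)"
    and bd: "exp_O (-1) \<sigma>" "exp_O (-1) \<sigma>'" "exp_O (-1) \<beta>" "exp_O (-1) G'" and t: "t < T"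
  shows "\<beta> t = \<beta>' t" "G t = G' t" "\<sigma> t = \<sigma>' t" "h t = h' t" "k t = k' t" "N t = N' t"
proof -
  \<comment> \<open>The solutions may be unbounded near T, so the coefficients are estimated on the
    closed ray up to R.\<close>
  obtain R where R: "t < R" "R < T" using dense[OF t] by blast
  have d: "(\<beta> has_real_derivative G t - 2 * \<beta> t) (at t)"
     "(G has_real_derivative kap t * (\<sigma> t - 3) * G t) (at t)"
     "(\<sigma> has_real_derivative h t - kap t * (\<sigma> t - \<sigma> t * \<sigma> t / 2)) (at t)"
     "(h has_real_derivative k t - 2 * h t) (at t)"
     "(k has_real_derivative kap t * (N t - 3 * k t)) (at t)"
     "(N has_real_derivative kap t * (2 * \<beta> t * G t - 4 * N t)) (at t)" if "t < T" for t
    using sys(1) that by (simp_all add: first_order_system_def)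
  have d': "(\<beta>' has_real_derivative G' t - 2 * \<beta>' t) (at t)"
     "(G' has_real_derivative kap t * (\<sigma>' t - 3) * G' t) (at t)"
     "(\<sigma>' has_real_derivative h' t - kap t * (\<sigma>' t - \<sigma>' t * \<sigma>' t / 2)) (at t)"
     "(h' has_real_derivative k' t - 2 * h' t) (at t)"
     "(k' has_real_derivative kap t * (N' t - 3 * k' t)) (at t)"
     "(N' has_real_derivative kap t * (2 * \<beta>' t * G' t - 4 * N' t)) (at t)" if "t < T" for t
    using sys(2) that by (simp_all add: first_order_system_def)
  have cont: "continuous_on {..R} f" if f: "\<And>t. t < T \<Longrightarrow> (f has_real_derivative f1 t) (at t)" for f f1
  proof (rule DERIV_continuous_on)
    fix x assume "x \<in> {..R}"
    then have "x < T" using R by simp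
    from f[OF this] show "(f has_real_derivative f1 x) (at x within {..R})"
      by (rule has_field_derivative_at_within)
  qed
  note ck = cont[OF kap_has_derivative]
  \<comment> \<open>The exponents leave 2 - 1 = 1; the weaker 1/2 is the common rate, since the
    weighted coupling of s to H decays no faster.\<close>
  have ev: "exp_O (1/2) (\<lambda>t. kap t * f t)" if "exp_O (-1) f" for f
    by (rule exp_O_mult[OF exp_O_kap[of 2] that]) simp_all
  have bdd: "\<exists>C\<ge>0. \<forall>t\<le>R. \<bar>kap t * f t\<bar> \<le> C * exp (1/2 * t)" if f: "exp_O (-1) f" "continuous_on {..R} f" for f
    by (rule exp_O_bounded_on_ray[OF ev[OF f(1)] continuous_on_mult[OF ck f(2)]]) blast
  have "\<exists>C\<ge>0. \<forall>t\<le>R. \<bar>kap t * (\<sigma> t - 3)\<bar> \<le> C * exp (1/2 * t)"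
    by (rule bdd[OF exp_O_diff[OF bd(1) exp_O_const] continuous_on_diff[OF cont[OF d(3)] continuous_on_const]]) simp_all
  then obtain C1 where C1: "C1 \<ge> 0" "\<And>t. t \<le> R \<Longrightarrow> \<bar>kap t * (\<sigma> t - 3)\<bar> \<le> C1 * exp (1/2 * t)" by blast
  have "\<exists>C\<ge>0. \<forall>t\<le>R. \<bar>kap t * (2 * G' t)\<bar> \<le> C * exp (1/2 * t)"
    by (rule bdd[OF exp_O_cmult[OF bd(4)] continuous_on_mult_left[OF cont[OF d'(2)]]])
  then obtain C2 where C2: "C2 \<ge> 0" "\<And>t. t \<le> R \<Longrightarrow> \<bar>kap t * (2 * G' t)\<bar> \<le> C2 * exp (1/2 * t)" by blast
  have "\<exists>C\<ge>0. \<forall>t\<le>R. \<bar>kap t * (1/2 * (\<sigma> t + \<sigma>' t) - 1)\<bar> \<le> C * exp (1/2 * t)"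
    by (rule bdd[OF exp_O_diff[OF exp_O_cmult[OF exp_O_add[OF bd(1,2)]] exp_O_const]
        continuous_on_diff[OF continuous_on_mult_left[OF continuous_on_add[OF cont[OF d(3)] cont[OF d'(3)]]] continuous_on_const]]) simp_all
  then obtain C3 where C3: "C3 \<ge> 0" "\<And>t. t \<le> R \<Longrightarrow> \<bar>kap t * (1/2 * (\<sigma> t + \<sigma>' t) - 1)\<bar> \<le> C3 * exp (1/2 * t)" by blast
  have "\<exists>C\<ge>0. \<forall>t\<le>R. \<bar>kap t * (2 * \<beta> t)\<bar> \<le> C * exp (1/2 * t)"
    by (rule bdd[OF exp_O_cmult[OF bd(3)] continuous_on_mult_left[OF cont[OF d(1)]]])
  then obtain C4 where C4: "C4 \<ge> 0" "\<And>t. t \<le> R \<Longrightarrow> \<bar>kap t * (2 * \<beta> t)\<bar> \<le> C4 * exp (1/2 * t)" by blast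
  have "\<exists>C\<ge>0. \<forall>t\<le>R. \<bar>kap t * 4\<bar> \<le> C * exp (1/2 * t)"
    by (rule bdd[OF exp_O_const continuous_on_const]) simp
  then obtain C5 where C5: "C5 \<ge> 0" "\<And>t. t \<le> R \<Longrightarrow> \<bar>kap t * 4\<bar> \<le> C5 * exp (1/2 * t)" by blast
  have "\<exists>C\<ge>0. \<forall>t\<le>R. \<bar>kap t * exp (- (1/2) * t)\<bar> \<le> C * exp (1/2 * t)"
    by (rule bdd[OF exp_O_mono[OF exp_O_exp]]) (simp, intro continuous_intros)
  then obtain C6 where C6: "C6 \<ge> 0" "\<And>t. t \<le> R \<Longrightarrow> \<bar>kap t * exp (- (1/2) * t)\<bar> \<le> C6 * exp (1/2 * t)" by blast
  \<comment> \<open>The summand 1 makes C e^(t/2) dominate the coupling e^(t/2) H in the equation of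
    s as well.\<close>
  define C where "C = C1 + C2 + C3 + C4 + C5 + C6 + 1"
  \<comment> \<open>In the variables below the constant linear part is dissipative: \<open>\<beta> - G / 2\<close> decays, and the weight
    \<open>e\<^sup>-\<^sup>t\<^sup>/\<^sup>2\<close> on \<open>k\<close> and \<open>h\<close> turns the coupling of \<open>\<sigma>\<close> to \<open>h\<close> into one of size \<open>e\<^sup>t\<^sup>/\<^sup>2\<close>. All other
    terms are integrable at \<open>-\<infinity>\<close>.\<close>
  define g b s n K H where "g = (\<lambda>t. G t - G' t)" and "b = (\<lambda>t. (\<beta> t - \<beta>' t) - (G t - G' t) / 2)"
    and "s = (\<lambda>t. \<sigma> t - \<sigma>' t)" and "n = (\<lambda>t. N t - N' t)"
    and "K = (\<lambda>t. exp (- (1/2) * t) * (k t - k' t))" and "H = (\<lambda>t. exp (- (1/2) * t) * (h t - h' t))"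
  note defs = g_def b_def s_def n_def K_def H_def
  define g1 where "g1 = (\<lambda>t. kap t * (\<sigma> t - 3) * g t + kap t * (2 * G' t) * s t / 2)"
  have dg: "(g has_real_derivative g1 t) (at t)" if "t < T" for t
    using d(2)[OF that] d'(2)[OF that] unfolding defs g1_def
    by (auto intro!: derivative_eq_intros simp: algebra_simps diff_divide_distrib)
  have db: "(b has_real_derivative - 2 * b t - g1 t / 2) (at t)" if "t < T" for t
  proof -
    have b: "b = (\<lambda>t. \<beta> t - \<beta>' t - g t / 2)" by (simp add: b_def g_def)
    have "(b has_real_derivative (G t - 2 * \<beta> t) - (G' t - 2 * \<beta>' t) - g1 t / 2) (at t)"
      unfolding b using d(1)[OF that] d'(1)[OF that] dg[OF that] by (auto intro!: derivative_eq_intros)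
    then show ?thesis by (rule DERIV_cong) (simp add: b g_def field_simps)
  qed
  have ds: "(s has_real_derivative exp (1/2 * t) * H t + kap t * (1/2 * (\<sigma> t + \<sigma>' t) - 1) * s t) (at t)" if "t < T" for t
  proof -
    have "exp (1/2 * t) * H t = h t - h' t" by (simp add: H_def mult.assoc[symmetric] exp_add[symmetric])
    moreover have "(s has_real_derivative (h t - kap t * (\<sigma> t - \<sigma> t * \<sigma> t / 2)) - (h' t - kap t * (\<sigma>' t - \<sigma>' t * \<sigma>' t / 2))) (at t)"
      unfolding s_def using d(3)[OF that] d'(3)[OF that] by (rule DERIV_diff)
    ultimately show ?thesis
      by (elim DERIV_cong) (simp add: s_def field_simps)
  qed
  have dn: "(n has_real_derivative kap t * (2 * \<beta> t) * g t + kap t * (2 * G' t) * (b t + g t / 2) - kap t * 4 * n t) (at t)" if "t < T" for t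
    using d(6)[OF that] d'(6)[OF that] unfolding defs
    by (auto intro!: derivative_eq_intros simp: algebra_simps)
  have dK: "(K has_real_derivative - K t / 2 + kap t * exp (- (1/2) * t) * n t - kap t * 4 * K t * (3/4)) (at t)" if "t < T" for t
    using d(5)[OF that] d'(5)[OF that] unfolding defs
    by (auto intro!: derivative_eq_intros simp: algebra_simps diff_divide_distrib)
  have dH: "(H has_real_derivative K t - 5/2 * H t) (at t)" if "t < T" for t
    using d(4)[OF that] d'(4)[OF that] unfolding defs
    by (auto intro!: derivative_eq_intros simp: algebra_simps diff_divide_distrib)
  define E where "E = (\<lambda>t. g t * g t + b t * b t + s t * s t + n t * n t + K t * K t + H t * H t)"
  define E' where "E' = (\<lambda>t. 2 * (g t * g1 t + b t * (- 2 * b t - g1 t / 2)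
     + s t * (exp (1/2 * t) * H t + kap t * (1/2 * (\<sigma> t + \<sigma>' t) - 1) * s t)
     + n t * (kap t * (2 * \<beta> t) * g t + kap t * (2 * G' t) * (b t + g t / 2) - kap t * 4 * n t)
     + K t * (- K t / 2 + kap t * exp (- (1/2) * t) * n t - kap t * 4 * K t * (3/4)) + H t * (K t - 5/2 * H t)))"
  have dE: "(E has_real_derivative E' t) (at t)" if "t < R" for t
    unfolding E_def E'_def
    using that R by (auto intro!: derivative_eq_intros dg db ds dn dK dH simp: algebra_simps)
  \<comment> \<open>The factor 24 is 2 times twelve products of variables, each with coefficient at
    most 1 and bounded by C e^(t/2) E. The terms without a small coefficient form a nonpositive
    quadratic form and are dropped.\<close>
  have le: "E' t \<le> 24 * C * exp (1/2 * t) * E t" if "t < R" for t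
  proof -
    define m where "m = C * exp (1/2 * t)"
    have mm: "C' * exp (1/2 * t) \<le> m" if "C' \<le> C" for C' using that by (simp add: m_def)
    have Cs: "C1 \<le> C" "C2 \<le> C" "C3 \<le> C" "C4 \<le> C" "C5 \<le> C" "C6 \<le> C" "1 \<le> C"
      using C1(1) C2(1) C3(1) C4(1) C5(1) C6(1) by (simp_all add: C_def)
    note tR = less_imp_le[OF that]
    have m7: "\<bar>exp (1/2 * t)\<bar> \<le> m" using mm[OF Cs(7)] by simp
    note m = order_trans[OF C1(2)[OF tR] mm[OF Cs(1)]] order_trans[OF C2(2)[OF tR] mm[OF Cs(2)]]
      order_trans[OF C3(2)[OF tR] mm[OF Cs(3)]] order_trans[OF C4(2)[OF tR] mm[OF Cs(4)]]
      order_trans[OF C5(2)[OF tR] mm[OF Cs(5)]] order_trans[OF C6(2)[OF tR] mm[OF Cs(6)]] m7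
    have prod: "\<bar>c * (x * y)\<bar> \<le> m * E t" if c: "\<bar>c\<bar> \<le> m" and xy: "x * x + y * y \<le> 2 * E t" for c x y
    proof -
      have "2 * \<bar>x * y\<bar> \<le> x * x + y * y"
        using zero_le_square[of "\<bar>x\<bar> - \<bar>y\<bar>"] by (simp add: algebra_simps abs_mult)
      then have "\<bar>x * y\<bar> \<le> E t" using xy by simp
      then show ?thesis unfolding abs_mult[of c] using c by (intro mult_mono) auto
    qed
    note nn = zero_le_square[of "g t"] zero_le_square[of "b t"] zero_le_square[of "s t"] zero_le_square[of "n t"]
      zero_le_square[of "K t"] zero_le_square[of "H t"]
    have xy: "g t * g t + g t * g t \<le> 2 * E t" "g t * g t + s t * s t \<le> 2 * E t" "g t * g t + b t * b t \<le> 2 * E t"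
      "s t * s t + b t * b t \<le> 2 * E t" "H t * H t + s t * s t \<le> 2 * E t" "s t * s t + s t * s t \<le> 2 * E t"
      "g t * g t + n t * n t \<le> 2 * E t" "b t * b t + n t * n t \<le> 2 * E t" "n t * n t + n t * n t \<le> 2 * E t"
      "n t * n t + K t * K t \<le> 2 * E t" "K t * K t + K t * K t \<le> 2 * E t"
      using nn by (simp_all add: E_def)
    note p = prod[OF m(1) xy(1)] prod[OF m(2) xy(2)] prod[OF m(1) xy(3)] prod[OF m(2) xy(4)] prod[OF m(7) xy(5)]
      prod[OF m(3) xy(6)] prod[OF m(4) xy(7)] prod[OF m(2) xy(8)] prod[OF m(2) xy(7)] prod[OF m(5) xy(9)]
      prod[OF m(6) xy(10)] prod[OF m(5) xy(11)]
    \<comment> \<open>This form equals -(K - H)^2 / 2 - 2 H^2; the weights on k and h were chosen to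
      supply the term -K^2/2.\<close>
    have q: "- (K t * K t) / 2 + H t * K t - 5/2 * (H t * H t) \<le> 0"
    proof -
      have "0 \<le> K t * K t - 2 * (H t * K t) + H t * H t"
        using zero_le_square[of "K t - H t"] by (simp add: algebra_simps)
      then show ?thesis using nn(6) by linarith
    qed
    have gen: "2 * (p1 + p2 / 2 - 2 * b2 - p3 / 2 - p4 / 4 + p5 + p6 + p7 + p8 + p9 / 2 - p10 + p11 - p12 * (3/4) + q0) \<le> 24 * M"
      if "\<bar>p1\<bar> \<le> M" "\<bar>p2\<bar> \<le> M" "\<bar>p3\<bar> \<le> M" "\<bar>p4\<bar> \<le> M" "\<bar>p5\<bar> \<le> M" "\<bar>p6\<bar> \<le> M" "\<bar>p7\<bar> \<le> M"
        "\<bar>p8\<bar> \<le> M" "\<bar>p9\<bar> \<le> M" "\<bar>p10\<bar> \<le> M" "\<bar>p11\<bar> \<le> M" "\<bar>p12\<bar> \<le> M" "q0 \<le> 0" "0 \<le> b2"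
      for p1 p2 p3 p4 p5 p6 p7 p8 p9 p10 p11 p12 q0 b2 M :: real
      using order_trans[OF abs_ge_zero that(1)] that(1,2,5-9,11)[THEN abs_le_D1] that(3,4,10,12)[THEN abs_le_D2] that(13,14)
      by (simp add: field_simps)
    have "E' t = 2 * (kap t * (\<sigma> t - 3) * (g t * g t) + kap t * (2 * G' t) * (g t * s t) / 2 - 2 * (b t * b t)
      - kap t * (\<sigma> t - 3) * (g t * b t) / 2 - kap t * (2 * G' t) * (s t * b t) / 4
      + exp (1/2 * t) * (H t * s t) + kap t * (1/2 * (\<sigma> t + \<sigma>' t) - 1) * (s t * s t)
      + kap t * (2 * \<beta> t) * (g t * n t) + kap t * (2 * G' t) * (b t * n t) + kap t * (2 * G' t) * (g t * n t) / 2
      - kap t * 4 * (n t * n t) + kap t * exp (- (1/2) * t) * (n t * K t) - kap t * 4 * (K t * K t) * (3/4)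
      + (- (K t * K t) / 2 + H t * K t - 5/2 * (H t * H t)))"
      unfolding E'_def g1_def by (simp add: field_simps)
    also have "\<dots> \<le> 24 * (m * E t)"
      by (rule gen[OF p q nn(2)])
    finally show ?thesis by (simp add: m_def)
  qed
  have eK: "exp_O (1/2) K" "exp_O (1/2) H"
    unfolding K_def H_def by (rule exp_O_mult[OF exp_O_exp diff(5)] exp_O_mult[OF exp_O_exp diff(4)]; simp)+
  have eb: "exp_O 1 b" unfolding b_def using exp_O_diff[OF diff(1) exp_O_cmult[OF diff(2), of "1/2"]] by simp
  have "(E \<longlongrightarrow> 0 * 0 + 0 * 0 + 0 * 0 + 0 * 0 + 0 * 0 + 0 * 0) at_bot"
    unfolding E_def
    by (intro tendsto_intros exp_O_tendsto_0[OF eb] exp_O_tendsto_0[OF diff(2)[folded g_def]] exp_O_tendsto_0[OF diff(3)[folded s_def]]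
      exp_O_tendsto_0[OF diff(6)[folded n_def]] exp_O_tendsto_0[OF eK(1)] exp_O_tendsto_0[OF eK(2)]) auto
  then have E0: "(E \<longlongrightarrow> 0) at_bot" by simp
  have "E t \<le> 0"
  proof (rule gronwall_at_bot[OF dE _ le E0 _ R(1)])
    show "((\<lambda>t. 48 * C * exp (1/2 * t)) has_real_derivative 24 * C * exp (1/2 * t)) (at t)" for t
      by (auto intro!: derivative_eq_intros)
    show "((\<lambda>t. 48 * C * exp (1/2 * t)) \<longlongrightarrow> 48 * C * 0) at_bot"
      by (intro tendsto_intros exp_tendsto_at_bot) simp
  qed
  then have "x * x \<le> 0" if "x \<in> {g t, b t, s t, n t, K t, H t}" for x
    using that zero_le_square[of "g t"] zero_le_square[of "b t"] zero_le_square[of "s t"] zero_le_square[of "n t"]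
      zero_le_square[of "K t"] zero_le_square[of "H t"] unfolding E_def by (elim insertE emptyE; hypsubst; linarith)
  then have z: "x = 0" if "x \<in> {g t, b t, s t, n t, K t, H t}" for x
    using that not_square_less_zero[of x] by (meson mult_eq_0_iff not_le order.antisym zero_le_square)
  show "\<beta> t = \<beta>' t" "G t = G' t" "\<sigma> t = \<sigma>' t" "h t = h' t" "k t = k' t" "N t = N' t"
    using z[of "g t"] z[of "b t"] z[of "s t"] z[of "n t"] z[of "K t"] z[of "H t"]
    by (simp_all add: defs)
qed

text \<open>Growth slower than every exponential. The class contains t and is closed under products,
  so any expression built from such functions becomes O(e^t) after multiplication by
  \<open>kap\<close>, with no bookkeeping of exponents.\<close>

definition slow_growth :: "(real \<Rightarrow> real) \<Rightarrow> bool" where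
  "slow_growth f \<longleftrightarrow> (\<forall>e>0. exp_O (- e) f)"

lemma slow_growth_D: "slow_growth f \<Longrightarrow> c < 0 \<Longrightarrow> exp_O c f"
  unfolding slow_growth_def by (drule spec[of _ "- c"]) simp

lemma slow_growth_exp_O: "exp_O c f \<Longrightarrow> c \<ge> 0 \<Longrightarrow> slow_growth f"
  unfolding slow_growth_def by (intro allI impI) (rule exp_O_mono, assumption, simp)

lemma slow_growth_add: "slow_growth f \<Longrightarrow> slow_growth g \<Longrightarrow> slow_growth (\<lambda>t. f t + g t)"
  unfolding slow_growth_def by (simp add: exp_O_add)

lemma slow_growth_diff: "slow_growth f \<Longrightarrow> slow_growth g \<Longrightarrow> slow_growth (\<lambda>t. f t - g t)"
  unfolding slow_growth_def by (simp add: exp_O_diff)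

lemma slow_growth_minus: "slow_growth f \<Longrightarrow> slow_growth (\<lambda>t. - f t)"
  unfolding slow_growth_def by (simp add: exp_O_minus)

lemma slow_growth_const: "slow_growth (\<lambda>t. a)"
  unfolding slow_growth_def by (simp add: exp_O_const)

lemma slow_growth_mult: "slow_growth f \<Longrightarrow> slow_growth g \<Longrightarrow> slow_growth (\<lambda>t. f t * g t)"
  unfolding slow_growth_def
proof (intro allI impI)
  fix e :: real assume fg: "\<forall>e>0. exp_O (- e) f" "\<forall>e>0. exp_O (- e) g" and e: "e > 0"
  have "exp_O (- (e/2)) f" "exp_O (- (e/2)) g" using fg e by simp_all
  then show "exp_O (- e) (\<lambda>t. f t * g t)" by (rule exp_O_mult) simp
qed

lemma slow_growth_divide: "slow_growth f \<Longrightarrow> slow_growth (\<lambda>t. f t / a)"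
  using slow_growth_mult[OF _ slow_growth_const[of "inverse a"], of f] by (simp add: divide_inverse)

lemma slow_growth_ident: "slow_growth (\<lambda>t. t)"
  unfolding slow_growth_def by (simp add: exp_O_ident)

lemma slow_growth_kap: "slow_growth kap"
  by (rule slow_growth_exp_O[OF exp_O_kap[of 0]]) simp_all

lemmas slow_growth_intros = slow_growth_add slow_growth_diff slow_growth_minus slow_growth_const slow_growth_mult slow_growth_divide slow_growth_kap

lemma exp_O_kap_slow_growth: "slow_growth f \<Longrightarrow> exp_O 1 (\<lambda>t. kap t * f t)"
  by (rule exp_O_mult[OF exp_O_kap[of 2] slow_growth_D[of f "-1"]]) simp_all

lemma slow_growth_cong: "slow_growth f \<Longrightarrow> (\<And>t. t < T \<Longrightarrow> f t = g t) \<Longrightarrow> slow_growth g"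
  unfolding slow_growth_def by (intro allI impI) (rule exp_O_cong[of _ f T g], simp_all)

text \<open>\<open>\<alpha>\<close> and \<open>\<pi>\<close> are not variables of the first-order
  system and are recovered from h, k and N up to terms with the factor \<open>kap\<close>. In terms
  of the limits at the axis: c0 = -k0, b0^rho = -k0/2 - \<sigma>0, b0^phi = G0/2, and the last
  relation ties N0 to d0.\<close>

lemma profile_asymptotics:
  assumes D: "D1 {..<T} \<alpha> \<alpha>1" "D1 {..<T} \<alpha>1 \<alpha>2" "D1 {..<T} \<beta> \<beta>1" "D1 {..<T} \<beta>1 \<beta>2"
    "D1 {..<T} \<gamma> \<gamma>1" "D1 {..<T} \<gamma>1 \<gamma>2" "D1 {..<T} \<pi> \<pi>1"
    and ns: "\<And>t. t < T \<Longrightarrow> NS_ode \<alpha> \<alpha>1 \<alpha>2 \<beta> \<beta>1 \<beta>2 \<gamma> \<gamma>1 \<gamma>2 \<pi> \<pi>1 t"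
    and lim: "((\<lambda>t. exp (2*t) * \<alpha> t) \<longlongrightarrow> 0) at_bot" "((\<lambda>t. exp (2*t) * \<beta> t) \<longlongrightarrow> 0) at_bot" "((\<lambda>t. exp t * \<gamma> t) \<longlongrightarrow> 0) at_bot"
  defines "\<sigma> \<equiv> \<lambda>t. \<alpha> t - \<gamma> t"
  obtains k0 N0 \<sigma>0 G0 d0 where
    "exp_O 1 (\<lambda>t. kfun \<alpha> \<alpha>1 \<sigma> t - k0)" "exp_O 1 (\<lambda>t. Nfun \<alpha> \<alpha>1 \<beta> \<sigma> \<pi> t - N0)" "exp_O 1 (\<lambda>t. hfun \<alpha> \<sigma> t - k0 / 2)"
    "exp_O 1 (\<lambda>t. \<sigma> t - (k0 / 2 * t + \<sigma>0))" "exp_O 1 (\<lambda>t. \<beta>1 t + 2 * \<beta> t - G0)" "exp_O 1 (\<lambda>t. \<beta> t - G0 / 2)"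
    "exp_O 1 (\<lambda>t. \<alpha> t - (- k0 / 2 * t + (- k0 / 2 - \<sigma>0)))" "exp_O 1 (\<lambda>t. \<pi>1 t - (- k0))" "exp_O 1 (\<lambda>t. \<pi> t - (- k0) * t - d0)"
    "N0 = 2 * d0 + 4 * \<sigma>0 + k0"
proof -
  let ?h = "hfun \<alpha> \<sigma>" and ?k = "kfun \<alpha> \<alpha>1 \<sigma>" and ?N = "Nfun \<alpha> \<alpha>1 \<beta> \<sigma> \<pi>"
  have sys: "first_order_system T \<beta> (\<lambda>t. \<beta>1 t + 2 * \<beta> t) \<sigma> ?h ?k ?N"
    unfolding \<sigma>_def by (rule first_order_system_of_NS_ode[OF D ns])
  have "((\<lambda>t. exp (2*t) * \<alpha> t - exp (1*t) * (exp t * \<gamma> t)) \<longlongrightarrow> 0 - 0 * 0) at_bot"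
    by (intro tendsto_intros lim exp_tendsto_at_bot) simp
  moreover have "exp (2*t) * \<alpha> t - exp (1*t) * (exp t * \<gamma> t) = exp (2*t) * \<sigma> t" for t
    by (simp add: \<sigma>_def right_diff_distrib mult.assoc[symmetric] mult_exp_exp)
  ultimately have "((\<lambda>t. exp (2*t) * \<sigma> t) \<longlongrightarrow> 0) at_bot"
    by simp
  then obtain k0 N0 \<sigma>0 G0 where A: "exp_O 1 (\<lambda>t. ?k t - k0)" "exp_O 1 (\<lambda>t. ?N t - N0)" "exp_O 1 (\<lambda>t. ?h t - k0 / 2)"
    "exp_O 1 (\<lambda>t. \<sigma> t - (k0 / 2 * t + \<sigma>0))" "exp_O 1 (\<lambda>t. \<beta>1 t + 2 * \<beta> t - G0)" "exp_O 1 (\<lambda>t. \<beta> t - G0 / 2)"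
    by (rule first_order_system_asymptotics[OF sys _ lim(2)])
  have gr0: "slow_growth f" if "exp_O 1 (\<lambda>t. f t - g t)" "slow_growth g" for f g
    using slow_growth_add[OF slow_growth_exp_O[OF that(1)] that(2)] by simp
  have gk: "slow_growth ?k" by (rule gr0[OF A(1) slow_growth_const])
  have gN: "slow_growth ?N" by (rule gr0[OF A(2) slow_growth_const])
  have gh: "slow_growth ?h" by (rule gr0[OF A(3) slow_growth_const])
  have gs: "slow_growth \<sigma>" by (rule gr0[OF A(4) slow_growth_add[OF slow_growth_mult[OF slow_growth_const slow_growth_ident] slow_growth_const]])
  have gb: "slow_growth \<beta>" by (rule gr0[OF A(6) slow_growth_const])
  define w where "w = (\<lambda>t. \<sigma> t - \<sigma> t * \<sigma> t / 2)"
  \<comment> \<open>\<open>e1\<close> and \<open>e2\<close> are the parts of h and k that carry the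
    factor \<kappa>; the remaining parts are linear in \<open>\<alpha>\<close>,
    \<open>\<alpha>1\<close> and \<open>\<sigma>\<close> and can be inverted at once.\<close>
  define e1 where "e1 = (\<lambda>t. kap t * w t)"
  define e2 where "e2 = (\<lambda>t. kap t * ((4 - 2 * kap t) * w t + (?h t - e1 t) * (1 - \<sigma> t)))"
  have gw: "slow_growth w" unfolding w_def by (intro slow_growth_intros gs)
  have e1: "exp_O 1 e1" unfolding e1_def by (rule exp_O_kap_slow_growth[OF gw])
  have ge1: "slow_growth e1" by (rule slow_growth_exp_O[OF e1]) simp
  have e2: "exp_O 1 e2" unfolding e2_def by (intro exp_O_kap_slow_growth slow_growth_intros gw ge1 gh gs)
  have ge2: "slow_growth e2" by (rule slow_growth_exp_O[OF e2]) simp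
  have al': "\<alpha> t = e1 t - \<sigma> t - ?h t" for t
    by (simp add: hfun_def e1_def w_def)
  have al1: "\<alpha>1 t = e2 t - e1 t + ?h t - ?k t" for t
  proof -
    have "?h t - e1 t = - \<alpha> t - \<sigma> t" using al' by simp
    then have "e2 t = kap t * ((4 - 2 * kap t) * w t + (- \<alpha> t - \<sigma> t) * (1 - \<sigma> t))" by (simp only: e2_def)
    then have "?k t = - \<alpha>1 t - \<alpha> t - \<sigma> t + e2 t" by (simp only: kfun_def w_def)
    then show ?thesis using al' by simp
  qed
  have ga: "slow_growth \<alpha>"
    by (rule slow_growth_cong[of "\<lambda>t. e1 t - \<sigma> t - ?h t" 0]) (intro slow_growth_intros ge1 gs gh, simp add: al')
  have ga1: "slow_growth \<alpha>1"
    by (rule slow_growth_cong[of "\<lambda>t. e2 t - e1 t + ?h t - ?k t" 0]) (intro slow_growth_intros ge1 ge2 gh gk, simp add: al1)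
  have gN': "slow_growth (\<lambda>t. ?N t - 2 * (1 - kap t) * \<pi> t)"
    unfolding Nfun_def kfun_def[abs_def] by (simp add: algebra_simps) (intro slow_growth_intros ga ga1 gs gb)
  have gq: "slow_growth (\<lambda>t. 1 + exp (2 * t))"
    by (intro slow_growth_add slow_growth_const slow_growth_exp_O[OF exp_O_exp]) simp
  \<comment> \<open>No bound on the pressure is assumed. It is solved for in the definition of N,
    where its coefficient is 2 (1 - \<kappa>) = 2 / (1 + e^(2t)).\<close>
  have gp: "slow_growth \<pi>"
  proof (rule slow_growth_cong)
    show "slow_growth (\<lambda>t. (1 + exp (2 * t)) / 2 * (?N t - (?N t - 2 * (1 - kap t) * \<pi> t)))"
      by (intro slow_growth_mult slow_growth_divide gq slow_growth_diff gN gN')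
    fix t :: real
    have "1 + exp (2*t) \<noteq> 0" using exp_gt_zero[of "2*t"] by linarith
    then show "(1 + exp (2 * t)) / 2 * (?N t - (?N t - 2 * (1 - kap t) * \<pi> t)) = \<pi> t"
      by (simp add: kap_def field_simps)
  qed
  define X where "X = (\<lambda>t. 3 * \<alpha>1 t + 6 * \<alpha> t - (\<alpha> t * \<alpha> t - \<beta> t * \<beta> t + \<sigma> t * \<alpha>1 t - 2 * (\<alpha> t - \<sigma> t) * \<alpha> t))"
  define Y where "Y = (\<lambda>t. 3 * (\<alpha>1 t + \<alpha> t + \<sigma> t) + 2 * (\<alpha> t - \<sigma> t) - \<sigma> t * (\<alpha>1 t + \<alpha> t + \<sigma> t) + (\<alpha> t - \<sigma> t) * (\<alpha> t - \<sigma> t))"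
  \<comment> \<open>The coefficient of \<kappa> in N - 2 \<pi> - 4 \<sigma> - 2 h, apart from
    multiples of \<open>e1\<close> and \<open>e2\<close>.\<close>
  define B where "B = (\<lambda>t. X t - Y t - 2 * \<pi> t - 2 * ((4 - 2 * kap t) * w t + (- \<alpha> t - \<sigma> t) * (1 - \<sigma> t))
     - 4 * w t - 4 * (1 - kap t) * w t - 2 * ((- \<alpha> t - \<sigma> t) * (1 - \<sigma> t)))"
  have gX: "slow_growth X" and gY: "slow_growth Y" unfolding X_def Y_def by (intro slow_growth_intros ga ga1 gs gb)+
  have gB: "slow_growth B" unfolding B_def by (intro slow_growth_intros gX gY ga gs gp gw)
  have Neq: "?N t - 2 * \<pi> t - 4 * \<sigma> t - 2 * ?h t = kap t * B t + 3 * e2 t - 2 * e1 t" for t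
  proof -
    have "?N t = (\<alpha>1 t + \<alpha> t + \<sigma> t) + kap t * X t + (1 - kap t) * Y t + 2 * (1 - kap t) * \<pi> t
      + 2 * (1 - kap t) * ((4 - 2 * kap t) * w t + (- \<alpha> t - \<sigma> t) * (1 - \<sigma> t))
      - 4 * kap t * (1 - kap t) * w t + (4 - 2 * kap t) * ((- \<alpha> t - \<sigma> t) * (1 - \<sigma> t))
      + ((- \<alpha>1 t + \<alpha> t + \<sigma> t) * (1 - \<sigma> t) - (\<alpha> t + \<sigma> t) * (\<alpha> t + \<sigma> t)) + 3 * ?k t"
      by (simp only: Nfun_def X_def Y_def w_def)
    moreover have "w t = \<sigma> t - \<sigma> t * \<sigma> t / 2" by (simp add: w_def)
    moreover have "e1 t = kap t * w t" by (simp add: e1_def)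
    ultimately show ?thesis
      using al'[of t] al1[of t] unfolding B_def Y_def by algebra
  qed
  have NE: "exp_O 1 (\<lambda>t. ?N t - 2 * \<pi> t - 4 * \<sigma> t - 2 * ?h t)"
    unfolding Neq by (intro exp_O_add exp_O_diff exp_O_cmult exp_O_kap_slow_growth gB e1 e2)
  have alE: "exp_O 1 (\<lambda>t. \<alpha> t - (- k0 / 2 * t + (- k0 / 2 - \<sigma>0)))"
      proof (rule exp_O_cong[OF exp_O_diff[OF exp_O_diff[OF e1 A(4)] A(3)]])
    show "e1 t - (\<sigma> t - (k0 / 2 * t + \<sigma>0)) - (?h t - k0 / 2) = \<alpha> t - (- k0 / 2 * t + (- k0 / 2 - \<sigma>0))" if "t < T" for t
      using al'[of t] by (simp add: algebra_simps)
  qed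
  have p1: "exp_O 1 (\<lambda>t. \<pi>1 t - (- k0))"
  proof (rule exp_O_cong)
    let ?C = "\<lambda>t. (3 * \<alpha>1 t + 6 * \<alpha> t) - (\<alpha> t * \<alpha> t - \<beta> t * \<beta> t + \<sigma> t * \<alpha>1 t - 2 * (\<alpha> t - \<sigma> t) * \<alpha> t)
      - (3 * (\<alpha>1 t + \<alpha> t + \<sigma> t) + 2 * (\<alpha> t - \<sigma> t)) + (\<sigma> t * (\<alpha>1 t + \<alpha> t + \<sigma> t) - (\<alpha> t - \<sigma> t) * (\<alpha> t - \<sigma> t)) - 2 * \<pi> t"
    show "exp_O 1 (\<lambda>t. e2 t - (?k t - k0) + kap t * ?C t)"
      by (intro exp_O_add exp_O_diff[OF e2 A(1)] exp_O_kap_slow_growth slow_growth_intros ga ga1 gs gb gp)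
    fix t assume t: "t < T"
    note g2 = NS_ode_gamma2[OF D(1,2,5,6) ns t]
    have s: "\<alpha>1 t + \<alpha> t + \<sigma> t = e2 t - ?k t" using al'[of t] al1[of t] by simp
    show "e2 t - (?k t - k0) + kap t * ?C t = \<pi>1 t - (- k0)"
      using NS_ode_solved(1)[OF ns[OF t] _ g2 refl, of "\<sigma> t"] s by (simp add: \<sigma>_def) algebra
  qed
  have dp: "((\<lambda>t. \<pi> t - (- k0) * t) has_real_derivative \<pi>1 t - (- k0)) (at t)" if "t < T" for t
    using D1D[OF D(7)] that by (auto intro!: derivative_eq_intros)
  obtain d0 where d0: "exp_O 1 (\<lambda>t. \<pi> t - (- k0) * t - d0)"
    by (rule exp_O_integral[OF dp p1 zero_less_one])
  \<comment> \<open>In this combination of O(e^t) quantities all functions and the linear terms in t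
    cancel. What is left is a constant that tends to 0, hence zero.\<close>
  have "exp_O 1 (\<lambda>t. (?N t - N0) - (?N t - 2 * \<pi> t - 4 * \<sigma> t - 2 * ?h t)
     - 2 * (\<pi> t - (- k0) * t - d0) - 4 * (\<sigma> t - (k0 / 2 * t + \<sigma>0)) - 2 * (?h t - k0 / 2))"
    by (intro exp_O_diff A NE exp_O_cmult d0)
  then have "exp_O 1 (\<lambda>t. (2 * d0 + 4 * \<sigma>0 + k0) - N0)"
    by (simp add: algebra_simps)
  from exp_O_tendsto_0[OF this] have "N0 = 2 * d0 + 4 * \<sigma>0 + k0"
    by (simp add: tendsto_const_iff)
  then show ?thesis
    using that[of k0 N0 \<sigma>0 G0 d0] A alE p1 d0 by blast
qed

section \<open>From profiles back to solutions on the punctured cone\<close>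

lemma vector_4_nth: "(vector [a, b, c, d] :: real^4) $ 1 = a" "(vector [a, b, c, d] :: real^4) $ 2 = b"
    "(vector [a, b, c, d] :: real^4) $ 3 = c" "(vector [a, b, c, d] :: real^4) $ 4 = d"
  unfolding vector_def by simp_all

lemma Ck_on_subset: "Ck_on k S f \<Longrightarrow> T \<subseteq> S \<Longrightarrow> Ck_on k T f"
  by (induction k arbitrary: f) (auto intro: continuous_on_subset)

lemma pcone_mono: "\<delta> \<le> \<delta>' \<Longrightarrow> pcone \<delta> \<subseteq> pcone \<delta>'"
proof
  fix x assume "\<delta> \<le> \<delta>'" and x: "x \<in> pcone \<delta>"
  then have "\<delta> * x$3 \<le> \<delta>' * x$3"
    by (intro mult_right_mono) (auto simp: pcone_def cone_def)
  moreover have "rad x < \<delta> * x$3" "x$3 > 0" "horiz x \<noteq> 0" using x by (simp_all add: pcone_def cone_def)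
  ultimately have "rad x < \<delta>' * x$3" by linarith
  then show "x \<in> pcone \<delta>'" using \<open>x$3 > 0\<close> \<open>horiz x \<noteq> 0\<close> by (simp add: pcone_def cone_def)
qed

lemma hom_axi_NS_solution_mono:
  assumes "hom_axi_NS_solution \<delta>' u p" "\<delta> \<le> \<delta>'"
  shows "hom_axi_NS_solution \<delta> u p"
  using assms(1) pcone_mono[OF assms(2)]
  unfolding hom_axi_NS_solution_def stationary_NS_on_def neg_homogeneous_on_def axisymmetric_on_def phi_independent_on_def
  by (meson subsetD)

lemma axis_limits_ex:
  assumes \<delta>: "\<delta> > 0" and sol: "hom_axi_NS_solution \<delta> u p" and C2: "Ck_on 2 (pcone \<delta>) u" "Ck_on 2 (pcone \<delta>) p"
    and mild: "mild_at_axis u"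
  shows "\<exists>l. axis_limits l u p"
proof -
  obtain \<alpha> \<alpha>1 \<alpha>2 \<beta> \<beta>1 \<beta>2 \<gamma> \<gamma>1 \<gamma>2 \<pi> \<pi>1 where
    D: "D1 {..<ln \<delta>} \<alpha> \<alpha>1" "D1 {..<ln \<delta>} \<alpha>1 \<alpha>2" "D1 {..<ln \<delta>} \<beta> \<beta>1" "D1 {..<ln \<delta>} \<beta>1 \<beta>2"
    "D1 {..<ln \<delta>} \<gamma> \<gamma>1" "D1 {..<ln \<delta>} \<gamma>1 \<gamma>2" "D1 {..<ln \<delta>} \<pi> \<pi>1"
    and up: "\<And>x. x \<in> pcone \<delta> \<Longrightarrow> u x = VF 1 \<alpha> \<beta> \<gamma> x" "\<And>x. x \<in> pcone \<delta> \<Longrightarrow> p x = SF 2 \<pi> x"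
    and ns: "\<And>t. t < ln \<delta> \<Longrightarrow> NS_ode \<alpha> \<alpha>1 \<alpha>2 \<beta> \<beta>1 \<beta>2 \<gamma> \<gamma>1 \<gamma>2 \<pi> \<pi>1 t"
    by (rule solution_profile[OF \<delta> sol C2]) (rule that; simp)
  have lim: "((\<lambda>t. exp (2*t) * \<alpha> t) \<longlongrightarrow> 0) at_bot" "((\<lambda>t. exp (2*t) * \<beta> t) \<longlongrightarrow> 0) at_bot" "((\<lambda>t. exp t * \<gamma> t) \<longlongrightarrow> 0) at_bot"
    using mild_profile[OF \<delta> up(1) mild] by simp_all
  obtain k0 N0 \<sigma>0 G0 d0 where
    A: "exp_O 1 (\<lambda>t. \<beta> t - G0 / 2)" "exp_O 1 (\<lambda>t. \<alpha> t - (- k0 / 2 * t + (- k0 / 2 - \<sigma>0)))"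
      "exp_O 1 (\<lambda>t. \<pi>1 t - (- k0))" "exp_O 1 (\<lambda>t. \<pi> t - (- k0) * t - d0)"
    by (rule profile_asymptotics[OF D ns lim])
  have AL: "axis_limits l u p \<longleftrightarrow> (\<pi>1 \<longlongrightarrow> par_c l) at_bot \<and> ((\<lambda>t. \<pi> t - par_c l * t) \<longlongrightarrow> par_d l) at_bot \<and>
     ((\<lambda>t. \<alpha> t - 1/2 * par_c l * t) \<longlongrightarrow> par_brho l) at_bot \<and> (\<beta> \<longlongrightarrow> par_bphi l) at_bot" for l
    by (rule axis_limits_profile[OF \<delta> up D(7)])
  have A2: "exp_O 1 (\<lambda>t. \<alpha> t - 1/2 * (- k0) * t - (- k0 / 2 - \<sigma>0))"
    using A(2) by (simp add: algebra_simps)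
  have "axis_limits (vector [- k0, d0, - k0 / 2 - \<sigma>0, G0 / 2]) u p"
    unfolding AL vector_4_nth
    by (intro conjI exp_O_tendsto[OF A(3)] exp_O_tendsto[OF A(4)] exp_O_tendsto[OF A2] exp_O_tendsto[OF A(1)] zero_less_one)
  then show ?thesis ..
qed

text \<open>The parameter l fixes all constants in the asymptotics, so the variables of the two
  first-order systems differ by O(e^t) and therefore agree. The profiles follow one at a time: h
  yields \<open>\<alpha>\<close>, k yields \<open>\<alpha>1\<close>, and N yields
  \<open>\<pi>\<close>.\<close>

lemma solution_unique:
  assumes \<delta>: "\<delta> > 0" and sol: "hom_axi_NS_solution \<delta> u p" "Ck_on 2 (pcone \<delta>) u" "Ck_on 2 (pcone \<delta>) p" "mild_at_axis u" "axis_limits l u p"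
    and sol': "hom_axi_NS_solution \<delta> u' p'" "Ck_on 2 (pcone \<delta>) u'" "Ck_on 2 (pcone \<delta>) p'" "mild_at_axis u'" "axis_limits l u' p'"
    and x: "x \<in> pcone \<delta>"
  shows "u x = u' x \<and> p x = p' x"
proof -
  have tl: "\<exists>\<alpha> \<alpha>1 \<beta> \<beta>1 \<sigma> \<pi>.
      (\<forall>x\<in>pcone \<delta>. u x = VF 1 \<alpha> \<beta> (\<lambda>t. \<alpha> t - \<sigma> t) x \<and> p x = SF 2 \<pi> x) \<and>
      first_order_system (ln \<delta>) \<beta> (\<lambda>t. \<beta>1 t + 2 * \<beta> t) \<sigma> (hfun \<alpha> \<sigma>) (kfun \<alpha> \<alpha>1 \<sigma>) (Nfun \<alpha> \<alpha>1 \<beta> \<sigma> \<pi>) \<and>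
      exp_O 1 (\<lambda>t. kfun \<alpha> \<alpha>1 \<sigma> t - (- par_c l)) \<and>
      exp_O 1 (\<lambda>t. Nfun \<alpha> \<alpha>1 \<beta> \<sigma> \<pi> t - (2 * par_d l + 4 * (par_c l / 2 - par_brho l) - par_c l)) \<and>
      exp_O 1 (\<lambda>t. hfun \<alpha> \<sigma> t - (- par_c l) / 2) \<and>
      exp_O 1 (\<lambda>t. \<sigma> t - ((- par_c l) / 2 * t + (par_c l / 2 - par_brho l))) \<and>
      exp_O 1 (\<lambda>t. \<beta>1 t + 2 * \<beta> t - 2 * par_bphi l) \<and> exp_O 1 (\<lambda>t. \<beta> t - 2 * par_bphi l / 2)"
    if sol: "hom_axi_NS_solution \<delta> u p" "Ck_on 2 (pcone \<delta>) u" "Ck_on 2 (pcone \<delta>) p" "mild_at_axis u" "axis_limits l u p"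
    for u p
  proof -
    obtain \<alpha> \<alpha>1 \<alpha>2 \<beta> \<beta>1 \<beta>2 \<gamma> \<gamma>1 \<gamma>2 \<pi> \<pi>1 where
      D: "D1 {..<ln \<delta>} \<alpha> \<alpha>1" "D1 {..<ln \<delta>} \<alpha>1 \<alpha>2" "D1 {..<ln \<delta>} \<beta> \<beta>1" "D1 {..<ln \<delta>} \<beta>1 \<beta>2"
      "D1 {..<ln \<delta>} \<gamma> \<gamma>1" "D1 {..<ln \<delta>} \<gamma>1 \<gamma>2" "D1 {..<ln \<delta>} \<pi> \<pi>1"
      and up: "\<And>x. x \<in> pcone \<delta> \<Longrightarrow> u x = VF 1 \<alpha> \<beta> \<gamma> x" "\<And>x. x \<in> pcone \<delta> \<Longrightarrow> p x = SF 2 \<pi> x"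
      and ns: "\<And>t. t < ln \<delta> \<Longrightarrow> NS_ode \<alpha> \<alpha>1 \<alpha>2 \<beta> \<beta>1 \<beta>2 \<gamma> \<gamma>1 \<gamma>2 \<pi> \<pi>1 t"
      by (rule solution_profile[OF \<delta> sol(1-3)]) (rule that; simp)
    have lim: "((\<lambda>t. exp (2*t) * \<alpha> t) \<longlongrightarrow> 0) at_bot" "((\<lambda>t. exp (2*t) * \<beta> t) \<longlongrightarrow> 0) at_bot" "((\<lambda>t. exp t * \<gamma> t) \<longlongrightarrow> 0) at_bot"
      using mild_profile[OF \<delta> up(1) sol(4)] by simp_all
    define \<sigma> where "\<sigma> = (\<lambda>t. \<alpha> t - \<gamma> t)"
    obtain k0 N0 \<sigma>0 G0 d0 where
      A: "exp_O 1 (\<lambda>t. kfun \<alpha> \<alpha>1 \<sigma> t - k0)" "exp_O 1 (\<lambda>t. Nfun \<alpha> \<alpha>1 \<beta> \<sigma> \<pi> t - N0)" "exp_O 1 (\<lambda>t. hfun \<alpha> \<sigma> t - k0 / 2)"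
      "exp_O 1 (\<lambda>t. \<sigma> t - (k0 / 2 * t + \<sigma>0))" "exp_O 1 (\<lambda>t. \<beta>1 t + 2 * \<beta> t - G0)" "exp_O 1 (\<lambda>t. \<beta> t - G0 / 2)"
      and B: "exp_O 1 (\<lambda>t. \<alpha> t - (- k0 / 2 * t + (- k0 / 2 - \<sigma>0)))" "exp_O 1 (\<lambda>t. \<pi>1 t - (- k0))" "exp_O 1 (\<lambda>t. \<pi> t - (- k0) * t - d0)"
      and N0: "N0 = 2 * d0 + 4 * \<sigma>0 + k0"
      unfolding \<sigma>_def by (rule profile_asymptotics[OF D ns lim])
    have B1: "exp_O 1 (\<lambda>t. \<alpha> t - 1/2 * (- k0) * t - (- k0 / 2 - \<sigma>0))"
      using B(1) by (simp add: algebra_simps)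
    have AL: "axis_limits l u p \<longleftrightarrow> (\<pi>1 \<longlongrightarrow> par_c l) at_bot \<and> ((\<lambda>t. \<pi> t - par_c l * t) \<longlongrightarrow> par_d l) at_bot \<and>
     ((\<lambda>t. \<alpha> t - 1/2 * par_c l * t) \<longlongrightarrow> par_brho l) at_bot \<and> (\<beta> \<longlongrightarrow> par_bphi l) at_bot" for l
    by (rule axis_limits_profile[OF \<delta> up D(7)])
    note L = sol(5)[unfolded AL]
    have c: "par_c l = - k0"
      using tendsto_unique[OF trivial_limit_at_bot_linorder L[THEN conjunct1] exp_O_tendsto[OF B(2)]] by simp
    have d: "par_d l = d0"
      using tendsto_unique[OF trivial_limit_at_bot_linorder _ exp_O_tendsto[OF B(3)]] L c by simp
    have br: "par_brho l = - k0 / 2 - \<sigma>0"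
      using tendsto_unique[OF trivial_limit_at_bot_linorder _ exp_O_tendsto[OF B1]] L c by simp
    have bp: "par_bphi l = G0 / 2"
      using tendsto_unique[OF trivial_limit_at_bot_linorder _ exp_O_tendsto[OF A(6)]] L by simp
    have "k0 = - par_c l" "G0 = 2 * par_bphi l" "\<sigma>0 = par_c l / 2 - par_brho l"
      "N0 = 2 * par_d l + 4 * (par_c l / 2 - par_brho l) - par_c l"
      using c d br bp N0 by simp_all
    note A' = A[unfolded this]
    have "first_order_system (ln \<delta>) \<beta> (\<lambda>t. \<beta>1 t + 2 * \<beta> t) \<sigma> (hfun \<alpha> \<sigma>) (kfun \<alpha> \<alpha>1 \<sigma>) (Nfun \<alpha> \<alpha>1 \<beta> \<sigma> \<pi>)"
      unfolding \<sigma>_def by (rule first_order_system_of_NS_ode[OF D ns])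
    moreover have "\<gamma> = (\<lambda>t. \<alpha> t - \<sigma> t)" by (simp add: \<sigma>_def)
    ultimately show ?thesis
      using up A' by blast
  qed
  obtain \<alpha> \<alpha>1 \<beta> \<beta>1 \<sigma> \<pi> where
    up: "\<forall>x\<in>pcone \<delta>. u x = VF 1 \<alpha> \<beta> (\<lambda>t. \<alpha> t - \<sigma> t) x \<and> p x = SF 2 \<pi> x" and
    S: "first_order_system (ln \<delta>) \<beta> (\<lambda>t. \<beta>1 t + 2 * \<beta> t) \<sigma> (hfun \<alpha> \<sigma>) (kfun \<alpha> \<alpha>1 \<sigma>) (Nfun \<alpha> \<alpha>1 \<beta> \<sigma> \<pi>)" and
    A: "exp_O 1 (\<lambda>t. kfun \<alpha> \<alpha>1 \<sigma> t - (- par_c l))"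
      "exp_O 1 (\<lambda>t. Nfun \<alpha> \<alpha>1 \<beta> \<sigma> \<pi> t - (2 * par_d l + 4 * (par_c l / 2 - par_brho l) - par_c l))"
      "exp_O 1 (\<lambda>t. hfun \<alpha> \<sigma> t - (- par_c l) / 2)"
      "exp_O 1 (\<lambda>t. \<sigma> t - ((- par_c l) / 2 * t + (par_c l / 2 - par_brho l)))"
      "exp_O 1 (\<lambda>t. \<beta>1 t + 2 * \<beta> t - 2 * par_bphi l)" "exp_O 1 (\<lambda>t. \<beta> t - 2 * par_bphi l / 2)"
    using tl[OF sol] by (elim exE conjE) (rule that)
  obtain \<alpha>' \<alpha>1' \<beta>' \<beta>1' \<sigma>' \<pi>' where
    up': "\<forall>x\<in>pcone \<delta>. u' x = VF 1 \<alpha>' \<beta>' (\<lambda>t. \<alpha>' t - \<sigma>' t) x \<and> p' x = SF 2 \<pi>' x" and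
    S': "first_order_system (ln \<delta>) \<beta>' (\<lambda>t. \<beta>1' t + 2 * \<beta>' t) \<sigma>' (hfun \<alpha>' \<sigma>') (kfun \<alpha>' \<alpha>1' \<sigma>') (Nfun \<alpha>' \<alpha>1' \<beta>' \<sigma>' \<pi>')" and
    A': "exp_O 1 (\<lambda>t. kfun \<alpha>' \<alpha>1' \<sigma>' t - (- par_c l))"
      "exp_O 1 (\<lambda>t. Nfun \<alpha>' \<alpha>1' \<beta>' \<sigma>' \<pi>' t - (2 * par_d l + 4 * (par_c l / 2 - par_brho l) - par_c l))"
      "exp_O 1 (\<lambda>t. hfun \<alpha>' \<sigma>' t - (- par_c l) / 2)"
      "exp_O 1 (\<lambda>t. \<sigma>' t - ((- par_c l) / 2 * t + (par_c l / 2 - par_brho l)))"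
      "exp_O 1 (\<lambda>t. \<beta>1' t + 2 * \<beta>' t - 2 * par_bphi l)" "exp_O 1 (\<lambda>t. \<beta>' t - 2 * par_bphi l / 2)"
    using tl[OF sol'] by (elim exE conjE) (rule that)
  have diff: "exp_O 1 (\<lambda>t. f t - g t)" if "exp_O 1 (\<lambda>t. f t - h t)" "exp_O 1 (\<lambda>t. g t - h t)" for f g h
    using exp_O_diff[OF that] by simp
  have bd: "exp_O (-1) f" if "exp_O 1 (\<lambda>t. f t - g t)" "slow_growth g" for f g
    using exp_O_add[OF exp_O_mono[OF that(1), of "-1"] slow_growth_D[OF that(2)]] by simp
  have lin: "slow_growth (\<lambda>t. a * t + b)" for a b
    by (intro slow_growth_intros slow_growth_ident)
  note U = first_order_system_unique[OF S S' diff[OF A(6) A'(6)] diff[OF A(5) A'(5)] diff[OF A(4) A'(4)] diff[OF A(3) A'(3)]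
      diff[OF A(1) A'(1)] diff[OF A(2) A'(2)] bd[OF A(4) lin] bd[OF A'(4) lin] bd[OF A(6) slow_growth_const] bd[OF A'(5) slow_growth_const]]
  define t where "t = ln (rho x)"
  have t: "t < ln \<delta>" using x pcone_eq_sect[OF \<delta>] by (simp add: t_def sect_def)
  have \<sigma>: "\<sigma> t = \<sigma>' t" and \<beta>: "\<beta> t = \<beta>' t" by (rule U(3,1)[OF t])+
  have \<alpha>: "\<alpha> t = \<alpha>' t" using U(4)[OF t] \<sigma> by (simp add: hfun_def)
  have \<alpha>1: "\<alpha>1 t = \<alpha>1' t" using U(5)[OF t] \<sigma> \<alpha> by (simp add: kfun_def)
  \<comment> \<open>Once all else agrees, N depends on the pressure through 2 (1 - \<kappa>) \<pi>
    alone, and \<kappa> < 1.\<close>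
  have "\<pi> t = \<pi>' t"
    using U(6)[OF t] U(5)[OF t] kap_bounds(2)[of t] unfolding Nfun_def \<sigma> \<alpha> \<beta> \<alpha>1 by simp
  then show ?thesis
    using up up' x \<sigma> \<alpha> \<beta> by (simp add: VF_def SF_def t_def[symmetric])
qed

section \<open>The coefficient polynomials\<close>

text \<open>The sum of \<open>2\<^sup>i \<bar>a\<^sub>i\<bar>\<close>. The weight is such that, on polynomials of degree at most \<open>n + 2\<close>,
  \<open>p'\<close> has norm at most \<open>n / 2 + 1\<close> times that of \<open>p\<close>, so that \<open>c p + p' = q\<close> can be solved with
  good bounds for all \<open>c \<ge> 2 n + 2\<close>.\<close>
definition pnorm :: "real poly \<Rightarrow> real" where
  "pnorm p = fold_coeffs (\<lambda>a b. \<bar>a\<bar> + 2 * b) p 0"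

lemma pnorm_0 [simp]: "pnorm 0 = 0"
  by (simp add: pnorm_def)

lemma pnorm_pCons [simp]: "pnorm (pCons a p) = \<bar>a\<bar> + 2 * pnorm p"
  by (cases "p = 0 \<and> a = 0") (auto simp: pnorm_def fold_coeffs_pCons_coeff_not_0_eq fold_coeffs_pCons_not_0_0_eq)

lemma pnorm_nonneg: "pnorm p \<ge> 0"
  by (induction p) auto

lemma pnorm_add: "pnorm (p + q) \<le> pnorm p + pnorm q"
  by (induction p q rule: poly_induct2) auto

lemma pnorm_smult: "pnorm (smult c p) = \<bar>c\<bar> * pnorm p"
  by (induction p) (auto simp: abs_mult algebra_simps)

lemma pnorm_minus: "pnorm (- p) = pnorm p"
  using pnorm_smult[of "-1" p] by simp

lemma pnorm_diff: "pnorm (p - q) \<le> pnorm p + pnorm q"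
  using pnorm_add[of p "- q"] by (simp add: pnorm_minus)

lemma pnorm_mult: "pnorm (p * q) \<le> pnorm p * pnorm q"
proof (induction p)
  case (pCons a p)
  have "pnorm (pCons a p * q) \<le> pnorm (smult a q) + pnorm (pCons 0 (p * q))"
    unfolding mult_pCons_left by (rule pnorm_add)
  then show ?case using pCons by (simp add: pnorm_smult algebra_simps)
qed simp

lemma pnorm_sum: "pnorm (sum f S) \<le> (\<Sum>i\<in>S. pnorm (f i))"
proof (induction S rule: infinite_finite_induct)
  case (insert x S)
  then show ?case using pnorm_add[of "f x" "sum f S"] by simp
qed simp_all

text \<open>The coefficient of index i is multiplied by i and moves to index i - 1, where the weight
  is half as large; the total factor is i/2.\<close>

lemma pnorm_pderiv: "degree p \<le> n \<Longrightarrow> pnorm (pderiv p) \<le> real n / 2 * pnorm p"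
proof (induction p arbitrary: n)
  case (pCons a p)
  show ?case
  proof (cases "p = 0")
    case False
    then obtain k where n: "n = Suc k" and k: "degree p \<le> k" using pCons.prems by (cases n) auto
    have "pnorm (pderiv (pCons a p)) \<le> pnorm p + 2 * pnorm (pderiv p)"
      unfolding pderiv_pCons using pnorm_add[of p "pCons 0 (pderiv p)"] by simp
    also have "\<dots> \<le> pnorm p + 2 * (real k / 2 * pnorm p)"
      using pCons.IH[OF k] by simp
    also have "\<dots> \<le> real n / 2 * (\<bar>a\<bar> + 2 * pnorm p)"
      by (simp add: n field_simps)
    finally show ?thesis by simp
  qed (simp add: pderiv_pCons)
qed simp

lemma poly_bound: "degree p \<le> n \<Longrightarrow> \<bar>poly p t\<bar> \<le> pnorm p * (1 + \<bar>t\<bar>) ^ n"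
proof (induction p arbitrary: n)
  case (pCons a p)
  have M: "1 \<le> (1 + \<bar>t\<bar>) ^ n" by simp
  show ?case
  proof (cases "p = 0")
    case True
    then show ?thesis using mult_left_mono[OF M, of "\<bar>a\<bar>"] by simp
  next
    case False
    then obtain k where n: "n = Suc k" and k: "degree p \<le> k" using pCons.prems by (cases n) auto
    have "\<bar>poly (pCons a p) t\<bar> \<le> \<bar>a\<bar> + \<bar>t\<bar> * \<bar>poly p t\<bar>"
      using abs_triangle_ineq[of a "t * poly p t"] by (simp add: abs_mult)
    also have "\<dots> \<le> \<bar>a\<bar> * (1 + \<bar>t\<bar>) ^ n + (2 * (1 + \<bar>t\<bar>)) * (pnorm p * (1 + \<bar>t\<bar>) ^ k)"
      using M pCons.IH[OF k] by (intro add_mono mult_mono) (auto simp: pnorm_nonneg mult_left_mono[of 1, simplified] intro: order_trans[OF _ mult_left_mono[OF M, of "\<bar>a\<bar>"]])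
    also have "\<dots> = pnorm (pCons a p) * (1 + \<bar>t\<bar>) ^ n"
      by (simp add: n algebra_simps)
    finally show ?thesis .
  qed
qed simp

text \<open>The derivative of \<open>e\<^sup>c\<^sup>t p\<close> is \<open>e\<^sup>c\<^sup>t\<close> times this polynomial.\<close>
definition opd :: "real \<Rightarrow> real poly \<Rightarrow> real poly" where
  "opd c p = smult c p + pderiv p"

lemma opd_add: "opd c (p + q) = opd c p + opd c q"
  and opd_diff: "opd c (p - q) = opd c p - opd c q"
  and opd_minus: "opd c (- p) = - opd c p"
  and opd_0 [simp]: "opd c 0 = 0"
  and opd_commute: "opd c (opd d p) = opd d (opd c p)"
  by (simp_all add: opd_def pderiv_add pderiv_diff pderiv_minus pderiv_smult smult_add_right smult_diff_right algebra_simps)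

lemma opd_sum: "opd c (sum f S) = (\<Sum>i\<in>S. opd c (f i))"
  by (induction S rule: infinite_finite_induct) (simp_all add: opd_add)

lemma degree_opd: "degree p \<le> n \<Longrightarrow> degree (opd c p) \<le> n"
  unfolding opd_def by (intro degree_add_le order_trans[OF degree_smult_le]) (auto simp: degree_pderiv)

lemma degree_opd_eq:
  assumes "c \<noteq> 0"
  shows "degree p \<le> degree (opd c p)"
proof (cases "p = 0")
  case False
  have "coeff (pderiv p) (degree p) = 0"
    by (simp add: coeff_pderiv coeff_eq_0)
  then have "coeff (opd c p) (degree p) \<noteq> 0" using False assms by (simp add: opd_def)
  then show ?thesis by (rule le_degree)
qed simp

lemma opd_eq_0_iff: "c \<noteq> 0 \<Longrightarrow> opd c p = 0 \<longleftrightarrow> p = 0"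
proof
  assume c: "c \<noteq> 0" and z: "opd c p = 0"
  then have "degree p = 0" using degree_opd_eq[OF c, of p] by simp
  then obtain a where p: "p = [:a:]" by (rule degree_eq_zeroE)
  have "smult c [:a:] = 0" using z unfolding p opd_def by (simp add: pderiv_pCons)
  then show "p = 0" using c p by simp
qed simp

lemma opd_cancel: "c \<noteq> 0 \<Longrightarrow> opd c p = opd c q \<longleftrightarrow> p = q"
  using opd_eq_0_iff[of c "p - q"] by (simp add: opd_diff)

text \<open>If r solves the equation for the derivative of q, then (q - r)/c solves it for q.
  Unwound, this is the Neumann series in d/dt, finite on polynomials.\<close>

lemma opd_surj: "c \<noteq> 0 \<Longrightarrow> \<exists>p. opd c p = q"
proof (induction "degree q" arbitrary: q rule: less_induct)
  case less
  show ?case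
  proof (cases "degree q = 0")
    case True
    then obtain a where "q = [:a:]" by (rule degree_eq_zeroE)
    then have "opd c [:a / c:] = q" using less.prems by (simp add: opd_def pderiv_pCons)
    then show ?thesis by blast
  next
    case False
    then have "degree (pderiv q) < degree q" by (simp add: degree_pderiv)
    then obtain r where r: "opd c r = pderiv q" using less by blast
    have "opd c (smult (1 / c) (q - r)) = smult (1 / c) (opd c (q - r))"
      by (simp add: opd_def pderiv_smult smult_add_right)
    also have "opd c (q - r) = smult c q" by (simp add: opd_diff r) (simp add: opd_def)
    also have "smult (1 / c) (smult c q) = q" using less.prems by simp
    finally show ?thesis by blast
  qed
qed

definition iopd :: "real \<Rightarrow> real poly \<Rightarrow> real poly" where
  "iopd c q = (SOME p. opd c p = q)"

lemma opd_iopd: "c \<noteq> 0 \<Longrightarrow> opd c (iopd c q) = q"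
  unfolding iopd_def using opd_surj[of c q] by (rule someI_ex)

lemma degree_iopd: "c \<noteq> 0 \<Longrightarrow> degree q \<le> n \<Longrightarrow> degree (iopd c q) \<le> n"
  using degree_opd_eq[of c "iopd c q"] by (simp add: opd_iopd)

lemma pnorm_opd:
  assumes "degree p \<le> n" "c \<ge> 0"
  shows "pnorm (opd c p) \<le> (c + real n / 2) * pnorm p"
  using pnorm_add[of "smult c p" "pderiv p"] pnorm_pderiv[OF assms(1)] assms(2)
  by (simp add: opd_def pnorm_smult algebra_simps)

text \<open>The solution p satisfies c p = q - p' and has degree at most n, so the norm of p' is at
  most n/2 times that of p and can be absorbed on the left.\<close>

lemma pnorm_iopd:
  assumes d: "degree q \<le> n" and c: "c - real n / 2 \<ge> m" "m > 0"
  shows "m * pnorm (iopd c q) \<le> pnorm q"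
proof -
  let ?p = "iopd c q"
  have c0: "c > 0" using c by (smt (verit) divide_nonneg_nonneg of_nat_0_le_iff)
  have p: "smult c ?p = q - pderiv ?p" using opd_iopd[of c q] c0 by (simp add: opd_def eq_diff_eq)
  have "c * pnorm ?p = pnorm (smult c ?p)" using c0 by (simp add: pnorm_smult)
  also have "\<dots> \<le> pnorm q + pnorm (pderiv ?p)" unfolding p by (rule pnorm_diff)
  also have "\<dots> \<le> pnorm q + real n / 2 * pnorm ?p"
    using pnorm_pderiv[OF degree_iopd[OF _ d, of c]] c0 by simp
  finally have "(c - real n / 2) * pnorm ?p \<le> pnorm q" by (simp add: algebra_simps)
  then show ?thesis
    using mult_right_mono[OF c(1) pnorm_nonneg[of ?p]] by linarith
qed

section \<open>The recursion for the coefficient polynomials\<close>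

type_synonym coefs = "real poly \<times> real poly \<times> real poly \<times> real poly"

abbreviation cA :: "coefs \<Rightarrow> real poly" where "cA s \<equiv> fst s"
abbreviation cB :: "coefs \<Rightarrow> real poly" where "cB s \<equiv> fst (snd s)"
abbreviation cG :: "coefs \<Rightarrow> real poly" where "cG s \<equiv> fst (snd (snd s))"
abbreviation cP :: "coefs \<Rightarrow> real poly" where "cP s \<equiv> snd (snd (snd s))"

text \<open>The components of the advection term \<open>u\<^sub>m \<cdot> \<nabla>u\<^sub>k\<close>.\<close>
definition conv1 :: "(nat \<Rightarrow> coefs) \<Rightarrow> nat \<Rightarrow> nat \<Rightarrow> real poly" where
  "conv1 s m k = cA (s m) * cA (s k) - cB (s m) * cB (s k) + (cA (s m) - cG (s m)) * opd (2 * real k) (cA (s k)) - smult 2 (cG (s m) * cA (s k))"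

definition conv2 :: "(nat \<Rightarrow> coefs) \<Rightarrow> nat \<Rightarrow> nat \<Rightarrow> real poly" where
  "conv2 s m k = cA (s m) * cB (s k) + cB (s m) * cA (s k) + (cA (s m) - cG (s m)) * opd (2 * real k) (cB (s k)) - smult 2 (cG (s m) * cB (s k))"

definition conv3 :: "(nat \<Rightarrow> coefs) \<Rightarrow> nat \<Rightarrow> nat \<Rightarrow> real poly" where
  "conv3 s m k = (cA (s m) - cG (s m)) * opd (2 * real k) (cG (s k)) - cG (s m) * cG (s k)"

definition csum :: "(nat \<Rightarrow> nat \<Rightarrow> real poly) \<Rightarrow> nat \<Rightarrow> real poly" where
  "csum f n = (\<Sum>m=0..n. f m (n - m))"

text \<open>The recursion (A3); \<open>N\<close> is the power of \<open>\<rho>\<close> carried by the \<open>(n+1)\<close>-st coefficients.\<close>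
definition coef_rel :: "nat \<Rightarrow> (nat \<Rightarrow> coefs) \<Rightarrow> coefs \<Rightarrow> bool" where
  "coef_rel n s r \<longleftrightarrow> (let N = 2 * real n + 2 in
     opd N (opd N (cP r)) = - (opd N (opd (N + 1) (cP (s n))) + opd N (csum (conv1 s) n) - opd (N + 1) (csum (conv3 s) n)) \<and>
     opd N (opd (N + 2) (cA r)) = - opd N (opd (N + 1) (cA (s n))) + csum (conv1 s) n + opd N (cP r) \<and>
     opd N (opd (N + 2) (cB r)) = - opd N (opd (N + 1) (cB (s n))) + csum (conv2 s) n \<and>
     opd N (opd N (cG r)) = - opd (N - 1) (opd N (cG (s n))) + csum (conv3 s) n - opd N (cP (s n)))"

text \<open>The pressure polynomial is computed before the others because the new radial coefficient
  depends on it.\<close>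

definition coef_step :: "nat \<Rightarrow> (nat \<Rightarrow> coefs) \<Rightarrow> coefs" where
  "coef_step n s = (let N = 2 * real n + 2;
     P = iopd N (iopd N (- (opd N (opd (N + 1) (cP (s n))) + opd N (csum (conv1 s) n) - opd (N + 1) (csum (conv3 s) n)))) in
     (iopd (N + 2) (iopd N (- opd N (opd (N + 1) (cA (s n))) + csum (conv1 s) n + opd N P)),
      iopd (N + 2) (iopd N (- opd N (opd (N + 1) (cB (s n))) + csum (conv2 s) n)),
      iopd N (iopd N (- opd (N - 1) (opd N (cG (s n))) + csum (conv3 s) n - opd N (cP (s n)))), P))"

lemma coef_rel_step: "coef_rel n s (coef_step n s)"
proof -
  have "2 * real n + 2 \<noteq> 0" "2 * real n + 2 + 2 \<noteq> 0" by linarith+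
  then show ?thesis by (simp add: coef_rel_def coef_step_def Let_def opd_iopd)
qed

lemma coef_rel_unique: "coef_rel n s r \<Longrightarrow> coef_rel n s r' \<Longrightarrow> r = r'"
proof -
  assume r: "coef_rel n s r" "coef_rel n s r'"
  have nz: "2 * real n + 2 \<noteq> 0" "2 * real n + 2 + 2 \<noteq> 0" by linarith+
  have P: "cP r = cP r'" using r nz unfolding coef_rel_def Let_def by (metis opd_cancel)
  have "cA r = cA r'" "cB r = cB r'" "cG r = cG r'"
    using r nz P unfolding coef_rel_def Let_def by (metis opd_cancel)+
  with P show ?thesis by (simp add: prod_eq_iff)
qed

lemma csum_cong: "(\<And>m k. m \<le> n \<Longrightarrow> k \<le> n \<Longrightarrow> f m k = g m k) \<Longrightarrow> csum f n = csum g n"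
  unfolding csum_def by (rule sum.cong) auto

lemma coef_rel_cong: "(\<And>m. m \<le> n \<Longrightarrow> s m = s' m) \<Longrightarrow> coef_rel n s r = coef_rel n s' r"
proof -
  assume s: "\<And>m. m \<le> n \<Longrightarrow> s m = s' m"
  have "csum (conv1 s) n = csum (conv1 s') n" "csum (conv2 s) n = csum (conv2 s') n" "csum (conv3 s) n = csum (conv3 s') n"
    by (rule csum_cong, simp add: s conv1_def conv2_def conv3_def)+
  then show ?thesis by (simp add: coef_rel_def s)
qed

text \<open>The third entry is the solution of incompressibility,
  \<open>opd 2 \<alpha> = opd 1 \<gamma>\<close>, for the given first entry; this starts the
  induction in \<open>coef_div_free\<close>.\<close>

definition coef_init :: "real^4 \<Rightarrow> coefs" where
  "coef_init l = ([:par_brho l, par_c l / 2:], [:par_bphi l:], [:2 * par_brho l - par_c l / 2, par_c l:], [:par_d l, par_c l:])"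

text \<open>A step reads all earlier coefficients, so the recursion carries the whole history.
  Entries beyond the current index still hold \<open>coef_init l\<close> and are not read by the
  next step.\<close>

primrec coef_hist :: "real^4 \<Rightarrow> nat \<Rightarrow> nat \<Rightarrow> coefs" where
  "coef_hist l 0 = (\<lambda>_. coef_init l)"
| "coef_hist l (Suc n) = (coef_hist l n)(Suc n := coef_step n (coef_hist l n))"

definition cf :: "real^4 \<Rightarrow> nat \<Rightarrow> coefs" where
  "cf l n = coef_hist l n n"

lemma coef_hist_eq: "m \<le> n \<Longrightarrow> coef_hist l n m = cf l m"
proof (induction n)
  case (Suc n)
  then show ?case by (cases "m = Suc n") (auto simp: cf_def)
qed (simp add: cf_def)

lemma cf_0: "cf l 0 = coef_init l"
  by (simp add: cf_def)

lemma cf_Suc: "coef_rel n (cf l) (cf l (Suc n))"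
proof -
  have "coef_rel n (coef_hist l n) (cf l (Suc n))"
    by (simp add: cf_def coef_rel_step)
  then show ?thesis using coef_rel_cong[of n "coef_hist l n" "cf l"] coef_hist_eq[of _ n l] by blast
qed

section \<open>Degree and norm bounds for the coefficients\<close>

definition deg_le :: "nat \<Rightarrow> coefs \<Rightarrow> bool" where
  "deg_le n r \<longleftrightarrow> degree (cA r) \<le> n \<and> degree (cB r) \<le> n \<and> degree (cG r) \<le> n \<and> degree (cP r) \<le> n"

definition cnorm :: "coefs \<Rightarrow> real" where
  "cnorm r = pnorm (cA r) + pnorm (cB r) + pnorm (cG r) + pnorm (cP r)"

lemma cnorm_bounds: "pnorm (cA r) \<le> cnorm r" "pnorm (cB r) \<le> cnorm r" "pnorm (cG r) \<le> cnorm r" "pnorm (cP r) \<le> cnorm r"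
  "0 \<le> cnorm r" "pnorm (cA r - cG r) \<le> cnorm r"
  using pnorm_nonneg[of "cA r"] pnorm_nonneg[of "cB r"] pnorm_nonneg[of "cG r"] pnorm_nonneg[of "cP r"] pnorm_diff[of "cA r" "cG r"]
  unfolding cnorm_def by linarith+

lemma degree_conv:
  assumes "deg_le (m + 1) (s m)" "deg_le (k + 1) (s k)"
  shows "degree (conv1 s m k) \<le> m + k + 2" "degree (conv2 s m k) \<le> m + k + 2" "degree (conv3 s m k) \<le> m + k + 2"
proof -
  have m: "degree (p * q) \<le> m + k + 2" if "degree p \<le> m + 1" "degree q \<le> k + 1" for p q :: "real poly"
    using degree_mult_le[of p q] that by simp
  show "degree (conv1 s m k) \<le> m + k + 2" "degree (conv2 s m k) \<le> m + k + 2" "degree (conv3 s m k) \<le> m + k + 2"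
    using assms unfolding conv1_def conv2_def conv3_def deg_le_def
    by (auto intro!: degree_add_le degree_diff_le m[simplified] degree_opd order_trans[OF degree_smult_le])
qed

lemma degree_csum:
  assumes "\<And>m k. m \<le> n \<Longrightarrow> k \<le> n \<Longrightarrow> degree (f m k) \<le> m + k + 2"
  shows "degree (csum f n) \<le> n + 2"
  unfolding csum_def
proof (rule degree_sum_le)
  fix m assume "m \<in> {0..n}"
  then show "degree (f m (n - m)) \<le> n + 2" using assms[of m "n - m"] by simp
qed simp


text \<open>Products of terms m and n - m have degree at most (m + 1) + (n - m + 1) = n + 2. The
  operators \<open>opd c\<close> to be inverted have c > 0, hence there is no resonance and
  inversion does not raise the degree.\<close>

lemma deg_le_cf: "deg_le (n + 1) (cf l n)"
proof (induction n rule: less_induct)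
  case (less n)
  show ?case
  proof (cases n)
    case 0
    then show ?thesis by (simp add: cf_0 coef_init_def deg_le_def)
  next
    case (Suc k)
    have IH: "deg_le (m + 1) (cf l m)" if "m \<le> k" for m using less.IH that Suc by simp
    have c: "degree (csum (conv1 (cf l)) k) \<le> k + 2" "degree (csum (conv2 (cf l)) k) \<le> k + 2" "degree (csum (conv3 (cf l)) k) \<le> k + 2"
      by (rule degree_csum, rule degree_conv; simp add: IH[simplified])+
    have h: "degree (cA (cf l k)) \<le> k + 2" "degree (cB (cf l k)) \<le> k + 2" "degree (cG (cf l k)) \<le> k + 2" "degree (cP (cf l k)) \<le> k + 2"
      using IH[of k] by (simp_all add: deg_le_def)
    have nz: "2 * real k + 2 \<noteq> 0" "2 * real k + 2 + 2 \<noteq> 0" by linarith+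
    have cancel: "degree p \<le> k + 2" if "opd a (opd b p) = q" "a \<noteq> 0" "b \<noteq> 0" "degree q \<le> k + 2" for a b p q
      using degree_opd_eq[OF that(2), of "opd b p"] degree_opd_eq[OF that(3), of p] that(1,4) by simp
    note R = cf_Suc[of k l, unfolded coef_rel_def Let_def]
    have P: "degree (cP (cf l (Suc k))) \<le> k + 2"
      by (rule cancel[OF R[THEN conjunct1] nz(1) nz(1)]) (intro degree_add_le degree_diff_le degree_opd h c | simp only: degree_minus)+
    have "degree (cA (cf l (Suc k))) \<le> k + 2"
      by (rule cancel[OF R[THEN conjunct2, THEN conjunct1] nz]) (intro degree_add_le degree_diff_le degree_opd h c P | simp only: degree_minus)+
    moreover have "degree (cB (cf l (Suc k))) \<le> k + 2"
      by (rule cancel[OF R[THEN conjunct2, THEN conjunct2, THEN conjunct1] nz]) (intro degree_add_le degree_diff_le degree_opd h c P | simp only: degree_minus)+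
    moreover have "degree (cG (cf l (Suc k))) \<le> k + 2"
      by (rule cancel[OF R[THEN conjunct2, THEN conjunct2, THEN conjunct2] nz(1) nz(1)]) (intro degree_add_le degree_diff_le degree_opd h c P | simp only: degree_minus)+
    ultimately show ?thesis using P by (simp add: deg_le_def Suc)
  qed
qed

text \<open>One derivative costs at most 5 (n + 1) and the undifferentiated products together at
  most 4, which is where 9 (n + 1) comes from.\<close>

lemma pnorm_conv:
  assumes s: "deg_le (m + 1) (s m)" "deg_le (k + 1) (s k)" and n: "m + k = n"
  shows "pnorm (conv1 s m k) \<le> 9 * (real n + 1) * (cnorm (s m) * cnorm (s k))"
    "pnorm (conv2 s m k) \<le> 9 * (real n + 1) * (cnorm (s m) * cnorm (s k))"
    "pnorm (conv3 s m k) \<le> 9 * (real n + 1) * (cnorm (s m) * cnorm (s k))"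
proof -
  let ?S = "cnorm (s m) * cnorm (s k)"
  note b = cnorm_bounds[of "s m"] and b' = cnorm_bounds[of "s k"]
  have m: "pnorm (p * q) \<le> ?S" if "pnorm p \<le> cnorm (s m)" "pnorm q \<le> cnorm (s k)" for p q
    using pnorm_mult[of p q] mult_mono[OF that b(5) pnorm_nonneg] by linarith
  have mo: "pnorm (p * opd (2 * real k) q) \<le> 5 * (real n + 1) * ?S"
    if p: "pnorm p \<le> cnorm (s m)" and q: "pnorm q \<le> cnorm (s k)" "degree q \<le> k + 1" for p q
  proof -
    have "pnorm (opd (2 * real k) q) \<le> (2 * real k + real (k + 1) / 2) * pnorm q"
      by (rule pnorm_opd[OF q(2)]) simp
    also have "\<dots> \<le> (5 * (real n + 1)) * cnorm (s k)"
      using q(1) n by (intro mult_mono) (auto simp: pnorm_nonneg)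
    finally have "pnorm p * pnorm (opd (2 * real k) q) \<le> cnorm (s m) * ((5 * (real n + 1)) * cnorm (s k))"
      using p b(5) by (intro mult_mono) (auto simp: pnorm_nonneg)
    then show ?thesis using pnorm_mult[of p "opd (2 * real k) q"] by (simp add: algebra_simps)
  qed
  have S0: "0 \<le> ?S" using b(5) b'(5) by simp
  have d: "degree (cA (s k)) \<le> k + 1" "degree (cB (s k)) \<le> k + 1" "degree (cG (s k)) \<le> k + 1"
    using s(2) by (simp_all add: deg_le_def)
  have fin: "x \<le> 9 * (real n + 1) * ?S" if "x \<le> 4 * ?S + 5 * (real n + 1) * ?S" for x
  proof -
    have "4 * ?S \<le> 4 * (real n + 1) * ?S" using S0 by (intro mult_right_mono) auto
    then show ?thesis using that by (simp add: algebra_simps)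
  qed
  have sm: "pnorm (smult 2 p) = 2 * pnorm p" for p by (simp add: pnorm_smult)
  show "pnorm (conv1 s m k) \<le> 9 * (real n + 1) * ?S"
  proof (rule fin)
    show "pnorm (conv1 s m k) \<le> 4 * ?S + 5 * (real n + 1) * ?S"
      unfolding conv1_def
      using pnorm_diff[of "cA (s m) * cA (s k) - cB (s m) * cB (s k) + (cA (s m) - cG (s m)) * opd (2 * real k) (cA (s k))" "smult 2 (cG (s m) * cA (s k))"]
        pnorm_add[of "cA (s m) * cA (s k) - cB (s m) * cB (s k)" "(cA (s m) - cG (s m)) * opd (2 * real k) (cA (s k))"]
        pnorm_diff[of "cA (s m) * cA (s k)" "cB (s m) * cB (s k)"]
        m[OF b(1) b'(1)] m[OF b(2) b'(2)] mo[OF b(6) b'(1) d(1)] m[OF b(3) b'(1)] sm[of "cG (s m) * cA (s k)"]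
      by linarith
  qed
  show "pnorm (conv2 s m k) \<le> 9 * (real n + 1) * ?S"
  proof (rule fin)
    show "pnorm (conv2 s m k) \<le> 4 * ?S + 5 * (real n + 1) * ?S"
      unfolding conv2_def
      using pnorm_diff[of "cA (s m) * cB (s k) + cB (s m) * cA (s k) + (cA (s m) - cG (s m)) * opd (2 * real k) (cB (s k))" "smult 2 (cG (s m) * cB (s k))"]
        pnorm_add[of "cA (s m) * cB (s k) + cB (s m) * cA (s k)" "(cA (s m) - cG (s m)) * opd (2 * real k) (cB (s k))"]
        pnorm_add[of "cA (s m) * cB (s k)" "cB (s m) * cA (s k)"]
        m[OF b(1) b'(2)] m[OF b(2) b'(1)] mo[OF b(6) b'(2) d(2)] m[OF b(3) b'(2)] sm[of "cG (s m) * cB (s k)"]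
      by linarith
  qed
  show "pnorm (conv3 s m k) \<le> 9 * (real n + 1) * ?S"
  proof (rule fin)
    show "pnorm (conv3 s m k) \<le> 4 * ?S + 5 * (real n + 1) * ?S"
      unfolding conv3_def
      using pnorm_diff[of "(cA (s m) - cG (s m)) * opd (2 * real k) (cG (s k))" "cG (s m) * cG (s k)"]
        mo[OF b(6) b'(3) d(3)] m[OF b(3) b'(3)] S0
      by linarith
  qed
qed

lemma pnorm_csum:
  assumes "\<And>m k. m + k = n \<Longrightarrow> pnorm (f m k) \<le> C * (cnorm (s m) * cnorm (s k))"
  shows "pnorm (csum f n) \<le> C * (\<Sum>m=0..n. cnorm (s m) * cnorm (s (n - m)))"
  unfolding csum_def sum_distrib_left
  by (rule order_trans[OF pnorm_sum sum_mono]) (rule assms, simp)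

text \<open>With M = n + 1, the two operators on the left are each bounded below by M. On the right
  a derivative costs 5 M and a convolution 9 M, and no term has more than two such factors.
  Cancelling M^2 leaves a constant independent of n.\<close>

lemma cnorm_cf_Suc:
  "cnorm (cf l (Suc n)) \<le> 600 * (cnorm (cf l n) + (\<Sum>m=0..n. cnorm (cf l m) * cnorm (cf l (n - m))))"
proof -
  define M where "M = real n + 1"
  define A where "A = cnorm (cf l n)"
  define S where "S = (\<Sum>m=0..n. cnorm (cf l m) * cnorm (cf l (n - m)))"
  define f1 f2 f3 where "f1 = csum (conv1 (cf l)) n" and "f2 = csum (conv2 (cf l)) n" and "f3 = csum (conv3 (cf l)) n"
  have M: "M \<ge> 1" by (simp add: M_def)
  have dcf: "deg_le (m + 1) (cf l m)" for m by (rule deg_le_cf)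
  have A0: "A \<ge> 0" and S0: "S \<ge> 0"
    unfolding A_def S_def by (auto intro!: sum_nonneg simp: cnorm_bounds)
  have f: "pnorm f1 \<le> 9 * M * S" "pnorm f2 \<le> 9 * M * S" "pnorm f3 \<le> 9 * M * S"
    unfolding f1_def f2_def f3_def S_def M_def by (rule pnorm_csum, rule pnorm_conv[OF dcf dcf]; assumption)+
  have df: "degree f1 \<le> n + 2" "degree f2 \<le> n + 2" "degree f3 \<le> n + 2"
    unfolding f1_def f2_def f3_def by (rule degree_csum, rule degree_conv[OF dcf dcf])+
  have dn: "degree (cA (cf l n)) \<le> n + 2" "degree (cB (cf l n)) \<le> n + 2" "degree (cG (cf l n)) \<le> n + 2" "degree (cP (cf l n)) \<le> n + 2"
    using dcf[of n] by (simp_all add: deg_le_def)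
  have dS: "degree (cA (cf l (Suc n))) \<le> n + 2" "degree (cB (cf l (Suc n))) \<le> n + 2" "degree (cG (cf l (Suc n))) \<le> n + 2" "degree (cP (cf l (Suc n))) \<le> n + 2"
    using dcf[of "Suc n"] by (simp_all add: deg_le_def)
  have An: "pnorm (cA (cf l n)) \<le> A" "pnorm (cB (cf l n)) \<le> A" "pnorm (cG (cf l n)) \<le> A" "pnorm (cP (cf l n)) \<le> A"
    unfolding A_def by (rule cnorm_bounds)+
  have up: "pnorm (opd c p) \<le> 5 * M * x" if "degree p \<le> n + 2" "0 \<le> c" "c \<le> 2 * real n + 4" "pnorm p \<le> x" for c p x
  proof -
    have "pnorm (opd c p) \<le> (c + real (n + 2) / 2) * pnorm p" by (rule pnorm_opd[OF that(1,2)])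
    also have "\<dots> \<le> (5 * M) * x"
    proof (rule mult_mono)
      have "c + real (n + 2) / 2 \<le> (2 * real n + 4) + real (n + 2) / 2" using that(3) by simp
      also have "\<dots> \<le> 5 * M" by (simp add: M_def field_simps)
      finally show "c + real (n + 2) / 2 \<le> 5 * M" .
    qed (use that M in \<open>auto simp: pnorm_nonneg\<close>)
    finally show ?thesis .
  qed
  have up2: "pnorm (opd c (opd d p)) \<le> 25 * M * M * x" if "degree p \<le> n + 2" "0 \<le> c" "c \<le> 2 * real n + 4" "0 \<le> d" "d \<le> 2 * real n + 4" "pnorm p \<le> x" for c d p x
    using up[OF degree_opd[OF that(1)] that(2,3) up[OF that(1,4,5,6)]] by (simp add: algebra_simps)
  \<comment> \<open>On degree at most n + 2 the lower bound for \<open>opd e\<close> is e - (n +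
    2)/2, which is at least n + 1 when e \<ge> 2 n + 2.\<close>
  have down: "M * M * pnorm p \<le> pnorm (opd c (opd d p))" if "degree p \<le> n + 2" "2 * real n + 2 \<le> c" "2 * real n + 2 \<le> d" for c d p
  proof -
    have 1: "M * pnorm q \<le> pnorm (opd e q)" if "degree q \<le> n + 2" "2 * real n + 2 \<le> e" for e q
    proof -
      have e: "e \<noteq> 0" using that by linarith
      have "iopd e (opd e q) = q" using opd_iopd[OF e, of "opd e q"] opd_cancel[OF e] by simp
      moreover have "M * pnorm (iopd e (opd e q)) \<le> pnorm (opd e q)"
        by (rule pnorm_iopd[OF degree_opd[OF that(1)]]) (use that in \<open>auto simp: M_def field_simps\<close>)
      ultimately show ?thesis by simp
    qed
    have "M * (M * pnorm p) \<le> M * pnorm (opd d p)" using 1[OF that(1,3)] M by (intro mult_left_mono) auto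
    also have "\<dots> \<le> pnorm (opd c (opd d p))" by (rule 1[OF degree_opd[OF that(1)] that(2)])
    finally show ?thesis by (simp add: mult.assoc)
  qed
  define N where "N = 2 * real n + 2"
  have N: "0 \<le> N" "N \<le> 2 * real n + 4" "0 \<le> N + 1" "N + 1 \<le> 2 * real n + 4" "0 \<le> N - 1" "N - 1 \<le> 2 * real n + 4"
    "2 * real n + 2 \<le> N" "2 * real n + 2 \<le> N + 2" by (simp_all add: N_def)
  note R = cf_Suc[of n l, unfolded coef_rel_def Let_def, folded N_def f1_def f2_def f3_def]
  have MM: "x \<le> y" if "M * M * x \<le> M * M * y" for x y
    using that M by simp
  have MS: "9 * M * S \<le> M * M * (9 * S)"
    using mult_right_mono[of 1 M "9 * M * S"] M S0 by (simp add: algebra_simps)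
  have P: "pnorm (cP (cf l (Suc n))) \<le> 25 * A + 90 * S"
  proof (rule MM)
    have "M * M * pnorm (cP (cf l (Suc n))) \<le> pnorm (opd N (opd N (cP (cf l (Suc n)))))"
      by (rule down[OF dS(4) N(7,7)])
    also have "\<dots> \<le> pnorm (opd N (opd (N + 1) (cP (cf l n)))) + pnorm (opd N f1) + pnorm (opd (N + 1) f3)"
      unfolding R[THEN conjunct1] pnorm_minus
      by (rule order_trans[OF pnorm_diff]) (simp add: pnorm_add)
    also have "\<dots> \<le> 25 * M * M * A + 5 * M * (9 * M * S) + 5 * M * (9 * M * S)"
      by (intro add_mono up2[OF dn(4) N(1,2,3,4) An(4)] up[OF df(1) N(1,2) f(1)] up[OF df(3) N(3,4) f(3)])
    also have "\<dots> = M * M * (25 * A + 90 * S)" by (simp add: algebra_simps)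
    finally show "M * M * pnorm (cP (cf l (Suc n))) \<le> M * M * (25 * A + 90 * S)" .
  qed
  have a: "pnorm (cA (cf l (Suc n))) \<le> 150 * A + 459 * S"
  proof (rule MM)
    have "M * M * pnorm (cA (cf l (Suc n))) \<le> pnorm (opd N (opd (N + 2) (cA (cf l (Suc n)))))"
      by (rule down[OF dS(1) N(7,8)])
    also have "\<dots> \<le> pnorm (opd N (opd (N + 1) (cA (cf l n)))) + pnorm f1 + pnorm (opd N (cP (cf l (Suc n))))"
      unfolding R[THEN conjunct2, THEN conjunct1]
      using pnorm_add[of "- opd N (opd (N + 1) (cA (cf l n))) + f1" "opd N (cP (cf l (Suc n)))"]
        pnorm_add[of "- opd N (opd (N + 1) (cA (cf l n)))" f1] by (simp add: pnorm_minus)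
    also have "\<dots> \<le> 25 * M * M * A + M * M * (9 * S) + 5 * M * (25 * A + 90 * S)"
      by (intro add_mono up2[OF dn(1) N(1,2,3,4) An(1)] order_trans[OF f(1) MS] up[OF dS(4) N(1,2) P])
    also have "5 * M * (25 * A + 90 * S) \<le> M * M * (125 * A + 450 * S)"
      using mult_right_mono[of 1 M "M * (125 * A + 450 * S)"] M S0 A0 by (simp add: algebra_simps)
    also have "25 * M * M * A + M * M * (9 * S) + M * M * (125 * A + 450 * S) = M * M * (150 * A + 459 * S)"
      by (simp add: algebra_simps)
    finally show "M * M * pnorm (cA (cf l (Suc n))) \<le> M * M * (150 * A + 459 * S)" by simp
  qed
  have b: "pnorm (cB (cf l (Suc n))) \<le> 25 * A + 9 * S"
  proof (rule MM)
    have "M * M * pnorm (cB (cf l (Suc n))) \<le> pnorm (opd N (opd (N + 2) (cB (cf l (Suc n)))))"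
      by (rule down[OF dS(2) N(7,8)])
    also have "\<dots> \<le> pnorm (opd N (opd (N + 1) (cB (cf l n)))) + pnorm f2"
      unfolding R[THEN conjunct2, THEN conjunct2, THEN conjunct1]
      using pnorm_add[of "- opd N (opd (N + 1) (cB (cf l n)))" f2] by (simp add: pnorm_minus)
    also have "\<dots> \<le> 25 * M * M * A + M * M * (9 * S)"
      by (intro add_mono up2[OF dn(2) N(1,2,3,4) An(2)] order_trans[OF f(2) MS])
    also have "\<dots> = M * M * (25 * A + 9 * S)" by (simp add: algebra_simps)
    finally show "M * M * pnorm (cB (cf l (Suc n))) \<le> M * M * (25 * A + 9 * S)" .
  qed
  have g: "pnorm (cG (cf l (Suc n))) \<le> 30 * A + 9 * S"
  proof (rule MM)
    have "M * M * pnorm (cG (cf l (Suc n))) \<le> pnorm (opd N (opd N (cG (cf l (Suc n)))))"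
      by (rule down[OF dS(3) N(7,7)])
    also have "\<dots> \<le> pnorm (opd (N - 1) (opd N (cG (cf l n)))) + pnorm f3 + pnorm (opd N (cP (cf l n)))"
      unfolding R[THEN conjunct2, THEN conjunct2, THEN conjunct2]
      using pnorm_diff[of "- opd (N - 1) (opd N (cG (cf l n))) + f3" "opd N (cP (cf l n))"]
        pnorm_add[of "- opd (N - 1) (opd N (cG (cf l n)))" f3] by (simp add: pnorm_minus)
    also have "\<dots> \<le> 25 * M * M * A + M * M * (9 * S) + 5 * M * A"
      by (intro add_mono up2[OF dn(3) N(5,6,1,2) An(3)] order_trans[OF f(3) MS] up[OF dn(4) N(1,2) An(4)])
    also have "5 * M * A \<le> M * M * (5 * A)"
      using mult_right_mono[of 1 M "M * (5 * A)"] M A0 by (simp add: algebra_simps)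
    also have "25 * M * M * A + M * M * (9 * S) + M * M * (5 * A) = M * M * (30 * A + 9 * S)" by (simp add: algebra_simps)
    finally show "M * M * pnorm (cG (cf l (Suc n))) \<le> M * M * (30 * A + 9 * S)" by simp
  qed
  \<comment> \<open>The four bounds add up to 230 A + 567 S.\<close>
  show ?thesis
    using a b g P A0 S0 unfolding cnorm_def[of "cf l (Suc n)"] A_def[symmetric] S_def[symmetric] by simp
qed

lemma sum_inverse_squares: "(\<Sum>m=0..n. 1 / (real m + 1)\<^sup>2) \<le> 2 - 1 / (real n + 1)"
proof (induction n)
  case (Suc n)
  have "1 / (real n + 2)\<^sup>2 \<le> 1 / (real n + 1) - 1 / (real n + 2)"
    by (simp add: divide_simps power2_eq_square)
  with Suc show ?case by (simp add: algebra_simps)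
qed simp

text \<open>For x + y = n + 2, the inequality (x + y)^2 \<le> 2 (x^2 + y^2) bounds 1/(x^2 y^2) by
  2/(n + 2)^2 times 1/x^2 + 1/y^2. Each of the two sums of inverse squares is at most 2, which gives
  8.\<close>

lemma conv_inverse_squares:
  "(\<Sum>m=0..n. 1 / (real m + 1)\<^sup>2 * (1 / (real (n - m) + 1)\<^sup>2)) \<le> 8 / (real n + 2)\<^sup>2"
proof -
  have t: "1 / (real m + 1)\<^sup>2 * (1 / (real (n - m) + 1)\<^sup>2) \<le> 2 / (real n + 2)\<^sup>2 * (1 / (real m + 1)\<^sup>2 + 1 / (real (n - m) + 1)\<^sup>2)"
    if "m \<in> {0..n}" for m
  proof -
    define x y where "x = real m + 1" and "y = real (n - m) + 1"
    have xy: "x > 0" "y > 0" "x + y = real n + 2" using that by (auto simp: x_def y_def of_nat_diff)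
    have "(x + y)\<^sup>2 \<le> 2 * (x\<^sup>2 + y\<^sup>2)" using zero_le_power2[of "x - y"] by (simp add: power2_eq_square algebra_simps)
    then have "1 / x\<^sup>2 * (1 / y\<^sup>2) \<le> 2 / (x + y)\<^sup>2 * (1 / x\<^sup>2 + 1 / y\<^sup>2)"
      using xy by (simp add: divide_simps)
    then show ?thesis unfolding xy(3) unfolding x_def y_def .
  qed
  have r: "(\<Sum>m=0..n. 1 / (real (n - m) + 1)\<^sup>2) = (\<Sum>m=0..n. 1 / (real m + 1)\<^sup>2)"
    using sum.nat_diff_reindex[of "\<lambda>m. 1 / (real m + 1)\<^sup>2" "Suc n"] by (simp add: atLeast0AtMost lessThan_Suc_atMost)
  have "(\<Sum>m=0..n. 1 / (real m + 1)\<^sup>2 * (1 / (real (n - m) + 1)\<^sup>2)) \<le>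
     2 / (real n + 2)\<^sup>2 * ((\<Sum>m=0..n. 1 / (real m + 1)\<^sup>2) + (\<Sum>m=0..n. 1 / (real (n - m) + 1)\<^sup>2))"
    unfolding sum.distrib[symmetric] sum_distrib_left by (rule sum_mono) (rule t)
  also have "\<dots> \<le> 2 / (real n + 2)\<^sup>2 * (2 + 2)"
    unfolding r using sum_inverse_squares[of n] by (intro mult_left_mono add_mono) (auto intro: order_trans)
  finally show ?thesis by simp
qed

lemma cnorm_cf_bound:
  assumes L: "cnorm (cf l 0) \<le> L"
  shows "cnorm (cf l n) \<le> L * (600 * (4 + 8 * L)) ^ n"
proof -
  define B where "B = 600 * (4 + 8 * L)"
  have L0: "L \<ge> 0" using L cnorm_bounds(5)[of "cf l 0"] by linarith
  have B0: "B \<ge> 0" using L0 by (simp add: B_def)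
  \<comment> \<open>The extra factor \<open>1 / (n + 1)\<^sup>2\<close> is reproduced by the convolution, so that the induction closes.\<close>
  have "cnorm (cf l n) \<le> L * B ^ n * (1 / (real n + 1)\<^sup>2)"
  proof (induction n rule: less_induct)
    case (less n)
    show ?case
    proof (cases n)
      case 0
      then show ?thesis using L by simp
    next
      case (Suc k)
      have IH: "cnorm (cf l m) \<le> L * B ^ m * (1 / (real m + 1)\<^sup>2)" if "m \<le> k" for m
        using less.IH that Suc by simp
      have "(\<Sum>m=0..k. cnorm (cf l m) * cnorm (cf l (k - m))) \<le>
          (\<Sum>m=0..k. (L * B ^ m * (1 / (real m + 1)\<^sup>2)) * (L * B ^ (k - m) * (1 / (real (k - m) + 1)\<^sup>2)))"
        using L0 B0 by (intro sum_mono mult_mono IH) (auto simp: cnorm_bounds)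
      also have "\<dots> = (\<Sum>m=0..k. L * L * B ^ k * (1 / (real m + 1)\<^sup>2 * (1 / (real (k - m) + 1)\<^sup>2)))"
      proof (rule sum.cong)
        fix m assume "m \<in> {0..k}"
        then have "B ^ k = B ^ m * B ^ (k - m)" by (simp add: power_add[symmetric])
        then show "(L * B ^ m * (1 / (real m + 1)\<^sup>2)) * (L * B ^ (k - m) * (1 / (real (k - m) + 1)\<^sup>2))
          = L * L * B ^ k * (1 / (real m + 1)\<^sup>2 * (1 / (real (k - m) + 1)\<^sup>2))" by simp
      qed simp
      also have "\<dots> \<le> L * L * B ^ k * (8 / (real k + 2)\<^sup>2)"
        unfolding sum_distrib_left[symmetric] using L0 B0 by (intro mult_left_mono conv_inverse_squares) auto
      finally have c: "(\<Sum>m=0..k. cnorm (cf l m) * cnorm (cf l (k - m))) \<le> L * L * B ^ k * (8 / (real k + 2)\<^sup>2)" .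
      have "1 / (real k + 1)\<^sup>2 \<le> 4 / (real k + 2)\<^sup>2"
        by (simp add: divide_simps power2_eq_square) (simp add: algebra_simps)
      then have i: "L * B ^ k * (1 / (real k + 1)\<^sup>2) \<le> L * B ^ k * (4 / (real k + 2)\<^sup>2)"
        using L0 B0 by (intro mult_left_mono) auto
      \<comment> \<open>The summands of B are used up here: 4 bounds ((k + 2)/(k + 1))^2 in the
        linear term, and 8 L comes from the convolution.\<close>
      have "cnorm (cf l (Suc k)) \<le> 600 * (L * B ^ k * (4 / (real k + 2)\<^sup>2) + L * L * B ^ k * (8 / (real k + 2)\<^sup>2))"
        by (intro order_trans[OF cnorm_cf_Suc] mult_left_mono add_mono order_trans[OF IH[OF order_refl] i] c) simp
      also have "\<dots> = L * B ^ Suc k * (1 / (real k + 2)\<^sup>2)"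
        by (simp add: B_def algebra_simps add_divide_distrib)
      finally show ?thesis by (simp add: Suc add.commute)
    qed
  qed
  also have "\<dots> \<le> L * B ^ n * 1" using L0 B0 by (intro mult_left_mono) auto
  finally show ?thesis by (simp add: B_def)
qed

section \<open>The formal expansion\<close>

text \<open>In terms of \<rho> this is \<rho>^(2n) times a polynomial in ln \<rho>, the profile of a
  term of index n.\<close>

definition ef :: "nat \<Rightarrow> real poly \<Rightarrow> real \<Rightarrow> real" where
  "ef n p t = exp (2 * real n * t) * poly p t"

lemma D1_ef: "D1 I (ef n p) (ef n (opd (2 * real n) p))"
  unfolding D1_def ef_def[abs_def] by (auto intro!: derivative_eq_intros poly_DERIV simp: opd_def algebra_simps)

lemma ef_add: "ef n p t + ef n q t = ef n (p + q) t"
  and ef_diff: "ef n p t - ef n q t = ef n (p - q) t"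
  and ef_minus: "- ef n p t = ef n (- p) t"
  and ef_smult: "c * ef n p t = ef n (smult c p) t"
  and ef_mult: "ef m p t * ef k q t = ef (m + k) (p * q) t"
  by (simp_all add: ef_def algebra_simps exp_add[symmetric])

lemma ef_sum: "(\<Sum>m\<in>M. ef n (f m) t) = ef n (\<Sum>m\<in>M. f m) t"
  by (simp add: ef_def poly_sum sum_distrib_left)

text \<open>The factor \<open>exp (-2*t)\<close> in front of the horizontal second derivatives
  lowers the index by one. This is why the recursion determines term n + 1 from the terms up to
  n.\<close>

lemma ef_Suc: "exp (-2*t) * ef (Suc n) p t = ef n p t"
proof -
  have "exp (-2*t) * exp (2 * real (Suc n) * t) = exp (2 * real n * t)"
    unfolding mult_exp_exp by (simp add: algebra_simps)
  then show ?thesis by (simp only: ef_def mult.assoc[symmetric])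
qed

lemma ef_eq_iff: "(\<forall>t. ef n p t = ef n q t) \<longleftrightarrow> p = q"
  by (simp add: ef_def) (metis poly_eq_poly_eq_iff ext)

definition uf :: "nat \<Rightarrow> coefs \<Rightarrow> real^3 \<Rightarrow> real^3" where
  "uf n r = VF 1 (ef n (cA r)) (ef n (cB r)) (ef n (cG r))"

definition pf :: "nat \<Rightarrow> coefs \<Rightarrow> real^3 \<Rightarrow> real" where
  "pf n r = SF 2 (ef n (cP r))"

section \<open>The recursion as an identity between coefficients\<close>

lemma recursion_eqs_cong:
  assumes u: "\<And>m x. m \<le> n \<Longrightarrow> x \<in> phalf \<Longrightarrow> u m x = u' m x" and p: "\<And>x. x \<in> phalf \<Longrightarrow> p n x = p' n x"
  shows "recursion_eqs n u p v q \<longleftrightarrow> recursion_eqs n u' p' v q"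
proof -
  note S = open_phalf
  have adv: "advect (u m) (\<lambda>y. u (n - m) y $ i) x = advect (u' m) (\<lambda>y. u' (n - m) y $ i) x" if "m \<le> n" "x \<in> phalf" for m i x
    by (rule advect_cong_open[OF S that(2)]) (use that u in auto)
  have div: "divergence (advect (u m) (u (n - m))) x = divergence (advect (u' m) (u' (n - m))) x" if "m \<le> n" "x \<in> phalf" for m x
    by (rule divergence_cong_open[OF S that(2)], rule advect_cong_open[OF S]) (use that u in auto)
  have p33: "partial 3 (partial 3 (p n)) x = partial 3 (partial 3 (p' n)) x" if "x \<in> phalf" for x
    by (rule partial_partial_cong_open[OF S that p])
  have p3: "partial 3 (p n) x = partial 3 (p' n) x" if "x \<in> phalf" for x
    by (rule partial_cong_open[OF S that p])
  have u33: "partial 3 (partial 3 (\<lambda>y. u n y $ i)) x = partial 3 (partial 3 (\<lambda>y. u' n y $ i)) x" if "x \<in> phalf" for x i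
    by (rule partial_partial_cong_open[OF S that]) (simp add: u)
  show ?thesis
    unfolding recursion_eqs_def by (intro ball_cong refl) (simp add: adv div p33 p3 u33)
qed

lemma ef_conv:
  "ef (m + k) (conv1 s m k) t = ef m (cA (s m)) t * ef k (cA (s k)) t - ef m (cB (s m)) t * ef k (cB (s k)) t
     + (ef m (cA (s m)) t - ef m (cG (s m)) t) * ef k (opd (2 * real k) (cA (s k))) t - 2 * ef m (cG (s m)) t * ef k (cA (s k)) t"
  "ef (m + k) (conv2 s m k) t = ef m (cA (s m)) t * ef k (cB (s k)) t + ef m (cB (s m)) t * ef k (cA (s k)) t
     + (ef m (cA (s m)) t - ef m (cG (s m)) t) * ef k (opd (2 * real k) (cB (s k))) t - 2 * ef m (cG (s m)) t * ef k (cB (s k)) t"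
  "ef (m + k) (conv3 s m k) t = (ef m (cA (s m)) t - ef m (cG (s m)) t) * ef k (opd (2 * real k) (cG (s k))) t - ef m (cG (s m)) t * ef k (cG (s k)) t"
  by (simp only: conv1_def conv2_def conv3_def ef_add ef_diff ef_mult ef_smult[of 2] mult.assoc, simp?)+

text \<open>All terms share the factor e^(2nt) once \<open>ef_Suc\<close> is applied, and d/dt acts
  on the coefficients of index n as \<open>opd (2 * n)\<close>. The sums keep
  \<open>m + (n - m)\<close> unsimplified, the form in which \<open>ef_conv\<close> and the
  derivative rule produce it.\<close>

lemma coef_rel_iff_ode:
  "coef_rel n s r \<longleftrightarrow> (\<forall>t.
     - (exp (-2*t) * ef (Suc n) (opd (2 * real (Suc n)) (opd (2 * real (Suc n)) (cP r))) t) =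
       ef n (opd (2 * real n) (opd (2 * real n) (cP (s n)))) t + 5 * ef n (opd (2 * real n) (cP (s n))) t + 6 * ef n (cP (s n)) t
       + (\<Sum>m=0..n. 2 * ef (m + (n - m)) (conv1 s m (n - m)) t
           + ef (m + (n - m)) (opd (2 * real (m + (n - m))) (conv1 s m (n - m))) t
           - ef (m + (n - m)) (opd (2 * real (m + (n - m))) (conv3 s m (n - m))) t
           - 3 * ef (m + (n - m)) (conv3 s m (n - m)) t) \<and>
     exp (-2*t) * (ef (Suc n) (opd (2 * real (Suc n)) (opd (2 * real (Suc n)) (cA r))) t + 2 * ef (Suc n) (opd (2 * real (Suc n)) (cA r)) t) =
       - (ef n (opd (2 * real n) (opd (2 * real n) (cA (s n)))) t + 5 * ef n (opd (2 * real n) (cA (s n))) t + 6 * ef n (cA (s n)) t)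
       + (\<Sum>m=0..n. ef (m + (n - m)) (conv1 s m (n - m)) t) + exp (-2*t) * ef (Suc n) (opd (2 * real (Suc n)) (cP r)) t \<and>
     exp (-2*t) * (ef (Suc n) (opd (2 * real (Suc n)) (opd (2 * real (Suc n)) (cB r))) t + 2 * ef (Suc n) (opd (2 * real (Suc n)) (cB r)) t) =
       - (ef n (opd (2 * real n) (opd (2 * real n) (cB (s n)))) t + 5 * ef n (opd (2 * real n) (cB (s n))) t + 6 * ef n (cB (s n)) t)
       + (\<Sum>m=0..n. ef (m + (n - m)) (conv2 s m (n - m)) t) \<and>
     exp (-2*t) * ef (Suc n) (opd (2 * real (Suc n)) (opd (2 * real (Suc n)) (cG r))) t =
       - (ef n (opd (2 * real n) (opd (2 * real n) (cG (s n)))) t + 3 * ef n (opd (2 * real n) (cG (s n))) t + 2 * ef n (cG (s n)) t)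
       + (\<Sum>m=0..n. ef (m + (n - m)) (conv3 s m (n - m)) t) - (2 * ef n (cP (s n)) t + ef n (opd (2 * real n) (cP (s n))) t))"
proof -
  define N where "N = 2 * real n + 2"
  have SN: "2 * real (Suc n) = N" by (simp add: N_def)
  have sm: "(\<Sum>m=0..n. ef (m + (n - m)) (f m) t) = ef n (\<Sum>m=0..n. f m) t" for f t
    unfolding ef_sum[symmetric] by (rule sum.cong) auto
  \<comment> \<open>Adding a constant to d/dt shifts the index of \<open>opd\<close>, and the
    second-order operators factor: D^2 + 5 D + 6 = (D + 2)(D + 3), D^2 + 3 D + 2 = (D + 1)(D + 2),
    D^2 + 2 D = D (D + 2).\<close>
  have op2: "smult 2 p + opd N p = opd (N + 2) p" "smult 3 p + opd (2 * real n) p = opd (N + 1) p" "smult 2 p + opd (2 * real n) p = opd N p"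
    "opd (2 * real n) (opd (2 * real n) p) + smult 5 (opd (2 * real n) p) + smult 6 p = opd N (opd (N + 1) p)"
    "opd (2 * real n) (opd (2 * real n) p) + smult 3 (opd (2 * real n) p) + smult 2 p = opd (N - 1) (opd N p)"
    "opd N (opd N p) + smult 2 (opd N p) = opd N (opd (N + 2) p)" for p
    unfolding opd_def N_def by (rule poly_eqI; simp add: coeff_pderiv pderiv_add pderiv_smult algebra_simps)+
  have sd: "(\<Sum>m=0..n. 2 * ef (m + (n - m)) (conv1 s m (n - m)) t + ef (m + (n - m)) (opd (2 * real (m + (n - m))) (conv1 s m (n - m))) t - ef (m + (n - m)) (opd (2 * real (m + (n - m))) (conv3 s m (n - m))) t - 3 * ef (m + (n - m)) (conv3 s m (n - m)) t) = ef n (opd N (csum (conv1 s) n) - opd (N + 1) (csum (conv3 s) n)) t" for t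
  proof -
    have "(\<Sum>m=0..n. 2 * ef (m + (n - m)) (conv1 s m (n - m)) t + ef (m + (n - m)) (opd (2 * real (m + (n - m))) (conv1 s m (n - m))) t - ef (m + (n - m)) (opd (2 * real (m + (n - m))) (conv3 s m (n - m))) t - 3 * ef (m + (n - m)) (conv3 s m (n - m)) t) = (\<Sum>m=0..n. ef n (opd N (conv1 s m (n-m)) - opd (N + 1) (conv3 s m (n-m))) t)"
    proof (rule sum.cong)
      fix m assume "m \<in> {0..n}"
      then have m: "m + (n - m) = n" by simp
      show "2 * ef (m + (n - m)) (conv1 s m (n - m)) t + ef (m + (n - m)) (opd (2 * real (m + (n - m))) (conv1 s m (n - m))) t - ef (m + (n - m)) (opd (2 * real (m + (n - m))) (conv3 s m (n - m))) t - 3 * ef (m + (n - m)) (conv3 s m (n - m)) t = ef n (opd N (conv1 s m (n-m)) - opd (N + 1) (conv3 s m (n-m))) t"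
        unfolding m op2(3)[symmetric] op2(2)[symmetric] by (simp only: ef_diff[symmetric] ef_add[symmetric] ef_smult[symmetric])
    qed simp
    also have "\<dots> = ef n (opd N (csum (conv1 s) n) - opd (N + 1) (csum (conv3 s) n)) t"
      unfolding ef_sum by (simp add: sum_subtractf opd_sum[symmetric] csum_def)
    finally show ?thesis .
  qed
  have e1: "exp (-2*t) * ef (Suc n) p t = ef n p t" for p t by (rule ef_Suc)
  show ?thesis
    unfolding SN coef_rel_def Let_def N_def[symmetric] all_conj_distrib
    unfolding sd distrib_left mult.left_commute[of "exp (-2*t)" 2 for t :: real] e1 sm
    unfolding ef_smult[of 2] ef_smult[of 3] ef_smult[of 5] ef_smult[of 6] ef_add ef_minus ef_diff op2 ef_eq_iff csum_def[symmetric]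
    by (auto simp: algebra_simps)
qed


lemma recursion_eqs_iff_coef_rel:
  assumes v: "\<And>x. x \<in> phalf \<Longrightarrow> v x = uf (Suc n) r x" "\<And>x. x \<in> phalf \<Longrightarrow> q x = pf (Suc n) r x"
  shows "recursion_eqs n (\<lambda>m. uf m (s m)) (\<lambda>m. pf m (s m)) v q \<longleftrightarrow> coef_rel n s r"
proof -
  let ?o = "\<lambda>n p. opd (2 * real n) p"
  show ?thesis
    unfolding coef_rel_iff_ode
    by (rule recursion_eqs_iff_ode[where \<alpha>="\<lambda>m. ef m (cA (s m))" and ?\<alpha>1.0="\<lambda>m. ef m (?o m (cA (s m)))" and ?\<alpha>2.0="\<lambda>m. ef m (?o m (?o m (cA (s m))))"
       and \<beta>="\<lambda>m. ef m (cB (s m))" and ?\<beta>1.0="\<lambda>m. ef m (?o m (cB (s m)))" and ?\<beta>2.0="\<lambda>m. ef m (?o m (?o m (cB (s m))))"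
       and \<gamma>="\<lambda>m. ef m (cG (s m))" and ?\<gamma>1.0="\<lambda>m. ef m (?o m (cG (s m)))" and ?\<gamma>2.0="\<lambda>m. ef m (?o m (?o m (cG (s m))))",
       OF D1_ef D1_ef D1_ef D1_ef D1_ef D1_ef D1_ef D1_ef D1_ef D1_ef D1_ef D1_ef D1_ef D1_ef D1_ef D1_ef ext[OF ef_conv(1)] ext[OF ef_conv(2)] ext[OF ef_conv(3)] D1_ef D1_ef[of _ _ "conv2 s _ _"] D1_ef])
      (simp_all add: v uf_def pf_def)
qed

text \<open>Incompressibility is not part of the recursion. Taking the divergence of the recursion shows that
  \<open>\<Delta>'\<close> annihilates \<open>div u\<^sub>n\<^sub>+\<^sub>1\<close>, and \<open>\<Delta>'\<close> is injective on terms of positive order in \<open>\<rho>\<close>.\<close>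
lemma coef_div_free: "opd (2 * real n + 2) (cA (cf l n)) = opd (2 * real n + 1) (cG (cf l n))"
proof (induction n)
  case 0
  show ?case
    by (simp add: cf_0 coef_init_def opd_def pderiv_pCons algebra_simps)
next
  case (Suc n)
  define N where "N = 2 * real n + 2"
  have N: "N \<noteq> 0" "N + 1 = 2 * real (Suc n) + 1" "N + 2 = 2 * real (Suc n) + 2" "N - 1 = 2 * real n + 1" by (simp_all add: N_def)
  note R = cf_Suc[of n l, unfolded coef_rel_def Let_def, folded N_def]
  have IH: "opd N (cA (cf l n)) = opd (N - 1) (cG (cf l n))" using Suc unfolding N(4) by (simp add: N_def)
  have a: "opd N (opd N (opd (N + 2) (cA (cf l (Suc n))))) =
      opd N (- opd N (opd (N + 1) (cA (cf l n))) + csum (conv1 (cf l)) n + opd N (cP (cf l (Suc n))))"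
    using R by simp
  have b: "opd N (opd N (opd (N + 1) (cG (cf l (Suc n))))) =
      opd (N + 1) (- opd (N - 1) (opd N (cG (cf l n))) + csum (conv3 (cf l)) n - opd N (cP (cf l n)))"
    using R by (metis opd_commute)
  have c: "opd N (opd N (opd (N + 1) (cA (cf l n)))) = opd (N + 1) (opd (N - 1) (opd N (cG (cf l n))))"
    by (simp only: opd_commute[of N "N + 1"] IH opd_commute[of N "N - 1"])
  \<comment> \<open>Inserting the pressure equation cancels \<open>conv1\<close>; the terms with
    \<open>conv3\<close> and the old pressure occur equally on both sides, and the old velocity
    terms agree by \<open>c\<close>, that is, by the induction hypothesis.\<close>
  have "opd N (opd N (opd (N + 2) (cA (cf l (Suc n))))) = opd N (opd N (opd (N + 1) (cG (cf l (Suc n)))))"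
    unfolding a b using R[THEN conjunct1] c
    by (simp add: opd_add opd_diff opd_minus opd_commute[of "N + 1" N])
  then have "opd (N + 2) (cA (cf l (Suc n))) = opd (N + 1) (cG (cf l (Suc n)))"
    by (simp only: opd_cancel[OF N(1)])
  then show ?case unfolding N(2,3) .
qed

lemma rad_eq_rho: "x \<in> phalf \<Longrightarrow> rad x = rho x * x$3"
  by (simp add: rho_def mem_phalf_iff)

lemma exp_rho: "x \<in> phalf \<Longrightarrow> exp (2 * real n * ln (rho x)) = rho x ^ (2 * n)"
  using exp_of_nat_mult[of "2 * n" "ln (rho x)"] rho_pos[of x] by simp

lemma rad_SF_2: "x \<in> phalf \<Longrightarrow> rad x * SF 2 f x = inverse (x$3) * rho x * f (ln (rho x))"
  by (simp add: rad_eq_rho SF_def power2_eq_square mem_phalf_iff)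

lemma scaleR_mem_phalf: "x \<in> phalf \<Longrightarrow> s > 0 \<Longrightarrow> s *\<^sub>R x \<in> phalf"
  by (simp add: mem_phalf_iff power_mult_distrib distrib_left[symmetric])

lemma rho_scaleR: "s > 0 \<Longrightarrow> rho (s *\<^sub>R x) = rho x"
  by (simp add: rho_def rad_eq power_mult_distrib distrib_left[symmetric] real_sqrt_mult)

lemma SF_scaleR: "s > 0 \<Longrightarrow> SF 2 f (s *\<^sub>R x) = s powr (-2) *\<^sub>R SF 2 f x"
  by (simp add: SF_def rho_scaleR powr_minus power_mult_distrib power_inverse)

lemma VF_scaleR:
  assumes s: "s > 0"
  shows "VF 1 \<alpha> \<beta> \<gamma> (s *\<^sub>R x) = s powr (-1) *\<^sub>R VF 1 \<alpha> \<beta> \<gamma> x"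
proof -
  have sf: "SF (1 + 1) f (s *\<^sub>R x) = SF (1 + 1) f x / (s * s)" "SF 1 f (s *\<^sub>R x) = SF 1 f x / s" for f
    using s by (simp_all add: SF_def rho_scaleR power_mult_distrib divide_inverse)
  have "s * y * (z / (s * s)) = y * z / s" for y z
    using s by simp
  then show ?thesis
    using s by (simp only: vec_eq_iff forall_3 VF_nth sf powr_minus powr_one vector_scaleR_component real_scaleR_def)
      (simp add: divide_inverse algebra_simps)
qed

text \<open>Identifies the class with quadruples of polynomials of degree at most n + 1. The odd
  power of \<rho> in the horizontal components is the even power of \<open>ef\<close> times the
  radius contained in \<open>VF\<close>.\<close>

lemma expansion_class_iff:
  "expansion_class n v q \<longleftrightarrow> (\<exists>r. deg_le (n + 1) r \<and> (\<forall>x\<in>phalf. v x = uf n r x \<and> q x = pf n r x))"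
proof -
  have comp: "(comp_rho v x = inverse (x$3) * rho x ^ (2*n+1) * poly a (ln (rho x)) \<and>
           comp_phi v x = inverse (x$3) * rho x ^ (2*n+1) * poly b (ln (rho x)) \<and>
           v x $ 3 = inverse (x$3) * rho x ^ (2*n) * poly g (ln (rho x)) \<and>
           q x = inverse ((x$3)^2) * rho x ^ (2*n) * poly c (ln (rho x))) \<longleftrightarrow> v x = uf n (a, b, g, c) x \<and> q x = pf n (a, b, g, c) x"
    if x: "x \<in> phalf" for x a b g c
  proof -
    have x3: "x$3 \<noteq> 0" using x by (simp add: mem_phalf_iff)
    show ?thesis
      unfolding uf_def VF_comp_iff[where u=v, OF x] one_add_one pf_def rad_SF_2[OF x]
      unfolding SF_def ef_def exp_rho[OF x] by (simp add: power_inverse mult_ac)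
  qed
  have hom: "neg_homogeneous_on phalf 1 v \<and> neg_homogeneous_on phalf 2 q"
    if vq: "\<And>x. x \<in> phalf \<Longrightarrow> v x = uf n r x \<and> q x = pf n r x" for r
  proof -
    have "v (s *\<^sub>R x) = s powr (-1) *\<^sub>R v x \<and> q (s *\<^sub>R x) = s powr (-2) *\<^sub>R q x" if x: "x \<in> phalf" and s: "s > 0" for x s
      using vq[OF x] vq[OF scaleR_mem_phalf[OF x s]] VF_scaleR[OF s] SF_scaleR[OF s] by (simp add: uf_def pf_def)
    then show ?thesis by (simp add: neg_homogeneous_on_def)
  qed
  show ?thesis
  proof
    assume "expansion_class n v q"
    then obtain a b g c where d: "degree a \<le> n + 1" "degree b \<le> n + 1" "degree g \<le> n + 1" "degree c \<le> n + 1"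
      and e: "\<forall>x\<in>phalf. comp_rho v x = inverse (x$3) * rho x ^ (2*n+1) * poly a (ln (rho x)) \<and>
           comp_phi v x = inverse (x$3) * rho x ^ (2*n+1) * poly b (ln (rho x)) \<and>
           v x $ 3 = inverse (x$3) * rho x ^ (2*n) * poly g (ln (rho x)) \<and>
           q x = inverse ((x$3)^2) * rho x ^ (2*n) * poly c (ln (rho x))"
      unfolding expansion_class_def by auto
    have "deg_le (n + 1) (a, b, g, c)" using d by (simp add: deg_le_def)
    moreover have "\<forall>x\<in>phalf. v x = uf n (a, b, g, c) x \<and> q x = pf n (a, b, g, c) x"
      using e comp by blast
    ultimately show "\<exists>r. deg_le (n + 1) r \<and> (\<forall>x\<in>phalf. v x = uf n r x \<and> q x = pf n r x)" by blast
  next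
    assume "\<exists>r. deg_le (n + 1) r \<and> (\<forall>x\<in>phalf. v x = uf n r x \<and> q x = pf n r x)"
    then obtain a b g c where r: "deg_le (n + 1) (a, b, g, c)" "\<And>x. x \<in> phalf \<Longrightarrow> v x = uf n (a, b, g, c) x \<and> q x = pf n (a, b, g, c) x"
      by (metis prod.collapse)
    have "degree a \<le> n + 1" "degree b \<le> n + 1" "degree g \<le> n + 1" "degree c \<le> n + 1"
      using r(1) by (simp_all add: deg_le_def)
    then show "expansion_class n v q"
      unfolding expansion_class_def using hom[OF r(2)] r(2) comp by blast
  qed
qed

lemma leading_term_iff:
  "leading_term l v q \<longleftrightarrow> (\<forall>x\<in>phalf. v x = uf 0 (coef_init l) x \<and> q x = pf 0 (coef_init l) x)"
  unfolding leading_term_def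
proof (rule ball_cong[OF refl])
  fix x assume x: "x \<in> phalf"
  have x3: "x$3 \<noteq> 0" using x by (simp add: mem_phalf_iff)
  show "(comp_rho v x = inverse (x$3) * rho x * (1/2 * par_c l * ln (rho x) + par_brho l) \<and>
     comp_phi v x = par_bphi l * inverse (x$3) * rho x \<and>
     v x $ 3 = inverse (x$3) * (par_c l * ln (rho x) + (2 * par_brho l - 1/2 * par_c l)) \<and>
     q x = inverse ((x$3)^2) * (par_c l * ln (rho x) + par_d l)) \<longleftrightarrow>
     v x = uf 0 (coef_init l) x \<and> q x = pf 0 (coef_init l) x"
    unfolding uf_def VF_comp_iff[where u=v, OF x] one_add_one pf_def rad_SF_2[OF x] ef_def
    by (simp add: SF_def coef_init_def power_inverse algebra_simps)
qed

lemma recursion_unique: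
  assumes "expansion_class (Suc n) v q" "recursion_eqs n (\<lambda>m. uf m (cf l m)) (\<lambda>m. pf m (cf l m)) v q" "x \<in> phalf"
  shows "v x = uf (Suc n) (cf l (Suc n)) x \<and> q x = pf (Suc n) (cf l (Suc n)) x"
proof -
  obtain r where r: "\<And>x. x \<in> phalf \<Longrightarrow> v x = uf (Suc n) r x \<and> q x = pf (Suc n) r x"
    using assms(1) unfolding expansion_class_iff by blast
  have "coef_rel n (cf l) r"
    using assms(2) recursion_eqs_iff_coef_rel[of v n r q "cf l"] r by blast
  then have "r = cf l (Suc n)" using cf_Suc by (rule coef_rel_unique)
  then show ?thesis using r[OF assms(3)] by simp
qed

lemma expansion_cf: "expansion l (\<lambda>n. uf n (cf l n)) (\<lambda>n. pf n (cf l n))"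
  unfolding expansion_def
proof (intro conjI allI impI)
  show "expansion_class n (uf n (cf l n)) (pf n (cf l n))" for n
    unfolding expansion_class_iff using deg_le_cf by blast
  show "leading_term l (uf 0 (cf l 0)) (pf 0 (cf l 0))"
    unfolding leading_term_iff cf_0 by simp
  show "recursion_eqs n (\<lambda>n. uf n (cf l n)) (\<lambda>n. pf n (cf l n)) (uf (Suc n) (cf l (Suc n))) (pf (Suc n) (cf l (Suc n)))" for n
    using recursion_eqs_iff_coef_rel[of "uf (Suc n) (cf l (Suc n))" n "cf l (Suc n)" "pf (Suc n) (cf l (Suc n))" "cf l"] cf_Suc by simp
  show "\<forall>x\<in>phalf. v x = uf (Suc n) (cf l (Suc n)) x \<and> q x = pf (Suc n) (cf l (Suc n)) x"
    if "expansion_class (Suc n) v q \<and> recursion_eqs n (\<lambda>n. uf n (cf l n)) (\<lambda>n. pf n (cf l n)) v q" for n v q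
    using that recursion_unique by blast
qed

lemma expansion_unique:
  assumes e: "expansion l u p" and x: "x \<in> phalf"
  shows "u n x = uf n (cf l n) x \<and> p n x = pf n (cf l n) x"
  using x
proof (induction n arbitrary: x rule: less_induct)
  case (less n)
  show ?case
  proof (cases n)
    case 0
    then show ?thesis using e less.prems unfolding expansion_def leading_term_iff cf_0[symmetric] by blast
  next
    case (Suc k)
    have "recursion_eqs k u p (u (Suc k)) (p (Suc k))" "expansion_class (Suc k) (u (Suc k)) (p (Suc k))"
      using e unfolding expansion_def by blast+
    moreover have "recursion_eqs k u p (u (Suc k)) (p (Suc k)) \<longleftrightarrow>
        recursion_eqs k (\<lambda>m. uf m (cf l m)) (\<lambda>m. pf m (cf l m)) (u (Suc k)) (p (Suc k))"
      by (rule recursion_eqs_cong) (use less.IH Suc in auto)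
    ultimately show ?thesis using recursion_unique less.prems unfolding Suc by blast
  qed
qed

section \<open>Convergence of the expansion\<close>

text \<open>Each factor n + 1 comes from differentiating the power series once; the coefficients (n
  + 1)(n + 2)^k of the derivative dominate (n + 1)^(k + 1).\<close>

lemma summable_power_times_geometric:
  fixes x :: real
  assumes "0 \<le> x" "x < 1"
  shows "summable (\<lambda>n. (real n + 1) ^ k * x ^ n)"
  using assms
proof (induction k arbitrary: x)
  case 0
  then show ?case by (simp add: summable_geometric)
next
  case (Suc k)
  have "summable (\<lambda>n. diffs (\<lambda>n. (real n + 1) ^ k) n * x ^ n)"
  proof (rule termdiff_converges)
    show "norm x < 1" using Suc.prems by simp
    show "summable (\<lambda>n. (real n + 1) ^ k * y ^ n)" if "norm y < 1" for y :: real
    proof (rule summable_norm_cancel)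
      show "summable (\<lambda>n. norm ((real n + 1) ^ k * y ^ n))"
        using Suc.IH[of "\<bar>y\<bar>"] that by (simp add: abs_mult power_abs)
    qed
  qed
  then show ?case
  proof (rule summable_comparison_test'[where N=0])
    fix n :: nat
    have "(real n + 1) * (real n + 1) ^ k \<le> (real n + 1) * (real n + 2) ^ k"
      by (intro mult_left_mono power_mono) auto
    then show "norm ((real n + 1) ^ Suc k * x ^ n) \<le> diffs (\<lambda>n. (real n + 1) ^ k) n * x ^ n"
      using Suc.prems by (simp add: diffs_def mult_right_mono add.commute)
  qed
qed

text \<open>B is the geometric rate of the coefficients and T the logarithm of the opening of the
  cone. The condition on \<open>B * exp T\<close> makes the series converge with ratio 1/2,
  including the powers of 1 + \<bar>t\<bar> that the logarithms cause.\<close>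

locale expansion_series =
  fixes K :: "(real^4) set" and B T :: real
  assumes B: "B \<ge> 0" and T: "T \<le> 0" and BT: "B * exp T \<le> 1/2"
begin

text \<open>The polynomial factor \<open>(real n + 1) ^ k\<close> is the room for differentiation:
  each derivative raises k by one and leaves the rate B unchanged. M and k must not depend on l,
  which gives uniformity over K.\<close>

definition Gf :: "(real^4 \<Rightarrow> nat \<Rightarrow> real poly) \<Rightarrow> bool" where
  "Gf P \<longleftrightarrow> (\<exists>M k. M \<ge> 0 \<and> (\<forall>l\<in>K. \<forall>n. degree (P l n) \<le> n + 1 \<and> pnorm (P l n) \<le> M * (real n + 1) ^ k * B ^ n))"

definition Sf :: "(real^4 \<Rightarrow> nat \<Rightarrow> real poly) \<Rightarrow> real^4 \<Rightarrow> real \<Rightarrow> real" where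
  "Sf P l t = (\<Sum>n. ef n (P l n) t)"

definition dP :: "(real^4 \<Rightarrow> nat \<Rightarrow> real poly) \<Rightarrow> real^4 \<Rightarrow> nat \<Rightarrow> real poly" where
  "dP P l n = opd (2 * real n) (P l n)"

lemma Gf_add: "Gf P \<Longrightarrow> Gf Q \<Longrightarrow> Gf (\<lambda>l n. P l n + Q l n)"
proof -
  assume "Gf P" "Gf Q"
  then obtain M k M' k' where P: "M \<ge> 0" "\<And>l n. l \<in> K \<Longrightarrow> degree (P l n) \<le> n + 1 \<and> pnorm (P l n) \<le> M * (real n + 1) ^ k * B ^ n"
    and Q: "M' \<ge> 0" "\<And>l n. l \<in> K \<Longrightarrow> degree (Q l n) \<le> n + 1 \<and> pnorm (Q l n) \<le> M' * (real n + 1) ^ k' * B ^ n"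
    unfolding Gf_def by blast
  have "pnorm (P l n + Q l n) \<le> (M + M') * (real n + 1) ^ (k + k') * B ^ n" if "l \<in> K" for l n
  proof -
    have i: "(real n + 1) ^ k \<le> (real n + 1) ^ (k + k')" "(real n + 1) ^ k' \<le> (real n + 1) ^ (k + k')"
      by (intro power_increasing; simp)+
    have "pnorm (P l n) \<le> M * (real n + 1) ^ (k + k') * B ^ n" "pnorm (Q l n) \<le> M' * (real n + 1) ^ (k + k') * B ^ n"
      using P Q that i B by (auto intro!: order_trans[OF conjunct2[OF P(2)[OF that]]] order_trans[OF conjunct2[OF Q(2)[OF that]]] mult_right_mono mult_left_mono)
    then show ?thesis using pnorm_add[of "P l n" "Q l n"] by (simp add: distrib_right)
  qed
  moreover have "degree (P l n + Q l n) \<le> n + 1" if "l \<in> K" for l n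
    using P(2)[OF that] Q(2)[OF that] by (intro degree_add_le) auto
  ultimately show ?thesis unfolding Gf_def using P(1) Q(1) by (intro exI[of _ "M + M'"] exI[of _ "k + k'"]) auto
qed

lemma Gf_smult: "Gf P \<Longrightarrow> Gf (\<lambda>l n. smult c (P l n))"
proof -
  assume "Gf P"
  then obtain M k where P: "M \<ge> 0" "\<And>l n. l \<in> K \<Longrightarrow> degree (P l n) \<le> n + 1 \<and> pnorm (P l n) \<le> M * (real n + 1) ^ k * B ^ n"
    unfolding Gf_def by blast
  have "pnorm (smult c (P l n)) \<le> (\<bar>c\<bar> * M) * (real n + 1) ^ k * B ^ n" if "l \<in> K" for l n
    using mult_left_mono[OF conjunct2[OF P(2)[OF that]], of "\<bar>c\<bar>" n] by (simp add: pnorm_smult mult.assoc)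
  moreover have "degree (smult c (P l n)) \<le> n + 1" if "l \<in> K" for l n
    using P(2)[OF that, of n] degree_smult_le[of c "P l n"] by simp
  ultimately show ?thesis unfolding Gf_def using P(1) by (intro exI[of _ "\<bar>c\<bar> * M"] exI[of _ k]) auto
qed

lemma Gf_dP: "Gf P \<Longrightarrow> Gf (dP P)"
proof -
  assume "Gf P"
  then obtain M k where P: "M \<ge> 0" "\<And>l n. l \<in> K \<Longrightarrow> degree (P l n) \<le> n + 1 \<and> pnorm (P l n) \<le> M * (real n + 1) ^ k * B ^ n"
    unfolding Gf_def by blast
  have "pnorm (dP P l n) \<le> (3 * M) * (real n + 1) ^ (Suc k) * B ^ n" if "l \<in> K" for l n
  proof -
    have "pnorm (dP P l n) \<le> (2 * real n + real (n + 1) / 2) * pnorm (P l n)"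
      unfolding dP_def using P(2)[OF that] by (intro pnorm_opd) auto
    also have "\<dots> \<le> (3 * (real n + 1)) * (M * (real n + 1) ^ k * B ^ n)"
      using P(2)[OF that, of n] by (intro mult_mono) (auto simp: pnorm_nonneg field_simps)
    finally show ?thesis by (simp add: algebra_simps)
  qed
  moreover have "degree (dP P l n) \<le> n + 1" if "l \<in> K" for l n
    unfolding dP_def using P(2)[OF that, of n] by (intro degree_opd) simp
  ultimately show ?thesis unfolding Gf_def using P(1) by (intro exI[of _ "3 * M"] exI[of _ "Suc k"]) auto
qed

text \<open>Of the two factors e^t in e^(2t), one compensates 1 + \<bar>t\<bar> \<le> e^(-t), the
  other turns B into B e^t \<le> 1/2.\<close>

lemma growth_factor: "t < T \<Longrightarrow> B * exp (2 * t) * (1 + \<bar>t\<bar>) \<le> 1/2"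
proof -
  assume t: "t < T"
  have "1 + \<bar>t\<bar> \<le> exp (- t)" using exp_ge_add_one_self[of "- t"] t T by simp
  then have "B * exp (2 * t) * (1 + \<bar>t\<bar>) \<le> B * exp (2 * t) * exp (- t)"
    using B by (intro mult_left_mono) auto
  also have "\<dots> = B * exp t" by (simp add: mult.assoc mult_exp_exp)
  also have "\<dots> \<le> B * exp T" using t B by (intro mult_left_mono) auto
  finally show ?thesis using BT by simp
qed

lemma ef_bound:
  assumes d: "degree p \<le> n + 1" and p: "pnorm p \<le> M * (real n + 1) ^ k * B ^ n" and M: "M \<ge> 0"
  shows "\<bar>ef n p t\<bar> \<le> M * (real n + 1) ^ k * (B * exp (2 * t) * (1 + \<bar>t\<bar>)) ^ n * (1 + \<bar>t\<bar>)"
proof -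
  have "\<bar>poly p t\<bar> \<le> (M * (real n + 1) ^ k * B ^ n) * (1 + \<bar>t\<bar>) ^ (n + 1)"
    by (rule order_trans[OF poly_bound[OF d]]) (use p in \<open>intro mult_right_mono; simp\<close>)
  then have "\<bar>ef n p t\<bar> \<le> exp (2 * t) ^ n * ((M * (real n + 1) ^ k * B ^ n) * (1 + \<bar>t\<bar>) ^ (n + 1))"
    by (simp add: ef_def abs_mult exp_of_nat_mult[symmetric] mult_ac)
  also have "\<dots> = M * (real n + 1) ^ k * (B * exp (2 * t) * (1 + \<bar>t\<bar>)) ^ n * (1 + \<bar>t\<bar>)"
    by (simp add: power_mult_distrib mult_ac)
  finally show ?thesis .
qed

lemma Gf_bound:
  assumes "Gf P"
  shows "\<exists>W. summable W \<and> (\<forall>n. W n \<ge> 0) \<and> (\<forall>l\<in>K. \<forall>t<T. \<forall>n. \<bar>ef n (P l n) t\<bar> \<le> W n * (1 + \<bar>t\<bar>))"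
proof -
  obtain M k where P: "M \<ge> 0" "\<And>l n. l \<in> K \<Longrightarrow> degree (P l n) \<le> n + 1 \<and> pnorm (P l n) \<le> M * (real n + 1) ^ k * B ^ n"
    using assms unfolding Gf_def by blast
  show ?thesis
  proof (intro exI[of _ "\<lambda>n. M * ((real n + 1) ^ k * (1/2) ^ n)"] conjI allI ballI impI)
    show "summable (\<lambda>n. M * ((real n + 1) ^ k * (1/2) ^ n))"
      by (intro summable_mult summable_power_times_geometric) auto
    show "0 \<le> M * ((real n + 1) ^ k * (1/2) ^ n)" for n using P(1) by simp
    fix l t n assume l: "l \<in> K" and t: "t < T"
    have "\<bar>ef n (P l n) t\<bar> \<le> M * (real n + 1) ^ k * (B * exp (2 * t) * (1 + \<bar>t\<bar>)) ^ n * (1 + \<bar>t\<bar>)"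
      using P l by (intro ef_bound) auto
    also have "\<dots> \<le> M * (real n + 1) ^ k * (1/2) ^ n * (1 + \<bar>t\<bar>)"
      using P(1) B growth_factor[OF t] by (intro mult_right_mono mult_left_mono power_mono) auto
    finally show "\<bar>ef n (P l n) t\<bar> \<le> M * ((real n + 1) ^ k * (1/2) ^ n) * (1 + \<bar>t\<bar>)"
      by (simp add: mult.assoc)
  qed
qed

lemma Sf_summable_norm: "Gf P \<Longrightarrow> l \<in> K \<Longrightarrow> t < T \<Longrightarrow> summable (\<lambda>n. norm (ef n (P l n) t))"
proof -
  assume P: "Gf P" and l: "l \<in> K" and t: "t < T"
  obtain W where "summable W \<and> (\<forall>n. W n \<ge> 0) \<and> (\<forall>l\<in>K. \<forall>t<T. \<forall>n. \<bar>ef n (P l n) t\<bar> \<le> W n * (1 + \<bar>t\<bar>))"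
    using Gf_bound[OF P] by (elim exE)
  then have W: "summable W" "\<And>n. W n \<ge> 0" "\<And>l t n. l \<in> K \<Longrightarrow> t < T \<Longrightarrow> \<bar>ef n (P l n) t\<bar> \<le> W n * (1 + \<bar>t\<bar>)"
    by simp_all
  show ?thesis
  proof (rule summable_comparison_test'[where N=0])
    show "summable (\<lambda>n. W n * (1 + \<bar>t\<bar>))" by (rule summable_mult2[OF W(1)])
  qed (simp add: W(3)[OF l t])
qed

lemma Sf_summable: "Gf P \<Longrightarrow> l \<in> K \<Longrightarrow> t < T \<Longrightarrow> summable (\<lambda>n. ef n (P l n) t)"
  by (rule summable_norm_cancel[OF Sf_summable_norm])

lemma Sf_sums: "Gf P \<Longrightarrow> l \<in> K \<Longrightarrow> t < T \<Longrightarrow> (\<lambda>n. ef n (P l n) t) sums Sf P l t"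
  unfolding Sf_def by (rule summable_sums[OF Sf_summable])

lemma Sf_add: "Gf P \<Longrightarrow> Gf Q \<Longrightarrow> l \<in> K \<Longrightarrow> t < T \<Longrightarrow> Sf (\<lambda>l n. P l n + Q l n) l t = Sf P l t + Sf Q l t"
  unfolding Sf_def ef_add[symmetric] by (rule suminf_add[symmetric]; rule Sf_summable)

lemma Sf_smult: "Gf P \<Longrightarrow> l \<in> K \<Longrightarrow> t < T \<Longrightarrow> Sf (\<lambda>l n. smult c (P l n)) l t = c * Sf P l t"
  unfolding Sf_def ef_smult[symmetric] by (rule suminf_mult; rule Sf_summable)

lemma D1_Sf:
  assumes P: "Gf P" and l: "l \<in> K"
  shows "D1 {..<T} (Sf P l) (Sf (dP P) l)"
  unfolding D1_def
proof
  fix t assume t: "t \<in> {..<T}"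
  obtain W where "summable W \<and> (\<forall>n. W n \<ge> 0) \<and> (\<forall>l\<in>K. \<forall>t<T. \<forall>n. \<bar>ef n (dP P l n) t\<bar> \<le> W n * (1 + \<bar>t\<bar>))"
    using Gf_bound[OF Gf_dP[OF P]] by (elim exE)
  then have W: "summable W" "\<And>n. W n \<ge> 0" "\<And>l t n. l \<in> K \<Longrightarrow> t < T \<Longrightarrow> \<bar>ef n (dP P l n) t\<bar> \<le> W n * (1 + \<bar>t\<bar>)"
    by simp_all
  \<comment> \<open>A window around t on which 1 + \<bar>x\<bar> \<le> 2 + \<bar>t\<bar>, so that
    the majorant is uniform.\<close>
  let ?S = "{t - 1<..<T}"
  have un: "uniformly_convergent_on ?S (\<lambda>N x. \<Sum>n<N. ef n (dP P l n) x)"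
  proof (rule Weierstrass_m_test')
    show "summable (\<lambda>n. W n * (2 + \<bar>t\<bar>))" by (intro summable_mult2 W)
    fix n x assume x: "x \<in> ?S"
    have "norm (ef n (dP P l n) x) \<le> W n * (1 + \<bar>x\<bar>)" using W(3)[OF l, of x n] x by simp
    also have "\<dots> \<le> W n * (2 + \<bar>t\<bar>)" using W(2) x t T by (intro mult_left_mono) auto
    finally show "norm (ef n (dP P l n) x) \<le> W n * (2 + \<bar>t\<bar>)" .
  qed
  have "((\<lambda>x. \<Sum>n. ef n (P l n) x) has_field_derivative (\<Sum>n. ef n (dP P l n) t)) (at t)"
  proof (rule has_field_derivative_series'(2)[OF _ _ un])
    show "convex ?S" by simp
    show "(ef n (P l n) has_real_derivative ef n (dP P l n) x) (at x within ?S)" for n x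
      using D1D[OF D1_ef, of x UNIV n "P l n"] by (simp add: dP_def has_field_derivative_at_within)
    show "t \<in> ?S" using t by simp
    show "t \<in> interior ?S" using t by (simp add: interior_open)
    show "summable (\<lambda>n. ef n (P l n) t)" using Sf_summable[OF P l] t by simp
  qed
  then show "(Sf P l has_real_derivative Sf (dP P) l t) (at t)" unfolding Sf_def[abs_def] .
qed

text \<open>Every omitted term contains z, hence e^(2t), and the logarithms cost (1 +
  \<bar>t\<bar>)^2, which is at most 16 e^(-t/2). The remainder is thus O(e^(3t/2)), better than
  required.\<close>

lemma Sf_leading:
  assumes P: "Gf P" and l: "l \<in> K"
  shows "exp_O 1 (\<lambda>t. Sf P l t - poly (P l 0) t)"
proof -
  obtain M k where P': "M \<ge> 0" "\<And>l n. l \<in> K \<Longrightarrow> degree (P l n) \<le> n + 1 \<and> pnorm (P l n) \<le> M * (real n + 1) ^ k * B ^ n"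
    using P unfolding Gf_def by blast
  have sm: "summable (\<lambda>n. (real n + 1) ^ k * (1/2) ^ n :: real)" by (rule summable_power_times_geometric) auto
  define W where "W = (\<lambda>n. M * (2 * ((real (Suc n) + 1) ^ k * (1/2) ^ Suc n)))"
  have W: "summable W" unfolding W_def using sm by (intro summable_mult) (rule summable_Suc_iff[THEN iffD2])
  show ?thesis
  proof (rule exp_O_I[of T _ "16 * B * suminf W"])
    fix t assume t: "t < T"
    define z where "z = B * exp (2 * t) * (1 + \<bar>t\<bar>)"
    have z: "0 \<le> z" "z \<le> 1/2" using growth_factor[OF t] B by (auto simp: z_def)
    have tb: "\<bar>ef (Suc n) (P l (Suc n)) t\<bar> \<le> W n * (z * (1 + \<bar>t\<bar>))" for n
    proof -
      have "\<bar>ef (Suc n) (P l (Suc n)) t\<bar> \<le> M * (real (Suc n) + 1) ^ k * z ^ Suc n * (1 + \<bar>t\<bar>)"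
        unfolding z_def by (rule ef_bound) (use P'(1) P'(2)[OF l, of "Suc n"] in auto)
      also have "z ^ Suc n \<le> z * (1/2) ^ n" using z by (simp add: mult_left_mono power_mono)
      then have "M * (real (Suc n) + 1) ^ k * z ^ Suc n * (1 + \<bar>t\<bar>) \<le> M * (real (Suc n) + 1) ^ k * (z * (1/2) ^ n) * (1 + \<bar>t\<bar>)"
        using P'(1) by (intro mult_right_mono mult_left_mono) auto
      also have "\<dots> = W n * (z * (1 + \<bar>t\<bar>))" by (simp add: W_def)
      finally show ?thesis .
    qed
    have s: "summable (\<lambda>n. ef n (P l n) t)" by (rule Sf_summable[OF P l t])
    have "Sf P l t - poly (P l 0) t = (\<Sum>n. ef (Suc n) (P l (Suc n)) t)"
      unfolding Sf_def using suminf_split_head[OF s] by (simp add: ef_def)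
    also have "\<bar>\<dots>\<bar> \<le> (\<Sum>n. W n * (z * (1 + \<bar>t\<bar>)))"
      using norm_suminf_le[of "\<lambda>n. ef (Suc n) (P l (Suc n)) t" "\<lambda>n. W n * (z * (1 + \<bar>t\<bar>))"] tb summable_mult2[OF W] by simp
    also have "\<dots> = suminf W * (z * (1 + \<bar>t\<bar>))" using suminf_mult2[OF W] by simp
    also have "\<dots> \<le> suminf W * (B * (16 * exp (1 * t)))"
    proof (rule mult_left_mono)
      have "1 + \<bar>t\<bar> \<le> 4 * exp (- (1/4) * t)" using exp_ge_add_one_self[of "- (1/4) * t"] t T by simp
      then have "(1 + \<bar>t\<bar>) * (1 + \<bar>t\<bar>) \<le> (4 * exp (- (1/4) * t)) * (4 * exp (- (1/4) * t))"
        by (intro mult_mono) auto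
      also have "\<dots> = 16 * exp (- (1/2) * t)" by (simp add: mult_exp_exp)
      finally have "exp (2 * t) * ((1 + \<bar>t\<bar>) * (1 + \<bar>t\<bar>)) \<le> exp (2 * t) * (16 * exp (- (1/2) * t))"
        by (intro mult_left_mono) auto
      also have "\<dots> = 16 * exp (3/2 * t)" by (simp add: mult_exp_exp)
      also have "\<dots> \<le> 16 * exp (1 * t)" using t T by simp
      finally show "z * (1 + \<bar>t\<bar>) \<le> B * (16 * exp (1 * t))"
        unfolding z_def using B by (simp add: mult.assoc mult_left_mono)
      show "0 \<le> suminf W" by (rule suminf_nonneg[OF W]) (use P'(1) in \<open>simp add: W_def\<close>)
    qed
    finally show "\<bar>Sf P l t - poly (P l 0) t\<bar> \<le> 16 * B * suminf W * exp (1 * t)" by (simp add: mult_ac)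
  qed
qed

end

section \<open>Convergence of series together with their derivatives\<close>

definition unif_series :: "'l set \<Rightarrow> (real^3) set \<Rightarrow> ('l \<Rightarrow> nat \<Rightarrow> real^3 \<Rightarrow> 'a::real_normed_vector) \<Rightarrow> ('l \<Rightarrow> real^3 \<Rightarrow> 'a) \<Rightarrow> bool" where
  "unif_series K S f F \<longleftrightarrow> (\<forall>V. compact V \<and> V \<subseteq> S \<longrightarrow>
     uniform_limit (K \<times> V) (\<lambda>N (l, x). \<Sum>n<N. f l n x) (\<lambda>(l, x). F l x) sequentially) \<and> (\<forall>l\<in>K. continuous_on S (F l))"

text \<open>Convergence in C^j on compact sets, uniform in the parameter, phrased through iterated
  partials so that induction on j can pass to a derivative. It yields both the C^2 convergence of
  the expansion and the smoothness of its sum.\<close>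

primrec Ck_series :: "nat \<Rightarrow> 'l set \<Rightarrow> (real^3) set \<Rightarrow> ('l \<Rightarrow> nat \<Rightarrow> real^3 \<Rightarrow> 'a::real_normed_vector) \<Rightarrow> ('l \<Rightarrow> real^3 \<Rightarrow> 'a) \<Rightarrow> bool" where
  "Ck_series 0 K S f F \<longleftrightarrow> unif_series K S f F"
| "Ck_series (Suc j) K S f F \<longleftrightarrow> unif_series K S f F \<and> (\<forall>l\<in>K. \<forall>x\<in>S. (\<forall>n. f l n differentiable (at x)) \<and> F l differentiable (at x)) \<and>
     (\<forall>i. Ck_series j K S (\<lambda>l n. partial i (f l n)) (\<lambda>l. partial i (F l)))"

lemma Ck_series_unif_series: "Ck_series j K S f F \<Longrightarrow> unif_series K S f F"
  by (cases j) auto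

lemma unif_series_cong:
  assumes "\<And>l n x. l \<in> K \<Longrightarrow> x \<in> S \<Longrightarrow> f l n x = g l n x" "\<And>l x. l \<in> K \<Longrightarrow> x \<in> S \<Longrightarrow> F l x = G l x" "unif_series K S g G"
  shows "unif_series K S f F"
  unfolding unif_series_def
proof (intro conjI allI impI ballI)
  fix V assume V: "compact V \<and> V \<subseteq> S"
  then have "uniform_limit (K \<times> V) (\<lambda>N (l, x). \<Sum>n<N. g l n x) (\<lambda>(l, x). G l x) sequentially"
    using assms(3) by (simp add: unif_series_def)
  moreover have "(\<Sum>n<N. f l n x) = (\<Sum>n<N. g l n x)" if "l \<in> K" "x \<in> V" for N l x
    using assms(1) that V by (intro sum.cong) auto
  ultimately show "uniform_limit (K \<times> V) (\<lambda>N (l, x). \<Sum>n<N. f l n x) (\<lambda>(l, x). F l x) sequentially"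
    using assms(2) V by (subst uniform_limit_cong'[where g="\<lambda>N (l, x). \<Sum>n<N. g l n x" and i="\<lambda>(l, x). G l x"]) auto
next
  fix l assume "l \<in> K"
  then show "continuous_on S (F l)"
    using assms(2,3) unfolding unif_series_def by (metis (no_types, lifting) continuous_on_cong)
qed

lemma Ck_series_cong:
  assumes "open S" "\<And>l n x. l \<in> K \<Longrightarrow> x \<in> S \<Longrightarrow> f l n x = g l n x" "\<And>l x. l \<in> K \<Longrightarrow> x \<in> S \<Longrightarrow> F l x = G l x" "Ck_series j K S g G"
  shows "Ck_series j K S f F"
  using assms(2-4)
proof (induction j arbitrary: f F g G)
  case 0
  then show ?case using unif_series_cong[of K S f g F G] by simp
next
  case (Suc j)
  have "unif_series K S f F" using Suc.prems unif_series_cong[of K S f g F G] by simp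
  moreover have "f l n differentiable (at x)" if "l \<in> K" "x \<in> S" for l n x
    by (rule differentiable_cong_open[OF assms(1) that(2) Suc.prems(1)[OF that(1)]]) (use Suc.prems(3) that in auto)
  moreover have "F l differentiable (at x)" if "l \<in> K" "x \<in> S" for l x
    by (rule differentiable_cong_open[OF assms(1) that(2) Suc.prems(2)[OF that(1)]]) (use Suc.prems(3) that in auto)
  moreover have "Ck_series j K S (\<lambda>l n. partial i (f l n)) (\<lambda>l. partial i (F l))" for i
  proof (rule Suc.IH)
    show "partial i (f l n) x = partial i (g l n) x" if "l \<in> K" "x \<in> S" for l n x
      by (rule partial_cong_open[OF assms(1) that(2) Suc.prems(1)[OF that(1)]])
    show "partial i (F l) x = partial i (G l) x" if "l \<in> K" "x \<in> S" for l x
      by (rule partial_cong_open[OF assms(1) that(2) Suc.prems(2)[OF that(1)]])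
    show "Ck_series j K S (\<lambda>l n. partial i (g l n)) (\<lambda>l. partial i (G l))" using Suc.prems(3) by simp
  qed
  ultimately show ?case by simp
qed

lemma unif_series_add:
  assumes "unif_series K S f F" "unif_series K S g G"
  shows "unif_series K S (\<lambda>l n x. f l n x + g l n x) (\<lambda>l x. F l x + G l x)"
  unfolding unif_series_def
proof (intro conjI allI impI ballI)
  fix V assume "compact V \<and> V \<subseteq> S"
  then have "uniform_limit (K \<times> V) (\<lambda>N (l, x). \<Sum>n<N. f l n x) (\<lambda>(l, x). F l x) sequentially"
    "uniform_limit (K \<times> V) (\<lambda>N (l, x). \<Sum>n<N. g l n x) (\<lambda>(l, x). G l x) sequentially"
    using assms by (simp_all add: unif_series_def)
  from uniform_limit_add[OF this] show "uniform_limit (K \<times> V) (\<lambda>N (l, x). \<Sum>n<N. f l n x + g l n x) (\<lambda>(l, x). F l x + G l x) sequentially"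
    by (simp add: sum.distrib case_prod_unfold)
qed (use assms in \<open>auto simp: unif_series_def intro!: continuous_on_add\<close>)

lemma unif_series_scaleR:
  assumes "unif_series K S f F"
  shows "unif_series K S (\<lambda>l n x. c *\<^sub>R f l n x) (\<lambda>l x. c *\<^sub>R F l x)"
  unfolding unif_series_def
proof (intro conjI allI impI ballI)
  fix V assume "compact V \<and> V \<subseteq> S"
  then have "uniform_limit (K \<times> V) (\<lambda>N (l, x). \<Sum>n<N. f l n x) (\<lambda>(l, x). F l x) sequentially"
    using assms by (simp_all add: unif_series_def)
  from bounded_linear.uniform_limit[OF bounded_linear_scaleR_right this, of c]
  show "uniform_limit (K \<times> V) (\<lambda>N (l, x). \<Sum>n<N. c *\<^sub>R f l n x) (\<lambda>(l, x). c *\<^sub>R F l x) sequentially"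
    by (simp add: scaleR_right.sum[symmetric] case_prod_unfold)
qed (use assms in \<open>auto simp: unif_series_def intro!: continuous_on_scaleR continuous_on_const\<close>)

lemma partial_scaleR_right:
  assumes "f differentiable (at x)"
  shows "partial i (\<lambda>x. c *\<^sub>R f x) x = c *\<^sub>R partial i f x"
proof -
  obtain f' where "(f has_derivative f') (at x)"
    using assms by (auto simp: differentiable_def)
  then show ?thesis
    by (simp add: partial_eqI[OF has_derivative_scaleR_right] partial_eqI)
qed

lemma Ck_series_add:
  assumes S: "open S"
  shows "Ck_series j K S f F \<Longrightarrow> Ck_series j K S g G \<Longrightarrow> Ck_series j K S (\<lambda>l n x. f l n x + g l n x) (\<lambda>l x. F l x + G l x)"
proof (induction j arbitrary: f F g G)
  case 0
  then show ?case by (simp add: unif_series_add)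
next
  case (Suc j)
  have d: "f l n differentiable (at x)" "F l differentiable (at x)" "g l n differentiable (at x)" "G l differentiable (at x)"
    if "l \<in> K" "x \<in> S" for l n x using Suc.prems that by auto
  have "Ck_series j K S (\<lambda>l n. partial i (\<lambda>x. f l n x + g l n x)) (\<lambda>l. partial i (\<lambda>x. F l x + G l x))" for i
    by (rule Ck_series_cong[OF S _ _ Suc.IH[of "\<lambda>l n. partial i (f l n)" "\<lambda>l. partial i (F l)" "\<lambda>l n. partial i (g l n)" "\<lambda>l. partial i (G l)"]])
      (use Suc.prems d in \<open>auto simp: partial_add\<close>)
  then show ?case using Suc.prems d by (simp add: unif_series_add)
qed

lemma Ck_series_scaleR:
  assumes S: "open S"
  shows "Ck_series j K S f F \<Longrightarrow> Ck_series j K S (\<lambda>l n x. c *\<^sub>R f l n x) (\<lambda>l x. c *\<^sub>R F l x)"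
proof (induction j arbitrary: f F)
  case 0
  then show ?case by (simp add: unif_series_scaleR)
next
  case (Suc j)
  have d: "f l n differentiable (at x)" "F l differentiable (at x)"
    if "l \<in> K" "x \<in> S" for l n x using Suc.prems that by auto
  have "Ck_series j K S (\<lambda>l n. partial i (\<lambda>x. c *\<^sub>R f l n x)) (\<lambda>l. partial i (\<lambda>x. c *\<^sub>R F l x))" for i
    by (rule Ck_series_cong[OF S _ _ Suc.IH[of "\<lambda>l n. partial i (f l n)" "\<lambda>l. partial i (F l)"]])
      (use Suc.prems d in \<open>auto simp: partial_scaleR_right\<close>)
  then show ?case using Suc.prems d by (simp add: unif_series_scaleR)
qed

lemma Ck_on_cong: "open S \<Longrightarrow> (\<And>x. x \<in> S \<Longrightarrow> f x = g x) \<Longrightarrow> Ck_on k S g \<Longrightarrow> Ck_on k S f"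
proof (induction k arbitrary: f g)
  case 0
  then show ?case using continuous_on_cong[of S S f g] by simp
next
  case (Suc k)
  have iff: "(f has_derivative f') (at x) \<longleftrightarrow> (g has_derivative f') (at x)" if "x \<in> S" for f' x
    using Suc.prems(1,2) that has_derivative_transform_within_open[of f f' x UNIV S g]
      has_derivative_transform_within_open[of g f' x UNIV S f] by auto
  have fd: "frechet_derivative f (at x) = frechet_derivative g (at x)" if "x \<in> S" for x
    by (simp add: frechet_derivative_def iff[OF that])
  have "Ck_on k S (\<lambda>x. frechet_derivative f (at x) v)" for v
    by (rule Suc.IH[OF Suc.prems(1), of _ "\<lambda>x. frechet_derivative g (at x) v"]) (use fd Suc.prems(3) in auto)
  moreover have "f differentiable (at x)" if "x \<in> S" for x
    using Suc.prems(3) iff that by (auto simp: differentiable_def)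
  ultimately show ?case by simp
qed

lemma frechet_derivative_eq_partial:
  fixes f :: "real^3 \<Rightarrow> 'a::real_normed_vector"
  assumes "f differentiable (at x)"
  shows "frechet_derivative f (at x) v = v$1 *\<^sub>R partial 1 f x + v$2 *\<^sub>R partial 2 f x + v$3 *\<^sub>R partial 3 f x"
proof -
  let ?f' = "frechet_derivative f (at x)"
  have lin: "linear ?f'" using assms by (rule linear_frechet_derivative)
  have "v = v$1 *\<^sub>R axis 1 1 + v$2 *\<^sub>R axis 2 1 + v$3 *\<^sub>R axis 3 1"
    by (simp add: vec_eq_iff forall_3)
  from arg_cong[OF this, of ?f'] show ?thesis
    by (simp add: partial_def linear_add[OF lin] linear_scale[OF lin])
qed

text \<open>\<open>Ck_on\<close> asks for derivatives in every fixed direction v. These are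
  constant-coefficient combinations of partials, under which \<open>Ck_series\<close> is
  closed.\<close>

lemma Ck_series_Ck_on:
  assumes S: "open S" and l: "l \<in> K"
  shows "Ck_series j K S f F \<Longrightarrow> Ck_on j S (F l)"
proof (induction j arbitrary: f F)
  case 0
  then show ?case using l by (simp add: unif_series_def)
next
  case (Suc j)
  have "Ck_on j S (\<lambda>x. frechet_derivative (F l) (at x) v)" for v
  proof (rule Ck_on_cong[OF S])
    show "frechet_derivative (F l) (at x) v = v$1 *\<^sub>R partial 1 (F l) x + v$2 *\<^sub>R partial 2 (F l) x + v$3 *\<^sub>R partial 3 (F l) x" if "x \<in> S" for x
      using Suc.prems l that by (intro frechet_derivative_eq_partial) auto
    have "Ck_series j K S (\<lambda>l n x. v$1 *\<^sub>R partial 1 (f l n) x + v$2 *\<^sub>R partial 2 (f l n) x + v$3 *\<^sub>R partial 3 (f l n) x)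
       (\<lambda>l x. v$1 *\<^sub>R partial 1 (F l) x + v$2 *\<^sub>R partial 2 (F l) x + v$3 *\<^sub>R partial 3 (F l) x)"
      using Suc.prems by (intro Ck_series_add[OF S] Ck_series_scaleR[OF S]) auto
    then show "Ck_on j S (\<lambda>x. v$1 *\<^sub>R partial 1 (F l) x + v$2 *\<^sub>R partial 2 (F l) x + v$3 *\<^sub>R partial 3 (F l) x)"
      by (rule Suc.IH)
  qed
  then show ?case using Suc.prems l by simp
qed

lemma partial_sum_lessThan:
  fixes N :: nat
  assumes "\<And>n. n < N \<Longrightarrow> f n differentiable (at x)"
  shows "partial i (\<lambda>y. \<Sum>n<N. f n y) x = (\<Sum>n<N. partial i (f n) x)"
  using assms
proof (induction N)
  case 0
  have "((\<lambda>y. 0) has_derivative (\<lambda>v. 0)) (at x)" by simp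
  from partial_eqI[OF this] show ?case by simp
next
  case (Suc N)
  then show ?case by (simp add: partial_add differentiable_sum)
qed

lemma C2_series_uniform_of_Ck_series:
  fixes f :: "'l \<Rightarrow> nat \<Rightarrow> real^3 \<Rightarrow> 'a::real_normed_vector"
  assumes S: "open S" and f: "Ck_series (Suc (Suc 0)) K S f F" and V: "compact V" "V \<subseteq> S"
  shows "C2_series_uniform K V f F"
proof -
  have d: "f l n differentiable (at x)" "partial i (f l n) differentiable (at x)" if "l \<in> K" "x \<in> S" for l n x i
    using f that by auto
  have p1: "partial i (\<lambda>y. \<Sum>n<N. f l n y) x = (\<Sum>n<N. partial i (f l n) x)" if "l \<in> K" "x \<in> S" for l x N i
    using d that by (intro partial_sum_lessThan) auto
  have p2: "partial i (partial j (\<lambda>y. \<Sum>n<N. f l n y)) x = (\<Sum>n<N. partial i (partial j (f l n)) x)" if "l \<in> K" "x \<in> S" for l x N i j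
  proof -
    have "partial i (partial j (\<lambda>y. \<Sum>n<N. f l n y)) x = partial i (\<lambda>x. \<Sum>n<N. partial j (f l n) x) x"
      by (rule partial_cong_open[OF S that(2) p1[OF that(1)]])
    then show ?thesis using d that by (simp add: partial_sum_lessThan)
  qed
  have u: "uniform_limit (K \<times> V) (\<lambda>N (l, x). g N l x) (\<lambda>(l, x). G l x) sequentially"
    if "unif_series K S h G" "\<And>N l x. l \<in> K \<Longrightarrow> x \<in> S \<Longrightarrow> g N l x = (\<Sum>n<N. h l n x)" for g G and h :: "'l \<Rightarrow> nat \<Rightarrow> real^3 \<Rightarrow> 'a"
  proof -
    have "uniform_limit (K \<times> V) (\<lambda>N (l, x). \<Sum>n<N. h l n x) (\<lambda>(l, x). G l x) sequentially"
      using that(1) V by (simp add: unif_series_def)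
    then show ?thesis
      using that(2) V by (subst uniform_limit_cong'[where g="\<lambda>N (l, x). \<Sum>n<N. h l n x" and i="\<lambda>(l, x). G l x"]) auto
  qed
  show ?thesis
    unfolding C2_series_uniform_def
  proof (intro conjI allI)
    show "uniform_limit (K \<times> V) (\<lambda>N (l, x). \<Sum>n<N. f l n x) (\<lambda>(l, x). F l x) sequentially"
      by (rule u[OF Ck_series_unif_series[OF f]]) simp
    show "uniform_limit (K \<times> V) (\<lambda>N (l, x). partial i (\<lambda>y. \<Sum>n<N. f l n y) x) (\<lambda>(l, x). partial i (F l) x) sequentially" for i
      by (rule u[where h="\<lambda>l n. partial i (f l n)"]) (use f p1 in auto)
    show "uniform_limit (K \<times> V) (\<lambda>N (l, x). partial i (partial j (\<lambda>y. \<Sum>n<N. f l n y)) x) (\<lambda>(l, x). partial i (partial j (F l)) x) sequentially" for i j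
      by (rule u[where h="\<lambda>l n. partial i (partial j (f l n))"]) (use f p2 in auto)
  qed
qed

lemma unif_series_sums:
  assumes "unif_series K S f F" "l \<in> K" "x \<in> S"
  shows "(\<lambda>n. f l n x) sums F l x"
proof -
  have "uniform_limit (K \<times> {x}) (\<lambda>N (l, x). \<Sum>n<N. f l n x) (\<lambda>(l, x). F l x) sequentially"
    using assms(1,3) by (simp add: unif_series_def)
  from tendsto_uniform_limitI[OF this, of "(l, x)"] show ?thesis
    using assms(2) by (simp add: sums_def)
qed

context expansion_series
begin

lemma hm_split: "hm a b k m g x = hm a b k m (\<lambda>_. 1) x * g (ln (rho x))"
  by (simp add: hm_def)

lemma unif_series_hm:
  fixes e :: "'a::banach"
  assumes P: "Gf P"
  shows "unif_series K (sect {..<T}) (\<lambda>l n x. hm a b k m (ef n (P l n)) x *\<^sub>R e) (\<lambda>l x. hm a b k m (Sf P l) x *\<^sub>R e)"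
  unfolding unif_series_def
proof (intro conjI allI impI ballI)
  fix V assume V: "compact V \<and> V \<subseteq> sect {..<T}"
  obtain W where "summable W \<and> (\<forall>n. W n \<ge> 0) \<and> (\<forall>l\<in>K. \<forall>t<T. \<forall>n. \<bar>ef n (P l n) t\<bar> \<le> W n * (1 + \<bar>t\<bar>))"
    using Gf_bound[OF P] by (elim exE)
  then have W: "summable W" "\<And>n. W n \<ge> 0" "\<And>l t n. l \<in> K \<Longrightarrow> t < T \<Longrightarrow> \<bar>ef n (P l n) t\<bar> \<le> W n * (1 + \<bar>t\<bar>)"
    by simp_all
  \<comment> \<open>Collects the factors that do not depend on n or on the parameter; c is
    continuous off the axis and hence bounded on V, which gives the majorant W n * C.\<close>
  define c where "c = (\<lambda>x. \<bar>hm a b k m (\<lambda>_. 1) x\<bar> * norm e * (1 + \<bar>ln (rho x)\<bar>))"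
  have "hm a b k m (\<lambda>_. 1) differentiable (at x)" if "x \<in> V" for x
    by (rule hm_differentiable[where I=UNIV and g'="\<lambda>_. 0"]) (use V that in \<open>auto simp: sect_def\<close>)
  moreover have "(\<lambda>x. ln (rho x)) differentiable (at x)" if "x \<in> V" for x
    using ln_rho_has_derivative[of x] V that by (auto simp: sect_def differentiable_def)
  ultimately have "continuous_on V c"
    unfolding c_def by (intro continuous_intros continuous_at_imp_continuous_on ballI differentiable_imp_continuous_within)
  then have "bounded (c ` V)" using V compact_continuous_image compact_imp_bounded by blast
  then obtain C where "\<forall>y\<in>c ` V. norm y \<le> C" unfolding bounded_iff by blast
  then have C: "\<bar>c x\<bar> \<le> C" if "x \<in> V" for x using that by (simp only: ball_simps real_norm_def)
  have un: "uniform_limit (K \<times> V) (\<lambda>N z. \<Sum>n<N. hm a b k m (ef n (P (fst z) n)) (snd z) *\<^sub>R e)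
     (\<lambda>z. \<Sum>n. hm a b k m (ef n (P (fst z) n)) (snd z) *\<^sub>R e) sequentially"
  proof (rule Weierstrass_m_test)
    show "summable (\<lambda>n. W n * C)" by (rule summable_mult2[OF W(1)])
    fix n z assume "z \<in> K \<times> V"
    then obtain l x where z: "z = (l, x)" "l \<in> K" "x \<in> V" by auto
    have t: "ln (rho x) < T" using z V by (auto simp: sect_def)
    have "norm (hm a b k m (ef n (P l n)) x *\<^sub>R e) = \<bar>hm a b k m (\<lambda>_. 1) x\<bar> * norm e * \<bar>ef n (P l n) (ln (rho x))\<bar>"
      by (subst hm_split) (simp add: abs_mult)
    also have "\<dots> \<le> \<bar>hm a b k m (\<lambda>_. 1) x\<bar> * norm e * (W n * (1 + \<bar>ln (rho x)\<bar>))"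
      using W(3)[OF z(2) t, of n] by (intro mult_left_mono) auto
    also have "\<dots> = W n * c x" by (simp add: c_def)
    also have "\<dots> \<le> W n * C" using C[OF z(3)] W(2)[of n] by (intro mult_left_mono) auto
    finally show "norm (hm a b k m (ef n (P (fst z) n)) (snd z) *\<^sub>R e) \<le> W n * C" by (simp add: z)
  qed
  have "(\<Sum>n. hm a b k m (ef n (P l n)) x *\<^sub>R e) = hm a b k m (Sf P l) x *\<^sub>R e" if "l \<in> K" "x \<in> V" for l x
  proof -
    have t: "ln (rho x) < T" using that V by (auto simp: sect_def)
    have "(\<lambda>n. (hm a b k m (\<lambda>_. 1) x * ef n (P l n) (ln (rho x))) *\<^sub>R e) sums ((hm a b k m (\<lambda>_. 1) x * Sf P l (ln (rho x))) *\<^sub>R e)"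
      by (intro sums_scaleR_left sums_mult Sf_sums P that t)
    then show ?thesis unfolding hm_split[of a b k m "ef _ _"] hm_split[of a b k m "Sf P l"] by (rule sums_unique[symmetric])
  qed
  then show "uniform_limit (K \<times> V) (\<lambda>N (l, x). \<Sum>n<N. hm a b k m (ef n (P l n)) x *\<^sub>R e) (\<lambda>(l, x). hm a b k m (Sf P l) x *\<^sub>R e) sequentially"
    using un by (subst uniform_limit_cong'[where g="\<lambda>N z. \<Sum>n<N. hm a b k m (ef n (P (fst z) n)) (snd z) *\<^sub>R e"
      and i="\<lambda>z. \<Sum>n. hm a b k m (ef n (P (fst z) n)) (snd z) *\<^sub>R e"]) auto
next
  fix l assume l: "l \<in> K"
  show "continuous_on (sect {..<T}) (\<lambda>x. hm a b k m (Sf P l) x *\<^sub>R e)"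
    using hm_differentiable[OF D1D[OF D1_Sf[OF P l]]]
    by (intro continuous_on_scaleR continuous_on_const continuous_at_imp_continuous_on ballI differentiable_imp_continuous_within)
qed

text \<open>The partials of such a series are sums of series of the same kind with coefficients
  \<open>P\<close> and \<open>dP P\<close> + c \<open>P\<close>, which again satisfy
  \<open>Gf\<close>. The induction on j therefore leaves P and all exponents arbitrary. The vector e
  lets one statement serve the pressure and the Cartesian directions of the velocity.\<close>

lemma Ck_series_hm:
  fixes e :: "'a::banach"
  shows "Gf P \<Longrightarrow> Ck_series j K (sect {..<T}) (\<lambda>l n x. hm a b k m (ef n (P l n)) x *\<^sub>R e) (\<lambda>l x. hm a b k m (Sf P l) x *\<^sub>R e)"
proof (induction j arbitrary: P a b k m)
  case 0
  then show ?case by (simp add: unif_series_hm)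
next
  case (Suc j)
  let ?S = "sect {..<T}"
  have S: "open ?S" by (rule open_sect) simp
  note P = Suc.prems
  have de: "D1 {..<T} (ef n (P l n)) (ef n (dP P l n))" for l n unfolding dP_def by (rule D1_ef)
  have d: "hm a b k m (ef n (P l n)) differentiable (at x)" if "x \<in> ?S" for l n x a b k m
    by (rule hm_differentiable[OF D1D[OF de[of n l]] that])
  have dS: "hm a b k m (Sf P l) differentiable (at x)" if "l \<in> K" "x \<in> ?S" for l x a b k m
    by (rule hm_differentiable[OF D1D[OF D1_Sf[OF P that(1)]] that(2)])
  have hs: "hm a b k m (\<lambda>t. c * g t) x = c * hm a b k m g x" for a b k m c g x by (simp add: hm_def)
  \<comment> \<open>Covers both profiles that arise: g' - 2 m g in horizontal directions with c = -2
    m, and k g + g' in the vertical one with c = k.\<close>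
  let ?Q = "\<lambda>c l n. dP P l n + smult c (P l n)"
  have GQ: "Gf (?Q c)" for c by (intro Gf_add Gf_dP Gf_smult P)
  have efQ: "ef n (?Q c l n) t = ef n (dP P l n) t + c * ef n (P l n) t" for c l n t by (simp add: ef_add[symmetric] ef_smult[symmetric])
  have SfQ: "Sf (?Q c) l t = Sf (dP P) l t + c * Sf P l t" if "l \<in> K" "t < T" for c l t
    by (simp add: Sf_add[OF Gf_dP[OF P] Gf_smult[OF P] that] Sf_smult[OF P that])
  have tS: "ln (rho x) < T" if "x \<in> ?S" for x using that by (simp add: sect_def)
  have "Ck_series j K ?S (\<lambda>l n. partial i (\<lambda>x. hm a b k m (ef n (P l n)) x *\<^sub>R e)) (\<lambda>l. partial i (\<lambda>x. hm a b k m (Sf P l) x *\<^sub>R e))" for i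
  proof -
    have 1: "Ck_series j K ?S (\<lambda>l n. partial 1 (\<lambda>x. hm a b k m (ef n (P l n)) x *\<^sub>R e)) (\<lambda>l. partial 1 (\<lambda>x. hm a b k m (Sf P l) x *\<^sub>R e))"
    proof (rule Ck_series_cong[OF S _ _ Ck_series_add[OF S Ck_series_scaleR[OF S Suc.IH[OF P, of "a-1" b k m], of "real a"] Suc.IH[OF GQ[of "- (2 * real m)"], of "a+1" b k "m+1"]]])
      fix l n x assume l: "l \<in> K" and x: "x \<in> ?S"
      show "partial 1 (\<lambda>x. hm a b k m (ef n (P l n)) x *\<^sub>R e) x =
          real a *\<^sub>R hm (a-1) b k m (ef n (P l n)) x *\<^sub>R e + hm (a+1) b k (m+1) (ef n (?Q (- (2 * real m)) l n)) x *\<^sub>R e"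
        using efQ[where c="- (2 * real m)" and l=l and n=n and t="ln (rho x)"]
        by (simp only: partial_scaleR_left[OF d[OF x]] partial_hm(1)[OF D1D[OF de[of n l]] x] scaleR_add_left scaleR_scaleR[symmetric]) (simp add: hm_def)
    next
      fix l x assume l: "l \<in> K" and x: "x \<in> ?S"
      show "partial 1 (\<lambda>x. hm a b k m (Sf P l) x *\<^sub>R e) x =
          real a *\<^sub>R hm (a-1) b k m (Sf P l) x *\<^sub>R e + hm (a+1) b k (m+1) (Sf (?Q (- (2 * real m))) l) x *\<^sub>R e"
        using SfQ[OF l tS[OF x], of "- (2 * real m)"]
        by (simp only: partial_scaleR_left[OF dS[OF l x]] partial_hm(1)[OF D1D[OF D1_Sf[OF P l]] x] scaleR_add_left scaleR_scaleR[symmetric]) (simp add: hm_def)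
    qed
    have 2: "Ck_series j K ?S (\<lambda>l n. partial 2 (\<lambda>x. hm a b k m (ef n (P l n)) x *\<^sub>R e)) (\<lambda>l. partial 2 (\<lambda>x. hm a b k m (Sf P l) x *\<^sub>R e))"
    proof (rule Ck_series_cong[OF S _ _ Ck_series_add[OF S Ck_series_scaleR[OF S Suc.IH[OF P, of a "b-1" k m], of "real b"] Suc.IH[OF GQ[of "- (2 * real m)"], of a "b+1" k "m+1"]]])
      fix l n x assume l: "l \<in> K" and x: "x \<in> ?S"
      show "partial 2 (\<lambda>x. hm a b k m (ef n (P l n)) x *\<^sub>R e) x =
          real b *\<^sub>R hm a (b-1) k m (ef n (P l n)) x *\<^sub>R e + hm a (b+1) k (m+1) (ef n (?Q (- (2 * real m)) l n)) x *\<^sub>R e"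
        using efQ[where c="- (2 * real m)" and l=l and n=n and t="ln (rho x)"]
        by (simp only: partial_scaleR_left[OF d[OF x]] partial_hm(2)[OF D1D[OF de[of n l]] x] scaleR_add_left scaleR_scaleR[symmetric]) (simp add: hm_def)
    next
      fix l x assume l: "l \<in> K" and x: "x \<in> ?S"
      show "partial 2 (\<lambda>x. hm a b k m (Sf P l) x *\<^sub>R e) x =
          real b *\<^sub>R hm a (b-1) k m (Sf P l) x *\<^sub>R e + hm a (b+1) k (m+1) (Sf (?Q (- (2 * real m))) l) x *\<^sub>R e"
        using SfQ[OF l tS[OF x], of "- (2 * real m)"]
        by (simp only: partial_scaleR_left[OF dS[OF l x]] partial_hm(2)[OF D1D[OF D1_Sf[OF P l]] x] scaleR_add_left scaleR_scaleR[symmetric]) (simp add: hm_def)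
    qed
    have 3: "Ck_series j K ?S (\<lambda>l n. partial 3 (\<lambda>x. hm a b k m (ef n (P l n)) x *\<^sub>R e)) (\<lambda>l. partial 3 (\<lambda>x. hm a b k m (Sf P l) x *\<^sub>R e))"
    proof (rule Ck_series_cong[OF S _ _ Ck_series_scaleR[OF S Suc.IH[OF GQ[of "real k"], of a b "k+1" m], of "-1"]])
      fix l n x assume l: "l \<in> K" and x: "x \<in> ?S"
      show "partial 3 (\<lambda>x. hm a b k m (ef n (P l n)) x *\<^sub>R e) x = (-1) *\<^sub>R hm a b (k+1) m (ef n (?Q (real k) l n)) x *\<^sub>R e"
        by (simp only: partial_scaleR_left[OF d[OF x]] partial_hm(3)[OF D1D[OF de[of n l]] x]) (simp add: hm_def efQ add.commute)
    next
      fix l x assume l: "l \<in> K" and x: "x \<in> ?S"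
      show "partial 3 (\<lambda>x. hm a b k m (Sf P l) x *\<^sub>R e) x = (-1) *\<^sub>R hm a b (k+1) m (Sf (?Q (real k)) l) x *\<^sub>R e"
        using SfQ[OF l tS[OF x], of "real k"]
        by (simp only: partial_scaleR_left[OF dS[OF l x]] partial_hm(3)[OF D1D[OF D1_Sf[OF P l]] x]) (simp add: hm_def add.commute)
    qed
    have "i = 1 \<or> i = 2 \<or> i = 3" using exhaust_3 by blast
    then show ?thesis using 1 2 3 by blast
  qed
  then show ?case using unif_series_hm[OF P] d dS by simp
qed

end

section \<open>The solution family\<close>

lemma VF_1_eq_hm: "VF 1 \<alpha> \<beta> \<gamma> x = hm 1 0 2 0 \<alpha> x *\<^sub>R axis 1 1 + hm 0 1 2 0 \<beta> x *\<^sub>R - axis 1 1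
    + hm 0 1 2 0 \<alpha> x *\<^sub>R axis 2 1 + hm 1 0 2 0 \<beta> x *\<^sub>R axis 2 1 + hm 0 0 1 0 \<gamma> x *\<^sub>R axis 3 1"
  by (simp add: vec_eq_iff forall_3 VF_nth SF_def hm_def power2_eq_square)

text \<open>At height z and radius r, with t = ln (r / z), the estimate is r \<bar>u\<bar> \<le> 2
  e^(2t) (\<bar>\<alpha>\<bar> + \<bar>\<beta>\<bar>) + e^t \<bar>\<gamma>\<bar>. The powers of z
  cancel, and the right-hand side tends to 0 as r does.\<close>

lemma mild_at_axis_VF:
  assumes \<delta>: "\<delta> > 0" and u: "\<And>x. x \<in> pcone \<delta> \<Longrightarrow> u x = VF 1 \<alpha> \<beta> \<gamma> x"
    and g: "slow_growth \<alpha>" "slow_growth \<beta>" "slow_growth \<gamma>"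
  shows "mild_at_axis u"
  unfolding mild_at_axis_def
proof (intro allI impI)
  fix z :: real assume z: "z > 0"
  define \<psi> where "\<psi> = (\<lambda>t. 2 * (exp (2*t) * (\<bar>\<alpha> t\<bar> + \<bar>\<beta> t\<bar>)) + exp (1*t) * \<bar>\<gamma> t\<bar>)"
  have ga: "((\<lambda>t. exp (c*t) * \<bar>f t\<bar>) \<longlongrightarrow> 0) at_bot" if "slow_growth f" "c > 0" for f c
  proof -
    have "exp_O (c/2) (\<lambda>t. exp (c*t) * f t)"
      by (rule exp_O_mult[OF exp_O_exp slow_growth_D[OF that(1), of "-c/2"]]) (use that in auto)
    from tendsto_rabs_zero[OF exp_O_tendsto_0[OF this]] that show ?thesis by (simp add: abs_mult)
  qed
  have "((\<lambda>t. 2 * (exp (2*t) * \<bar>\<alpha> t\<bar> + exp (2*t) * \<bar>\<beta> t\<bar>) + exp (1*t) * \<bar>\<gamma> t\<bar>) \<longlongrightarrow> 2 * (0 + 0) + 0) at_bot"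
    by (intro tendsto_intros ga g) auto
  then have \<psi>: "(\<psi> \<longlongrightarrow> 0) at_bot" by (simp add: \<psi>_def distrib_left)
  have lt: "filterlim (\<lambda>y::real^2. ln (norm y / z)) at_bot (at 0)"
  proof (rule filterlim_compose[OF ln_at_0])
    have "((\<lambda>y::real^2. norm y / z) \<longlongrightarrow> norm (0::real^2) / z) (at 0)"
      using z by (intro tendsto_intros) auto
    moreover have "\<forall>\<^sub>F y in at (0::real^2). norm y / z \<in> {0<..} \<and> norm y / z \<noteq> 0"
      using z by (simp add: eventually_at_filter)
    ultimately show "filterlim (\<lambda>y::real^2. norm y / z) (at_right 0) (at 0)"
      unfolding filterlim_at by simp
  qed
  show "(\<lambda>y::real^2. norm (u (vector [y$1, y$2, z]))) \<in> o[at 0](\<lambda>y. inverse (norm y))"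
  proof (rule smalloI_tendsto)
    show "\<forall>\<^sub>F y in at (0::real^2). inverse (norm y) \<noteq> 0" by (simp add: eventually_at_filter)
    show "((\<lambda>y::real^2. norm (u (vector [y$1, y$2, z])) / inverse (norm y)) \<longlongrightarrow> 0) (at 0)"
    proof (rule Lim_null_comparison[OF _ filterlim_compose[OF \<psi> lt]])
      have "\<forall>\<^sub>F y in at (0::real^2). ln (norm y / z) < ln \<delta>"
        using lt by (simp add: filterlim_at_bot_dense)
      moreover have "\<forall>\<^sub>F y in at (0::real^2). y \<noteq> 0" by (simp add: eventually_at_filter)
      ultimately show "\<forall>\<^sub>F y in at (0::real^2). norm (norm (u (vector [y$1, y$2, z])) / inverse (norm y)) \<le> \<psi> (ln (norm y / z))"
      proof eventually_elim
        case (elim y)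
        define x :: "real^3" where "x = vector [y$1, y$2, z]"
        define t where "t = ln (norm y / z)"
        have hx: "horiz x = y" by (simp add: x_def horiz_def vec_eq_iff forall_2)
        have x3: "x$3 = z" by (simp add: x_def)
        have rx: "rad x = norm y" "x$3 = z" "rho x = norm y / z" by (simp_all add: rad_def hx rho_def x3)
        have px: "x \<in> phalf" using elim z by (simp add: phalf_def hx rx)
        have xc: "x \<in> pcone \<delta>" using px elim by (simp add: pcone_eq_sect[OF \<delta>] sect_def rx)
        have et: "norm y = z * exp t" using elim z by (simp add: t_def)
        have tx: "ln (rho x) = t" by (simp add: rx t_def)
        have x12: "\<bar>x$1\<bar> \<le> norm y" "\<bar>x$2\<bar> \<le> norm y" by (simp_all add: x_def component_le_norm_cart)
        let ?A = "SF (1+1) \<alpha> x" and ?B = "SF (1+1) \<beta> x" and ?C = "SF 1 \<gamma> x"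
        have c: "\<bar>u x $ 1\<bar> \<le> norm y * (\<bar>?A\<bar> + \<bar>?B\<bar>)" "\<bar>u x $ 2\<bar> \<le> norm y * (\<bar>?A\<bar> + \<bar>?B\<bar>)"
        proof -
          have m: "\<bar>x$1 * ?A\<bar> \<le> norm y * \<bar>?A\<bar>" "\<bar>x$2 * ?A\<bar> \<le> norm y * \<bar>?A\<bar>" "\<bar>x$1 * ?B\<bar> \<le> norm y * \<bar>?B\<bar>" "\<bar>x$2 * ?B\<bar> \<le> norm y * \<bar>?B\<bar>"
            using x12 by (simp_all add: abs_mult mult_right_mono)
          show "\<bar>u x $ 1\<bar> \<le> norm y * (\<bar>?A\<bar> + \<bar>?B\<bar>)" "\<bar>u x $ 2\<bar> \<le> norm y * (\<bar>?A\<bar> + \<bar>?B\<bar>)"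
            unfolding u[OF xc] VF_nth distrib_left
            using m abs_triangle_ineq4[of "x$1 * ?A" "x$2 * ?B"] abs_triangle_ineq[of "x$2 * ?A" "x$1 * ?B"] by linarith+
        qed
        have "norm (u x) \<le> \<bar>u x $ 1\<bar> + \<bar>u x $ 2\<bar> + \<bar>u x $ 3\<bar>"
          using norm_le_l1_cart[of "u x"] by (simp add: sum_3)
        also have "\<dots> \<le> 2 * (norm y * (\<bar>?A\<bar> + \<bar>?B\<bar>)) + \<bar>?C\<bar>"
          using c by (simp add: u[OF xc] VF_nth(3))
        finally have "norm (u x) * norm y \<le> (2 * (norm y * (\<bar>?A\<bar> + \<bar>?B\<bar>)) + \<bar>?C\<bar>) * norm y"
          by (rule mult_right_mono) simp
        also have "\<dots> = \<psi> t"
        proof -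
          have AB: "\<bar>?A\<bar> = \<bar>\<alpha> t\<bar> / (z * z)" "\<bar>?B\<bar> = \<bar>\<beta> t\<bar> / (z * z)" "\<bar>?C\<bar> = \<bar>\<gamma> t\<bar> / z"
            using z by (simp_all add: SF_def tx x3 abs_mult divide_inverse)
          have "exp (2*t) = exp t * exp t" by (simp add: mult_exp_exp)
          then show ?thesis unfolding AB et \<psi>_def using z by (simp add: field_simps)
        qed
        finally show ?case unfolding x_def t_def by (simp add: divide_inverse)
      qed
    qed
  qed
qed

lemma axisymmetric_VF:
  assumes \<delta>: "\<delta> > 0" and u: "\<And>x. x \<in> pcone \<delta> \<Longrightarrow> u x = VF 1 \<alpha> \<beta> \<gamma> x" and p: "\<And>x. x \<in> pcone \<delta> \<Longrightarrow> p x = SF 2 \<pi> x"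
  shows "axisymmetric_on (pcone \<delta>) u p"
proof -
  have ind: "phi_independent_on (pcone \<delta>) f" if "\<And>x. x \<in> pcone \<delta> \<Longrightarrow> f x = g (rad x) (x$3)" for f g
    unfolding phi_independent_on_def using that by (simp add: rad_cyl)
  have ph: "x \<in> phalf" if "x \<in> pcone \<delta>" for x using that \<delta> by (simp add: pcone_eq_sect sect_def)
  have S: "SF k f x = inverse (x$3) ^ k * f (ln (rad x / x$3))" for k f x by (simp add: SF_def rho_def)
  have c: "comp_rho u x = rad x * SF (1+1) \<alpha> x" "comp_phi u x = rad x * SF (1+1) \<beta> x" "u x $ 3 = SF 1 \<gamma> x" if "x \<in> pcone \<delta>" for x
    using VF_comp_iff[where u=u and k=1, OF ph[OF that], THEN iffD1, OF u[OF that]] by simp_all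
  show ?thesis
    unfolding axisymmetric_on_def
  proof (intro conjI)
    show "phi_independent_on (pcone \<delta>) (comp_rho u)"
      by (rule ind[of _ "\<lambda>r z. r * (inverse z ^ (1+1) * \<alpha> (ln (r / z)))"]) (simp only: c S)
    show "phi_independent_on (pcone \<delta>) (comp_phi u)"
      by (rule ind[of _ "\<lambda>r z. r * (inverse z ^ (1+1) * \<beta> (ln (r / z)))"]) (simp only: c S)
    show "phi_independent_on (pcone \<delta>) (\<lambda>x. u x $ 3)"
      by (rule ind[of _ "\<lambda>r z. inverse z ^ 1 * \<gamma> (ln (r / z))"]) (simp only: c S)
    show "phi_independent_on (pcone \<delta>) p"
      by (rule ind[of _ "\<lambda>r z. inverse z ^ 2 * \<pi> (ln (r / z))"]) (simp only: p S)
  qed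
qed

locale expansion_family = expansion_series +
  fixes L :: real
  assumes L: "L \<ge> 0" and cf_bound: "\<And>l n. l \<in> K \<Longrightarrow> cnorm (cf l n) \<le> L * B ^ n"
begin

abbreviation "PA \<equiv> \<lambda>l n. cA (cf l n)"
abbreviation "PB \<equiv> \<lambda>l n. cB (cf l n)"
abbreviation "PG \<equiv> \<lambda>l n. cG (cf l n)"
abbreviation "PP \<equiv> \<lambda>l n. cP (cf l n)"

definition "Ul l = VF 1 (Sf PA l) (Sf PB l) (Sf PG l)"
definition "Pl l = SF 2 (Sf PP l)"

lemma Gf_cf: "Gf PA" "Gf PB" "Gf PG" "Gf PP"
proof -
  have d: "degree (PA l n) \<le> n + 1 \<and> degree (PB l n) \<le> n + 1 \<and> degree (PG l n) \<le> n + 1 \<and> degree (PP l n) \<le> n + 1" for l n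
    using deg_le_cf[of n l] by (simp add: deg_le_def)
  have I: "Gf P" if "\<And>l n. degree (P l n) \<le> n + 1" "\<And>l n. pnorm (P l n) \<le> cnorm (cf l n)" for P
    unfolding Gf_def
  proof (intro exI[of _ L] exI[of _ 0] conjI ballI allI)
    show "pnorm (P l n) \<le> L * (real n + 1) ^ 0 * B ^ n" if "l \<in> K" for l n
      using order_trans[OF \<open>\<And>l n. pnorm (P l n) \<le> cnorm (cf l n)\<close> cf_bound[OF that]] by simp
  qed (use L that in auto)
  show "Gf PA" "Gf PB" "Gf PG" "Gf PP"
    by (rule I; simp add: d[simplified] cnorm_bounds)+
qed

lemma Ck_series_U: "Ck_series j K (sect {..<T}) (\<lambda>l n. uf n (cf l n)) Ul"
  by (rule Ck_series_cong[OF open_sect[OF open_lessThan] _ _ Ck_series_add[OF open_sect[OF open_lessThan] Ck_series_add[OF open_sect[OF open_lessThan]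
     Ck_series_add[OF open_sect[OF open_lessThan] Ck_series_add[OF open_sect[OF open_lessThan] Ck_series_hm[OF Gf_cf(1)] Ck_series_hm[OF Gf_cf(2)]] Ck_series_hm[OF Gf_cf(1)]] Ck_series_hm[OF Gf_cf(2)]] Ck_series_hm[OF Gf_cf(3)]]])
    (simp_all only: uf_def Ul_def VF_1_eq_hm)

lemma Ck_series_P: "Ck_series j K (sect {..<T}) (\<lambda>l n. pf n (cf l n)) Pl"
  by (rule Ck_series_cong[OF open_sect[OF open_lessThan] _ _ Ck_series_hm[OF Gf_cf(4), of _ 0 0 2 0 "1::real"]])
    (simp_all add: pf_def Pl_def SF_eq_hm)

lemma sums_Suc_diff: "f sums s \<Longrightarrow> (\<lambda>n. f (Suc n)) sums (s - f 0)" for f :: "nat \<Rightarrow> real"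
  by (simp add: sums_Suc_iff)

text \<open>Summing the recursion over n turns the convolutions into Cauchy products.
  Incompressibility is summed from \<open>coef_div_free\<close>.\<close>

lemma NS_ode_Sf:
  assumes l: "l \<in> K" and t: "t < T"
  shows "NS_ode (Sf PA l) (Sf (dP PA) l) (Sf (dP (dP PA)) l) (Sf PB l) (Sf (dP PB) l) (Sf (dP (dP PB)) l)
    (Sf PG l) (Sf (dP PG) l) (Sf (dP (dP PG)) l) (Sf PP l) (Sf (dP PP) l) t"
proof -
  define e where "e = exp (-2*t)"
  define f where "f = (\<lambda>P n. ef n ((P :: real^4 \<Rightarrow> nat \<Rightarrow> real poly) l n) t)"
  have s: "f P sums Sf P l t" if "Gf P" for P unfolding f_def by (rule Sf_sums[OF that l t])
  have sS: "(\<lambda>n. f P (Suc n)) sums (Sf P l t - f P 0)" if "Gf P" for P by (rule sums_Suc_diff[OF s[OF that]])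
  have cp: "(\<lambda>n. \<Sum>m=0..n. f P m * f Q (n - m)) sums (Sf P l t * Sf Q l t)" if "Gf P" "Gf Q" for P Q
    using Cauchy_product_sums[OF Sf_summable_norm[OF that(1) l t] Sf_summable_norm[OF that(2) l t]]
    by (simp add: f_def Sf_def atLeast0AtMost)
  note G = Gf_cf Gf_dP[OF Gf_cf(1)] Gf_dP[OF Gf_cf(2)] Gf_dP[OF Gf_cf(3)] Gf_dP[OF Gf_cf(4)]
    Gf_dP[OF Gf_dP[OF Gf_cf(1)]] Gf_dP[OF Gf_dP[OF Gf_cf(2)]] Gf_dP[OF Gf_dP[OF Gf_cf(3)]]
  have dPf: "opd (2 * real n) (P l n) = dP P l n" for P n by (simp add: dP_def)
  have f0: "f P n = ef n (P l n) t" for P n by (simp add: f_def)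
  note R = coef_rel_iff_ode[THEN iffD1, OF cf_Suc[of _ l], THEN spec[where x=t]]
  have c1: "(\<Sum>m=0..n. ef (m + (n - m)) (conv1 (cf l) m (n - m)) t) =
     (\<Sum>m=0..n. f PA m * f PA (n-m)) - (\<Sum>m=0..n. f PB m * f PB (n-m)) + ((\<Sum>m=0..n. f PA m * f (dP PA) (n-m)) - (\<Sum>m=0..n. f PG m * f (dP PA) (n-m)))
       - 2 * (\<Sum>m=0..n. f PG m * f PA (n-m))" for n
    unfolding ef_conv f_def dP_def sum_distrib_left by (simp add: sum.distrib[symmetric] sum_subtractf[symmetric] algebra_simps)
  have c2: "(\<Sum>m=0..n. ef (m + (n - m)) (conv2 (cf l) m (n - m)) t) =
     (\<Sum>m=0..n. f PA m * f PB (n-m)) + (\<Sum>m=0..n. f PB m * f PA (n-m)) + ((\<Sum>m=0..n. f PA m * f (dP PB) (n-m)) - (\<Sum>m=0..n. f PG m * f (dP PB) (n-m)))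
       - 2 * (\<Sum>m=0..n. f PG m * f PB (n-m))" for n
    unfolding ef_conv f_def dP_def sum_distrib_left by (simp add: sum.distrib[symmetric] sum_subtractf[symmetric] algebra_simps)
  have c3: "(\<Sum>m=0..n. ef (m + (n - m)) (conv3 (cf l) m (n - m)) t) =
     ((\<Sum>m=0..n. f PA m * f (dP PG) (n-m)) - (\<Sum>m=0..n. f PG m * f (dP PG) (n-m))) - (\<Sum>m=0..n. f PG m * f PG (n-m))" for n
    unfolding ef_conv f_def dP_def by (simp add: sum.distrib[symmetric] sum_subtractf[symmetric] algebra_simps)
  \<comment> \<open>The shifted sums omit the terms of index 0. In the radial equation these are c0
    on both sides, from 2 \<alpha>' and from \<pi>', and cancel; in the other two momentum equations
    they vanish.\<close>
  have z: "f (dP PA) 0 = par_c l / 2" "f (dP (dP PA)) 0 = 0" "f (dP PB) 0 = 0" "f (dP (dP PB)) 0 = 0"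
    "f (dP (dP PG)) 0 = 0" "f (dP PP) 0 = par_c l"
    by (simp_all add: f_def dP_def cf_0 coef_init_def opd_def ef_def pderiv_pCons)
  have E1: "e * (f (dP (dP PA)) (Suc n) + 2 * f (dP PA) (Suc n)) =
      - (f (dP (dP PA)) n + 5 * f (dP PA) n + 6 * f PA n) + (\<Sum>m=0..n. ef (m + (n - m)) (conv1 (cf l) m (n - m)) t) + e * f (dP PP) (Suc n)" for n
    using R[of n] unfolding f_def dP_def e_def by blast
  have E2: "e * (f (dP (dP PB)) (Suc n) + 2 * f (dP PB) (Suc n)) =
      - (f (dP (dP PB)) n + 5 * f (dP PB) n + 6 * f PB n) + (\<Sum>m=0..n. ef (m + (n - m)) (conv2 (cf l) m (n - m)) t)" for n
    using R[of n] unfolding f_def dP_def e_def by blast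
  have E3: "e * f (dP (dP PG)) (Suc n) =
      - (f (dP (dP PG)) n + 3 * f (dP PG) n + 2 * f PG n) + (\<Sum>m=0..n. ef (m + (n - m)) (conv3 (cf l) m (n - m)) t) - (2 * f PP n + f (dP PP) n)" for n
    using R[of n] unfolding f_def dP_def e_def by blast
  have E4: "2 * f PA n + f (dP PA) n - f (dP PG) n - f PG n = 0" for n
  proof -
    have "opd (2 * real n) (PA l n) + smult 2 (PA l n) = opd (2 * real n) (PG l n) + PG l n"
      using coef_div_free[of n l] by (simp add: opd_def smult_add_left algebra_simps)
    from arg_cong[OF this, of "\<lambda>p. ef n p t"] show ?thesis
      unfolding f_def dP_def ef_smult[of 2] ef_add[symmetric] by simp
  qed
  have "(\<lambda>n. e * (f (dP (dP PA)) (Suc n) + 2 * f (dP PA) (Suc n))) sums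
     (e * ((Sf (dP (dP PA)) l t - f (dP (dP PA)) 0) + 2 * (Sf (dP PA) l t - f (dP PA) 0)))"
    by (intro sums_mult sums_add sS G)
  moreover have "(\<lambda>n. e * (f (dP (dP PA)) (Suc n) + 2 * f (dP PA) (Suc n))) sums
     (- (Sf (dP (dP PA)) l t + 5 * Sf (dP PA) l t + 6 * Sf PA l t) +
      (Sf PA l t * Sf PA l t - Sf PB l t * Sf PB l t + (Sf PA l t * Sf (dP PA) l t - Sf PG l t * Sf (dP PA) l t) - 2 * (Sf PG l t * Sf PA l t))
      + e * (Sf (dP PP) l t - f (dP PP) 0))"
    unfolding E1 c1 by (intro sums_mult sums_add sums_diff sums_minus sS s cp G)
  ultimately have 1: "e * (Sf (dP (dP PA)) l t + 2 * (Sf (dP PA) l t - par_c l / 2)) =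
      - (Sf (dP (dP PA)) l t + 5 * Sf (dP PA) l t + 6 * Sf PA l t) +
      (Sf PA l t * Sf PA l t - Sf PB l t * Sf PB l t + (Sf PA l t * Sf (dP PA) l t - Sf PG l t * Sf (dP PA) l t) - 2 * (Sf PG l t * Sf PA l t))
      + e * (Sf (dP PP) l t - par_c l)"
    unfolding z by (simp add: sums_unique2)
  have "(\<lambda>n. e * (f (dP (dP PB)) (Suc n) + 2 * f (dP PB) (Suc n))) sums
     (e * ((Sf (dP (dP PB)) l t - f (dP (dP PB)) 0) + 2 * (Sf (dP PB) l t - f (dP PB) 0)))"
    by (intro sums_mult sums_add sS G)
  moreover have "(\<lambda>n. e * (f (dP (dP PB)) (Suc n) + 2 * f (dP PB) (Suc n))) sums
     (- (Sf (dP (dP PB)) l t + 5 * Sf (dP PB) l t + 6 * Sf PB l t) +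
      (Sf PA l t * Sf PB l t + Sf PB l t * Sf PA l t + (Sf PA l t * Sf (dP PB) l t - Sf PG l t * Sf (dP PB) l t) - 2 * (Sf PG l t * Sf PB l t)))"
    unfolding E2 c2 by (intro sums_mult sums_add sums_diff sums_minus sS s cp G)
  ultimately have 2: "e * (Sf (dP (dP PB)) l t + 2 * Sf (dP PB) l t) =
      - (Sf (dP (dP PB)) l t + 5 * Sf (dP PB) l t + 6 * Sf PB l t) +
      (Sf PA l t * Sf PB l t + Sf PB l t * Sf PA l t + (Sf PA l t * Sf (dP PB) l t - Sf PG l t * Sf (dP PB) l t) - 2 * (Sf PG l t * Sf PB l t))"
    unfolding z by (simp add: sums_unique2)
  have "(\<lambda>n. e * f (dP (dP PG)) (Suc n)) sums (e * (Sf (dP (dP PG)) l t - f (dP (dP PG)) 0))"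
    by (intro sums_mult sS G)
  moreover have "(\<lambda>n. e * f (dP (dP PG)) (Suc n)) sums
     (- (Sf (dP (dP PG)) l t + 3 * Sf (dP PG) l t + 2 * Sf PG l t) +
      ((Sf PA l t * Sf (dP PG) l t - Sf PG l t * Sf (dP PG) l t) - Sf PG l t * Sf PG l t) - (2 * Sf PP l t + Sf (dP PP) l t))"
    unfolding E3 c3 by (intro sums_mult sums_add sums_diff sums_minus sS s cp G)
  ultimately have 3: "e * Sf (dP (dP PG)) l t =
      - (Sf (dP (dP PG)) l t + 3 * Sf (dP PG) l t + 2 * Sf PG l t) +
      ((Sf PA l t * Sf (dP PG) l t - Sf PG l t * Sf (dP PG) l t) - Sf PG l t * Sf PG l t) - (2 * Sf PP l t + Sf (dP PP) l t)"
    unfolding z by (simp add: sums_unique2)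
  have "(\<lambda>n. 2 * f PA n + f (dP PA) n - f (dP PG) n - f PG n) sums (2 * Sf PA l t + Sf (dP PA) l t - Sf (dP PG) l t - Sf PG l t)"
    by (intro sums_mult sums_add sums_diff s G)
  then have "(\<lambda>n. 0::real) sums (2 * Sf PA l t + Sf (dP PA) l t - Sf (dP PG) l t - Sf PG l t)"
    unfolding E4 .
  then have 4: "2 * Sf PA l t + Sf (dP PA) l t - Sf (dP PG) l t - Sf PG l t = 0"
    by (rule sums_unique2[OF _ sums_zero])
  show ?thesis
    unfolding NS_ode_def e_def[symmetric]
  proof (intro conjI)
    show "e * (Sf (dP (dP PA)) l t + 2 * Sf (dP PA) l t) + (Sf (dP (dP PA)) l t + 5 * Sf (dP PA) l t + 6 * Sf PA l t) =
       Sf PA l t * Sf PA l t - Sf PB l t * Sf PB l t + (Sf PA l t - Sf PG l t) * Sf (dP PA) l t - 2 * Sf PG l t * Sf PA l t + e * Sf (dP PP) l t"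
      using 1 by (simp add: algebra_simps)
    show "e * (Sf (dP (dP PB)) l t + 2 * Sf (dP PB) l t) + (Sf (dP (dP PB)) l t + 5 * Sf (dP PB) l t + 6 * Sf PB l t) =
       Sf PA l t * Sf PB l t + Sf PB l t * Sf PA l t + (Sf PA l t - Sf PG l t) * Sf (dP PB) l t - 2 * Sf PG l t * Sf PB l t"
      using 2 by (simp add: algebra_simps)
    show "e * Sf (dP (dP PG)) l t + (Sf (dP (dP PG)) l t + 3 * Sf (dP PG) l t + 2 * Sf PG l t) =
       (Sf PA l t - Sf PG l t) * Sf (dP PG) l t - Sf PG l t * Sf PG l t - (2 * Sf PP l t + Sf (dP PP) l t)"
      using 3 by (simp add: algebra_simps)
  qed (rule 4)
qed

lemma param_solution_U:
  assumes l: "l \<in> K" and \<delta>: "\<delta> > 0" "T = ln \<delta>"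
  shows "param_solution \<delta> l (Ul l) (Pl l)"
proof -
  have S: "pcone \<delta> = sect {..<T}" using pcone_eq_sect[OF \<delta>(1)] \<delta>(2) by simp
  have ph: "x \<in> phalf" if "x \<in> pcone \<delta>" for x using that S by (simp add: sect_def)
  have d: "D1 {..<T} (Sf P l) (Sf (dP P) l)" if "Gf P" for P by (rule D1_Sf[OF that l])
  note dd = d[OF Gf_cf(1)] d[OF Gf_dP[OF Gf_cf(1)]] d[OF Gf_cf(2)] d[OF Gf_dP[OF Gf_cf(2)]] d[OF Gf_cf(3)] d[OF Gf_dP[OF Gf_cf(3)]] d[OF Gf_cf(4)]
  have "stationary_NS_on (sect {..<T}) (Ul l) (Pl l)"
    unfolding stationary_NS_iff_ode[OF open_lessThan dd Ul_def[THEN fun_cong] Pl_def[THEN fun_cong]]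
    using NS_ode_Sf[OF l] by simp
  moreover have "neg_homogeneous_on (pcone \<delta>) 1 (Ul l)" "neg_homogeneous_on (pcone \<delta>) 2 (Pl l)"
    unfolding neg_homogeneous_on_def Ul_def Pl_def using VF_scaleR SF_scaleR by auto
  moreover have "axisymmetric_on (pcone \<delta>) (Ul l) (Pl l)"
    by (rule axisymmetric_VF[OF \<delta>(1)]) (simp_all add: Ul_def Pl_def)
  ultimately have "hom_axi_NS_solution \<delta> (Ul l) (Pl l)"
    by (simp add: hom_axi_NS_solution_def S)
  moreover have "Cinf_on (pcone \<delta>) (Ul l)" "Cinf_on (pcone \<delta>) (Pl l)"
    unfolding Cinf_on_def S using Ck_series_Ck_on[OF open_sect[OF open_lessThan] l Ck_series_U] Ck_series_Ck_on[OF open_sect[OF open_lessThan] l Ck_series_P] by auto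
  moreover have "mild_at_axis (Ul l)"
  proof (rule mild_at_axis_VF[OF \<delta>(1)])
    have g: "slow_growth (Sf P l)" if "Gf P" "slow_growth (poly (P l 0))" for P
      using slow_growth_add[OF slow_growth_exp_O[OF Sf_leading[OF that(1) l]] that(2)] by simp
    have gp: "slow_growth (poly [:a, b:])" for a b :: real
    proof -
      have "poly [:a, b:] = (\<lambda>t. a + t * b)" by (simp add: fun_eq_iff)
      then show ?thesis using slow_growth_add[OF slow_growth_const[of a] slow_growth_mult[OF slow_growth_ident slow_growth_const[of b]]] by simp
    qed
    show "slow_growth (Sf PA l)" "slow_growth (Sf PB l)" "slow_growth (Sf PG l)"
      by (rule g[OF Gf_cf(1)] g[OF Gf_cf(2)] g[OF Gf_cf(3)], use gp gp[of _ 0] in \<open>simp add: cf_0 coef_init_def\<close>)+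
  qed (simp add: Ul_def)
  moreover have "axis_limits l (Ul l) (Pl l)"
  proof -
    have A: "exp_O 1 (\<lambda>t. Sf PA l t - 1/2 * par_c l * t - par_brho l)"
      using Sf_leading[OF Gf_cf(1) l] by (simp add: cf_0 coef_init_def algebra_simps)
    have Bt: "exp_O 1 (\<lambda>t. Sf PB l t - par_bphi l)"
      using Sf_leading[OF Gf_cf(2) l] by (simp add: cf_0 coef_init_def)
    have P0: "exp_O 1 (\<lambda>t. Sf PP l t - par_c l * t - par_d l)"
      using Sf_leading[OF Gf_cf(4) l] by (simp add: cf_0 coef_init_def algebra_simps)
    have P1: "exp_O 1 (\<lambda>t. Sf (dP PP) l t - par_c l)"
      using Sf_leading[OF Gf_dP[OF Gf_cf(4)] l] by (simp add: cf_0 coef_init_def dP_def opd_def pderiv_pCons)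
    have "axis_limits l (Ul l) (Pl l) \<longleftrightarrow> (Sf (dP PP) l \<longlongrightarrow> par_c l) at_bot \<and> ((\<lambda>t. Sf PP l t - par_c l * t) \<longlongrightarrow> par_d l) at_bot \<and>
     ((\<lambda>t. Sf PA l t - 1/2 * par_c l * t) \<longlongrightarrow> par_brho l) at_bot \<and> (Sf PB l \<longlongrightarrow> par_bphi l) at_bot"
      by (rule axis_limits_profile[OF \<delta>(1) _ _ dd(7)[unfolded \<delta>(2)]]) (simp_all add: Ul_def Pl_def)
    then show ?thesis
      using exp_O_tendsto[OF A] exp_O_tendsto[OF Bt] exp_O_tendsto[OF P0] exp_O_tendsto[OF P1] by simp
  qed
  ultimately show ?thesis by (simp add: param_solution_def)
qed

lemma solution_family_U:
  assumes \<delta>: "\<delta> > 0" "T = ln \<delta>"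
  shows "solution_family K \<delta> Ul Pl"
proof -
  have S: "pcone \<delta> = sect {..<T}" using pcone_eq_sect[OF \<delta>(1)] \<delta>(2) by simp
  have So: "open (sect {..<T})" by (rule open_sect) simp
  have un: "v x = Ul l x \<and> q x = Pl l x" if "l \<in> K" "param_solution \<delta> l v q" "x \<in> pcone \<delta>" for l v q x
    using that(2) param_solution_U[OF that(1) \<delta>] unfolding param_solution_def Cinf_on_def
    by (intro solution_unique[OF \<delta>(1) _ _ _ _ _ _ _ _ _ _ that(3), of v q l]) auto
  show ?thesis
    unfolding solution_family_def
  proof (intro conjI exI[of _ "\<lambda>l n. uf n (cf l n)"] exI[of _ "\<lambda>l n. pf n (cf l n)"] ballI allI impI)
    fix l assume l: "l \<in> K"
    show "param_solution \<delta> l (Ul l) (Pl l)" by (rule param_solution_U[OF l \<delta>])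
    show "v x = Ul l x" "q x = Pl l x" if "param_solution \<delta> l v q" "x \<in> pcone \<delta>" for v q x
      using un[OF l that] by simp_all
    show "expansion l (\<lambda>n. uf n (cf l n)) (\<lambda>n. pf n (cf l n))" by (rule expansion_cf)
    show "u' n x = uf n (cf l n) x" "p' n x = pf n (cf l n) x" if "expansion l u' p'" "x \<in> phalf" for u' p' n x
      using expansion_unique[OF that] by simp_all
    show "(\<lambda>n. uf n (cf l n) x) sums Ul l x" "(\<lambda>n. pf n (cf l n) x) sums Pl l x" if "x \<in> pcone \<delta>" for x
      using unif_series_sums[OF Ck_series_unif_series[OF Ck_series_U[of 0]] l] unif_series_sums[OF Ck_series_unif_series[OF Ck_series_P[of 0]] l] that S by auto
  next
    fix V assume "compact V \<and> V \<subseteq> pcone \<delta>"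
    then show "C2_series_uniform K V (\<lambda>l n. uf n (cf l n)) Ul" "C2_series_uniform K V (\<lambda>l n. pf n (cf l n)) Pl"
      using C2_series_uniform_of_Ck_series[OF So Ck_series_U] C2_series_uniform_of_Ck_series[OF So Ck_series_P] S by auto
  qed
qed

end

lemma solution_family_exists:
  assumes K: "compact K"
  shows "\<exists>\<delta>>0. \<exists>U P. solution_family K \<delta> U P"
proof -
  obtain R where R: "R > 0" "\<And>l. l \<in> K \<Longrightarrow> norm l \<le> R"
    using compact_imp_bounded[OF K] unfolding bounded_pos by blast
  \<comment> \<open>The norms of the four initial polynomials are at most 2 R, R, 9/2 R and 3
    R.\<close>
  define L where "L = 12 * R"
  define B where "B = 600 * (4 + 8 * L)"
  \<comment> \<open>Chosen so that B e^T = 1/2 for T = ln \<delta>. It depends on K only through the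
    radius R of a ball containing K.\<close>
  define \<delta> where "\<delta> = 1 / (2 * B)"
  have L0: "L > 0" using R by (simp add: L_def)
  then have B0: "B > 1" by (simp add: B_def)
  have c0: "cnorm (cf l 0) \<le> L" if "l \<in> K" for l
  proof -
    have b: "\<bar>l $ i\<bar> \<le> R" for i using component_le_norm_cart[of l i] R(2)[OF that] by simp
    have "\<bar>2 * par_brho l - par_c l / 2\<bar> \<le> 2 * \<bar>par_brho l\<bar> + \<bar>par_c l\<bar> / 2" by linarith
    then show ?thesis using b[of 1] b[of 2] b[of 3] b[of 4]
      by (simp add: cf_0 coef_init_def cnorm_def L_def, linarith)
  qed
  interpret expansion_family K B "ln \<delta>" L
  proof
    show "0 \<le> B" "0 \<le> L" using B0 L0 by simp_all
    show "ln \<delta> \<le> 0" using B0 by (simp add: \<delta>_def)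
    show "B * exp (ln \<delta>) \<le> 1/2" using B0 by (simp add: \<delta>_def)
    show "cnorm (cf l n) \<le> L * B ^ n" if "l \<in> K" for l n
      unfolding B_def by (rule cnorm_cf_bound[OF c0[OF that]])
  qed
  have "\<delta> > 0" using B0 by (simp add: \<delta>_def)
  then show ?thesis using solution_family_U[of \<delta>] by blast
qed

lemma axis_limits_unique:
  assumes "axis_limits l u p" "axis_limits l' u p"
  shows "l = l'"
proof -
  note a = assms[unfolded axis_limits_def, THEN spec[of _ 0]]
  have c: "par_c l = par_c l'"
    using a by (blast intro: tendsto_unique[OF trivial_limit_at_right_real])
  have "par_d l = par_d l'" "par_brho l = par_brho l'" "par_bphi l = par_bphi l'"
    using a unfolding c by (blast intro: tendsto_unique[OF trivial_limit_at_right_real])+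
  with c show ?thesis by (simp add: vec_eq_iff forall_4)
qed

theorem theorem1p1:
  shows "(\<forall>K :: (real^4) set. compact K \<longrightarrow> (\<exists>\<delta>>0. \<exists>U P. solution_family K \<delta> U P)) \<and>
    (\<forall>\<delta>' u p. \<delta>' > 0 \<and> hom_axi_NS_solution \<delta>' u p \<and>
       Ck_on 2 (pcone \<delta>') u \<and> Ck_on 2 (pcone \<delta>') p \<and> mild_at_axis u \<longrightarrow>
       (\<exists>!l. axis_limits l u p) \<and>
       (\<forall>l. axis_limits l u p \<longrightarrow>
          (\<forall>\<delta>>0. \<forall>U P. solution_family {l} \<delta> U P \<longrightarrow>
             (\<exists>\<delta>\<^sub>1>0. \<delta>\<^sub>1 \<le> \<delta>' \<and> \<delta>\<^sub>1 \<le> \<delta> \<and> (\<forall>x\<in>pcone \<delta>\<^sub>1. u x = U l x \<and> p x = P l x)))))"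
proof (intro conjI allI impI)
  show "\<exists>\<delta>>0. \<exists>U P. solution_family K \<delta> U P" if "compact K" for K
    by (rule solution_family_exists[OF that])
next
  fix \<delta>' u p
  assume h: "\<delta>' > 0 \<and> hom_axi_NS_solution \<delta>' u p \<and> Ck_on 2 (pcone \<delta>') u \<and> Ck_on 2 (pcone \<delta>') p \<and> mild_at_axis u"
  then show "\<exists>!l. axis_limits l u p"
    using axis_limits_ex axis_limits_unique by (metis (no_types, lifting))
  fix l \<delta> U P
  assume lim: "axis_limits l u p" and \<delta>: "0 < \<delta>" and fam: "solution_family {l} \<delta> U P"
  \<comment> \<open>On the smaller of the two cones both pairs are solutions with the same limits at
    the axis, so uniqueness applies there directly.\<close>
  define \<delta>1 where "\<delta>1 = min \<delta> \<delta>'"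
  have d1: "\<delta>1 > 0" "\<delta>1 \<le> \<delta>'" "\<delta>1 \<le> \<delta>" using h \<delta> by (auto simp: \<delta>1_def)
  have ps: "param_solution \<delta> l (U l) (P l)" using fam by (simp add: solution_family_def)
  have "u x = U l x \<and> p x = P l x" if "x \<in> pcone \<delta>1" for x
  proof (rule solution_unique[OF d1(1) _ _ _ _ lim _ _ _ _ _ that])
    show "hom_axi_NS_solution \<delta>1 u p" "Ck_on 2 (pcone \<delta>1) u" "Ck_on 2 (pcone \<delta>1) p" "mild_at_axis u"
      using h hom_axi_NS_solution_mono[OF _ d1(2)] Ck_on_subset[OF _ pcone_mono[OF d1(2)]] by blast+
    show "hom_axi_NS_solution \<delta>1 (U l) (P l)" "mild_at_axis (U l)" "axis_limits l (U l) (P l)"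
      using ps hom_axi_NS_solution_mono[OF _ d1(3)] unfolding param_solution_def by blast+
    show "Ck_on 2 (pcone \<delta>1) (U l)" "Ck_on 2 (pcone \<delta>1) (P l)"
      using ps Ck_on_subset[OF _ pcone_mono[OF d1(3)]] unfolding param_solution_def Cinf_on_def by blast+
  qed
  then show "\<exists>\<delta>\<^sub>1>0. \<delta>\<^sub>1 \<le> \<delta>' \<and> \<delta>\<^sub>1 \<le> \<delta> \<and> (\<forall>x\<in>pcone \<delta>\<^sub>1. u x = U l x \<and> p x = P l x)"
    using d1 by blast
qed

end
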